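(* Let $k$ be a $p$-adic field, $G$, $P=MN$, $\bar N$, $\psi_x$ as in the context, $\omega\subseteq\bar N$ an $M$-orbit, and assume that the unitary representation $\pi$ of $P$ on $L^2(\omega)$ described in the context extends to a unitary representation of $G$. Let $V$ be the space of $G$-smooth elements in $L^2(\omega)$ (represented by locally constant functions on $\omega$). Let $x\in\bar N$ and let $\ell$ be a linear functional on $V$ such that $\ell(\pi(n)f)=\psi_x(n)\ell(f)$ for all $n\in N$, $f\in V$. \begin{itemize} \item If $x$ is not in the topological closure of $\omega$, then $\ell=0$. \item If $x\in\omega$, then there exists $\lambda\in\mathbb C$ such that $\ell(f)=\lambda f(x)$ for all $f\in V$. \end{itemize}
   Context: **Groups.** Let $k$ be a field of characteristic $0$. A composition algebra over $k$ is a unital, not necessarily associative algebra $D$ with a non-degenerate quadratic form $N_D$ satisfying $N_D(uv)=N_D(u)N_D(v)$ (so $\dim D\in\{1,2,4,8\}$); $u\mapsto\bar u$ is its canonical involution. $J$ denotes one of the following Jordan algebras, of degree $r$: (a) $J=H_r(D)$, the $r\times r$ matrices over $D$ equal to their conjugate transpose, with $x\circ y=\frac12(xy+yx)$, where $\dim D\in\{1,2,4\}$, or $\dim D=8$ and $r=3$; put $e_i=E_{ii}$; (b) $r=2$ and $J=J_2(V,Q)=ke_1\oplus ke_2\oplus V$ for a non-degenerate quadratic space $(V,Q)$, $V\ne0$, with product determined by $(a,b,v)\circ(a,b,v)=(a^2+Q(v),b^2+Q(v),(a+b)v)$. $G$ is (the group of $k$-points of) the simply connected, absolutely simple algebraic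 group over $k$ attached to $J$ by the Kantor–Koecher–Tits construction: its Lie algebra $\mathfrak g$ contains an $\mathfrak{sl}_2$-triple $(f,h,e)$ ($[h,e]=2e$, $[h,f]=-2f$, $[e,f]=h$) such that $\mathrm{ad}\,h$ has eigenvalues $-2,0,2$ on $\mathfrak g$ with eigenspaces $\bar{\mathfrak n},\mathfrak m,\mathfrak n$, and $\mathfrak n$ with the product $x\circ y=\frac12[x,[f,y]]$ is identified with $J$ (identity $e=e_1+\cdots+e_r$). $P=MN$ is the maximal parabolic subgroup with Lie algebra $\mathfrak m\oplus\mathfrak n$, $M$ the centralizer of $h$, $N$ its abelian unipotent radical, $\bar P=M\bar N$ the opposite parabolic; $N\cong\mathfrak n$ and $\bar N\cong\bar{\mathfrak n}$ via $\exp$, and $M$ acts on them by conjugation. $\kappa$ is the Killing form rescaled so that $\kappa(f_i,e_i)=1$ where $f_i=-\frac12[f,[f,e_i]]$; $\langle n,x\rangle=\kappa(\log n,\log x)$ for $n\in N$, $x\in\bar N$. **The representation.** Fix a non-trivial unitary character $\psi$ of $k$ and put $\psi_x(n)=\psi(\langle n,x\rangle)$. Let $dx$ be a quasi-$M$-invariant measure on $\omega$ and $\nu:M\to\mathbb C^\times$ a smooth character with $d(mx)=|\nu(m)|^{-2}dx$. $P$ acts unitarily on $L^2(\omega)$ by $\pi(m)f(y)=\nu(m)f(m^{-1}y)$ for $m\in M$ and $\pi(n)f(y)=\psi_y(n)f(y)$ for $n\in N$. An element is $G$-smooth if it is fixed by an open compact subgroup of $G$; $G$-smooth elements are represented uniquely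 by locally constant functions on $\omega$, so $f(x)$ makes sense. *)

theory Defs
  imports
    "HOL-Analysis.Analysis"
    "HOL-Library.Poly_Mapping"
    "HOL-Computational_Algebra.Polynomial"
    "HOL-Algebra.Algebraic_Closure_Type"
    "HOL-Algebra.Coset"
    "Jordan_Normal_Form.Determinant"
begin

section \<open>Linear algebraic groups\<close>

definition GL :: "nat \<Rightarrow> 'a::field mat monoid" where
  "GL n = units_of (ring_mat TYPE('a) n ())"

abbreviation mat_subgroup :: "nat \<Rightarrow> 'a::field mat set \<Rightarrow> 'a mat monoid" where
  "mat_subgroup n H \<equiv> (GL n)\<lparr>carrier := H\<rparr>"

text \<open>Polynomials in the matrix entries \<open>x\<^sub>i\<^sub>j\<close>, the variables being indexed by \<open>(i, j)\<close>. They are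
  evaluated along a map \<open>h\<close> of the coefficients (an inclusion of fields, or \<open>k \<rightarrow> k[t]\<close>).\<close>

type_synonym 'a matpoly = "((nat \<times> nat) \<Rightarrow>\<^sub>0 nat) \<Rightarrow>\<^sub>0 'a"

definition matpoly_eval ::
    "('a::zero \<Rightarrow> 'b::comm_semiring_1) \<Rightarrow> (nat \<times> nat \<Rightarrow> 'b) \<Rightarrow> 'a matpoly \<Rightarrow> 'b" where
  "matpoly_eval h x p =
     (\<Sum>m\<in>Poly_Mapping.keys p. h (Poly_Mapping.lookup p m) *
        (\<Prod>ij\<in>Poly_Mapping.keys m. x ij ^ Poly_Mapping.lookup m ij))"

definition entries :: "nat \<Rightarrow> 'a::zero mat \<Rightarrow> nat \<times> nat \<Rightarrow> 'a" where
  "entries n A = (\<lambda>(i, j). if i < n \<and> j < n then A $$ (i, j) else 0)"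

definition zariski_closed :: "('a::zero \<Rightarrow> 'b::field) \<Rightarrow> nat \<Rightarrow> 'b mat set \<Rightarrow> bool" where
  "zariski_closed h n Z \<longleftrightarrow>
     (\<exists>S :: 'a matpoly set.
        Z = {A \<in> carrier (GL n). \<forall>p\<in>S. matpoly_eval h (entries n A) p = 0})"

definition algebraic_group :: "nat \<Rightarrow> 'a::field mat set \<Rightarrow> bool" where
  "algebraic_group n H \<longleftrightarrow> subgroup H (GL n) \<and> zariski_closed id n H"

definition zariski_connected :: "nat \<Rightarrow> 'a::field mat set \<Rightarrow> bool" where
  "zariski_connected n Z \<longleftrightarrow>
     (\<forall>A B. zariski_closed id n A \<and> zariski_closed id n B \<and> A \<union> B = Z \<and> A \<inter> B = {}
        \<longrightarrow> A = {} \<or> B = {})"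

text \<open>The coordinate ring of \<open>GL\<^sub>m\<close> is generated by the entries and \<open>det\<^sup>-\<^sup>1\<close>.\<close>

definition regular_map :: "nat \<Rightarrow> 'a::field mat set \<Rightarrow> nat \<Rightarrow> ('a mat \<Rightarrow> 'a mat) \<Rightarrow> bool" where
  "regular_map m H n \<phi> \<longleftrightarrow>
     (\<forall>i<n. \<forall>j<n. \<exists>(p :: 'a matpoly) (d :: nat). \<forall>A\<in>H.
        \<phi> A $$ (i, j) = matpoly_eval id (entries m A) p / Determinant.det A ^ d)"

definition algebraic_hom ::
    "nat \<Rightarrow> 'a::field mat set \<Rightarrow> nat \<Rightarrow> 'a mat set \<Rightarrow> ('a mat \<Rightarrow> 'a mat) \<Rightarrow> bool" where
  "algebraic_hom m H n G \<phi> \<longleftrightarrow>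
     \<phi> \<in> hom (mat_subgroup m H) (mat_subgroup n G) \<and> regular_map m H n \<phi>"

definition algebraic_iso ::
    "nat \<Rightarrow> 'a::field mat set \<Rightarrow> nat \<Rightarrow> 'a mat set \<Rightarrow> ('a mat \<Rightarrow> 'a mat) \<Rightarrow> bool" where
  "algebraic_iso m H n G \<phi> \<longleftrightarrow>
     algebraic_hom m H n G \<phi> \<and>
     (\<exists>\<theta>. algebraic_hom n G m H \<theta> \<and> (\<forall>A\<in>H. \<theta> (\<phi> A) = A) \<and> (\<forall>B\<in>G. \<phi> (\<theta> B) = B))"

definition isogeny ::
    "nat \<Rightarrow> 'a::field mat set \<Rightarrow> nat \<Rightarrow> 'a mat set \<Rightarrow> ('a mat \<Rightarrow> 'a mat) \<Rightarrow> bool" where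
  "isogeny m H n G \<phi> \<longleftrightarrow>
     algebraic_hom m H n G \<phi> \<and> \<phi> ` H = G \<and>
     finite (kernel (mat_subgroup m H) (mat_subgroup n G) \<phi>)"

text \<open>These two notions are meant over an algebraically closed field of characteristic \<open>0\<close>, where
  every isogeny from a connected group is central and separable.\<close>

definition simply_connected_group :: "nat \<Rightarrow> 'a::alg_closed_field mat set \<Rightarrow> bool" where
  "simply_connected_group n G \<longleftrightarrow>
     (\<forall>m H \<phi>. algebraic_group m H \<and> zariski_connected m H \<and> isogeny m H n G \<phi>
        \<longrightarrow> algebraic_iso m H n G \<phi>)"

definition almost_simple_group :: "nat \<Rightarrow> 'a::alg_closed_field mat set \<Rightarrow> bool" where
  "almost_simple_group n G \<longleftrightarrow>
     algebraic_group n G \<and> zariski_connected n G \<and>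
     (\<exists>A\<in>G. \<exists>B\<in>G. A * B \<noteq> B * A) \<and>
     (\<forall>H. algebraic_group n H \<and> zariski_connected n H \<and> normal H (mat_subgroup n G)
        \<longrightarrow> H = {1\<^sub>m n} \<or> H = G)"

text \<open>An algebraic group over \<open>k\<close> is given by its group \<open>G\<close> of points over an algebraic closure.
  Since \<open>k\<close> is perfect, \<open>G\<close> is defined over \<open>k\<close> iff it is cut out by polynomials over \<open>k\<close>, and its
  Lie algebra over \<open>k\<close> consists of the \<open>Y\<close> for which \<open>1 + t Y\<close> satisfies modulo \<open>t\<^sup>2\<close> all the
  equations over \<open>k\<close> of \<open>G\<close>.\<close>

definition rational_points :: "nat \<Rightarrow> 'k::field alg_closure mat set \<Rightarrow> 'k mat set" where
  "rational_points n G = {A \<in> carrier (GL n). map_mat to_ac A \<in> G}"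

definition lie_algebra :: "nat \<Rightarrow> 'k::field alg_closure mat set \<Rightarrow> 'k mat set" where
  "lie_algebra n G =
     {Y \<in> carrier_mat n n. \<forall>p :: 'k matpoly.
        (\<forall>A\<in>G. matpoly_eval to_ac (entries n A) p = 0) \<longrightarrow>
        Polynomial.coeff (matpoly_eval (\<lambda>c. pCons c 0)
          (\<lambda>ij. pCons (entries n (1\<^sub>m n) ij) (pCons (entries n Y ij) 0)) p) 1 = 0}"

definition lie_bracket :: "'k::field mat \<Rightarrow> 'k mat \<Rightarrow> 'k mat" where
  "lie_bracket A B = A * B - B * A"

definition lincomb_mat :: "nat \<Rightarrow> nat \<Rightarrow> (nat \<Rightarrow> 'k::field) \<Rightarrow> (nat \<Rightarrow> 'k mat) \<Rightarrow> 'k mat" where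
  "lincomb_mat n d c b = Matrix.mat n n (\<lambda>ij. \<Sum>l<d. c l * b l $$ ij)"

definition mat_basis :: "nat \<Rightarrow> 'k::field mat set \<Rightarrow> nat \<Rightarrow> (nat \<Rightarrow> 'k mat) \<Rightarrow> bool" where
  "mat_basis n S d b \<longleftrightarrow>
     (\<forall>l<d. b l \<in> S) \<and> (\<forall>Y\<in>S. \<exists>!c. (\<forall>l\<ge>d. c l = 0) \<and> Y = lincomb_mat n d c b)"

definition trace_on :: "nat \<Rightarrow> 'k::field mat set \<Rightarrow> ('k mat \<Rightarrow> 'k mat) \<Rightarrow> 'k" where
  "trace_on n S F =
     (THE t. \<exists>d b C. mat_basis n S d b \<and>
        (\<forall>j<d. F (b j) = lincomb_mat n d (\<lambda>i. C i j) b) \<and> t = (\<Sum>i<d. C i i))"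

definition killing_form :: "nat \<Rightarrow> 'k::field mat set \<Rightarrow> 'k mat \<Rightarrow> 'k mat \<Rightarrow> 'k" where
  "killing_form n L A B = trace_on n L (\<lambda>Y. lie_bracket A (lie_bracket B Y))"

text \<open>Only used on nilpotent \<open>n \<times> n\<close> matrices, for which the exponential series stops before the
  \<open>n\<close>-th term.\<close>

definition mat_exp :: "nat \<Rightarrow> 'k::field_char_0 mat \<Rightarrow> 'k mat" where
  "mat_exp n A = Matrix.mat n n (\<lambda>ij. \<Sum>l<n. (A ^\<^sub>m l) $$ ij / fact l)"


section \<open>Composition algebras and Jordan algebras\<close>

definition polar :: "('v::ab_group_add \<Rightarrow> 'k::field) \<Rightarrow> 'v \<Rightarrow> 'v \<Rightarrow> 'k" where
  "polar Q u w = Q (u + w) - Q u - Q w"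

locale quadratic_space = vector_space sc
  for sc :: "'k::field_char_0 \<Rightarrow> 'v::ab_group_add \<Rightarrow> 'v" +
  fixes Q :: "'v \<Rightarrow> 'k"
  assumes quad_scale: "Q (sc c u) = c\<^sup>2 * Q u"
    and polar_add: "polar Q (u + u') w = polar Q u w + polar Q u' w"
    and polar_scale: "polar Q (sc c u) w = c * polar Q u w"
    and nondegenerate: "(\<And>w. polar Q u w = 0) \<Longrightarrow> u = 0"

locale composition_algebra = quadratic_space sc N
  for sc :: "'k::field_char_0 \<Rightarrow> 'd::ab_group_add \<Rightarrow> 'd" and N :: "'d \<Rightarrow> 'k" +
  fixes prd :: "'d \<Rightarrow> 'd \<Rightarrow> 'd" and unit :: 'd
  assumes mult_add_left: "prd (u + u') w = prd u w + prd u' w"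
    and mult_add_right: "prd u (w + w') = prd u w + prd u w'"
    and mult_scale_left: "prd (sc c u) w = sc c (prd u w)"
    and mult_scale_right: "prd u (sc c w) = sc c (prd u w)"
    and unit_left: "prd unit u = u"
    and unit_right: "prd u unit = u"
    and norm_mult: "N (prd u w) = N u * N w"

definition canonical_involution ::
    "('k::field \<Rightarrow> 'd::ab_group_add \<Rightarrow> 'd) \<Rightarrow> ('d \<Rightarrow> 'k) \<Rightarrow> 'd \<Rightarrow> 'd \<Rightarrow> 'd" where
  "canonical_involution sc N unit u = sc (polar N u unit) unit - u"

record ('k, 'j) jordan_algebra =
  jcarrier :: "'j set"
  jadd :: "'j \<Rightarrow> 'j \<Rightarrow> 'j"
  jscale :: "'k \<Rightarrow> 'j \<Rightarrow> 'j"
  jprod :: "'j \<Rightarrow> 'j \<Rightarrow> 'j"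
  junit :: 'j
  jframe :: "'j set" \<comment> \<open>the idempotents \<open>e\<^sub>1, \<dots>, e\<^sub>r\<close>\<close>

definition dmat_mult ::
    "nat \<Rightarrow> ('d::ab_group_add \<Rightarrow> 'd \<Rightarrow> 'd) \<Rightarrow> 'd mat \<Rightarrow> 'd mat \<Rightarrow> 'd mat" where
  "dmat_mult r prd A B =
     Matrix.mat r r (\<lambda>(i, j). \<Sum>l<r. prd (A $$ (i, l)) (B $$ (l, j)))"

definition hermitian_jordan ::
    "nat \<Rightarrow> ('k::field_char_0 \<Rightarrow> 'd::ab_group_add \<Rightarrow> 'd) \<Rightarrow> ('d \<Rightarrow> 'k) \<Rightarrow> ('d \<Rightarrow> 'd \<Rightarrow> 'd) \<Rightarrow> 'd
      \<Rightarrow> ('k, 'd mat) jordan_algebra" where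
  "hermitian_jordan r sc N prd unit =
     \<lparr> jcarrier = {A \<in> carrier_mat r r. \<forall>i<r. \<forall>j<r.
                     A $$ (i, j) = canonical_involution sc N unit (A $$ (j, i))},
       jadd = (+),
       jscale = (\<lambda>c. map_mat (sc c)),
       jprod = (\<lambda>A B. map_mat (sc (1/2)) (dmat_mult r prd A B + dmat_mult r prd B A)),
       junit = Matrix.mat r r (\<lambda>(a, b). if a = b then unit else 0),
       jframe = {Matrix.mat r r (\<lambda>(a, b). if a = i \<and> b = i then unit else 0) | i. i < r} \<rparr>"

text \<open>The polarisation of \<open>(a, b, w) \<circ> (a, b, w) = (a\<^sup>2 + Q w, b\<^sup>2 + Q w, (a + b) w)\<close>.\<close>

definition quadratic_jordan ::
    "('k::field_char_0 \<Rightarrow> 'v::ab_group_add \<Rightarrow> 'v) \<Rightarrow> ('v \<Rightarrow> 'k) \<Rightarrow> ('k, 'k \<times> 'k \<times> 'v) jordan_algebra"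
  where
  "quadratic_jordan sc Q =
     \<lparr> jcarrier = UNIV,
       jadd = (\<lambda>(a, b, w) (a', b', w'). (a + a', b + b', w + w')),
       jscale = (\<lambda>c (a, b, w). (c * a, c * b, sc c w)),
       jprod = (\<lambda>(a, b, w) (a', b', w').
         (a * a' + polar Q w w' / 2, b * b' + polar Q w w' / 2,
          sc (1/2) (sc (a + b) w' + sc (a' + b') w))),
       junit = (1, 1, 0),
       jframe = {(1, 0, 0), (0, 1, 0)} \<rparr>"


section \<open>The group attached to a Jordan algebra\<close>

record (overloaded) ('k::field_char_0) kkt_datum =
  kkt_size :: nat \<comment> \<open>the group is a subgroup of \<open>GL\<close> of this size\<close>
  kkt_group :: "'k alg_closure mat set"
  kkt_f :: "'k mat"
  kkt_h :: "'k mat"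
  kkt_e :: "'k mat"
  kkt_const :: 'k \<comment> \<open>\<open>\<kappa>\<close> is this multiple of the Killing form\<close>

definition kkt_G :: "'k::field_char_0 kkt_datum \<Rightarrow> 'k mat set" where
  "kkt_G T = rational_points (kkt_size T) (kkt_group T)"

definition kkt_lie :: "'k::field_char_0 kkt_datum \<Rightarrow> 'k mat set" where
  "kkt_lie T = lie_algebra (kkt_size T) (kkt_group T)"

definition kkt_eigenspace :: "'k::field_char_0 kkt_datum \<Rightarrow> 'k \<Rightarrow> 'k mat set" where
  "kkt_eigenspace T c = {Y \<in> kkt_lie T. lie_bracket (kkt_h T) Y = c \<cdot>\<^sub>m Y}"

definition kkt_act :: "'k::field_char_0 kkt_datum \<Rightarrow> 'k mat \<Rightarrow> 'k mat \<Rightarrow> 'k mat" where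
  "kkt_act T g x = g * x * inv\<^bsub>GL (kkt_size T)\<^esub> g"

definition kkt_M :: "'k::field_char_0 kkt_datum \<Rightarrow> 'k mat set" where
  "kkt_M T = {g \<in> kkt_G T. kkt_act T g (kkt_h T) = kkt_h T}"

definition kkt_N :: "'k::field_char_0 kkt_datum \<Rightarrow> 'k mat set" where
  "kkt_N T = mat_exp (kkt_size T) ` kkt_eigenspace T 2"

definition kkt_Nbar :: "'k::field_char_0 kkt_datum \<Rightarrow> 'k mat set" where
  "kkt_Nbar T = mat_exp (kkt_size T) ` kkt_eigenspace T (-2)"

definition kkt_kappa :: "'k::field_char_0 kkt_datum \<Rightarrow> 'k mat \<Rightarrow> 'k mat \<Rightarrow> 'k" where
  "kkt_kappa T A B = kkt_const T * killing_form (kkt_size T) (kkt_lie T) A B"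

definition kkt_pairing :: "'k::field_char_0 kkt_datum \<Rightarrow> 'k mat \<Rightarrow> 'k mat \<Rightarrow> 'k" where
  "kkt_pairing T n x =
     kkt_kappa T (inv_into (kkt_eigenspace T 2) (mat_exp (kkt_size T)) n)
                 (inv_into (kkt_eigenspace T (-2)) (mat_exp (kkt_size T)) x)"

text \<open>A simply connected, absolutely (almost) simple group over \<open>k\<close> whose Lie algebra is graded by
  an \<open>sl\<^sub>2\<close>-triple with degrees \<open>-2, 0, 2\<close>.\<close>

definition kkt_graded_group :: "'k::field_char_0 kkt_datum \<Rightarrow> bool" where
  "kkt_graded_group T \<longleftrightarrow>
     zariski_closed (to_ac :: 'k \<Rightarrow> 'k alg_closure) (kkt_size T) (kkt_group T) \<and>
     almost_simple_group (kkt_size T) (kkt_group T) \<and>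
     simply_connected_group (kkt_size T) (kkt_group T) \<and>
     kkt_f T \<in> kkt_lie T \<and> kkt_h T \<in> kkt_lie T \<and> kkt_e T \<in> kkt_lie T \<and>
     lie_bracket (kkt_h T) (kkt_e T) = 2 \<cdot>\<^sub>m kkt_e T \<and>
     lie_bracket (kkt_h T) (kkt_f T) = (-2) \<cdot>\<^sub>m kkt_f T \<and>
     lie_bracket (kkt_e T) (kkt_f T) = kkt_h T \<and>
     (\<forall>Y\<in>kkt_lie T. \<exists>A\<in>kkt_eigenspace T (-2). \<exists>B\<in>kkt_eigenspace T 0. \<exists>C\<in>kkt_eigenspace T 2.
        Y = A + B + C)"

text \<open>The eigenspace of degree \<open>2\<close> with the product \<open>x \<circ> y = 1/2 [x, [f, y]]\<close> is identified with
  \<open>J\<close>, and \<open>\<kappa>\<close> is normalised by \<open>\<kappa> (f\<^sub>i, e\<^sub>i) = 1\<close>, where \<open>f\<^sub>i = -1/2 [f, [f, e\<^sub>i]]\<close>. As the Lie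
  algebra is simple, this and the grading determine it as the Kantor--Koecher--Tits algebra
  of \<open>J\<close>.\<close>

definition kkt_attached ::
    "'k::field_char_0 kkt_datum \<Rightarrow> ('k, 'j) jordan_algebra \<Rightarrow> bool" where
  "kkt_attached T J \<longleftrightarrow> kkt_graded_group T \<and>
     (\<exists>\<phi>. bij_betw \<phi> (jcarrier J) (kkt_eigenspace T 2) \<and>
        (\<forall>a\<in>jcarrier J. \<forall>b\<in>jcarrier J. \<phi> (jadd J a b) = \<phi> a + \<phi> b) \<and>
        (\<forall>c. \<forall>a\<in>jcarrier J. \<phi> (jscale J c a) = c \<cdot>\<^sub>m \<phi> a) \<and>
        (\<forall>a\<in>jcarrier J. \<forall>b\<in>jcarrier J.
           \<phi> (jprod J a b) = (1/2) \<cdot>\<^sub>m lie_bracket (\<phi> a) (lie_bracket (kkt_f T) (\<phi> b))) \<and>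
        \<phi> (junit J) = kkt_e T \<and>
        (\<forall>i\<in>jframe J.
           kkt_kappa T
             ((-1/2) \<cdot>\<^sub>m lie_bracket (kkt_f T) (lie_bracket (kkt_f T) (\<phi> i))) (\<phi> i) = 1))"


section \<open>Topology\<close>

text \<open>A \<open>p\<close>-adic field is a non-archimedean local field of characteristic \<open>0\<close>; \<open>v\<close> is its absolute
  value.\<close>

definition field_topology :: "('k::field \<Rightarrow> real) \<Rightarrow> 'k topology" where
  "field_topology v = Metric_space.mtopology UNIV (\<lambda>a b. v (a - b))"

definition padic_field :: "('k::field_char_0 \<Rightarrow> real) \<Rightarrow> bool" where
  "padic_field v \<longleftrightarrow>
     (\<forall>a. 0 \<le> v a) \<and> (\<forall>a. v a = 0 \<longleftrightarrow> a = 0) \<and>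
     (\<forall>a b. v (a * b) = v a * v b) \<and> (\<forall>a b. v (a + b) \<le> max (v a) (v b)) \<and>
     (\<exists>a. v a \<noteq> 0 \<and> v a \<noteq> 1) \<and>
     compactin (field_topology v) {a. v a \<le> 1}"

definition mat_topology :: "('k::field \<Rightarrow> real) \<Rightarrow> nat \<Rightarrow> 'k mat topology" where
  "mat_topology v n = Metric_space.mtopology (carrier_mat n n)
     (\<lambda>A B. Max (insert 0 {v (A $$ (i, j) - B $$ (i, j)) | i j. i < n \<and> j < n}))"

abbreviation kkt_topology ::
    "('k::field_char_0 \<Rightarrow> real) \<Rightarrow> 'k kkt_datum \<Rightarrow> 'k mat set \<Rightarrow> 'k mat topology" where
  "kkt_topology v T S \<equiv> subtopology (mat_topology v (kkt_size T)) S"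

definition locally_constant :: "'a topology \<Rightarrow> ('a \<Rightarrow> 'b) \<Rightarrow> bool" where
  "locally_constant \<tau> f \<longleftrightarrow>
     (\<forall>a\<in>topspace \<tau>. \<exists>U. openin \<tau> U \<and> a \<in> U \<and> (\<forall>b\<in>U. f b = f a))"

definition unitary_character :: "('k::field \<Rightarrow> real) \<Rightarrow> ('k \<Rightarrow> complex) \<Rightarrow> bool" where
  "unitary_character v \<psi> \<longleftrightarrow>
     (\<forall>a b. \<psi> (a + b) = \<psi> a * \<psi> b) \<and> (\<forall>a. cmod (\<psi> a) = 1) \<and>
     continuous_map (field_topology v) euclidean \<psi>"


section \<open>Representations on \<open>L\<^sup>2(\<omega>)\<close>\<close>

definition kkt_orbit :: "'k::field_char_0 kkt_datum \<Rightarrow> 'k mat set \<Rightarrow> bool" where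
  "kkt_orbit T \<omega> \<longleftrightarrow> (\<exists>x0\<in>kkt_Nbar T. \<omega> = {kkt_act T m x0 | m. m \<in> kkt_M T})"

definition smooth_character ::
    "('k::field_char_0 \<Rightarrow> real) \<Rightarrow> 'k kkt_datum \<Rightarrow> ('k mat \<Rightarrow> complex) \<Rightarrow> bool" where
  "smooth_character v T \<nu> \<longleftrightarrow>
     (\<forall>m\<in>kkt_M T. \<nu> m \<noteq> 0) \<and>
     (\<forall>m\<in>kkt_M T. \<forall>m'\<in>kkt_M T. \<nu> (m * m') = \<nu> m * \<nu> m') \<and>
     locally_constant (kkt_topology v T (kkt_M T)) \<nu>"

text \<open>A non-zero Radon measure on \<open>\<omega>\<close> (regularity is automatic, since \<open>\<omega>\<close> is locally compact and
  second countable) with \<open>d(m x) = |\<nu>(m)|\<^sup>-\<^sup>2 dx\<close>.\<close>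

definition quasi_invariant_measure ::
    "('k::field_char_0 \<Rightarrow> real) \<Rightarrow> 'k kkt_datum \<Rightarrow> 'k mat set \<Rightarrow> ('k mat \<Rightarrow> complex)
      \<Rightarrow> 'k mat measure \<Rightarrow> bool" where
  "quasi_invariant_measure v T \<omega> \<nu> \<mu> \<longleftrightarrow>
     space \<mu> = \<omega> \<and> sets \<mu> = sigma_sets \<omega> {U. openin (kkt_topology v T \<omega>) U} \<and>
     (\<forall>C. compactin (kkt_topology v T \<omega>) C \<longrightarrow> emeasure \<mu> C < \<infinity>) \<and>
     emeasure \<mu> \<omega> \<noteq> 0 \<and>
     (\<forall>m\<in>kkt_M T. \<forall>A\<in>sets \<mu>.
        emeasure \<mu> (kkt_act T m ` A) = ennreal (1 / (cmod (\<nu> m))\<^sup>2) * emeasure \<mu> A)"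

text \<open>Elements of the Hilbert space \<open>L\<^sup>2(\<mu>)\<close> are represented by square integrable functions,
  considered up to \<open>eq_L2\<close>.\<close>

definition L2 :: "'a measure \<Rightarrow> ('a \<Rightarrow> complex) set" where
  "L2 \<mu> = {f \<in> borel_measurable \<mu>. integrable \<mu> (\<lambda>y. (cmod (f y))\<^sup>2)}"

definition eq_L2 :: "'a measure \<Rightarrow> ('a \<Rightarrow> complex) \<Rightarrow> ('a \<Rightarrow> complex) \<Rightarrow> bool" where
  "eq_L2 \<mu> f g \<longleftrightarrow> (AE y in \<mu>. f y = g y)"

definition inner_L2 :: "'a measure \<Rightarrow> ('a \<Rightarrow> complex) \<Rightarrow> ('a \<Rightarrow> complex) \<Rightarrow> complex" where
  "inner_L2 \<mu> f g = (LINT y|\<mu>. f y * cnj (g y))"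

definition unitary_representation ::
    "'g monoid \<Rightarrow> 'g topology \<Rightarrow> 'a measure \<Rightarrow> ('g \<Rightarrow> ('a \<Rightarrow> complex) \<Rightarrow> 'a \<Rightarrow> complex) \<Rightarrow> bool" where
  "unitary_representation \<G> \<tau> \<mu> \<Phi> \<longleftrightarrow>
     (\<forall>g\<in>carrier \<G>. \<forall>f\<in>L2 \<mu>. \<Phi> g f \<in> L2 \<mu>) \<and>
     (\<forall>g\<in>carrier \<G>. \<forall>f\<in>L2 \<mu>. \<forall>f'\<in>L2 \<mu>. eq_L2 \<mu> f f' \<longrightarrow> eq_L2 \<mu> (\<Phi> g f) (\<Phi> g f')) \<and>
     (\<forall>g\<in>carrier \<G>. \<forall>f\<in>L2 \<mu>. \<forall>f'\<in>L2 \<mu>. \<forall>a b.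
        eq_L2 \<mu> (\<Phi> g (\<lambda>y. a * f y + b * f' y)) (\<lambda>y. a * \<Phi> g f y + b * \<Phi> g f' y)) \<and>
     (\<forall>g\<in>carrier \<G>. \<forall>f\<in>L2 \<mu>. \<forall>f'\<in>L2 \<mu>. inner_L2 \<mu> (\<Phi> g f) (\<Phi> g f') = inner_L2 \<mu> f f') \<and>
     (\<forall>f\<in>L2 \<mu>. eq_L2 \<mu> (\<Phi> \<one>\<^bsub>\<G>\<^esub> f) f) \<and>
     (\<forall>g\<in>carrier \<G>. \<forall>g'\<in>carrier \<G>. \<forall>f\<in>L2 \<mu>. eq_L2 \<mu> (\<Phi> (g \<otimes>\<^bsub>\<G>\<^esub> g') f) (\<Phi> g (\<Phi> g' f))) \<and>
     (\<forall>f\<in>L2 \<mu>. \<forall>g0\<in>carrier \<G>. \<forall>\<epsilon>>0. \<exists>U. openin \<tau> U \<and> g0 \<in> U \<and>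
        (\<forall>g\<in>U. (LINT y|\<mu>. (cmod (\<Phi> g f y - \<Phi> g0 f y))\<^sup>2) < \<epsilon>))"

text \<open>The action \<open>\<pi>\<close> of \<open>P = MN\<close>, given on \<open>M\<close> and on \<open>N\<close>.\<close>

definition pi_M ::
    "'k::field_char_0 kkt_datum \<Rightarrow> ('k mat \<Rightarrow> complex) \<Rightarrow> 'k mat
      \<Rightarrow> ('k mat \<Rightarrow> complex) \<Rightarrow> 'k mat \<Rightarrow> complex" where
  "pi_M T \<nu> m f = (\<lambda>y. \<nu> m * f (kkt_act T (inv\<^bsub>GL (kkt_size T)\<^esub> m) y))"

definition psi_char ::
    "'k::field_char_0 kkt_datum \<Rightarrow> ('k \<Rightarrow> complex) \<Rightarrow> 'k mat \<Rightarrow> 'k mat \<Rightarrow> complex" where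
  "psi_char T \<psi> x n = \<psi> (kkt_pairing T n x)"

definition pi_N ::
    "'k::field_char_0 kkt_datum \<Rightarrow> ('k \<Rightarrow> complex) \<Rightarrow> 'k mat
      \<Rightarrow> ('k mat \<Rightarrow> complex) \<Rightarrow> 'k mat \<Rightarrow> complex" where
  "pi_N T \<psi> n f = (\<lambda>y. psi_char T \<psi> y n * f y)"

definition extends_pi ::
    "('k::field_char_0 \<Rightarrow> real) \<Rightarrow> 'k kkt_datum \<Rightarrow> ('k \<Rightarrow> complex) \<Rightarrow> ('k mat \<Rightarrow> complex)
      \<Rightarrow> 'k mat measure \<Rightarrow> ('k mat \<Rightarrow> ('k mat \<Rightarrow> complex) \<Rightarrow> 'k mat \<Rightarrow> complex) \<Rightarrow> bool" where
  "extends_pi v T \<psi> \<nu> \<mu> \<Phi> \<longleftrightarrow>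
     unitary_representation (mat_subgroup (kkt_size T) (kkt_G T)) (kkt_topology v T (kkt_G T)) \<mu> \<Phi> \<and>
     (\<forall>m\<in>kkt_M T. \<forall>f\<in>L2 \<mu>. eq_L2 \<mu> (\<Phi> m f) (pi_M T \<nu> m f)) \<and>
     (\<forall>n\<in>kkt_N T. \<forall>f\<in>L2 \<mu>. eq_L2 \<mu> (\<Phi> n f) (pi_N T \<psi> n f))"

text \<open>The space \<open>V\<close>. Each \<open>G\<close>-smooth element of \<open>L\<^sup>2(\<omega>)\<close> has a unique locally constant
  representative on \<open>\<omega>\<close>; as functions here live on all matrices, it is extended by \<open>0\<close>.\<close>

definition smooth_vectors ::
    "('k::field_char_0 \<Rightarrow> real) \<Rightarrow> 'k kkt_datum \<Rightarrow> 'k mat set \<Rightarrow> 'k mat measure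
      \<Rightarrow> ('k mat \<Rightarrow> ('k mat \<Rightarrow> complex) \<Rightarrow> 'k mat \<Rightarrow> complex) \<Rightarrow> ('k mat \<Rightarrow> complex) set" where
  "smooth_vectors v T \<omega> \<mu> \<Phi> =
     {f \<in> L2 \<mu>. locally_constant (kkt_topology v T \<omega>) f \<and> (\<forall>y. y \<notin> \<omega> \<longrightarrow> f y = 0) \<and>
        (\<exists>K. subgroup K (mat_subgroup (kkt_size T) (kkt_G T)) \<and>
           openin (kkt_topology v T (kkt_G T)) K \<and> compactin (kkt_topology v T (kkt_G T)) K \<and>
           (\<forall>g\<in>K. eq_L2 \<mu> (\<Phi> g f) f))}"

definition linear_functional_on ::
    "('a \<Rightarrow> complex) set \<Rightarrow> (('a \<Rightarrow> complex) \<Rightarrow> complex) \<Rightarrow> bool" where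
  "linear_functional_on V ell \<longleftrightarrow>
     (\<forall>f\<in>V. \<forall>g\<in>V. \<forall>a b. ell (\<lambda>y. a * f y + b * g y) = a * ell f + b * ell g)"

end

theory Submission imports Defs "HOL-Library.Function_Algebras" begin

text \<open>Let \<open>u\<close> be a smooth vector and \<open>A\<close> of degree \<open>2\<close>. For a positive integer \<open>q\<close> close enough to \<open>0\<close> in
  \<open>k\<close>, \<open>exp (q A)\<close> fixes \<open>u\<close>, so averaging \<open>\<psi>\<^sub>x(exp (j A))\<inverse> \<pi>(exp (j A)) u\<close> over \<open>j < q\<close> multiplies \<open>u\<close> by
  the indicator function of \<open>{y. \<psi>\<^sub>y(exp A) = \<psi>\<^sub>x(exp A)}\<close>, while \<open>ell u\<close> does not change. As bounded
  subsets of \<open>k\<close> are totally bounded and \<open>\<psi>\<close> is non-trivial, finitely many \<open>A\<close> force \<open>\<kappa>(B, log y)\<close> to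
  be close to \<open>\<kappa>(B, log x)\<close> for all \<open>y\<close> in the support of the average; since \<open>\<kappa>\<close> pairs the degrees
  \<open>2\<close> and \<open>- 2\<close> nondegenerately, this support can be made to lie in any neighbourhood of \<open>x\<close>. Hence
  \<open>ell u\<close> depends only on \<open>u\<close> near \<open>x\<close>.

  The elements of degree \<open>2\<close> orthogonal to degree \<open>- 2\<close> form an ideal of \<open>J\<close> that contains no \<open>e\<^sub>i\<close>, so
  they vanish because \<open>J\<close> is simple. That \<open>exp A\<close> is a rational point of \<open>G\<close> for nilpotent \<open>A\<close> in the
  Lie algebra needs Galois descent, as \<open>G\<close> is given by points over the algebraic closure.

  Smooth vectors are almost everywhere equal only if they are equal: \<open>\<omega>\<close> is a separable homogeneous
  space, so a null open set would have countably many null translates covering \<open>\<omega>\<close>.\<close>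

text \<open>Left translation by a point of \<open>kkt_group T\<close> turns an equation over k into
  one over the algebraic closure, while \<open>lie_algebra\<close> tests tangent vectors only
  against equations over k. This is the obstacle that descent removes, and the reason why
  automorphisms of the algebraic closure over k have to be constructed. The average can be a finite
  sum because the integers are bounded in k: positive integers q come arbitrarily near 0, and
  \<open>\<psi>\<close> takes q-fold multiples to q-th powers. On the support of u the ratio of the
  two characters is then a q-th root of unity, and a geometric sum does the work of an integral over
  a compact subgroup. No logarithm series is needed either. For \<open>Y\<close> of degree c with
  \<open>c \<noteq> 0\<close> the powers of \<open>Y\<close> have distinct weights under
  \<open>ad h\<close>; this forces nilpotency and makes the logarithm linear in the entries of the
  exponential. The radical is controlled in degree 2 only; nondegeneracy in degree -2 is reached
  because \<open>(ad f)^2 (ad e)^2\<close> is multiplication by 4 there.\<close>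

section \<open>Extending homomorphisms over k to automorphisms of the algebraic closure\<close>

text \<open>A partial homomorphism is given only by its graph \<open>R\<close>, so applying it to
  the coefficients of \<open>P\<close> becomes a relation between \<open>P\<close> and its image
  \<open>Q\<close>.\<close>

definition rel_poly :: "('a::zero \<times> 'b::zero) set \<Rightarrow> 'a poly \<Rightarrow> 'b poly \<Rightarrow> bool" where
  "rel_poly R P Q \<longleftrightarrow> (\<forall>i. (Polynomial.coeff P i, Polynomial.coeff Q i) \<in> R)"

text \<open>Graphs of \<open>k\<close>-homomorphisms from subrings of the algebraic closure to the algebraic
  closure.\<close>

definition ac_graph :: "('k::field alg_closure \<times> 'k alg_closure) set \<Rightarrow> bool" where
  "ac_graph R \<longleftrightarrow>
     (\<forall>a. (to_ac a, to_ac a) \<in> R) \<and>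
     (\<forall>u w u' w'. (u, w) \<in> R \<longrightarrow> (u', w') \<in> R \<longrightarrow> (u + u', w + w') \<in> R \<and> (u * u', w * w') \<in> R) \<and>
     (\<forall>w. (0, w) \<in> R \<longrightarrow> w = 0)"

lemma ac_graph_const: "ac_graph R \<Longrightarrow> (to_ac a, to_ac a) \<in> R"
  and ac_graph_add: "ac_graph R \<Longrightarrow> (u, w) \<in> R \<Longrightarrow> (u', w') \<in> R \<Longrightarrow> (u + u', w + w') \<in> R"
  and ac_graph_mult: "ac_graph R \<Longrightarrow> (u, w) \<in> R \<Longrightarrow> (u', w') \<in> R \<Longrightarrow> (u * u', w * w') \<in> R"
  and ac_graph_zeroD: "ac_graph R \<Longrightarrow> (0, w) \<in> R \<Longrightarrow> w = 0"
  by (simp_all add: ac_graph_def)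

lemma ac_graphI:
  assumes "\<And>a. (to_ac a, to_ac a) \<in> R"
    and "\<And>u w u' w'. (u, w) \<in> R \<Longrightarrow> (u', w') \<in> R \<Longrightarrow> (u + u', w + w') \<in> R"
    and "\<And>u w u' w'. (u, w) \<in> R \<Longrightarrow> (u', w') \<in> R \<Longrightarrow> (u * u', w * w') \<in> R"
    and "\<And>w. (0, w) \<in> R \<Longrightarrow> w = 0"
  shows "ac_graph R"
  using assms by (simp add: ac_graph_def)

lemma ac_graph_zero: "ac_graph R \<Longrightarrow> (0, 0) \<in> R"
  and ac_graph_one: "ac_graph R \<Longrightarrow> (1, 1) \<in> R"
  using ac_graph_const[of R 0] ac_graph_const[of R 1] by simp_all

lemma ac_graph_diff:
  assumes "ac_graph R" "(u, w) \<in> R" "(u', w') \<in> R"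
  shows "(u - u', w - w') \<in> R"
proof -
  have "(to_ac (- 1) * u', to_ac (- 1) * w') \<in> R"
    by (rule ac_graph_mult[OF assms(1) ac_graph_const[OF assms(1)] assms(3)])
  then have "(- u', - w') \<in> R" by simp
  from ac_graph_add[OF assms(1,2) this] show ?thesis by simp
qed

lemma ac_graph_unique: "ac_graph R \<Longrightarrow> (u, w) \<in> R \<Longrightarrow> (u, w') \<in> R \<Longrightarrow> w = w'"
  using ac_graph_diff[of R u w u w'] ac_graph_zeroD[of R "w - w'"] by simp

lemma ac_graph_sum:
  assumes "ac_graph R" "\<And>i. i \<in> A \<Longrightarrow> (f i, g i) \<in> R"
  shows "(sum f A, sum g A) \<in> R"
  using assms(2) by (induction A rule: infinite_finite_induct)
    (auto intro: ac_graph_add[OF assms(1)] simp: ac_graph_zero[OF assms(1)])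

lemma ac_graph_poly:
  assumes "ac_graph R" "(u, w) \<in> R"
  shows "(poly (map_poly to_ac p) u, poly (map_poly to_ac p) w) \<in> R"
proof (induction p)
  case 0
  then show ?case by (simp add: ac_graph_zero[OF assms(1)])
next
  case (pCons a p)
  then show ?case
    by (auto simp: map_poly_pCons intro!: ac_graph_add[OF assms(1)] ac_graph_mult[OF assms(1)]
        assms(2) ac_graph_const[OF assms(1)])
qed

text \<open>Dividing an annihilating polynomial of \<open>u\<close> by the variable until its
  constant term \<open>a\<close> is nonzero gives \<open>a + u q(u) = 0\<close>, hence the inverse
  \<open>- q(u) / a\<close>. Consequently every ring between k and its algebraic closure is a
  field.\<close>

lemma ac_inverse_poly:
  fixes u :: "'k::field alg_closure"
  assumes "u \<noteq> 0"
  obtains c :: "'k poly" where "u * poly (map_poly to_ac c) u = 1"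
proof -
  have *: "\<exists>p. Polynomial.coeff p 0 \<noteq> 0 \<and> poly (map_poly to_ac p) u = 0"
    if "q \<noteq> 0" "poly (map_poly to_ac q) u = 0" for q :: "'k poly"
    using that
  proof (induction q)
    case (pCons a q)
    show ?case
    proof (cases "a = 0")
      case True
      then show ?thesis using pCons assms by (auto simp: map_poly_pCons)
    next
      case False
      then show ?thesis using pCons by (intro exI[of _ "pCons a q"]) auto
    qed
  qed simp
  obtain q :: "'k poly" where "q \<noteq> 0" "poly (map_poly to_ac q) u = 0"
    by (rule alg_closure_algebraic)
  with * obtain p where p: "Polynomial.coeff p 0 \<noteq> 0" "poly (map_poly to_ac p) u = 0" by blast
  obtain a q where aq: "p = pCons a q" by (cases p)
  with p have "a \<noteq> 0" "to_ac a + u * poly (map_poly to_ac q) u = 0"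
    by (auto simp: map_poly_pCons)
  moreover obtain d where d: "d * a = - 1" using \<open>a \<noteq> 0\<close> by (metis field_class.field_inverse mult_minus_left)
  moreover have "poly (map_poly to_ac (Polynomial.smult d q)) u = to_ac d * poly (map_poly to_ac q) u"
    by (subst map_poly_smult) auto
  moreover have "to_ac d * to_ac a = - 1" using d by (metis to_ac_1 to_ac_minus to_ac_mult)
  ultimately have "u * poly (map_poly to_ac (Polynomial.smult d q)) u = 1"
    by (metis add.inverse_inverse add_eq_0_iff mult.left_commute mult_minus_right)
  then show thesis by (rule that)
qed

text \<open>The inverse of \<open>u\<close> is a polynomial in \<open>u\<close> over k, so its image
  is already determined by the graph. Thus the domain of a graph is a field and the homomorphism is
  injective.\<close>

lemma ac_graph_inverse:
  assumes "ac_graph R" "(u, w) \<in> R" "u \<noteq> 0"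
  shows "(inverse u, inverse w) \<in> R" "w \<noteq> 0"
proof -
  obtain c :: "'a poly" where c: "u * poly (map_poly to_ac c) u = 1"
    using ac_inverse_poly assms(3) by blast
  have R: "(poly (map_poly to_ac c) u, poly (map_poly to_ac c) w) \<in> R"
    by (rule ac_graph_poly[OF assms(1,2)])
  from ac_graph_mult[OF assms(1,2) this] c
  have "(1, w * poly (map_poly to_ac c) w) \<in> R" by simp
  then have 1: "w * poly (map_poly to_ac c) w = 1"
    using ac_graph_unique[OF assms(1)] ac_graph_one[OF assms(1)] by metis
  show "w \<noteq> 0" using 1 by auto
  have "inverse u = poly (map_poly to_ac c) u" "inverse w = poly (map_poly to_ac c) w"
    using c 1 by (auto intro: inverse_unique)
  then show "(inverse u, inverse w) \<in> R" using R by simp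
qed

lemma rel_poly_add:
  "ac_graph R \<Longrightarrow> rel_poly R P Q \<Longrightarrow> rel_poly R P' Q' \<Longrightarrow> rel_poly R (P + P') (Q + Q')"
  by (simp add: rel_poly_def ac_graph_add)

lemma rel_poly_mult:
  "ac_graph R \<Longrightarrow> rel_poly R P Q \<Longrightarrow> rel_poly R P' Q' \<Longrightarrow> rel_poly R (P * P') (Q * Q')"
  by (auto simp: rel_poly_def coeff_mult intro!: ac_graph_sum ac_graph_mult)

lemma rel_poly_diff:
  "ac_graph R \<Longrightarrow> rel_poly R P Q \<Longrightarrow> rel_poly R P' Q' \<Longrightarrow> rel_poly R (P - P') (Q - Q')"
  by (simp add: rel_poly_def ac_graph_diff)

lemma rel_poly_smult:
  "ac_graph R \<Longrightarrow> rel_poly R P Q \<Longrightarrow> (u, w) \<in> R \<Longrightarrow>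
    rel_poly R (Polynomial.smult u P) (Polynomial.smult w Q)"
  by (simp add: rel_poly_def ac_graph_mult)

lemma rel_poly_monom:
  "ac_graph R \<Longrightarrow> (u, w) \<in> R \<Longrightarrow> rel_poly R (Polynomial.monom u n) (Polynomial.monom w n)"
  by (auto simp: rel_poly_def ac_graph_zero)

text \<open>\<open>m\<close> is the minimal polynomial of \<open>a\<close> over the domain of
  \<open>R\<close>, and \<open>m'\<close> is its image under the homomorphism. The roots of
  \<open>m'\<close> are the possible images of \<open>a\<close>.\<close>

definition min_rel_poly where
  "min_rel_poly R a m m' \<longleftrightarrow> rel_poly R m m' \<and> poly m a = 0 \<and> Polynomial.lead_coeff m = 1 \<and>
     (\<forall>P Q. rel_poly R P Q \<longrightarrow> P \<noteq> 0 \<longrightarrow> poly P a = 0 \<longrightarrow> Polynomial.degree m \<le> Polynomial.degree P)"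

lemma min_rel_poly_ex:
  fixes a :: "'k::field alg_closure"
  assumes R: "ac_graph R"
  obtains m m' where "min_rel_poly R a m m'"
proof -
  let ?P = "\<lambda>(P, Q). rel_poly R P Q \<and> P \<noteq> 0 \<and> poly P a = 0"
  obtain q :: "'k poly" where q: "q \<noteq> 0" "poly (map_poly to_ac q) a = 0"
    by (rule alg_closure_algebraic)
  have "?P (map_poly to_ac q, map_poly to_ac q)"
    using q by (auto simp: rel_poly_def coeff_map_poly ac_graph_const[OF R] map_poly_eq_0_iff)
  from ex_has_least_nat[of ?P, OF this, of "\<lambda>(P, Q). Polynomial.degree P"]
  obtain P Q where PQ: "rel_poly R P Q" "P \<noteq> 0" "poly P a = 0"
    and min: "\<And>P' Q'. rel_poly R P' Q' \<Longrightarrow> P' \<noteq> 0 \<Longrightarrow> poly P' a = 0 \<Longrightarrow>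
      Polynomial.degree P \<le> Polynomial.degree P'"
    by auto
  let ?l = "Polynomial.lead_coeff P" and ?d = "Polynomial.degree P"
  have l: "(?l, Polynomial.coeff Q ?d) \<in> R" using PQ(1) by (simp add: rel_poly_def)
  have "min_rel_poly R a (Polynomial.smult (inverse ?l) P)
      (Polynomial.smult (inverse (Polynomial.coeff Q ?d)) Q)"
    unfolding min_rel_poly_def
    using PQ min ac_graph_inverse(1)[OF R l] by (auto intro!: rel_poly_smult R)
  then show thesis by (rule that)
qed

text \<open>Division by \<open>m\<close>, carried out on \<open>P\<close> and by \<open>m'\<close>
  on \<open>Q\<close> at the same time. It is what makes sending \<open>P(a)\<close> to
  \<open>Q(b)\<close> well defined.\<close>

lemma min_rel_poly_root:
  assumes R: "ac_graph R" and m: "min_rel_poly R a m m'" and b: "poly m' b = 0"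
    and "rel_poly R P Q" "poly P a = 0"
  shows "poly Q b = 0"
  using assms(4,5)
proof (induction "Polynomial.degree P" arbitrary: P Q rule: less_induct)
  case less
  have mm: "rel_poly R m m'" "poly m a = 0" "Polynomial.lead_coeff m = 1"
    and min: "\<And>P Q. rel_poly R P Q \<Longrightarrow> P \<noteq> 0 \<Longrightarrow> poly P a = 0 \<Longrightarrow>
      Polynomial.degree m \<le> Polynomial.degree P"
    using m unfolding min_rel_poly_def by blast+
  have Z: "poly Q b = 0" if "P = 0"
  proof -
    have "Polynomial.coeff Q i = 0" for i
      using less.prems(1) that ac_graph_zeroD[OF R] by (auto simp: rel_poly_def)
    then have "Q = 0" by (simp add: poly_eq_iff)
    then show ?thesis by simp
  qed
  show ?case
  proof (cases "P = 0")
    case False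
    let ?l = "Polynomial.lead_coeff P" and ?d = "Polynomial.degree P"
    let ?e = "?d - Polynomial.degree m"
    have dm: "Polynomial.degree m \<le> ?d" using min less.prems False by blast
    have m0: "m \<noteq> 0" using mm(3) by auto
    have dm0: "Polynomial.degree m > 0"
    proof (rule ccontr)
      assume "\<not> 0 < Polynomial.degree m"
      then obtain c where "m = [:c:]" using degree_eq_zeroE by blast
      with mm(2,3) show False by simp
    qed
    have l: "(?l, Polynomial.coeff Q ?d) \<in> R" using less.prems(1) by (simp add: rel_poly_def)
    \<comment> \<open>As \<open>m\<close> is monic, this cancels the leading term of
      \<open>P\<close>. The corresponding multiple of \<open>m'\<close> is subtracted from
      \<open>Q\<close>; the two corrections vanish at \<open>a\<close> and at
      \<open>b\<close>.\<close>
    define P' where "P' = P - Polynomial.monom ?l ?e * m"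
    define Q' where "Q' = Q - Polynomial.monom (Polynomial.coeff Q ?d) ?e * m'"
    have "rel_poly R P' Q'" unfolding P'_def Q'_def
      by (intro rel_poly_diff rel_poly_mult rel_poly_monom R less.prems l mm)
    moreover have "poly P' a = 0" using less.prems mm by (simp add: P'_def)
    moreover have "Polynomial.degree P' < ?d"
    proof -
      have deg: "Polynomial.degree (Polynomial.monom ?l ?e * m) = ?d"
        using False m0 dm by (simp add: degree_mult_eq degree_monom_eq)
      have lc: "Polynomial.coeff (Polynomial.monom ?l ?e * m) ?d = ?l"
        using mm(3) dm by (simp add: coeff_monom_mult)
      have "Polynomial.degree P' \<le> ?d" unfolding P'_def
        by (rule degree_diff_le) (auto simp: deg)
      moreover have "Polynomial.coeff P' ?d = 0" by (simp add: P'_def lc)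
      moreover have "?d > 0" using dm dm0 by simp
      ultimately show ?thesis
        by (metis degree_0 le_neq_implies_less leading_coeff_neq_0)
    qed
    ultimately have "poly Q' b = 0" using less.hyps by blast
    then show ?thesis using b by (simp add: Q'_def)
  qed (use Z in simp)
qed

text \<open>The ring generated by \<open>a\<close> over the domain consists of values of
  polynomials. One value may come from several \<open>P\<close>, and
  \<open>min_rel_poly_root\<close> makes the images agree.\<close>

lemma ac_graph_adjoin:
  assumes R: "ac_graph R" and m: "min_rel_poly R a m m'" and b: "poly m' b = 0"
  obtains R' where "ac_graph R'" "R \<subseteq> R'" "(a, b) \<in> R'"
proof
  let ?R = "{(poly P a, poly Q b) | P Q. rel_poly R P Q}"
  have c: "rel_poly R [:u:] [:w:]" if "(u, w) \<in> R" for u w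
    using that by (auto simp: rel_poly_def coeff_pCons ac_graph_zero[OF R] split: nat.split)
  show sub: "R \<subseteq> ?R"
  proof
    fix z assume "z \<in> R"
    then show "z \<in> ?R" using c[of "fst z" "snd z"] by (cases z) force
  qed
  show "(a, b) \<in> ?R"
    using rel_poly_monom[OF R ac_graph_one[OF R], of 1] by (force simp: poly_monom)
  have add: "(u + u', w + w') \<in> ?R" and mult: "(u * u', w * w') \<in> ?R"
    if uw: "(u, w) \<in> ?R" "(u', w') \<in> ?R" for u w u' w'
  proof -
    obtain P Q P' Q' where *: "rel_poly R P Q" "rel_poly R P' Q'"
      "u = poly P a" "w = poly Q b" "u' = poly P' a" "w' = poly Q' b" using uw by auto
    have "u + u' = poly (P + P') a" "w + w' = poly (Q + Q') b" using * by simp_all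
    then show "(u + u', w + w') \<in> ?R" using rel_poly_add[OF R *(1,2)] by blast
    have "u * u' = poly (P * P') a" "w * w' = poly (Q * Q') b" using * by simp_all
    then show "(u * u', w * w') \<in> ?R" using rel_poly_mult[OF R *(1,2)] by blast
  qed
  have z: "w = 0" if "(0, w) \<in> ?R" for w
  proof -
    from that obtain P Q where "poly P a = 0" "w = poly Q b" "rel_poly R P Q"
      unfolding mem_Collect_eq prod.inject by metis
    then show ?thesis using min_rel_poly_root[OF R m b] by blast
  qed
  have "(to_ac c, to_ac c) \<in> ?R" for c using sub ac_graph_const[OF R] by blast
  then show "ac_graph ?R" using add mult z by (rule ac_graphI)
qed

text \<open>A graph that is maximal by Zorn is total, since a missing \<open>a\<close> could be sent
  to a root of the image of its minimal polynomial. Surjectivity is counting: the map permutes the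
  finitely many roots of a polynomial over k.\<close>

lemma ac_graph_extend:
  fixes R0 :: "('k::field alg_closure \<times> 'k alg_closure) set"
  assumes "ac_graph R0"
  obtains \<sigma> :: "'k alg_closure \<Rightarrow> 'k alg_closure" where
    "\<And>u w. \<sigma> (u + w) = \<sigma> u + \<sigma> w" "\<And>u w. \<sigma> (u * w) = \<sigma> u * \<sigma> w"
    "\<And>a. \<sigma> (to_ac a) = to_ac a" "bij \<sigma>" "\<And>u w. (u, w) \<in> R0 \<Longrightarrow> \<sigma> u = w"
proof -
  have "\<exists>M\<in>{R. ac_graph R \<and> R0 \<subseteq> R}.
      \<forall>S\<in>{R. ac_graph R \<and> R0 \<subseteq> R}. M \<subseteq> S \<longrightarrow> S = M"
  proof (rule subset_Zorn_nonempty)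
    show "{R. ac_graph R \<and> R0 \<subseteq> R} \<noteq> {}" using assms by blast
    fix C assume C: "C \<noteq> {}" "subset.chain {R. ac_graph R \<and> R0 \<subseteq> R} C"
    then have g: "\<And>R. R \<in> C \<Longrightarrow> ac_graph R \<and> R0 \<subseteq> R"
      and ch: "\<And>R S. R \<in> C \<Longrightarrow> S \<in> C \<Longrightarrow> R \<subseteq> S \<or> S \<subseteq> R"
      by (auto simp: subset_chain_def)
    have pair: "\<exists>R\<in>C. ac_graph R \<and> (u, w) \<in> R \<and> (u', w') \<in> R"
      if uw: "(u, w) \<in> \<Union>C" "(u', w') \<in> \<Union>C" for u w u' w'
    proof -
      obtain R S where "R \<in> C" "(u, w) \<in> R" "S \<in> C" "(u', w') \<in> S" using uw by blast
      then show ?thesis using ch[of R S] g by blast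
    qed
    have "ac_graph (\<Union>C)"
    proof (rule ac_graphI)
      fix a 
      obtain R where "R \<in> C" using C(1) by blast
      then show "(to_ac a, to_ac a) \<in> \<Union>C" using g ac_graph_const by (meson UnionI)
    next
      fix u w u' w' assume "(u, w) \<in> \<Union>C" "(u', w') \<in> \<Union>C"
      from pair[OF this] show "(u + u', w + w') \<in> \<Union>C" using ac_graph_add by blast
    next
      fix u w u' w' assume "(u, w) \<in> \<Union>C" "(u', w') \<in> \<Union>C"
      from pair[OF this] show "(u * u', w * w') \<in> \<Union>C" using ac_graph_mult by blast
    next
      fix w assume "(0, w) \<in> \<Union>C"
      then obtain R where "R \<in> C" "(0, w) \<in> R" by blast
      then show "w = 0" using g ac_graph_zeroD by metis
    qed
    then show "\<Union>C \<in> {R. ac_graph R \<and> R0 \<subseteq> R}" using C(1) g by blast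
  qed
  then obtain R where "R \<in> {R. ac_graph R \<and> R0 \<subseteq> R}"
    and *: "\<forall>S\<in>{R. ac_graph R \<and> R0 \<subseteq> R}. R \<subseteq> S \<longrightarrow> S = R" by (elim bexE)
  then have R: "ac_graph R" "R0 \<subseteq> R" by simp_all
  have max: "S = R" if "ac_graph S" "R \<subseteq> S" for S
    using * that R(2) by simp
  have tot: "\<exists>b. (a, b) \<in> R" for a
  proof -
    obtain m m' where m: "min_rel_poly R a m m'" using min_rel_poly_ex[OF R(1)] by blast
    then have mm: "rel_poly R m m'" "poly m a = 0" "Polynomial.lead_coeff m = 1"
      by (auto simp: min_rel_poly_def)
    then have "(1, Polynomial.coeff m' (Polynomial.degree m)) \<in> R" by (metis rel_poly_def)
    \<comment> \<open>The leading coefficient 1 of \<open>m\<close> survives in \<open>m'\<close>,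
      so \<open>m'\<close> is not constant and has a root.\<close>
    then have 1: "Polynomial.coeff m' (Polynomial.degree m) = 1"
      using ac_graph_unique[OF R(1)] ac_graph_one[OF R(1)] by metis
    have "Polynomial.degree m > 0"
    proof (rule ccontr)
      assume "\<not> 0 < Polynomial.degree m"
      then obtain c where "m = [:c:]" using degree_eq_zeroE by blast
      with mm(2,3) show False by simp
    qed
    with 1 have "Polynomial.degree m' > 0"
      by (metis le_degree not_less_zero not_gr_zero le_zero_eq zero_neq_one)
    then obtain b where "poly m' b = 0" using alg_closed_imp_poly_has_root by blast
    from ac_graph_adjoin[OF R(1) m this] obtain R' where "ac_graph R'" "R \<subseteq> R'" "(a, b) \<in> R'" .
    then show ?thesis using max by blast
  qed
  define \<sigma> where "\<sigma> u = (SOME w. (u, w) \<in> R)" for u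
  have s: "(u, \<sigma> u) \<in> R" for u unfolding \<sigma>_def using tot by (rule someI_ex)
  have eq: "\<sigma> u = w" if "(u, w) \<in> R" for u w using ac_graph_unique[OF R(1) s that] .
  have inj: "inj \<sigma>"
  proof (rule injI)
    fix u w assume "\<sigma> u = \<sigma> w"
    with ac_graph_diff[OF R(1) s s, of u w] have "(u - w, 0) \<in> R" by simp
    then show "u = w" using ac_graph_inverse(2)[OF R(1)] by force
  qed
  have "\<exists>z. y = \<sigma> z" for y
  proof -
    obtain p :: "'k poly" where p: "p \<noteq> 0" "poly (map_poly to_ac p) y = 0"
      by (rule alg_closure_algebraic)
    let ?Z = "{z. poly (map_poly to_ac p) z = 0}"
    have fin: "finite ?Z" using p by (intro poly_roots_finite) (simp add: map_poly_eq_0_iff)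
    have "\<sigma> ` ?Z \<subseteq> ?Z"
    proof clarify
      fix z assume "poly (map_poly to_ac p) z = 0"
      with ac_graph_poly[OF R(1) s, of p z] show "poly (map_poly to_ac p) (\<sigma> z) = 0"
        using ac_graph_zeroD[OF R(1)] by simp
    qed
    then have "\<sigma> ` ?Z = ?Z"
      by (rule endo_inj_surj[OF fin]) (use inj in \<open>blast intro: inj_on_subset\<close>)
    moreover have "y \<in> ?Z" using p(2) by simp
    ultimately have "y \<in> \<sigma> ` ?Z" by simp
    then show ?thesis by (elim imageE) (rule exI)
  qed
  then have b: "bij \<sigma>" using inj by (simp add: bij_def surj_def)
  have "\<sigma> (u + w) = \<sigma> u + \<sigma> w" "\<sigma> (u * w) = \<sigma> u * \<sigma> w" for u w
    using eq[OF ac_graph_add[OF R(1) s s]] eq[OF ac_graph_mult[OF R(1) s s]] by simp_all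
  moreover have "\<sigma> (to_ac a) = to_ac a" for a
    using eq[OF ac_graph_const[OF R(1)]] .
  moreover note b
  moreover have "\<sigma> u = w" if "(u, w) \<in> R0" for u w
    using eq R(2) that by (meson subsetD)
  ultimately show thesis by (rule that)
qed

text \<open>The minimal polynomial of \<open>c\<close> over k has degree at least 2 and is separable
  in characteristic 0. It therefore has a root \<open>c' \<noteq> c\<close>, and sending
  \<open>c\<close> to \<open>c'\<close> extends to an automorphism.\<close>

lemma ac_automorphism_moving:
  fixes c :: "'k::field_char_0 alg_closure"
  assumes "c \<notin> range to_ac"
  shows "\<exists>\<sigma> :: 'k alg_closure \<Rightarrow> 'k alg_closure. (\<forall>u w. \<sigma> (u + w) = \<sigma> u + \<sigma> w) \<and>
    (\<forall>u w. \<sigma> (u * w) = \<sigma> u * \<sigma> w) \<and> (\<forall>a. \<sigma> (to_ac a) = to_ac a) \<and> bij \<sigma> \<and> \<sigma> c \<noteq> c"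
proof -
  let ?R = "range (\<lambda>a :: 'k. (to_ac a, to_ac a))"
  have R: "ac_graph ?R" unfolding ac_graph_def
    by (auto simp flip: to_ac_add to_ac_mult)
  obtain m m' where m: "min_rel_poly ?R c m m'" using min_rel_poly_ex[OF R] by blast
  then have mm: "rel_poly ?R m m'" "poly m c = 0" "Polynomial.lead_coeff m = 1"
    and min: "\<And>P Q. rel_poly ?R P Q \<Longrightarrow> P \<noteq> 0 \<Longrightarrow> poly P c = 0 \<Longrightarrow>
      Polynomial.degree m \<le> Polynomial.degree P"
    unfolding min_rel_poly_def by blast+
  have rng: "Polynomial.coeff m i \<in> range to_ac" and eq: "Polynomial.coeff m' i = Polynomial.coeff m i" for i
    using mm(1) by (auto simp: rel_poly_def dest!: spec[of _ i])
  have m': "m' = m" using eq by (simp add: poly_eq_iff)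
  have d0: "Polynomial.degree m > 0"
  proof (rule ccontr)
    assume "\<not> 0 < Polynomial.degree m"
    then obtain c where "m = [:c:]" using degree_eq_zeroE by blast
    with mm(2,3) show False by simp
  qed
  obtain q where q: "m = [:- c, 1:] * q" using mm(2) by (metis dvdE poly_eq_0_iff_dvd)
  have "q \<noteq> 0" using q d0 by auto
  have dq: "Polynomial.degree m = Suc (Polynomial.degree q)"
    unfolding q using \<open>q \<noteq> 0\<close> by (subst degree_mult_eq) auto
  have "Polynomial.degree q > 0"
  proof (rule ccontr)
    assume "\<not> 0 < Polynomial.degree q"
    then obtain d where d: "q = [:d:]" using degree_eq_zeroE by blast
    with q mm(3) have "d = 1" by (auto split: if_splits)
    with d q have "Polynomial.coeff m 0 = - c" by simp
    with rng[of 0] have "- c \<in> range to_ac" by simp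
    then obtain a where "- c = to_ac a" by blast
    then have "c = to_ac (- a)" by (metis minus_minus to_ac_minus)
    then show False using assms by blast
  qed
  then obtain c' where c': "poly q c' = 0" using alg_closed_imp_poly_has_root by blast
  \<comment> \<open>Otherwise \<open>c\<close> is a double root of \<open>m\<close>, and the
    derivative of \<open>m\<close>, again with coefficients in k, contradicts minimality.\<close>
  have "c' \<noteq> c"
  proof
    assume "c' = c"
    with c' have "poly (pderiv m) c = 0"
      by (simp only: q pderiv_mult) (simp add: pderiv_pCons)
    moreover have "pderiv m \<noteq> 0" using d0 by (simp add: pderiv_eq_0_iff)
    moreover have "rel_poly ?R (pderiv m) (pderiv m)"
      unfolding rel_poly_def coeff_pderiv
    proof
      fix i
      obtain a where a: "Polynomial.coeff m (Suc i) = to_ac a" using rng by blast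
      show "(of_nat (Suc i) * Polynomial.coeff m (Suc i), of_nat (Suc i) * Polynomial.coeff m (Suc i)) \<in> ?R"
        unfolding a by (rule image_eqI[of _ _ "of_nat (Suc i) * a"]) (simp_all del: of_nat_Suc)
    qed
    ultimately have "Polynomial.degree m \<le> Polynomial.degree (pderiv m)" using min by blast
    then show False using d0 by (simp add: degree_pderiv)
  qed
  have "poly m' c' = 0" using c' by (simp add: m' q)
  from ac_graph_adjoin[OF R m this] obtain R' where
    R': "ac_graph R'" "?R \<subseteq> R'" "(c, c') \<in> R'" .
  show ?thesis
  proof (rule ac_graph_extend[OF R'(1)])
    fix \<sigma> :: "'k alg_closure \<Rightarrow> 'k alg_closure"
    assume *: "\<And>u w. \<sigma> (u + w) = \<sigma> u + \<sigma> w" "\<And>u w. \<sigma> (u * w) = \<sigma> u * \<sigma> w"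
      "\<And>a. \<sigma> (to_ac a) = to_ac a" "bij \<sigma>" "\<And>u w. (u, w) \<in> R' \<Longrightarrow> \<sigma> u = w"
    have "\<sigma> c \<noteq> c" using *(5)[OF R'(3)] \<open>c' \<noteq> c\<close> by simp
    with *(1-4) show ?thesis by (intro exI[of _ \<sigma>]) simp
  qed
qed

section \<open>Polynomial expressions, their derivatives and substitutions\<close>

text \<open>Syntax trees allow evaluation, derivation and substitution by structural recursion.
  Equality of polynomials as such never matters, only values and derivatives do.\<close>

datatype 'a pexp = PC 'a | PV "nat \<times> nat" | PA "'a pexp" "'a pexp" | PM "'a pexp" "'a pexp"

primrec peval :: "('a \<Rightarrow> 'b::comm_ring_1) \<Rightarrow> (nat \<times> nat \<Rightarrow> 'b) \<Rightarrow> 'a pexp \<Rightarrow> 'b" where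
  "peval h x (PC c) = h c"
| "peval h x (PV ij) = x ij"
| "peval h x (PA a b) = peval h x a + peval h x b"
| "peval h x (PM a b) = peval h x a * peval h x b"

text \<open>The directional derivative at \<open>x\<close> along \<open>z\<close>, that is, the
  coefficient of t in the value at \<open>x + t z\<close>.\<close>

primrec pdiff :: "('a \<Rightarrow> 'b::comm_ring_1) \<Rightarrow> (nat \<times> nat \<Rightarrow> 'b) \<Rightarrow> (nat \<times> nat \<Rightarrow> 'b) \<Rightarrow> 'a pexp \<Rightarrow> 'b"
  where
  "pdiff h x z (PC c) = 0"
| "pdiff h x z (PV ij) = z ij"
| "pdiff h x z (PA a b) = pdiff h x z a + pdiff h x z b"
| "pdiff h x z (PM a b) = peval h x a * pdiff h x z b + pdiff h x z a * peval h x b"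

text \<open>A derivation whose results are expressions again, so that it can be iterated;
  \<open>z\<close> is a vector field with polynomial coefficients.\<close>

primrec pD :: "(nat \<times> nat \<Rightarrow> 'a::zero pexp) \<Rightarrow> 'a pexp \<Rightarrow> 'a pexp" where
  "pD z (PC c) = PC 0"
| "pD z (PV ij) = z ij"
| "pD z (PA a b) = PA (pD z a) (pD z b)"
| "pD z (PM a b) = PA (PM a (pD z b)) (PM (pD z a) b)"

primrec psubst :: "(nat \<times> nat \<Rightarrow> 'a pexp) \<Rightarrow> 'a pexp \<Rightarrow> 'a pexp" where
  "psubst s (PC c) = PC c"
| "psubst s (PV ij) = s ij"
| "psubst s (PA a b) = PA (psubst s a) (psubst s b)"
| "psubst s (PM a b) = PM (psubst s a) (psubst s b)"

primrec pSum :: "nat \<Rightarrow> (nat \<Rightarrow> 'a::zero pexp) \<Rightarrow> 'a pexp" where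
  "pSum 0 f = PC 0"
| "pSum (Suc n) f = PA (pSum n f) (f n)"

primrec pProd :: "nat \<Rightarrow> (nat \<Rightarrow> 'a::one pexp) \<Rightarrow> 'a pexp" where
  "pProd 0 f = PC 1"
| "pProd (Suc n) f = PM (pProd n f) (f n)"

lemma peval_pSum: "h 0 = 0 \<Longrightarrow> peval h x (pSum n f) = (\<Sum>i<n. peval h x (f i))"
  by (induction n) simp_all

lemma pdiff_pSum: "pdiff h x z (pSum n f) = (\<Sum>i<n. pdiff h x z (f i))"
  by (induction n) simp_all

lemma peval_pProd: "h 1 = 1 \<Longrightarrow> peval h x (pProd n f) = (\<Prod>i<n. peval h x (f i))"
  by (induction n) simp_all

lemma peval_psubst: "peval h x (psubst s e) = peval h (\<lambda>ij. peval h x (s ij)) e"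
  by (induction e) simp_all

lemma pdiff_psubst:
  "pdiff h x z (psubst s e) = pdiff h (\<lambda>ij. peval h x (s ij)) (\<lambda>ij. pdiff h x z (s ij)) e"
  by (induction e) (simp_all add: peval_psubst)

lemma peval_pD: "h 0 = 0 \<Longrightarrow> peval h x (pD z e) = pdiff h x (\<lambda>ij. peval h x (z ij)) e"
  by (induction e) simp_all

lemma peval_map_pexp: "peval id x (map_pexp h e) = peval h x e"
  by (induction e) simp_all

lemma pdiff_map_pexp: "pdiff id x z (map_pexp h e) = pdiff h x z e"
  by (induction e) (simp_all add: peval_map_pexp[unfolded id_def])

lemma pdiff_add: "pdiff h x (\<lambda>ij. z ij + w ij) e = pdiff h x z e + pdiff h x w e"
  by (induction e) (simp_all add: algebra_simps)

lemma pdiff_scale: "pdiff h x (\<lambda>ij. c * z ij) e = c * pdiff h x z e"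
  by (induction e) (simp_all add: algebra_simps)

lemma peval_hom:
  assumes "\<And>a b. g (a + b) = g a + g b" "\<And>a b. g (a * b) = g a * g b"
  shows "g (peval h x e) = peval (\<lambda>c. g (h c)) (\<lambda>ij. g (x ij)) e"
  by (induction e) (simp_all add: assms)

lemma pdiff_hom:
  assumes "g 0 = 0" "\<And>a b. g (a + b) = g a + g b" "\<And>a b. g (a * b) = g a * g b"
  shows "g (pdiff h x z e) = pdiff (\<lambda>c. g (h c)) (\<lambda>ij. g (x ij)) (\<lambda>ij. g (z ij)) e"
  by (induction e) (simp_all add: assms peval_hom[where g = g])

text \<open>With \<open>x\<close> the identity matrix and \<open>z\<close> a tangent vector this is
  the evaluation modulo t^2 used in \<open>lie_algebra\<close>.\<close>

lemma peval_dual: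
  "Polynomial.coeff (peval (\<lambda>c. pCons (h c) 0) (\<lambda>ij. pCons (x ij) (pCons (z ij) 0)) e) 0 = peval h x e"
  "Polynomial.coeff (peval (\<lambda>c. pCons (h c) 0) (\<lambda>ij. pCons (x ij) (pCons (z ij) 0)) e) 1 =
    pdiff h x z e"
  by (induction e) (simp_all add: coeff_mult)

text \<open>The chain rule along a polynomial curve, later the curve exp(t Y).\<close>

lemma pderiv_peval:
  "pderiv (peval (\<lambda>c. [:h c:]) x e) = pdiff (\<lambda>c. [:h c:]) x (\<lambda>ij. pderiv (x ij)) e"
  by (induction e) (simp_all add: pderiv_add pderiv_mult pderiv_pCons algebra_simps)

subsection \<open>Comparison with polynomials in normal form\<close>

text \<open>Sums and products of expressions are indexed by initial segments of the naturals, so the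
  support of a polynomial has to be enumerated.\<close>

definition enum_set :: "'c set \<Rightarrow> nat \<Rightarrow> 'c" where
  "enum_set S = (SOME f. bij_betw f {..<card S} S)"

lemma enum_set: "finite S \<Longrightarrow> bij_betw (enum_set S) {..<card S} S"
  unfolding enum_set_def
  using someI_ex[of "\<lambda>f. bij_betw f {..<card S} S"] ex_bij_betw_nat_finite[of S]
  by (simp add: atLeast0LessThan)

definition pexp_monom :: "((nat \<times> nat) \<Rightarrow>\<^sub>0 nat) \<Rightarrow> 'a::one pexp" where
  "pexp_monom m = pProd (card (Poly_Mapping.keys m)) (\<lambda>i.
     pProd (Poly_Mapping.lookup m (enum_set (Poly_Mapping.keys m) i))
       (\<lambda>_. PV (enum_set (Poly_Mapping.keys m) i)))"

definition pexp_of_matpoly :: "'a::{zero,one} matpoly \<Rightarrow> 'a pexp" where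
  "pexp_of_matpoly p = pSum (card (Poly_Mapping.keys p)) (\<lambda>i.
     PM (PC (Poly_Mapping.lookup p (enum_set (Poly_Mapping.keys p) i)))
       (pexp_monom (enum_set (Poly_Mapping.keys p) i)))"

definition mono_eval :: "(nat \<times> nat \<Rightarrow> 'b::comm_semiring_1) \<Rightarrow> ((nat \<times> nat) \<Rightarrow>\<^sub>0 nat) \<Rightarrow> 'b" where
  "mono_eval x m = (\<Prod>ij\<in>Poly_Mapping.keys m. x ij ^ Poly_Mapping.lookup m ij)"

lemma peval_pexp_of_matpoly:
  fixes h :: "'a::{zero,one} \<Rightarrow> 'b::comm_ring_1"
  assumes "h 0 = 0" "h 1 = 1"
  shows "peval h x (pexp_of_matpoly p) = matpoly_eval h x p"
proof -
  have m: "peval h x (pexp_monom m) = mono_eval x m" for m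
    unfolding pexp_monom_def mono_eval_def
    by (simp add: peval_pProd assms sum.reindex_bij_betw prod.reindex_bij_betw[OF enum_set,
        of "Poly_Mapping.keys m" "\<lambda>ij. x ij ^ Poly_Mapping.lookup m ij"])
  show ?thesis unfolding pexp_of_matpoly_def matpoly_eval_def
    by (simp add: peval_pSum assms m mono_eval_def[symmetric] sum.reindex_bij_betw[OF enum_set,
        of "Poly_Mapping.keys p" "\<lambda>m. h (Poly_Mapping.lookup p m) * mono_eval x m"])
qed

lemma mono_eval_superset:
  assumes "finite S" "Poly_Mapping.keys m \<subseteq> S"
  shows "mono_eval x m = (\<Prod>ij\<in>S. x ij ^ Poly_Mapping.lookup m ij)"
  unfolding mono_eval_def
  by (rule prod.mono_neutral_left) (use assms in \<open>auto simp: in_keys_iff\<close>)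

lemma mono_eval_add: "mono_eval x (m + m') = mono_eval x m * mono_eval x m'"
proof -
  let ?S = "Poly_Mapping.keys m \<union> Poly_Mapping.keys m'"
  have "mono_eval x (m + m') = (\<Prod>ij\<in>?S. x ij ^ Poly_Mapping.lookup (m + m') ij)"
    by (rule mono_eval_superset) (use Poly_Mapping.keys_add[of m m'] in auto)
  also have "\<dots> = mono_eval x m * mono_eval x m'"
    by (simp add: mono_eval_superset[of ?S m] mono_eval_superset[of ?S m'] lookup_add power_add
        prod.distrib)
  finally show ?thesis .
qed

lemma matpoly_eval_superset:
  assumes "finite S" "Poly_Mapping.keys p \<subseteq> S" "h 0 = 0"
  shows "matpoly_eval h x p = (\<Sum>m\<in>S. h (Poly_Mapping.lookup p m) * mono_eval x m)"
  unfolding matpoly_eval_def mono_eval_def[symmetric]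
  by (rule sum.mono_neutral_left) (use assms in \<open>auto simp: in_keys_iff\<close>)

lemma matpoly_eval_add:
  assumes "h 0 = 0" "\<And>a b. h (a + b) = h a + h b"
  shows "matpoly_eval h x (p + q) = matpoly_eval h x p + matpoly_eval h x q"
proof -
  let ?S = "Poly_Mapping.keys p \<union> Poly_Mapping.keys q"
  have "matpoly_eval h x (p + q) = (\<Sum>m\<in>?S. h (Poly_Mapping.lookup (p + q) m) * mono_eval x m)"
    by (rule matpoly_eval_superset) (use Poly_Mapping.keys_add[of p q] assms in auto)
  also have "\<dots> = matpoly_eval h x p + matpoly_eval h x q"
    by (simp add: matpoly_eval_superset[of ?S p] matpoly_eval_superset[of ?S q] lookup_add assms
        distrib_right sum.distrib)
  finally show ?thesis .
qed

lemma matpoly_eval_single: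
  assumes "h 0 = 0"
  shows "matpoly_eval h x (Poly_Mapping.single m c) = h c * mono_eval x m"
  by (subst matpoly_eval_superset[of "{m}"]) (use assms in \<open>auto simp: lookup_single\<close>)

lemma matpoly_eval_zero: "matpoly_eval h x 0 = 0"
  by (simp add: matpoly_eval_def)

lemma poly_mapping_sum_single:
  "(p :: 'c \<Rightarrow>\<^sub>0 'a::comm_monoid_add) =
    (\<Sum>m\<in>Poly_Mapping.keys p. Poly_Mapping.single m (Poly_Mapping.lookup p m))"
proof (rule poly_mapping_eqI)
  fix k
  show "Poly_Mapping.lookup p k = Poly_Mapping.lookup
      (\<Sum>m\<in>Poly_Mapping.keys p. Poly_Mapping.single m (Poly_Mapping.lookup p m)) k"
    by (simp add: lookup_sum lookup_single when_def in_keys_iff)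
qed

lemma matpoly_eval_sum:
  assumes "h 0 = 0" "\<And>a b. h (a + b) = h a + h b"
  shows "matpoly_eval h x (sum f A) = (\<Sum>i\<in>A. matpoly_eval h x (f i))"
  by (induction A rule: infinite_finite_induct)
    (simp_all add: matpoly_eval_zero matpoly_eval_add[of h] assms)

lemma matpoly_eval_mult:
  fixes h :: "'a::comm_ring_1 \<Rightarrow> 'b::comm_ring_1"
  assumes "h 0 = 0" "\<And>a b. h (a + b) = h a + h b" "\<And>a b. h (a * b) = h a * h b"
  shows "matpoly_eval h x (p * q) = matpoly_eval h x p * matpoly_eval h x q"
proof -
  let ?s = "\<lambda>p m. Poly_Mapping.single m (Poly_Mapping.lookup p m)"
  have "p * q = (\<Sum>m\<in>Poly_Mapping.keys p. ?s p m) * (\<Sum>m\<in>Poly_Mapping.keys q. ?s q m)"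
    using poly_mapping_sum_single[of p] poly_mapping_sum_single[of q] by simp
  also have "\<dots> = (\<Sum>m\<in>Poly_Mapping.keys p. \<Sum>m'\<in>Poly_Mapping.keys q. ?s p m * ?s q m')"
    by (rule sum_product)
  finally have "matpoly_eval h x (p * q) =
      (\<Sum>m\<in>Poly_Mapping.keys p. \<Sum>m'\<in>Poly_Mapping.keys q. matpoly_eval h x (?s p m * ?s q m'))"
    by (simp add: matpoly_eval_sum[of h] assms)
  also have "\<dots> = (\<Sum>m\<in>Poly_Mapping.keys p. \<Sum>m'\<in>Poly_Mapping.keys q.
      (h (Poly_Mapping.lookup p m) * mono_eval x m) * (h (Poly_Mapping.lookup q m') * mono_eval x m'))"
    by (simp add: mult_single matpoly_eval_single[of h] assms mono_eval_add mult_ac)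
  also have "\<dots> = matpoly_eval h x p * matpoly_eval h x q"
    unfolding matpoly_eval_def mono_eval_def[symmetric] by (rule sum_product[symmetric])
  finally show ?thesis .
qed

primrec matpoly_of_pexp :: "'a::comm_ring_1 pexp \<Rightarrow> 'a matpoly" where
  "matpoly_of_pexp (PC c) = Poly_Mapping.single 0 c"
| "matpoly_of_pexp (PV ij) = Poly_Mapping.single (Poly_Mapping.single ij 1) 1"
| "matpoly_of_pexp (PA a b) = matpoly_of_pexp a + matpoly_of_pexp b"
| "matpoly_of_pexp (PM a b) = matpoly_of_pexp a * matpoly_of_pexp b"

lemma matpoly_eval_of_pexp:
  fixes h :: "'a::comm_ring_1 \<Rightarrow> 'b::comm_ring_1"
  assumes "h 0 = 0" "h 1 = 1" "\<And>a b. h (a + b) = h a + h b" "\<And>a b. h (a * b) = h a * h b"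
  shows "matpoly_eval h x (matpoly_of_pexp e) = peval h x e"
proof (induction e)
  case (PC c)
  then show ?case using assms by (simp add: matpoly_eval_single mono_eval_def)
next
  case (PV ij)
  then show ?case using assms by (simp add: matpoly_eval_single mono_eval_def)
qed (simp_all add: matpoly_eval_add[of h] matpoly_eval_mult[of h] assms)

subsection \<open>Matrix groups\<close>

lemma GL_carrier:
  "A \<in> carrier (GL n) \<longleftrightarrow>
    A \<in> carrier_mat n n \<and> (\<exists>B\<in>carrier_mat n n. A * B = 1\<^sub>m n \<and> B * A = 1\<^sub>m n)"
  by (auto simp: GL_def units_of_carrier Units_def ring_mat_simps)

lemma GL_mult: "mult (GL n) = (*)" and GL_one: "one (GL n) = 1\<^sub>m n"
  by (simp_all add: GL_def units_of_mult units_of_one ring_mat_simps)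

lemma GL_group: "group (GL n)"
proof -
  interpret ring "ring_mat TYPE('a::field) n ()" by (rule ring_mat)
  show ?thesis unfolding GL_def by (rule units_group)
qed

lemma GL_inv:
  fixes A :: "'a::field mat"
  assumes "A \<in> carrier (GL n)"
  shows "inv\<^bsub>GL n\<^esub> A \<in> carrier (GL n)" "inv\<^bsub>GL n\<^esub> A \<in> carrier_mat n n"
    "A * inv\<^bsub>GL n\<^esub> A = 1\<^sub>m n" "inv\<^bsub>GL n\<^esub> A * A = 1\<^sub>m n"
proof -
  interpret group "GL n :: 'a mat monoid" by (rule GL_group)
  show *: "inv\<^bsub>GL n\<^esub> A \<in> carrier (GL n)" using assms by simp
  then show "inv\<^bsub>GL n\<^esub> A \<in> carrier_mat n n" by (simp add: GL_carrier)
  show "A * inv\<^bsub>GL n\<^esub> A = 1\<^sub>m n" "inv\<^bsub>GL n\<^esub> A * A = 1\<^sub>m n"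
    using r_inv[OF assms] l_inv[OF assms] by (simp_all add: GL_mult GL_one)
qed

lemma entries_mult:
  assumes "A \<in> carrier_mat n n" "B \<in> carrier_mat n n"
  shows "entries n (A * B) = (\<lambda>(i, j). \<Sum>l<n. entries n A (i, l) * entries n B (l, j))"
  using assms by (auto simp: entries_def fun_eq_iff scalar_prod_def atLeast0LessThan intro!: sum.cong)

lemma map_mat_mult_hom:
  fixes \<sigma> :: "'a::comm_ring_1 \<Rightarrow> 'b::comm_ring_1"
  assumes "\<sigma> 0 = 0" "\<And>u w. \<sigma> (u + w) = \<sigma> u + \<sigma> w" "\<And>u w. \<sigma> (u * w) = \<sigma> u * \<sigma> w"
    and "A \<in> carrier_mat n n" "B \<in> carrier_mat n n"
  shows "map_mat \<sigma> (A * B) = map_mat \<sigma> A * map_mat \<sigma> B"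
proof (rule eq_matI)
  have s: "\<sigma> (sum f S) = (\<Sum>i\<in>S. \<sigma> (f i))" for f and S :: "nat set"
    by (induction S rule: infinite_finite_induct) (simp_all add: assms)
  fix i j assume "i < dim_row (map_mat \<sigma> A * map_mat \<sigma> B)" "j < dim_col (map_mat \<sigma> A * map_mat \<sigma> B)"
  then show "map_mat \<sigma> (A * B) $$ (i, j) = (map_mat \<sigma> A * map_mat \<sigma> B) $$ (i, j)"
    using assms(4,5) by (simp add: scalar_prod_def s assms(3))
qed (use assms in auto)

lemma map_mat_GL:
  fixes \<sigma> :: "'a::field \<Rightarrow> 'b::field"
  assumes "\<sigma> 0 = 0" "\<sigma> 1 = 1" "\<And>u w. \<sigma> (u + w) = \<sigma> u + \<sigma> w" "\<And>u w. \<sigma> (u * w) = \<sigma> u * \<sigma> w"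
    and "A \<in> carrier (GL n)"
  shows "map_mat \<sigma> A \<in> carrier (GL n)"
proof -
  obtain B where B: "A \<in> carrier_mat n n" "B \<in> carrier_mat n n" "A * B = 1\<^sub>m n" "B * A = 1\<^sub>m n"
    using assms(5) by (auto simp: GL_carrier)
  have 1: "map_mat \<sigma> (1\<^sub>m n) = 1\<^sub>m n"
    by (rule eq_matI) (auto simp: assms(1,2))
  have "map_mat \<sigma> A * map_mat \<sigma> B = 1\<^sub>m n"
    using map_mat_mult_hom[OF assms(1,3,4) B(1,2)] B(3) 1 by simp
  moreover have "map_mat \<sigma> B * map_mat \<sigma> A = 1\<^sub>m n"
    using map_mat_mult_hom[OF assms(1,3,4) B(2,1)] B(4) 1 by simp
  ultimately show ?thesis unfolding GL_carrier
    by (intro conjI bexI[of _ "map_mat \<sigma> B"]) (use B in auto)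
qed

lemma entries_map_mat:
  "\<sigma> 0 = 0 \<Longrightarrow> A \<in> carrier_mat n n \<Longrightarrow> entries n (map_mat \<sigma> A) = (\<lambda>ij. \<sigma> (entries n A ij))"
  by (auto simp: entries_def fun_eq_iff)

section \<open>Groups defined over k and the descent of their equations\<close>

locale k_group =
  fixes n :: nat and G :: "'k::field_char_0 alg_closure mat set"
  assumes closed: "zariski_closed (to_ac :: 'k \<Rightarrow> 'k alg_closure) n G"
    and subgroup: "subgroup G (GL n)"
begin

definition vanishing :: "'k pexp \<Rightarrow> bool" where
  "vanishing e \<longleftrightarrow> (\<forall>A\<in>G. peval to_ac (entries n A) e = 0)"

lemma G_carrier: "A \<in> G \<Longrightarrow> A \<in> carrier_mat n n" and G_GL: "A \<in> G \<Longrightarrow> A \<in> carrier (GL n)"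
  using subgroup.subset[OF subgroup] by (auto simp: GL_carrier)

lemma G_mult: "A \<in> G \<Longrightarrow> B \<in> G \<Longrightarrow> A * B \<in> G"
  using subgroup.m_closed[OF subgroup] by (simp add: GL_mult)

lemma G_one: "1\<^sub>m n \<in> G"
  using subgroup.one_closed[OF subgroup] by (simp add: GL_one)

text \<open>Closedness over k provides some defining set of equations; all vanishing expressions
  together contain it and serve as a canonical choice.\<close>

lemma G_iff: "A \<in> G \<longleftrightarrow> A \<in> carrier (GL n) \<and> (\<forall>e. vanishing e \<longrightarrow> peval to_ac (entries n A) e = 0)"
proof
  assume r: "A \<in> carrier (GL n) \<and> (\<forall>e. vanishing e \<longrightarrow> peval to_ac (entries n A) e = 0)"
  obtain S :: "'k matpoly set" where
    S: "G = {A \<in> carrier (GL n). \<forall>p\<in>S. matpoly_eval to_ac (entries n A) p = 0}"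
    using closed unfolding zariski_closed_def by (elim exE)
  have "matpoly_eval to_ac (entries n A) p = 0" if "p \<in> S" for p
  proof -
    have "matpoly_eval to_ac (entries n B) p = 0" if B: "B \<in> G" for B
      using B \<open>p \<in> S\<close> by (subst (asm) S) simp
    then have "vanishing (pexp_of_matpoly p)"
      by (simp add: vanishing_def peval_pexp_of_matpoly)
    then have "peval to_ac (entries n A) (pexp_of_matpoly p) = 0" using r by simp
    then show ?thesis by (simp add: peval_pexp_of_matpoly)
  qed
  then show "A \<in> G" using r by (subst S) simp
qed (auto simp: vanishing_def G_GL)

text \<open>The definition quantifies over \<open>matpoly\<close>. The conversions in both
  directions preserve values, so expressions can be used as test equations instead.\<close>

lemma lie_iff:
  "Y \<in> lie_algebra n G \<longleftrightarrow> Y \<in> carrier_mat n n \<and>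
    (\<forall>e. vanishing e \<longrightarrow> pdiff id (entries n (1\<^sub>m n)) (entries n Y) e = 0)"
proof -
  let ?x = "\<lambda>ij. pCons (entries n (1\<^sub>m n) ij) (pCons (entries n Y ij) 0)"
  have d: "Polynomial.coeff (peval (\<lambda>c. pCons c 0) ?x e) 1 = pdiff id (entries n (1\<^sub>m n)) (entries n Y) e"
    for e :: "'k pexp"
    using peval_dual(2)[of id "entries n (1\<^sub>m n)" "entries n Y" e] by simp
  have 1: "vanishing e \<longleftrightarrow> (\<forall>A\<in>G. matpoly_eval to_ac (entries n A) (matpoly_of_pexp e) = 0)" for e
    by (simp add: vanishing_def matpoly_eval_of_pexp)
  have 2: "(\<forall>A\<in>G. matpoly_eval to_ac (entries n A) p = 0) \<longleftrightarrow> vanishing (pexp_of_matpoly p)" for p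
    by (simp add: vanishing_def peval_pexp_of_matpoly)
  have 3: "matpoly_eval (\<lambda>c. pCons c 0) ?x (matpoly_of_pexp e) = peval (\<lambda>c. pCons c 0) ?x e"
    for e :: "'k pexp"
    by (rule matpoly_eval_of_pexp) auto
  have 4: "peval (\<lambda>c. pCons c 0) ?x (pexp_of_matpoly p) = matpoly_eval (\<lambda>c. pCons c 0) ?x p"
    for p :: "'k matpoly"
    by (rule peval_pexp_of_matpoly) auto
  have "(\<forall>p. vanishing (pexp_of_matpoly p) \<longrightarrow> Polynomial.coeff (matpoly_eval (\<lambda>c. pCons c 0) ?x p) 1 = 0)
      \<longleftrightarrow> (\<forall>e. vanishing e \<longrightarrow> pdiff id (entries n (1\<^sub>m n)) (entries n Y) e = 0)" (is "?L \<longleftrightarrow> ?R")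
  proof (intro iffI allI impI)
    fix e assume L: ?L and "vanishing e"
    then have "\<forall>A\<in>G. matpoly_eval to_ac (entries n A) (matpoly_of_pexp e) = 0"
      by (simp only: 1)
    then have "vanishing (pexp_of_matpoly (matpoly_of_pexp e))" by (simp only: 2)
    with L have "Polynomial.coeff (matpoly_eval (\<lambda>c. pCons c 0) ?x (matpoly_of_pexp e)) 1 = 0" by simp
    then show "pdiff id (entries n (1\<^sub>m n)) (entries n Y) e = 0" by (simp only: 3 d)
  next
    fix p assume R: ?R and "vanishing (pexp_of_matpoly p)"
    then show "Polynomial.coeff (matpoly_eval (\<lambda>c. pCons c 0) ?x p) 1 = 0"
      unfolding 4[symmetric] d by simp
  qed
  then show ?thesis unfolding lie_algebra_def mem_Collect_eq 2 by (simp only:)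
qed

text \<open>The equations of \<open>G\<close> have coefficients in k, which \<open>\<sigma>\<close>
  fixes, so applying \<open>\<sigma>\<close> to \<open>e(A) = 0\<close> gives the equation at the
  conjugated matrix.\<close>

lemma G_aut:
  assumes s: "\<And>u w. \<sigma> (u + w) = \<sigma> u + \<sigma> w" "\<And>u w. \<sigma> (u * w) = \<sigma> u * \<sigma> w"
    "\<And>a. \<sigma> (to_ac a) = to_ac a" and A: "A \<in> G"
  shows "map_mat \<sigma> A \<in> G"
proof -
  have 01: "\<sigma> 0 = 0" "\<sigma> 1 = 1" using s(3)[of 0] s(3)[of 1] by simp_all
  have ev: "peval to_ac (entries n (map_mat \<sigma> A)) e = \<sigma> (peval to_ac (entries n A) e)" for e
    using peval_hom[of \<sigma> to_ac "entries n A" e, OF s(1,2)]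
    by (simp add: entries_map_mat 01 G_carrier[OF A] s(3))
  have v: "peval to_ac (entries n A) e = 0" if "vanishing e" for e
    using A that by (simp add: vanishing_def)
  have g: "map_mat \<sigma> A \<in> carrier (GL n)" by (rule map_mat_GL[OF 01 s(1,2) G_GL[OF A]])
  have z: "\<forall>e. vanishing e \<longrightarrow> peval to_ac (entries n (map_mat \<sigma> A)) e = 0"
    unfolding ev using v 01(1) by simp
  show ?thesis by (rule iffD2[OF G_iff]) (rule conjI[OF g z])
qed

text \<open>An equation over the algebraic closure satisfied on \<open>G\<close> is a combination of equations over
  \<open>k\<close>: applying an automorphism that moves a coefficient, one can shorten the relation.\<close>

lemma descent_sum:
  fixes N :: nat
  assumes Y: "Y \<in> lie_algebra n G"
    and rel: "\<And>A. A \<in> G \<Longrightarrow> (\<Sum>i<N. c i * peval to_ac (entries n A) (e i)) = 0"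
  shows "(\<Sum>i<N. c i * to_ac (pdiff id (entries n (1\<^sub>m n)) (entries n Y) (e i))) = 0"
  using rel
proof (induction "card {i. i < N \<and> c i \<noteq> 0}" arbitrary: c rule: less_induct)
  case less
  let ?d = "\<lambda>i. pdiff id (entries n (1\<^sub>m n)) (entries n Y) (e i)"
  let ?v = "\<lambda>A i. peval to_ac (entries n A) (e i)"
  have fewer: "(\<Sum>i<N. b i * to_ac (?d i)) = 0"
    if b: "\<And>i. i < N \<Longrightarrow> c i = 0 \<Longrightarrow> b i = 0" "j < N" "c j \<noteq> 0" "b j = 0"
      and r: "\<And>A. A \<in> G \<Longrightarrow> (\<Sum>i<N. b i * ?v A i) = 0" for b j
  proof -
    have "{i. i < N \<and> b i \<noteq> 0} \<subset> {i. i < N \<and> c i \<noteq> 0}"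
    proof (rule psubsetI)
      show "{i. i < N \<and> b i \<noteq> 0} \<subseteq> {i. i < N \<and> c i \<noteq> 0}"
      proof
        fix i assume "i \<in> {i. i < N \<and> b i \<noteq> 0}"
        then show "i \<in> {i. i < N \<and> c i \<noteq> 0}" using b(1)[of i] by (cases "c i = 0") simp_all
      qed
      have "j \<notin> {i. i < N \<and> b i \<noteq> 0}" "j \<in> {i. i < N \<and> c i \<noteq> 0}"
        using b(2-4) by simp_all
      then show "{i. i < N \<and> b i \<noteq> 0} \<noteq> {i. i < N \<and> c i \<noteq> 0}" by metis
    qed
    then have "card {i. i < N \<and> b i \<noteq> 0} < card {i. i < N \<and> c i \<noteq> 0}"
      by (rule psubset_card_mono[rotated]) (rule finite_subset[of _ "{..<N}"], auto)
    then show ?thesis using r by (rule less.hyps)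
  qed
  show ?case
  proof (cases "\<exists>i<N. c i \<noteq> 0")
    case False
    then show ?thesis by simp
  next
    case True
    then obtain i0 where i0: "i0 < N" "c i0 \<noteq> 0" by auto
    \<comment> \<open>With the coefficient at \<open>i0\<close> normalised to 1, every automorphism
      over k fixes it, so \<open>i0\<close> drops out of \<open>d\<close> below.\<close>
    define b where "b i = c i / c i0" for i
    have rb: "(\<Sum>i<N. b i * ?v A i) = 0" if "A \<in> G" for A
    proof -
      have "(\<Sum>i<N. b i * ?v A i) = (\<Sum>i<N. c i * ?v A i) / c i0"
        by (simp add: b_def sum_divide_distrib)
      then show ?thesis using less.prems[OF that] by simp
    qed
    have "(\<Sum>i<N. b i * to_ac (?d i)) = 0"
    proof (cases "\<forall>i<N. b i \<in> range to_ac")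
      case True
      define a where "a i = of_ac (b i)" for i
      have ba: "b i = to_ac (a i)" if "i < N" for i
        using True that unfolding a_def by (subst to_ac_of_ac) simp_all
      \<comment> \<open>All coefficients lie in k, so the whole relation is one equation of
        \<open>G\<close> over k.\<close>
      have "vanishing (pSum N (\<lambda>i. PM (PC (a i)) (e i)))"
        unfolding vanishing_def using rb by (simp add: peval_pSum ba)
      then have "pdiff id (entries n (1\<^sub>m n)) (entries n Y) (pSum N (\<lambda>i. PM (PC (a i)) (e i))) = 0"
        using Y by (simp add: lie_iff)
      then have "(\<Sum>i<N. a i * ?d i) = 0" by (simp add: pdiff_pSum)
      then have "to_ac (\<Sum>i<N. a i * ?d i) = 0" by simp
      then show ?thesis by (simp add: to_ac_sum ba)
    next
      case False
      then obtain i1 where i1: "i1 < N" "b i1 \<notin> range to_ac" by auto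
      obtain \<sigma> :: "'k alg_closure \<Rightarrow> 'k alg_closure" where
        \<sigma>: "(\<forall>u w. \<sigma> (u + w) = \<sigma> u + \<sigma> w) \<and> (\<forall>u w. \<sigma> (u * w) = \<sigma> u * \<sigma> w) \<and>
          (\<forall>a. \<sigma> (to_ac a) = to_ac a) \<and> bij \<sigma> \<and> \<sigma> (b i1) \<noteq> b i1"
        using ac_automorphism_moving[OF i1(2)] by (rule exE)
      then have s: "\<sigma> (u + w) = \<sigma> u + \<sigma> w" "\<sigma> (u * w) = \<sigma> u * \<sigma> w"
        "\<sigma> (to_ac a) = to_ac a" "bij \<sigma>" and mv: "\<sigma> (b i1) \<noteq> b i1" for u w a
        by simp_all
      have s0: "\<sigma> 0 = 0" and s1: "\<sigma> 1 = 1" using s(3)[of 0] s(3)[of 1] by simp_all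
      define \<tau> where "\<tau> = inv_into UNIV \<sigma>"
      have st: "\<sigma> (\<tau> u) = u" and ts: "\<tau> (\<sigma> u) = u" for u
        using s(4) by (simp_all add: \<tau>_def bij_is_surj surj_f_inv_f bij_is_inj)
      have t: "\<tau> (u + w) = \<tau> u + \<tau> w" "\<tau> (u * w) = \<tau> u * \<tau> w" "\<tau> (to_ac a) = to_ac a" for u w a
        using ts[of "\<tau> u + \<tau> w"] ts[of "\<tau> u * \<tau> w"] ts[of "to_ac a"] by (simp_all add: s st)
      have t0: "\<tau> 0 = 0" using t(3)[of 0] by simp
      have ssum: "\<sigma> (sum f S) = (\<Sum>i\<in>S. \<sigma> (f i))" for f and S :: "nat set"
        by (induction S rule: infinite_finite_induct) (simp_all add: s s0)
      have rs: "(\<Sum>i<N. \<sigma> (b i) * ?v A i) = 0" if A: "A \<in> G" for A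
      proof -
        \<comment> \<open>The relation is used at the image of \<open>A\<close> under the inverse
          automorphism. Applying \<open>\<sigma>\<close> brings the values back to \<open>A\<close>,
          and only the coefficients have moved.\<close>
        have "map_mat \<tau> A \<in> G" using t by (rule G_aut) (rule A)
        then have "\<sigma> (\<Sum>i<N. b i * ?v (map_mat \<tau> A) i) = 0" using rb s0 by simp
        moreover have "\<sigma> (?v (map_mat \<tau> A) i) = ?v A i" for i
          using peval_hom[of \<sigma> to_ac "entries n (map_mat \<tau> A)" "e i", OF s(1,2)]
          by (simp add: entries_map_mat t0 G_carrier[OF A] s(3) st)
        ultimately show ?thesis by (simp add: ssum s)
      qed
      define d where "d i = b i - \<sigma> (b i)" for i
      have d1: "d i1 \<noteq> 0" using mv by (simp add: d_def)
      have rd: "(\<Sum>i<N. d i * ?v A i) = 0" if "A \<in> G" for A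
        using rb[OF that] rs[OF that] by (simp add: d_def left_diff_distrib sum_subtractf)
      have 1: "(\<Sum>i<N. d i * to_ac (?d i)) = 0"
        by (rule fewer[OF _ i0 _ rd]) (use i0 s0 s1 in \<open>auto simp: d_def b_def\<close>)
      \<comment> \<open>The multiple of \<open>d\<close> is chosen to cancel the index
        \<open>i1\<close>, while \<open>d\<close> itself lacks \<open>i0\<close>. Both relations are
        shorter than the given one, and together they recover \<open>b\<close>.\<close>
      define g where "g i = b i - b i1 / d i1 * d i" for i
      have 2: "(\<Sum>i<N. g i * to_ac (?d i)) = 0"
      proof (rule fewer[of g i1])
        show "c i1 \<noteq> 0" using i1(2) by (auto simp: b_def)
        fix A assume "A \<in> G"
        then have "(\<Sum>i<N. b i * ?v A i) - b i1 / d i1 * (\<Sum>i<N. d i * ?v A i) = 0"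
          using rb rd by simp
        then show "(\<Sum>i<N. g i * ?v A i) = 0"
          by (simp add: g_def left_diff_distrib sum_subtractf sum_distrib_left mult.assoc)
      qed (use d1 i1 s0 in \<open>auto simp: g_def d_def b_def\<close>)
      have "(\<Sum>i<N. b i * to_ac (?d i)) =
          (\<Sum>i<N. g i * to_ac (?d i)) + b i1 / d i1 * (\<Sum>i<N. d i * to_ac (?d i))"
        by (simp add: g_def left_diff_distrib sum_subtractf sum_distrib_left mult.assoc)
      then show ?thesis using 1 2 by simp
    qed
    moreover have "(\<Sum>i<N. c i * to_ac (?d i)) = c i0 * (\<Sum>i<N. b i * to_ac (?d i))"
      using i0(2) by (simp add: b_def sum_distrib_left)
    ultimately show ?thesis by simp
  qed
qed

end

text \<open>Linear combinations of expressions over k with coefficients in a larger ring, the shape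
  to which \<open>descent_sum\<close> applies.\<close>

definition leval :: "('k::field \<Rightarrow> 'b::comm_ring_1) \<Rightarrow> (nat \<times> nat \<Rightarrow> 'b) \<Rightarrow> ('b \<times> 'k pexp) list \<Rightarrow> 'b" where
  "leval h x xs = (\<Sum>(c, e)\<leftarrow>xs. c * peval h x e)"

definition ldiff :: "('k::field \<Rightarrow> 'b::comm_ring_1) \<Rightarrow> (nat \<times> nat \<Rightarrow> 'b) \<Rightarrow> (nat \<times> nat \<Rightarrow> 'b) \<Rightarrow>
    ('b \<times> 'k pexp) list \<Rightarrow> 'b" where
  "ldiff h x z xs = (\<Sum>(c, e)\<leftarrow>xs. c * pdiff h x z e)"

fun lmult :: "('b::comm_ring_1 \<times> 'k pexp) list \<Rightarrow> ('b \<times> 'k pexp) list \<Rightarrow> ('b \<times> 'k pexp) list" where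
  "lmult [] ys = []"
| "lmult ((c, e) # xs) ys = map (\<lambda>(d, f). (c * d, PM e f)) ys @ lmult xs ys"

lemma leval_lmult: "leval h x (lmult xs ys) = leval h x xs * leval h x ys"
proof -
  have *: "leval h x (map (\<lambda>(d, f). (c * d, PM e f)) ys) = c * peval h x e * leval h x ys" for c e
    by (induction ys) (auto simp: leval_def algebra_simps)
  show ?thesis
  proof (induction xs)
    case (Cons a xs)
    then show ?case using *[of "fst a" "snd a"]
      by (cases a) (simp add: leval_def algebra_simps)
  qed (simp add: leval_def)
qed

lemma ldiff_lmult:
  "ldiff h x z (lmult xs ys) = leval h x xs * ldiff h x z ys + ldiff h x z xs * leval h x ys"
proof -
  have *: "ldiff h x z (map (\<lambda>(d, f). (c * d, PM e f)) ys) =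
      c * peval h x e * ldiff h x z ys + c * pdiff h x z e * leval h x ys" for c e
    by (induction ys) (auto simp: ldiff_def leval_def algebra_simps)
  show ?thesis
  proof (induction xs)
    case (Cons a xs)
    then show ?case using *[of "fst a" "snd a"]
      by (cases a) (simp add: ldiff_def leval_def algebra_simps)
  qed (simp add: ldiff_def leval_def)
qed

text \<open>Multiplying out separates the constants of the larger ring from expressions over
  k.\<close>

primrec plist :: "'b::comm_ring_1 pexp \<Rightarrow> ('b \<times> 'k::field pexp) list" where
  "plist (PC c) = [(c, PC 1)]"
| "plist (PV ij) = [(1, PV ij)]"
| "plist (PA a b) = plist a @ plist b"
| "plist (PM a b) = lmult (plist a) (plist b)"

lemma leval_plist: "h 1 = 1 \<Longrightarrow> leval h x (plist q) = peval id x q"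
  by (induction q) (simp_all add: leval_lmult, simp_all add: leval_def)

lemma ldiff_plist: "h 1 = 1 \<Longrightarrow> ldiff h x z (plist q) = pdiff id x z q"
  by (induction q) (simp_all add: ldiff_lmult leval_plist, simp_all add: ldiff_def)

context k_group begin

text \<open>Multiplied out, \<open>q\<close> is a combination of expressions over k that vanishes on
  \<open>G\<close>, so \<open>descent_sum\<close> applies. Rational tangent vectors thus annihilate
  the equations over the algebraic closure as well.\<close>

lemma descent:
  assumes Y: "Y \<in> lie_algebra n G" and q: "\<And>A. A \<in> G \<Longrightarrow> peval id (entries n A) q = 0"
  shows "pdiff id (entries n (1\<^sub>m n)) (\<lambda>ij. to_ac (entries n Y ij)) q = 0"
proof -
  let ?xs = "plist q :: ('k alg_closure \<times> 'k pexp) list"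
  have 1: "(\<Sum>i<length ?xs. fst (?xs ! i) * peval to_ac (entries n A) (snd (?xs ! i))) =
      leval to_ac (entries n A) ?xs" for A
    by (simp add: leval_def sum_list_sum_nth atLeast0LessThan case_prod_beta)
  have "(\<Sum>i<length ?xs. fst (?xs ! i) *
      to_ac (pdiff id (entries n (1\<^sub>m n)) (entries n Y) (snd (?xs ! i)))) = 0"
    by (rule descent_sum[OF Y]) (simp add: 1 leval_plist q)
  moreover have "to_ac (pdiff id (entries n (1\<^sub>m n)) (entries n Y) e) =
      pdiff to_ac (entries n (1\<^sub>m n)) (\<lambda>ij. to_ac (entries n Y ij)) e" for e
  proof -
    have "(\<lambda>ij. to_ac (entries n (1\<^sub>m n) ij)) = (entries n (1\<^sub>m n) :: _ \<Rightarrow> 'k alg_closure)"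
      by (auto simp: entries_def fun_eq_iff)
    then show ?thesis
      using pdiff_hom[of "to_ac :: 'k \<Rightarrow> _" id "entries n (1\<^sub>m n)" "entries n Y" e] by simp
  qed
  ultimately have "ldiff to_ac (entries n (1\<^sub>m n)) (\<lambda>ij. to_ac (entries n Y ij)) ?xs = 0"
    by (simp add: ldiff_def sum_list_sum_nth atLeast0LessThan case_prod_beta)
  then show ?thesis by (simp add: ldiff_plist)
qed

text \<open>The entries of \<open>X Y\<close> as linear expressions in \<open>X\<close>; with this
  field of directions, \<open>pD\<close> is the left-invariant vector field of
  \<open>Y\<close>.\<close>

definition right_mult :: "'k mat \<Rightarrow> nat \<times> nat \<Rightarrow> 'k pexp" where
  "right_mult Y = (\<lambda>(i, j). if i < n \<and> j < n then pSum n (\<lambda>l. PM (PV (i, l)) (PC (entries n Y (l, j)))) else PC 0)"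

lemma peval_right_mult:
  "h 0 = 0 \<Longrightarrow> peval h x (right_mult Y (i, j)) =
    (if i < n \<and> j < n then \<Sum>l<n. x (i, l) * h (entries n Y (l, j)) else 0)"
  by (simp add: right_mult_def peval_pSum)

text \<open>The derivative at \<open>A\<close> along \<open>A Y\<close> is the derivative at 1 along
  \<open>Y\<close> of the left translate of \<open>e\<close> by \<open>A\<close>. That translate has
  coefficients in the algebraic closure, which is where \<open>descent\<close> enters.\<close>

lemma vanishing_pD:
  assumes Y: "Y \<in> lie_algebra n G" and e: "vanishing e"
  shows "vanishing (pD (right_mult Y) e)"
  unfolding vanishing_def
proof
  fix A assume A: "A \<in> G"
  define s where "s = (\<lambda>(i, j). if i < n \<and> j < n then pSum n (\<lambda>l. PM (PC (entries n A (i, l))) (PV (l, j))) else PC 0)"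
  have ps: "peval id x (s (i, j)) = (if i < n \<and> j < n then \<Sum>l<n. entries n A (i, l) * x (l, j) else 0)"
    and ds: "pdiff id x z (s (i, j)) = (if i < n \<and> j < n then \<Sum>l<n. entries n A (i, l) * z (l, j) else 0)"
    for x z i j
    by (simp_all add: s_def peval_pSum pdiff_pSum)
  have ent: "(\<lambda>ij. peval id (entries n B) (s ij)) = entries n (A * B)" if "B \<in> carrier_mat n n" for B
    unfolding entries_mult[OF G_carrier[OF A] that]
    by (auto simp: fun_eq_iff ps entries_def intro!: sum.neutral sum.cong)
  have "peval id (entries n B) (psubst s (map_pexp to_ac e)) = 0" if B: "B \<in> G" for B
    using e G_mult[OF A B] by (simp add: peval_psubst ent[OF G_carrier[OF B]] peval_map_pexp vanishing_def)
  from descent[OF Y this]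
  have "pdiff to_ac (entries n (A * 1\<^sub>m n)) (\<lambda>ij. pdiff id (entries n (1\<^sub>m n)) (\<lambda>ij. to_ac (entries n Y ij)) (s ij)) e = 0"
    by (simp only: pdiff_psubst ent[OF one_carrier_mat] pdiff_map_pexp)
  moreover have "(\<lambda>ij. pdiff id (entries n (1\<^sub>m n)) (\<lambda>ij. to_ac (entries n Y ij)) (s ij)) =
      (\<lambda>ij. peval to_ac (entries n A) (right_mult Y ij))"
    by (auto simp: fun_eq_iff ds peval_right_mult)
  ultimately show "peval to_ac (entries n A) (pD (right_mult Y) e) = 0"
    using G_carrier[OF A] by (simp add: peval_pD)
qed

lemma peval_one_vanishing: "vanishing e \<Longrightarrow> peval id (entries n (1\<^sub>m n)) e = 0"
proof -
  assume "vanishing e"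
  then have "peval to_ac (entries n (1\<^sub>m n)) e = 0" using G_one by (simp add: vanishing_def)
  moreover have "(\<lambda>ij. to_ac (entries n (1\<^sub>m n) ij)) = (entries n (1\<^sub>m n) :: _ \<Rightarrow> 'k alg_closure)"
    by (auto simp: entries_def fun_eq_iff)
  ultimately have "to_ac (peval id (entries n (1\<^sub>m n)) e) = 0"
    using peval_hom[of "to_ac :: 'k \<Rightarrow> _" id "entries n (1\<^sub>m n)" e] by simp
  then show ?thesis by simp
qed

end

lemma entries_add: "A \<in> carrier_mat n n \<Longrightarrow> B \<in> carrier_mat n n \<Longrightarrow>
    entries n (A + B) = (\<lambda>ij. entries n A ij + entries n (B :: 'a::ring_1 mat) ij)"
  by (auto simp: entries_def fun_eq_iff)

lemma entries_diff: "A \<in> carrier_mat n n \<Longrightarrow> B \<in> carrier_mat n n \<Longrightarrow>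
    entries n (A - B) = (\<lambda>ij. entries n A ij + (- 1) * entries n (B :: 'a::ring_1 mat) ij)"
  by (auto simp: entries_def fun_eq_iff)

lemma entries_smult: "A \<in> carrier_mat n n \<Longrightarrow>
    entries n (c \<cdot>\<^sub>m A) = (\<lambda>ij. c * entries n (A :: 'a::ring_1 mat) ij)"
  by (auto simp: entries_def fun_eq_iff)

lemma entries_zero: "entries n (0\<^sub>m n n) = (\<lambda>ij. 0 * x ij :: 'a::ring_1)"
  by (auto simp: entries_def fun_eq_iff)

lemma entries_eqI:
  "A \<in> carrier_mat n n \<Longrightarrow> B \<in> carrier_mat n n \<Longrightarrow> entries n A = entries n B \<Longrightarrow> A = B"
  by (rule eq_matI) (auto simp: entries_def fun_eq_iff, metis)

subsection \<open>Exponentials of nilpotent matrices\<close>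

text \<open>The entries of exp(t Y) as polynomials in t, truncated in the same way as
  \<open>mat_exp\<close>, which is the value at t = 1.\<close>

definition texp :: "nat \<Rightarrow> 'k::field_char_0 mat \<Rightarrow> nat \<times> nat \<Rightarrow> 'k poly" where
  "texp n Y = (\<lambda>(i, j). if i < n \<and> j < n
     then (\<Sum>l<n. Polynomial.monom ((Y ^\<^sub>m l) $$ (i, j) / fact l) l) else 0)"

lemma coeff_texp:
  "Polynomial.coeff (texp n Y (i, j)) m =
    (if i < n \<and> j < n \<and> m < n then (Y ^\<^sub>m m) $$ (i, j) / fact m else 0)"
proof (cases "m < n")
  case True
  then show ?thesis by (simp add: texp_def coeff_sum sum.delta'[of "{..<n}"])
next
  case False
  then have "(\<Sum>l<n. if l = m then (Y ^\<^sub>m l) $$ (i, j) / fact l else 0) = 0"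
    by (intro sum.neutral) auto
  then show ?thesis using False by (simp add: texp_def coeff_sum)
qed

lemma poly_texp_0: "poly (texp n Y ij) 0 = entries n (1\<^sub>m n) ij"
  if "Y \<in> carrier_mat n n"
proof (cases ij)
  case (Pair i j)
  show ?thesis using that unfolding Pair
    by (subst poly_0_coeff_0, subst coeff_texp) (auto simp: entries_def)
qed

lemma poly_texp_1: "poly (texp n Y ij) 1 = entries n (mat_exp n Y) ij"
  by (cases ij) (simp add: texp_def entries_def mat_exp_def poly_sum poly_monom)

lemma pow_mat_entry_Suc:
  fixes Y :: "'k::field mat"
  assumes Y: "Y \<in> carrier_mat n n" and ij: "i < n" "j < n"
  shows "(Y ^\<^sub>m Suc m) $$ (i, j) = (\<Sum>l<n. (Y ^\<^sub>m m) $$ (i, l) * Y $$ (l, j))"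
    and "(Y ^\<^sub>m Suc m) $$ (i, j) = (\<Sum>l<n. Y $$ (i, l) * (Y ^\<^sub>m m) $$ (l, j))"
proof -
  have P: "Y ^\<^sub>m m \<in> carrier_mat n n" using Y by (rule pow_carrier_mat)
  have comm: "Y ^\<^sub>m k * Y = Y * Y ^\<^sub>m k" for k
  proof (induction k)
    case (Suc k)
    have "Y ^\<^sub>m k \<in> carrier_mat n n" using Y by (rule pow_carrier_mat)
    then show ?case using Suc Y by (simp add: assoc_mult_mat[of _ n n _ n _ n])
  qed (use Y in simp)
  show "(Y ^\<^sub>m Suc m) $$ (i, j) = (\<Sum>l<n. (Y ^\<^sub>m m) $$ (i, l) * Y $$ (l, j))"
    using Y P ij by (auto simp: scalar_prod_def atLeast0LessThan intro!: sum.cong)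
  show "(Y ^\<^sub>m Suc m) $$ (i, j) = (\<Sum>l<n. Y $$ (i, l) * (Y ^\<^sub>m m) $$ (l, j))"
    unfolding pow_mat.simps comm using Y P ij
    by (auto simp: scalar_prod_def atLeast0LessThan intro!: sum.cong)
qed

text \<open>Differentiation shifts the exponential series by one. The truncation loses the term with
  the n-th power of \<open>Y\<close>, and this is exactly the term that \<open>nil\<close>
  removes.\<close>

lemma pderiv_texp:
  fixes Y :: "'k::field_char_0 mat"
  assumes Y: "Y \<in> carrier_mat n n" and nil: "Y ^\<^sub>m n = 0\<^sub>m n n"
  shows "pderiv (texp n Y (i, j)) =
      (if i < n \<and> j < n then \<Sum>l<n. texp n Y (i, l) * [:entries n Y (l, j):] else 0)"
    and "pderiv (texp n Y (i, j)) =
      (if i < n \<and> j < n then \<Sum>l<n. [:entries n Y (i, l):] * texp n Y (l, j) else 0)"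
proof -
  have c: "Polynomial.coeff (pderiv (texp n Y (i, j))) m = (Y ^\<^sub>m Suc m) $$ (i, j) / fact m"
    if "i < n" "j < n" "m < n" for m
  proof (cases "Suc m < n")
    case True
    have "of_nat (Suc m) / (fact (Suc m) :: 'k) = 1 / fact m"
      by (simp add: fact_Suc field_simps del: of_nat_Suc)
    then show ?thesis using that True
      by (simp add: coeff_pderiv coeff_texp del: of_nat_Suc pow_mat.simps fact_Suc)
        (metis (no_types, lifting) mult.commute mult_1 times_divide_eq_left times_divide_eq_right)
  next
    case False
    then have "Suc m = n" using that by simp
    then show ?thesis using that nil by (simp add: coeff_pderiv coeff_texp del: of_nat_Suc pow_mat.simps)
  qed
  have o: "texp n Y (i, j) = 0" if "\<not> (i < n \<and> j < n)" using that by (auto simp: texp_def)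
  have z: "Polynomial.coeff (pderiv (texp n Y (i, j))) m = 0" if "\<not> m < n" for m
    using that by (simp add: coeff_pderiv coeff_texp)
  show "pderiv (texp n Y (i, j)) =
      (if i < n \<and> j < n then \<Sum>l<n. texp n Y (i, l) * [:entries n Y (l, j):] else 0)"
  proof (cases "i < n \<and> j < n")
    case True
    show ?thesis
    proof (rule poly_eqI)
      fix m
      show "Polynomial.coeff (pderiv (texp n Y (i, j))) m = Polynomial.coeff
          (if i < n \<and> j < n then \<Sum>l<n. texp n Y (i, l) * [:entries n Y (l, j):] else 0) m"
        using True c[of m] z[of m] pow_mat_entry_Suc(1)[OF Y, of i j m]
        by (cases "m < n") (simp_all add: coeff_sum coeff_texp entries_def sum_divide_distrib mult_ac
            del: pow_mat.simps)
    qed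
  qed (use o in auto)
  show "pderiv (texp n Y (i, j)) =
      (if i < n \<and> j < n then \<Sum>l<n. [:entries n Y (i, l):] * texp n Y (l, j) else 0)"
  proof (cases "i < n \<and> j < n")
    case True
    show ?thesis
    proof (rule poly_eqI)
      fix m
      show "Polynomial.coeff (pderiv (texp n Y (i, j))) m = Polynomial.coeff
          (if i < n \<and> j < n then \<Sum>l<n. [:entries n Y (i, l):] * texp n Y (l, j) else 0) m"
        using True c[of m] z[of m] pow_mat_entry_Suc(2)[OF Y, of i j m]
        by (cases "m < n") (simp_all add: coeff_sum coeff_texp entries_def sum_divide_distrib mult_ac
            del: pow_mat.simps)
    qed
  qed (use o in auto)
qed

lemma pow_mat_uminus:
  fixes Y :: "'k::field mat"
  assumes Y: "Y \<in> carrier_mat n n"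
  shows "(- Y) ^\<^sub>m m = (- 1) ^ m \<cdot>\<^sub>m (Y ^\<^sub>m m)"
proof (induction m)
  case 0
  show ?case using Y by auto
next
  case (Suc m)
  have P: "Y ^\<^sub>m m \<in> carrier_mat n n" using Y by (rule pow_carrier_mat)
  have "- Y = (- 1) \<cdot>\<^sub>m Y" using Y by auto
  then have "(- Y) ^\<^sub>m Suc m = ((- 1) ^ m \<cdot>\<^sub>m (Y ^\<^sub>m m)) * ((- 1) \<cdot>\<^sub>m Y)" using Suc by simp
  also have "\<dots> = (- 1) \<cdot>\<^sub>m ((- 1) ^ m \<cdot>\<^sub>m (Y ^\<^sub>m m * Y))"
    using P Y by (simp add: mult_smult_distrib[of _ n n] smult_carrier_mat mult_smult_assoc_mat[of _ n n])
  also have "\<dots> = (- 1) ^ Suc m \<cdot>\<^sub>m (Y ^\<^sub>m Suc m)"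
    by (rule eq_matI) (use P Y in \<open>auto simp: mult.assoc\<close>)
  finally show ?case .
qed

lemma mat_exp_carrier: "mat_exp n Y \<in> carrier_mat n n"
  by (simp add: mat_exp_def)

lemma pderiv_sum: "pderiv (sum f A) = (\<Sum>i\<in>A. pderiv (f i))"
  by (induction A rule: infinite_finite_induct) (simp_all add: pderiv_add)

text \<open>The product exp(t Y) exp(-t Y) has derivative 0 in t, so its values at t = 1 and t = 0
  agree.\<close>

lemma mat_exp_mult_uminus:
  fixes Y :: "'k::field_char_0 mat"
  assumes Y: "Y \<in> carrier_mat n n" and nil: "Y ^\<^sub>m n = 0\<^sub>m n n"
  shows "mat_exp n Y * mat_exp n (- Y) = 1\<^sub>m n"
proof (rule entries_eqI)
  have Y': "- Y \<in> carrier_mat n n" using Y by simp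
  have nil': "(- Y) ^\<^sub>m n = 0\<^sub>m n n" by (simp add: pow_mat_uminus[OF Y] nil)
  define W where "W i j = (\<Sum>l<n. texp n Y (i, l) * texp n (- Y) (l, j))" for i j
  have W1: "poly (W i j) 1 = entries n (mat_exp n Y * mat_exp n (- Y)) (i, j)" for i j
    by (simp add: W_def poly_sum poly_texp_1 entries_mult[OF mat_exp_carrier mat_exp_carrier])
  have W0: "poly (W i j) 0 = entries n (1\<^sub>m n) (i, j)" for i j
  proof -
    have "entries n (1\<^sub>m n :: 'k mat) (i, j) =
        (\<Sum>l<n. entries n (1\<^sub>m n) (i, l) * entries n (1\<^sub>m n) (l, j))"
      using fun_cong[OF entries_mult[of "1\<^sub>m n :: 'k mat" n "1\<^sub>m n"], of "(i, j)"] by simp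
    then show ?thesis
      by (simp only: W_def poly_sum poly_mult poly_texp_0[OF Y] poly_texp_0[OF Y'])
  qed
  have "pderiv (W i j) = 0" for i j
  proof (cases "i < n \<and> j < n")
    case True
    have e: "[:entries n (- Y) (l, p):] = - [:entries n Y (l, p):]" for l p
      using Y by (auto simp: entries_def)
    have "pderiv (W i j) =
        (\<Sum>l<n. texp n Y (i, l) * (\<Sum>p<n. [:entries n (- Y) (l, p):] * texp n (- Y) (p, j))) +
        (\<Sum>l<n. texp n (- Y) (l, j) * (\<Sum>p<n. texp n Y (i, p) * [:entries n Y (p, l):]))"
      using True unfolding W_def
      by (simp add: pderiv_sum pderiv_mult pderiv_texp(1)[OF Y nil]
          pderiv_texp(2)[OF Y' nil'] sum.distrib)
    also have "\<dots> = - (\<Sum>l<n. \<Sum>p<n. texp n Y (i, l) * ([:entries n Y (l, p):] * texp n (- Y) (p, j))) +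
        (\<Sum>l<n. \<Sum>p<n. texp n Y (i, p) * ([:entries n Y (p, l):] * texp n (- Y) (l, j)))"
      by (simp only: e sum_distrib_left) (simp add: sum_negf mult_ac)
    also have "\<dots> = 0" by (subst sum.swap) simp
    finally show ?thesis .
  next
    case False
    then have "W i j = 0" unfolding W_def by (intro sum.neutral) (auto simp: texp_def)
    then show ?thesis by simp
  qed
  then have "Polynomial.degree (W i j) = 0" for i j by (simp add: pderiv_eq_0_iff)
  then have "poly (W i j) 1 = poly (W i j) 0" for i j
    by (metis degree_eq_zeroE mult_zero_right pCons_0_0 poly_0 poly_pCons)
  then show "entries n (mat_exp n Y * mat_exp n (- Y)) = entries n (1\<^sub>m n)"
    by (simp add: fun_eq_iff flip: W0 W1)
qed (use mat_exp_carrier[of n Y] mat_exp_carrier[of n "- Y"] in auto)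

lemma mat_exp_GL:
  fixes Y :: "'k::field_char_0 mat"
  assumes Y: "Y \<in> carrier_mat n n" and nil: "Y ^\<^sub>m n = 0\<^sub>m n n"
  shows "mat_exp n Y \<in> carrier (GL n)"
proof -
  have Y': "- Y \<in> carrier_mat n n" using Y by simp
  have nil': "(- Y) ^\<^sub>m n = 0\<^sub>m n n" by (simp add: pow_mat_uminus[OF Y] nil)
  have "- (- Y) = Y" by (rule eq_matI) auto
  then have 2: "mat_exp n (- Y) * mat_exp n Y = 1\<^sub>m n"
    using mat_exp_mult_uminus[OF Y' nil'] by simp
  show ?thesis unfolding GL_carrier
    by (rule conjI[OF mat_exp_carrier], rule bexI[OF conjI mat_exp_carrier],
        rule mat_exp_mult_uminus[OF Y nil], rule 2)
qed

subsection \<open>The Lie algebra and the rational points\<close>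

lemma lie_bracket_carrier:
  "A \<in> carrier_mat n n \<Longrightarrow> B \<in> carrier_mat n n \<Longrightarrow> lie_bracket A B \<in> carrier_mat n n"
  by (auto simp: lie_bracket_def)

context k_group begin

lemma lie_carrier: "Y \<in> lie_algebra n G \<Longrightarrow> Y \<in> carrier_mat n n"
  by (simp add: lie_iff)

lemma lie_zero: "0\<^sub>m n n \<in> lie_algebra n G"
  unfolding lie_iff entries_zero[of n "\<lambda>_. 0"] pdiff_scale by simp

lemma lie_add: "Y \<in> lie_algebra n G \<Longrightarrow> Z \<in> lie_algebra n G \<Longrightarrow> Y + Z \<in> lie_algebra n G"
  by (simp add: lie_iff entries_add pdiff_add)

lemma lie_smult: "Y \<in> lie_algebra n G \<Longrightarrow> c \<cdot>\<^sub>m Y \<in> lie_algebra n G"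
  by (simp add: lie_iff entries_smult pdiff_scale)

text \<open>At the point \<open>x\<close> the field of a matrix \<open>A\<close> has direction
  \<open>x A\<close>. Second derivatives are symmetric, so the commutator of the fields of
  \<open>Y\<close> and \<open>Z\<close> is the field of \<open>Y Z - Z Y\<close>.\<close>

lemma bracket_derivation:
  fixes x :: "nat \<times> nat \<Rightarrow> 'k"
  assumes h: "\<And>c. h c = (c :: 'k)" and Y: "Y \<in> carrier_mat n n" and Z: "Z \<in> carrier_mat n n"
  defines "r \<equiv> \<lambda>A ij. peval h x (right_mult A ij)"
  shows "pdiff h x (r Y) (pD (right_mult Z) e) =
    pdiff h x (r Z) (pD (right_mult Y) e) +
    pdiff h x (\<lambda>ij. r (Y * Z) ij + (- 1) * r (Z * Y) ij) e"
proof (induction e)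
  case (PV ij)
  obtain i j where ij: "ij = (i, j)" by (cases ij)
  have d: "pdiff h x (r A) (right_mult B (i, j)) =
      (if i < n \<and> j < n then \<Sum>l<n. r A (i, l) * entries n B (l, j) else 0)" for A B
    by (simp add: right_mult_def pdiff_pSum h)
  have "(\<Sum>l<n. r A (i, l) * entries n B (l, j)) = r (A * B) (i, j)"
    if "A \<in> carrier_mat n n" "B \<in> carrier_mat n n" "i < n" "j < n" for A B
  proof -
    have "(\<Sum>l<n. r A (i, l) * entries n B (l, j)) =
        (\<Sum>l<n. \<Sum>p<n. x (i, p) * entries n A (p, l) * entries n B (l, j))"
      using that by (simp add: r_def peval_right_mult h sum_distrib_right)
    also have "\<dots> = (\<Sum>p<n. \<Sum>l<n. x (i, p) * entries n A (p, l) * entries n B (l, j))"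
      by (rule sum.swap)
    also have "\<dots> = r (A * B) (i, j)"
      using that by (simp add: r_def peval_right_mult h entries_mult sum_distrib_left mult.assoc)
    finally show ?thesis .
  qed
  then show ?case using Y Z by (cases "i < n \<and> j < n") (auto simp: ij d, auto simp: r_def peval_right_mult h)
next
  case (PM a b)
  have p: "peval h x (pD (right_mult A) e) = pdiff h x (r A) e" for A e
    by (simp add: peval_pD r_def h)
  show ?case
    by (simp only: pD.simps pdiff.simps peval.simps p PM) (simp add: algebra_simps)
qed simp_all

lemma right_mult_one:
  assumes Y: "Y \<in> carrier_mat n n"
  shows "(\<lambda>ij. peval id (entries n (1\<^sub>m n)) (right_mult Y ij)) = entries n Y"
proof (rule ext)
  fix ij :: "nat \<times> nat"
  obtain i j where ij: "ij = (i, j)" by (cases ij)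
  have "entries n Y (i, j) = (\<Sum>l<n. entries n (1\<^sub>m n) (i, l) * entries n Y (l, j))"
    using fun_cong[OF entries_mult[OF one_carrier_mat Y], of "(i, j)"]
    unfolding left_mult_one_mat[OF Y] prod.case .
  moreover have "entries n Y (i, j) = 0" if "\<not> (i < n \<and> j < n)"
    using that by (auto simp: entries_def)
  ultimately show "peval id (entries n (1\<^sub>m n)) (right_mult Y ij) = entries n Y ij"
    unfolding ij by (subst peval_right_mult) simp_all
qed

text \<open>Differentiating an equation along the field of \<open>Z\<close> gives an equation again,
  which \<open>Y\<close> annihilates, and likewise with the roles exchanged. The difference is the
  derivative along the bracket.\<close>

lemma lie_bracket_closed:
  assumes Y: "Y \<in> lie_algebra n G" and Z: "Z \<in> lie_algebra n G"
  shows "lie_bracket Y Z \<in> lie_algebra n G"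
proof -
  note c = lie_carrier[OF Y] lie_carrier[OF Z]
  have v: "pdiff id (entries n (1\<^sub>m n)) (entries n A) (pD (right_mult B) e) = 0"
    if "A \<in> lie_algebra n G" "B \<in> lie_algebra n G" "vanishing e" for A B e
    using that vanishing_pD by (simp add: lie_iff)
  have "pdiff id (entries n (1\<^sub>m n)) (entries n (lie_bracket Y Z)) e = 0" if e: "vanishing e" for e
  proof -
    have "entries n (lie_bracket Y Z) = (\<lambda>ij. entries n (Y * Z) ij + (- 1) * entries n (Z * Y) ij)"
      unfolding lie_bracket_def by (rule entries_diff) (use c in auto)
    moreover have "(\<lambda>ij. entries n (Y * Z) ij + (- 1) * entries n (Z * Y) ij) =
      (\<lambda>ij. peval id (entries n (1\<^sub>m n)) (right_mult (Y * Z) ij) +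
        (- 1) * peval id (entries n (1\<^sub>m n)) (right_mult (Z * Y) ij))"
      using right_mult_one[of "Y * Z"] right_mult_one[of "Z * Y"] c by (simp add: fun_eq_iff)
    moreover have "pdiff id (entries n (1\<^sub>m n)) (entries n Y) (pD (right_mult Z) e) =
      pdiff id (entries n (1\<^sub>m n)) (entries n Z) (pD (right_mult Y) e) +
      pdiff id (entries n (1\<^sub>m n)) (\<lambda>ij. peval id (entries n (1\<^sub>m n)) (right_mult (Y * Z) ij) +
        (- 1) * peval id (entries n (1\<^sub>m n)) (right_mult (Z * Y) ij)) e"
      using bracket_derivation[OF id_apply c, of "entries n (1\<^sub>m n)" e]
      unfolding right_mult_one[OF c(1)] right_mult_one[OF c(2)] .
    ultimately show ?thesis using v[OF Y Z e] v[OF Z Y e] by simp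
  qed
  then show ?thesis using c by (simp add: lie_iff lie_bracket_carrier)
qed

lemma rational_points_carrier:
  "A \<in> rational_points n G \<Longrightarrow> A \<in> carrier_mat n n"
  "A \<in> rational_points n G \<Longrightarrow> A \<in> carrier (GL n)"
  by (auto simp: rational_points_def GL_carrier)

lemma subgroup_rational_points: "subgroup (rational_points n G) (GL n)"
proof -
  interpret K: group "GL n :: 'k mat monoid" by (rule GL_group)
  interpret L: group "GL n :: 'k alg_closure mat monoid" by (rule GL_group)
  have one: "map_mat to_ac (1\<^sub>m n :: 'k mat) = 1\<^sub>m n" by (rule eq_matI) auto
  have mult: "map_mat to_ac (A * B) = map_mat to_ac A * map_mat to_ac B"
    if "A \<in> carrier_mat n n" "B \<in> carrier_mat n n" for A B :: "'k mat"
    using that by (intro map_mat_mult_hom) auto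
  show ?thesis
  proof (rule K.subgroupI)
    show "rational_points n G \<subseteq> carrier (GL n)" by (auto simp: rational_points_def)
    show "rational_points n G \<noteq> {}"
      using G_one K.one_closed by (auto simp: rational_points_def one GL_one intro!: exI[of _ "1\<^sub>m n"])
    fix A assume A: "A \<in> rational_points n G"
    note Ac = rational_points_carrier[OF A]
    let ?B = "inv\<^bsub>GL n\<^esub> A"
    have B: "?B \<in> carrier (GL n)" "?B \<in> carrier_mat n n" "?B * A = 1\<^sub>m n"
      using GL_inv[OF Ac(2)] by auto
    have mA: "map_mat to_ac A \<in> G" using A by (simp add: rational_points_def)
    have "map_mat to_ac ?B * map_mat to_ac A = 1\<^sub>m n"
      using mult[OF B(2) Ac(1)] B(3) one by simp
    then have "inv\<^bsub>GL n\<^esub> (map_mat to_ac A) = map_mat to_ac ?B"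
      by (intro L.inv_equality) (simp_all add: GL_mult GL_one G_GL[OF mA] map_mat_GL[OF _ _ _ _ B(1)])
    then show "?B \<in> rational_points n G"
      using B(1) subgroup.m_inv_closed[OF subgroup mA] by (simp add: rational_points_def)
  next
    fix A B assume A: "A \<in> rational_points n G" and B: "B \<in> rational_points n G"
    note c = rational_points_carrier[OF A] rational_points_carrier[OF B]
    have "A * B \<in> carrier (GL n)"
      using K.m_closed[OF c(2,4)] by (simp add: GL_mult)
    moreover have "map_mat to_ac A * map_mat to_ac B \<in> G"
      by (rule G_mult) (use A B in \<open>simp_all add: rational_points_def\<close>)
    then have "map_mat to_ac (A * B) \<in> G" by (simp only: mult[OF c(1,3)])
    ultimately show "A \<otimes>\<^bsub>GL n\<^esub> B \<in> rational_points n G"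
      by (simp add: rational_points_def GL_mult)
  qed
qed

text \<open>Along the curve exp(t Y) the derivative of an equation is the value of another equation,
  its derivative along the field of \<open>Y\<close>. By induction all coefficients of the resulting
  polynomial in t vanish, characteristic 0 allowing division by the exponents; t = 1 gives the
  claim.\<close>

lemma mat_exp_rational:
  assumes Y: "Y \<in> lie_algebra n G" and nil: "Y ^\<^sub>m n = 0\<^sub>m n n"
  shows "mat_exp n Y \<in> rational_points n G"
proof -
  note Yc = lie_carrier[OF Y]
  let ?\<phi> = "\<lambda>e. peval (\<lambda>c. [:id c:]) (texp n Y) e"
  have d: "pderiv (?\<phi> e) = ?\<phi> (pD (right_mult Y) e)" for e
  proof -
    have "(\<lambda>ij. pderiv (texp n Y ij)) = (\<lambda>ij. peval (\<lambda>c. [:id c:]) (texp n Y) (right_mult Y ij))"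
      by (auto simp: fun_eq_iff pderiv_texp(1)[OF Yc nil] peval_right_mult)
    then show ?thesis by (subst pderiv_peval) (simp add: peval_pD)
  qed
  have c: "Polynomial.coeff (?\<phi> e) m = 0" if "vanishing e" for e m
    using that
  proof (induction m arbitrary: e)
    case 0
    have "poly (?\<phi> e) 0 = peval (\<lambda>c. poly [:id c:] 0) (\<lambda>ij. poly (texp n Y ij) 0) e"
      by (rule peval_hom) simp_all
    also have "\<dots> = peval id (entries n (1\<^sub>m n)) e" by (simp add: poly_texp_0[OF Yc] id_def)
    finally show ?case using peval_one_vanishing[OF 0] by (simp add: poly_0_coeff_0)
  next
    case (Suc m)
    have "Polynomial.coeff (pderiv (?\<phi> e)) m = 0"
      unfolding d by (rule Suc.IH) (rule vanishing_pD[OF Y Suc.prems])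
    then show ?case by (simp add: coeff_pderiv del: of_nat_Suc)
  qed
  have v: "peval id (entries n (mat_exp n Y)) e = 0" if "vanishing e" for e
  proof -
    have "?\<phi> e = 0" using c[OF that] by (simp add: poly_eq_iff)
    moreover have "poly (?\<phi> e) 1 = peval (\<lambda>c. poly [:id c:] 1) (\<lambda>ij. poly (texp n Y ij) 1) e"
      by (rule peval_hom) simp_all
    ultimately show ?thesis by (simp add: poly_texp_1 id_def)
  qed
  have g: "mat_exp n Y \<in> carrier (GL n)" by (rule mat_exp_GL[OF Yc nil])
  have "peval to_ac (entries n (map_mat to_ac (mat_exp n Y))) e = to_ac (peval id (entries n (mat_exp n Y)) e)" for e
    using peval_hom[of "to_ac :: 'k \<Rightarrow> _" id "entries n (mat_exp n Y)" e]
    by (simp add: entries_map_mat mat_exp_carrier)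
  then have "map_mat to_ac (mat_exp n Y) \<in> G"
    by (intro iffD2[OF G_iff] conjI allI impI map_mat_GL[OF _ _ _ _ g]) (simp_all add: v)
  then show ?thesis using g by (simp add: rational_points_def)
qed

text \<open>Substituting conjugation by \<open>m\<close> into an equation of \<open>G\<close> gives
  another equation of \<open>G\<close>. Its derivative at 1 along \<open>Y\<close> is the derivative
  of the original one along the conjugate of \<open>Y\<close>.\<close>

lemma lie_conj:
  assumes Y: "Y \<in> lie_algebra n G" and m: "m \<in> rational_points n G"
  shows "m * Y * inv\<^bsub>GL n\<^esub> m \<in> lie_algebra n G"
proof -
  let ?w = "inv\<^bsub>GL n\<^esub> m"
  have w: "?w \<in> rational_points n G"
    using subgroup.m_inv_closed[OF subgroup_rational_points m] .
  note c = rational_points_carrier(1)[OF m] rational_points_carrier(1)[OF w] lie_carrier[OF Y]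
  have mw: "m * ?w = 1\<^sub>m n" using GL_inv(3)[OF rational_points_carrier(2)[OF m]] .
  define s :: "nat \<times> nat \<Rightarrow> 'k pexp" where
    "s = (\<lambda>(i, j). if i < n \<and> j < n then pSum n (\<lambda>b. PM (pSum n (\<lambda>a. PM (PC (entries n m (i, a))) (PV (a, b))))
       (PC (entries n ?w (b, j)))) else PC 0)"
  have ps: "h 0 = 0 \<Longrightarrow> peval h x (s (i, j)) = (if i < n \<and> j < n
      then \<Sum>b<n. (\<Sum>a<n. h (entries n m (i, a)) * x (a, b)) * h (entries n ?w (b, j)) else 0)"
    for h :: "'k \<Rightarrow> 'c::comm_ring_1" and x i j
    by (simp add: s_def peval_pSum)
  have ds: "pdiff id x z (s (i, j)) = (if i < n \<and> j < n
      then \<Sum>b<n. (\<Sum>a<n. entries n m (i, a) * z (a, b)) * entries n ?w (b, j) else 0)" for x z i j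
    by (simp add: s_def pdiff_pSum)
  have triple: "entries n (A * B * C) (i, j) = (if i < n \<and> j < n then
      \<Sum>b<n. (\<Sum>a<n. entries n A (i, a) * entries n B (a, b)) * entries n C (b, j) else 0)"
    if "A \<in> carrier_mat n n" "B \<in> carrier_mat n n" "C \<in> carrier_mat n n"
    for A B C :: "'c::comm_ring_1 mat" and i j
    unfolding entries_mult[OF mult_carrier_mat[OF that(1,2)] that(3)] entries_mult[OF that(1,2)]
    by (auto intro!: sum.neutral simp: entries_def)
  let ?m = "map_mat to_ac m" and ?v = "map_mat to_ac ?w"
  have mc: "?m \<in> carrier_mat n n" "?v \<in> carrier_mat n n" using c by auto
  have mG: "?m \<in> G" "?v \<in> G" using m w by (simp_all add: rational_points_def)
  have sG: "vanishing (psubst s e)" if e: "vanishing e" for e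
    unfolding vanishing_def
  proof
    fix A assume A: "A \<in> G"
    have "(\<lambda>ij. peval to_ac (entries n A) (s ij)) = entries n (?m * A * ?v)"
      using c by (auto simp: fun_eq_iff ps triple[OF mc(1) G_carrier[OF A] mc(2)] entries_map_mat)
    then show "peval to_ac (entries n A) (psubst s e) = 0"
      using e G_mult[OF G_mult[OF mG(1) A] mG(2)] by (simp add: peval_psubst vanishing_def)
  qed
  have "pdiff id (entries n (1\<^sub>m n)) (entries n (m * Y * ?w)) e = 0" if e: "vanishing e" for e
  proof -
    have "pdiff id (entries n (1\<^sub>m n)) (entries n Y) (psubst s e) = 0"
      using Y sG[OF e] by (simp add: lie_iff)
    moreover have "(\<lambda>ij. peval id (entries n (1\<^sub>m n)) (s ij)) = entries n (m * 1\<^sub>m n * ?w)"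
      by (auto simp: fun_eq_iff ps triple[OF c(1) one_carrier_mat c(2)])
    moreover have "(\<lambda>ij. pdiff id (entries n (1\<^sub>m n)) (entries n Y) (s ij)) = entries n (m * Y * ?w)"
      by (auto simp: fun_eq_iff ds triple[OF c(1) c(3) c(2)])
    ultimately show ?thesis using c by (simp add: pdiff_psubst mw)
  qed
  then show ?thesis using c by (simp add: lie_iff)
qed

end

subsection \<open>Linear spaces of matrices\<close>

text \<open>Matrices of a fixed size do not form a type, so linear algebra takes place in spaces of
  functions, which matrices enter through \<open>entries\<close>.\<close>

lemma vector_space_fun: "vector_space (\<lambda>(c :: 'k::field) (f :: 'i \<Rightarrow> 'k) i. c * f i)"
  unfolding vector_space_def by (auto simp: plus_fun_def distrib_left distrib_right mult.assoc)

lemma vector_space_field: "vector_space ((*) :: 'k::field \<Rightarrow> 'k \<Rightarrow> 'k)"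
  unfolding vector_space_def by (auto simp: distrib_left distrib_right mult.assoc)

interpretation fs: vector_space "\<lambda>(c :: 'k::field) (f :: 'i \<Rightarrow> 'k) i. c * f i"
  by (rule vector_space_fun)

interpretation fs_pair: vector_space_pair "\<lambda>(c :: 'k::field) (f :: 'i \<Rightarrow> 'k) i. c * f i"
    "\<lambda>(c :: 'k::field) (f :: 'j \<Rightarrow> 'k) i. c * f i"
  by (rule vector_space_pair.intro[OF vector_space_fun vector_space_fun])

interpretation fs_dual: vector_space_pair "\<lambda>(c :: 'k::field) (f :: 'i \<Rightarrow> 'k) i. c * f i"
    "(*) :: 'k::field \<Rightarrow> 'k \<Rightarrow> 'k"
  by (rule vector_space_pair.intro[OF vector_space_fun vector_space_field])

lemma fun_sum_apply: "(sum f A) i = (\<Sum>a\<in>A. f a i)"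
  by (induction A rule: infinite_finite_induct) simp_all

definition unit_fun :: "'i \<Rightarrow> 'i \<Rightarrow> 'k::field" where
  "unit_fun p = (\<lambda>i. if i = p then 1 else 0)"

lemma fun_unit_expansion:
  fixes f :: "'i \<Rightarrow> 'k::field"
  assumes "finite I" "\<And>i. i \<notin> I \<Longrightarrow> f i = 0"
  shows "f = (\<Sum>p\<in>I. (\<lambda>i. f p * unit_fun p i))"
proof
  fix i
  have "(\<Sum>p\<in>I. f p * unit_fun p i) = (\<Sum>p\<in>I. if p = i then f p else 0)"
    by (rule sum.cong) (auto simp: unit_fun_def)
  then show "f i = (\<Sum>p\<in>I. (\<lambda>i. f p * unit_fun p i)) i"
    using assms by (simp add: fun_sum_apply)
qed

locale mat_space =
  fixes n :: nat and S :: "'k::field mat set"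
  assumes carrier: "S \<subseteq> carrier_mat n n"
    and zero: "0\<^sub>m n n \<in> S"
    and add: "Y \<in> S \<Longrightarrow> Z \<in> S \<Longrightarrow> Y + Z \<in> S"
    and smult: "Y \<in> S \<Longrightarrow> c \<cdot>\<^sub>m Y \<in> S"

lemma lincomb_0: "lincomb_mat n 0 c b = 0\<^sub>m n n"
  by (rule eq_matI) (auto simp: lincomb_mat_def)

lemma lincomb_Suc:
  "b d \<in> carrier_mat n n \<Longrightarrow> lincomb_mat n (Suc d) c b = lincomb_mat n d c b + c d \<cdot>\<^sub>m b d"
  by (rule eq_matI) (auto simp: lincomb_mat_def)

lemma entries_lincomb:
  "(\<And>l. l < d \<Longrightarrow> b l \<in> carrier_mat n n) \<Longrightarrow>
    entries n (lincomb_mat n d c b) = (\<Sum>l<d. (\<lambda>ij. c l * entries n (b l) ij))"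
  by (auto simp: fun_eq_iff fun_sum_apply entries_def lincomb_mat_def)

lemma mat_entries: "Y \<in> carrier_mat n n \<Longrightarrow> Matrix.mat n n (entries n Y) = Y"
  by (rule eq_matI) (auto simp: entries_def)

context mat_space begin

lemma carrierD: "Y \<in> S \<Longrightarrow> Y \<in> carrier_mat n n"
  using carrier by (rule subsetD)

lemma lincomb_in: "(\<And>l. l < d \<Longrightarrow> b l \<in> S) \<Longrightarrow> lincomb_mat n d c b \<in> S"
proof (induction d)
  case (Suc d)
  then have "b d \<in> S" by simp
  then show ?case using Suc by (simp add: lincomb_Suc carrierD add smult)
qed (simp add: lincomb_0 zero)

text \<open>\<open>trace_on\<close> speaks of an arbitrary basis and would denote nothing without
  one.\<close>

lemma basis_exists: obtains d b where "mat_basis n S d b"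
proof -
  let ?V = "entries n ` S"
  obtain B where B: "B \<subseteq> ?V" "fs.independent B" "?V \<subseteq> fs.span B"
    using fs.maximal_independent_subset[of ?V] by blast
  let ?I = "{..<n} \<times> {..<n}"
  let ?U = "unit_fun ` ?I :: (nat \<times> nat \<Rightarrow> 'k) set"
  have "?V \<subseteq> fs.span ?U"
  proof
    fix f assume "f \<in> ?V"
    then have "f = (\<Sum>p\<in>?I. (\<lambda>i. f p * unit_fun p i))"
      by (intro fun_unit_expansion) (auto simp: entries_def split: if_splits)
    also have "\<dots> \<in> fs.span ?U"
      by (intro fs.span_sum fs.span_scale fs.span_base) auto
    finally show "f \<in> fs.span ?U" .
  qed
  then have finB: "finite B"
    using fs.independent_span_bound[of ?U B] B by auto
  define d where "d = card B"
  obtain g where g: "bij_betw g {..<d} B"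
    using ex_bij_betw_nat_finite[OF finB] by (auto simp: d_def atLeast0LessThan)
  define b where "b l = Matrix.mat n n (g l)" for l
  have gb: "entries n (b l) = g l" and bS: "b l \<in> S" if l: "l < d" for l
  proof -
    have "g l \<in> ?V" using g B(1) l by (auto simp: bij_betw_def)
    then obtain Y where Y: "Y \<in> S" "g l = entries n Y" by auto
    then have "b l = Y" by (simp add: b_def mat_entries carrierD)
    then show "entries n (b l) = g l" "b l \<in> S" using Y by auto
  qed
  have ent: "entries n (lincomb_mat n d c b) = (\<Sum>l<d. (\<lambda>ij. c l * g l ij))" for c
    by (subst entries_lincomb) (simp_all add: bS carrierD gb)
  have "\<exists>!c. (\<forall>l\<ge>d. c l = 0) \<and> Y = lincomb_mat n d c b" if Y: "Y \<in> S" for Y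
  proof (rule ex_ex1I)
    have "entries n Y \<in> fs.span B" using B(3) Y by auto
    then obtain r where r: "entries n Y = (\<Sum>v\<in>B. (\<lambda>i. r v * v i))"
      using fs.span_finite[OF finB] by auto
    let ?c = "\<lambda>l. if l < d then r (g l) else 0"
    have "entries n (lincomb_mat n d ?c b) = entries n Y"
      unfolding ent r using sum.reindex_bij_betw[OF g, of "\<lambda>v i. r v * v i"] by simp
    then have "Y = lincomb_mat n d ?c b"
      by (intro entries_eqI[of _ n]) (use Y in \<open>auto simp: carrierD lincomb_in bS\<close>)
    then show "\<exists>c. (\<forall>l\<ge>d. c l = 0) \<and> Y = lincomb_mat n d c b" by (intro exI[of _ ?c]) simp
  next
    fix c c' assume c: "(\<forall>l\<ge>d. c l = 0) \<and> Y = lincomb_mat n d c b"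
      and c': "(\<forall>l\<ge>d. c' l = 0) \<and> Y = lincomb_mat n d c' b"
    then have "(\<Sum>l<d. (\<lambda>ij. c l * g l ij)) = (\<Sum>l<d. (\<lambda>ij. c' l * g l ij))"
      using ent by metis
    then have 0: "(\<Sum>l<d. (\<lambda>ij. (c l - c' l) * g l ij)) = 0"
      by (simp add: fun_eq_iff fun_sum_apply left_diff_distrib sum_subtractf)
    define u where "u v = c (inv_into {..<d} g v) - c' (inv_into {..<d} g v)" for v
    have ug: "u (g l) = c l - c' l" if "l < d" for l
      using g that by (simp add: u_def bij_betw_def)
    have "(\<Sum>v\<in>B. (\<lambda>i. u v * v i)) = (\<Sum>l<d. (\<lambda>i. u (g l) * g l i))"
      using sum.reindex_bij_betw[OF g, of "\<lambda>v i. u v * v i"] by simp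
    also have "\<dots> = 0" using 0 ug by simp
    finally have "\<forall>v\<in>B. u v = 0"
      using B(2) fs.dependent_finite[OF finB] by auto
    then have "c l = c' l" if "l < d" for l
      using ug[OF that] g that by (auto simp: bij_betw_def)
    then show "c = c'" using c c' by (metis ext not_le)
  qed
  then have "mat_basis n S d b" by (simp add: mat_basis_def bS)
  then show thesis by (rule that)
qed

definition lin_op :: "('k mat \<Rightarrow> 'k mat) \<Rightarrow> bool" where
  "lin_op F \<longleftrightarrow> (\<forall>Y\<in>S. F Y \<in> S) \<and> (\<forall>Y\<in>S. \<forall>Z\<in>S. F (Y + Z) = F Y + F Z) \<and>
     (\<forall>c. \<forall>Y\<in>S. F (c \<cdot>\<^sub>m Y) = c \<cdot>\<^sub>m F Y)"

lemma lin_opD: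
  assumes "lin_op F"
  shows "Y \<in> S \<Longrightarrow> F Y \<in> S" "Y \<in> S \<Longrightarrow> Z \<in> S \<Longrightarrow> F (Y + Z) = F Y + F Z"
    "Y \<in> S \<Longrightarrow> F (c \<cdot>\<^sub>m Y) = c \<cdot>\<^sub>m F Y"
  using assms by (simp_all add: lin_op_def)

lemma lin_op_zero:
  assumes F: "lin_op F"
  shows "F (0\<^sub>m n n) = 0\<^sub>m n n"
proof -
  have *: "0 \<cdot>\<^sub>m A = 0\<^sub>m n n" if "A \<in> carrier_mat n n" for A :: "'k mat"
    using that by (intro eq_matI) auto
  have "F (0 \<cdot>\<^sub>m 0\<^sub>m n n) = 0 \<cdot>\<^sub>m F (0\<^sub>m n n)" by (rule lin_opD(3)[OF F zero])
  also have "\<dots> = 0\<^sub>m n n" by (rule *) (rule carrierD[OF lin_opD(1)[OF F zero]])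
  finally show ?thesis by (simp only: *[OF zero_carrier_mat])
qed

lemma lin_op_lincomb:
  assumes F: "lin_op F" and b: "\<And>l. l < d \<Longrightarrow> b l \<in> S"
  shows "F (lincomb_mat n d c b) = lincomb_mat n d c (\<lambda>l. F (b l))"
  using b
proof (induction d)
  case 0
  then show ?case by (simp add: lincomb_0 lin_op_zero[OF F])
next
  case (Suc d)
  have bd: "b d \<in> S" "F (b d) \<in> S" using Suc.prems F by (auto simp: lin_op_def)
  have "F (lincomb_mat n d c b + c d \<cdot>\<^sub>m b d) = F (lincomb_mat n d c b) + c d \<cdot>\<^sub>m F (b d)"
  proof -
    have "lincomb_mat n d c b \<in> S" by (rule lincomb_in) (use Suc.prems in simp)
    then show ?thesis using bd by (simp only: lin_opD[OF F] smult)
  qed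
  then show ?case using Suc bd by (simp add: lincomb_Suc carrierD)
qed

lemma lin_op_comp: "lin_op F \<Longrightarrow> lin_op H \<Longrightarrow> lin_op (\<lambda>Y. F (H Y))"
  by (simp add: lin_op_def)

lemma lin_op_add:
  assumes F: "lin_op F" and H: "lin_op H"
  shows "lin_op (\<lambda>Y. F Y + H Y)"
  unfolding lin_op_def
proof (intro conjI ballI allI)
  fix Y Z c assume Y: "Y \<in> S"
  note c = carrierD[OF lin_opD(1)[OF F]] carrierD[OF lin_opD(1)[OF H]]
  show "F Y + H Y \<in> S" using Y by (simp add: add lin_opD(1)[OF F] lin_opD(1)[OF H])
  show "F (c \<cdot>\<^sub>m Y) + H (c \<cdot>\<^sub>m Y) = c \<cdot>\<^sub>m (F Y + H Y)"
    unfolding lin_opD(3)[OF F Y] lin_opD(3)[OF H Y] using c[OF Y]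
    by (intro eq_matI) (auto simp: distrib_left)
  assume Z: "Z \<in> S"
  show "F (Y + Z) + H (Y + Z) = F Y + H Y + (F Z + H Z)"
    unfolding lin_opD(2)[OF F Y Z] lin_opD(2)[OF H Y Z] using c[OF Y] c[OF Z]
    by (intro eq_matI) auto
qed

lemma lin_op_smult:
  assumes F: "lin_op F"
  shows "lin_op (\<lambda>Y. a \<cdot>\<^sub>m F Y)"
  unfolding lin_op_def
proof (intro conjI ballI allI)
  fix Y Z c assume Y: "Y \<in> S"
  note c = carrierD[OF lin_opD(1)[OF F]]
  show "a \<cdot>\<^sub>m F Y \<in> S" using Y by (simp add: smult lin_opD(1)[OF F])
  show "a \<cdot>\<^sub>m F (c \<cdot>\<^sub>m Y) = c \<cdot>\<^sub>m (a \<cdot>\<^sub>m F Y)"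
    unfolding lin_opD(3)[OF F Y] using c[OF Y] by (intro eq_matI) auto
  assume Z: "Z \<in> S"
  show "a \<cdot>\<^sub>m F (Y + Z) = a \<cdot>\<^sub>m F Y + a \<cdot>\<^sub>m F Z"
    unfolding lin_opD(2)[OF F Y Z] using c[OF Y] c[OF Z]
    by (intro eq_matI) (auto simp: distrib_left)
qed

end

locale mat_space_basis = mat_space n S for n and S :: "'k::field mat set" +
  fixes d :: nat and b :: "nat \<Rightarrow> 'k mat"
  assumes basis: "mat_basis n S d b"
begin

definition coord :: "'k mat \<Rightarrow> nat \<Rightarrow> 'k" where
  "coord Y = (THE c. (\<forall>l\<ge>d. c l = 0) \<and> Y = lincomb_mat n d c b)"

lemma basis_in: "l < d \<Longrightarrow> b l \<in> S"
  using basis by (simp add: mat_basis_def)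

lemma coord: assumes "Y \<in> S" shows "Y = lincomb_mat n d (coord Y) b" "l \<ge> d \<Longrightarrow> coord Y l = 0"
proof -
  have "\<exists>!c. (\<forall>l\<ge>d. c l = 0) \<and> Y = lincomb_mat n d c b" using basis assms by (simp add: mat_basis_def)
  from theI'[OF this] show "Y = lincomb_mat n d (coord Y) b" "l \<ge> d \<Longrightarrow> coord Y l = 0"
    unfolding coord_def by auto
qed

lemma coord_eq:
  assumes "l < d" shows "coord (lincomb_mat n d c b) l = c l"
proof -
  let ?Y = "lincomb_mat n d c b" and ?c = "\<lambda>l. if l < d then c l else 0"
  have Y: "?Y \<in> S" by (rule lincomb_in) (rule basis_in)
  have 1: "\<exists>!c. (\<forall>l\<ge>d. c l = 0) \<and> ?Y = lincomb_mat n d c b" using basis Y by (simp add: mat_basis_def)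
  have "?Y = lincomb_mat n d ?c b" by (simp add: lincomb_mat_def)
  then have "coord ?Y = ?c"
    unfolding coord_def by (intro the1_equality[OF 1]) simp
  then show ?thesis using assms by simp
qed

lemma coord_add:
  assumes "Y \<in> S" "Z \<in> S" "l < d" shows "coord (Y + Z) l = coord Y l + coord Z l"
proof -
  have "lincomb_mat n d (coord Y) b + lincomb_mat n d (coord Z) b =
      lincomb_mat n d (\<lambda>l. coord Y l + coord Z l) b"
    by (rule eq_matI) (auto simp: lincomb_mat_def sum.distrib algebra_simps)
  then have "Y + Z = lincomb_mat n d (\<lambda>l. coord Y l + coord Z l) b"
    using coord(1)[OF assms(1)] coord(1)[OF assms(2)] by simp
  then show ?thesis using coord_eq[OF assms(3)] by simp
qed

lemma coord_smult:
  assumes "Y \<in> S" "l < d" shows "coord (c \<cdot>\<^sub>m Y) l = c * coord Y l"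
proof -
  have "c \<cdot>\<^sub>m lincomb_mat n d (coord Y) b = lincomb_mat n d (\<lambda>l. c * coord Y l) b"
    by (rule eq_matI) (auto simp: lincomb_mat_def sum_distrib_left algebra_simps)
  then have "c \<cdot>\<^sub>m Y = lincomb_mat n d (\<lambda>l. c * coord Y l) b"
    using coord(1)[OF assms(1)] by simp
  then show ?thesis using coord_eq[OF assms(2)] by simp
qed

lemma coord_lincomb:
  assumes "\<And>l. l < m \<Longrightarrow> z l \<in> S" "i < d"
  shows "coord (lincomb_mat n m c z) i = (\<Sum>l<m. c l * coord (z l) i)"
  using assms(1)
proof (induction m)
  case 0
  have "lincomb_mat n 0 c z = lincomb_mat n d (\<lambda>_. 0) b"
    by (rule eq_matI) (auto simp: lincomb_mat_def)
  then show ?case using coord_eq[OF assms(2), of "\<lambda>_. 0"] by simp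
next
  case (Suc m)
  then have "z m \<in> S" by simp
  then show ?case using Suc assms(2) lincomb_in[of m z c]
    by (simp add: lincomb_Suc carrierD coord_add coord_smult smult)
qed

definition tr :: "('k mat \<Rightarrow> 'k mat) \<Rightarrow> 'k" where
  "tr F = (\<Sum>i<d. coord (F (b i)) i)"

lemma tr_comm:
  assumes F: "lin_op F" and H: "lin_op H"
  shows "tr (\<lambda>Y. F (H Y)) = tr (\<lambda>Y. H (F Y))"
proof -
  have *: "coord (F (H (b i))) i = (\<Sum>j<d. coord (H (b i)) j * coord (F (b j)) i)"
    if F: "lin_op F" and H: "lin_op H" and i: "i < d" for F H i
  proof -
    have "H (b i) \<in> S" using H basis_in[OF i] by (simp add: lin_op_def)
    then have "F (H (b i)) = lincomb_mat n d (coord (H (b i))) (\<lambda>j. F (b j))"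
      by (subst coord(1), simp) (rule lin_op_lincomb[OF F basis_in])
    then show ?thesis using F basis_in i
      by (simp add: coord_lincomb lin_op_def)
  qed
  have "tr (\<lambda>Y. F (H Y)) = (\<Sum>i<d. \<Sum>j<d. coord (H (b i)) j * coord (F (b j)) i)"
    by (simp add: tr_def *[OF F H])
  also have "\<dots> = (\<Sum>j<d. \<Sum>i<d. coord (F (b j)) i * coord (H (b i)) j)"
    by (subst sum.swap) (simp add: mult.commute)
  also have "\<dots> = tr (\<lambda>Y. H (F Y))" by (simp add: tr_def *[OF H F])
  finally show ?thesis .
qed

lemma tr_add: "lin_op F \<Longrightarrow> lin_op H \<Longrightarrow> tr (\<lambda>Y. F Y + H Y) = tr F + tr H"
  using basis_in by (simp add: tr_def lin_op_def coord_add sum.distrib)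

lemma tr_smult: "lin_op F \<Longrightarrow> tr (\<lambda>Y. c \<cdot>\<^sub>m F Y) = c * tr F"
  using basis_in by (simp add: tr_def lin_op_def coord_smult sum_distrib_left)

lemma tr_cong: "(\<And>Y. Y \<in> S \<Longrightarrow> F Y = H Y) \<Longrightarrow> tr F = tr H"
  using basis_in by (simp add: tr_def)

text \<open>Expressing each of two bases in the other writes both traces as the same double sum, so
  the description in \<open>trace_on\<close> has a unique value.\<close>

lemma trace_on_eq_tr:
  assumes F: "lin_op F"
  shows "trace_on n S F = tr F"
  unfolding trace_on_def
proof (rule the_equality)
  show "\<exists>d b C. mat_basis n S d b \<and> (\<forall>j<d. F (b j) = lincomb_mat n d (\<lambda>i. C i j) b) \<and> tr F = (\<Sum>i<d. C i i)"
    using basis coord(1) F basis_in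
    by (intro exI[of _ d] exI[of _ b] exI[of _ "\<lambda>i j. coord (F (b j)) i"])
      (auto simp: tr_def lin_op_def)
next
  fix t assume "\<exists>d b C. mat_basis n S d b \<and> (\<forall>j<d. F (b j) = lincomb_mat n d (\<lambda>i. C i j) b) \<and> t = (\<Sum>i<d. C i i)"
  then obtain d' b' C where b': "mat_basis n S d' b'"
    and C: "\<And>j. j < d' \<Longrightarrow> F (b' j) = lincomb_mat n d' (\<lambda>i. C i j) b'" and t: "t = (\<Sum>i<d'. C i i)"
    by auto
  interpret B': mat_space_basis n S d' b' by unfold_locales (rule b')
  have Fb': "F (b' j) \<in> S" if "j < d'" for j using F B'.basis_in[OF that] by (simp add: lin_op_def)
  have "t = (\<Sum>j<d'. B'.coord (F (b' j)) j)" unfolding t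
    by (intro sum.cong refl) (simp add: C B'.coord_eq)
  also have "\<dots> = (\<Sum>j<d'. \<Sum>i<d. coord (F (b' j)) i * B'.coord (b i) j)"
  proof (intro sum.cong refl)
    fix j assume "j \<in> {..<d'}"
    then have j: "j < d'" by simp
    have "B'.coord (F (b' j)) j = B'.coord (lincomb_mat n d (coord (F (b' j))) b) j"
      using coord(1)[OF Fb'[OF j]] by simp
    also have "\<dots> = (\<Sum>i<d. coord (F (b' j)) i * B'.coord (b i) j)"
      by (rule B'.coord_lincomb) (simp_all add: basis_in j)
    finally show "B'.coord (F (b' j)) j = (\<Sum>i<d. coord (F (b' j)) i * B'.coord (b i) j)" .
  qed
  also have "\<dots> = (\<Sum>i<d. \<Sum>j<d'. B'.coord (b i) j * coord (F (b' j)) i)"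
    by (subst sum.swap) (simp add: mult.commute)
  also have "\<dots> = tr F" unfolding tr_def
  proof (intro sum.cong refl)
    fix i assume "i \<in> {..<d}"
    then have i: "i < d" by simp
    have "F (b i) = F (lincomb_mat n d' (B'.coord (b i)) b')"
      using B'.coord(1)[OF basis_in[OF i]] by simp
    also have "\<dots> = lincomb_mat n d' (B'.coord (b i)) (\<lambda>j. F (b' j))"
      by (rule lin_op_lincomb[OF F]) (rule B'.basis_in)
    finally show "(\<Sum>j<d'. B'.coord (b i) j * coord (F (b' j)) i) = coord (F (b i)) i"
      by (simp add: coord_lincomb[OF Fb' i])
  qed
  finally show "t = tr F" .
qed

end

context mat_space begin

lemma trace_on_comm:
  "lin_op F \<Longrightarrow> lin_op H \<Longrightarrow> trace_on n S (\<lambda>Y. F (H Y)) = trace_on n S (\<lambda>Y. H (F Y))"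
  and trace_on_add:
  "lin_op F \<Longrightarrow> lin_op H \<Longrightarrow> trace_on n S (\<lambda>Y. F Y + H Y) = trace_on n S F + trace_on n S H"
  and trace_on_smult: "lin_op F \<Longrightarrow> trace_on n S (\<lambda>Y. c \<cdot>\<^sub>m F Y) = c * trace_on n S F"
  and trace_on_cong: "lin_op F \<Longrightarrow> lin_op H \<Longrightarrow> (\<And>Y. Y \<in> S \<Longrightarrow> F Y = H Y) \<Longrightarrow>
    trace_on n S F = trace_on n S H"
proof -
  obtain d b where "mat_basis n S d b" by (rule basis_exists)
  then interpret B: mat_space_basis n S d b by unfold_locales
  show "lin_op F \<Longrightarrow> lin_op H \<Longrightarrow> trace_on n S (\<lambda>Y. F (H Y)) = trace_on n S (\<lambda>Y. H (F Y))"
    by (simp add: B.trace_on_eq_tr lin_op_comp B.tr_comm)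
  show "lin_op F \<Longrightarrow> lin_op H \<Longrightarrow> trace_on n S (\<lambda>Y. F Y + H Y) = trace_on n S F + trace_on n S H"
    by (simp add: B.trace_on_eq_tr lin_op_add B.tr_add)
  show "lin_op F \<Longrightarrow> trace_on n S (\<lambda>Y. c \<cdot>\<^sub>m F Y) = c * trace_on n S F"
    by (simp add: B.trace_on_eq_tr lin_op_smult B.tr_smult)
  show "trace_on n S F = trace_on n S H"
    if "lin_op F" "lin_op H" "\<And>Y. Y \<in> S \<Longrightarrow> F Y = H Y"
    unfolding B.trace_on_eq_tr[OF that(1)] B.trace_on_eq_tr[OF that(2)]
    by (rule B.tr_cong[OF that(3)])
qed

definition lin_form :: "('k mat \<Rightarrow> 'k) \<Rightarrow> bool" where
  "lin_form \<phi> \<longleftrightarrow> (\<forall>Y\<in>S. \<forall>Z\<in>S. \<phi> (Y + Z) = \<phi> Y + \<phi> Z) \<and> (\<forall>c. \<forall>Y\<in>S. \<phi> (c \<cdot>\<^sub>m Y) = c * \<phi> Y)"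

lemma lin_formD:
  assumes "lin_form \<phi>"
  shows "Y \<in> S \<Longrightarrow> Z \<in> S \<Longrightarrow> \<phi> (Y + Z) = \<phi> Y + \<phi> Z" "Y \<in> S \<Longrightarrow> \<phi> (c \<cdot>\<^sub>m Y) = c * \<phi> Y"
  using assms by (simp_all add: lin_form_def)

lemma lin_form_lincomb:
  assumes \<phi>: "lin_form \<phi>" and z: "\<And>l. l < m \<Longrightarrow> z l \<in> S"
  shows "\<phi> (lincomb_mat n m c z) = (\<Sum>l<m. c l * \<phi> (z l))"
  using z
proof (induction m)
  case 0
  have "\<phi> (0 \<cdot>\<^sub>m 0\<^sub>m n n) = 0 * \<phi> (0\<^sub>m n n)" by (rule lin_formD(2)[OF \<phi> zero])
  moreover have "0 \<cdot>\<^sub>m 0\<^sub>m n n = (0\<^sub>m n n :: 'k mat)" by (rule eq_matI) auto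
  ultimately show ?case by (simp only: lincomb_0) simp
next
  case (Suc m)
  then have "z m \<in> S" by simp
  moreover have "lincomb_mat n m c z \<in> S" by (rule lincomb_in) (use Suc.prems in simp)
  ultimately show ?case using Suc
    by (simp add: lincomb_Suc carrierD lin_formD[OF \<phi>] smult)
qed

text \<open>The form is extended from \<open>S\<close> to all functions on index pairs, where its
  values on unit functions are the coefficients. Linear forms thereby become explicit in the
  entries, which later yields their continuity.\<close>

lemma lin_form_entries:
  assumes \<phi>: "lin_form \<phi>"
  shows "\<exists>c. \<forall>Y\<in>S. \<phi> Y = (\<Sum>p\<in>{..<n} \<times> {..<n}. c p * entries n Y p)"
proof -
  obtain d b where b: "mat_basis n S d b" by (rule basis_exists)
  then interpret B: mat_space_basis n S d b by unfold_locales
  note lc = lin_form_lincomb[OF \<phi>]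
  let ?g = "\<lambda>l. entries n (b l)"
  have inj: "c = c'" if "(\<forall>l\<ge>d. c l = 0)" "(\<forall>l\<ge>d. c' l = 0)" "lincomb_mat n d c b = lincomb_mat n d c' b" for c c'
  proof
    fix l
    show "c l = c' l"
    proof (cases "l < d")
      case True
      from arg_cong[OF that(3), of "\<lambda>Y. B.coord Y l"] show ?thesis by (simp add: B.coord_eq True)
    qed (use that in simp)
  qed
  have ginj: "inj_on ?g {..<d}"
  proof (rule inj_onI)
    fix l m assume lm: "l \<in> {..<d}" "m \<in> {..<d}" "?g l = ?g m"
    then have "b l = b m" by (intro entries_eqI[of _ n]) (auto simp: B.basis_in carrierD)
    have "lincomb_mat n d (\<lambda>i. if i = l then 1 else 0) b = b l"
      if "l < d" for l
      using that carrierD[OF B.basis_in[OF that]]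
      by (intro eq_matI) (auto simp: lincomb_mat_def if_distrib[of "\<lambda>x. x * _"] cong: if_cong)
    then have "(\<lambda>i. if i = l then 1 else 0 :: 'k) = (\<lambda>i. if i = m then 1 else 0)"
      using lm \<open>b l = b m\<close> by (intro inj) auto
    then show "l = m" by (metis zero_neq_one)
  qed
  have indep: "fs.independent (?g ` {..<d})"
  proof -
    have "u v = 0" if u: "(\<Sum>v\<in>?g ` {..<d}. (\<lambda>i. u v * v i)) = 0" and v: "v \<in> ?g ` {..<d}" for u v
    proof -
      let ?c = "\<lambda>l. if l < d then u (?g l) else 0"
      have "(\<Sum>l<d. (\<lambda>i. u (?g l) * ?g l i)) = 0"
        using u by (simp add: sum.reindex[OF ginj])
      then have "entries n (lincomb_mat n d ?c b) = 0"
        by (subst entries_lincomb) (auto simp: B.basis_in carrierD)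
      then have "entries n (lincomb_mat n d ?c b) = entries n (lincomb_mat n d (\<lambda>_. 0) b)"
        by (auto simp: entries_def lincomb_mat_def fun_eq_iff)
      then have "lincomb_mat n d ?c b = lincomb_mat n d (\<lambda>_. 0) b"
        by (rule entries_eqI[rotated 2]) (auto simp: lincomb_mat_def)
      then have "?c = (\<lambda>_. 0)" by (intro inj) auto
      then show ?thesis using v by (auto simp: fun_eq_iff split: if_splits)
    qed
    then show ?thesis by (subst fs.dependent_finite) auto
  qed
  obtain g where g: "Vector_Spaces.linear (\<lambda>c f i. c * f i) (*) g" "\<forall>v\<in>?g ` {..<d}. g v = \<phi> (Matrix.mat n n v)"
    using fs_dual.linear_independent_extend[OF indep, of "\<lambda>v. \<phi> (Matrix.mat n n v)"] by blast
  then interpret g: Vector_Spaces.linear "\<lambda>(c :: 'k) f i. c * f i" "(*)" g by simp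
  show ?thesis
  proof (intro exI ballI)
    fix Y assume Y: "Y \<in> S"
    let ?I = "{..<n} \<times> {..<n}"
    have "entries n Y = (\<Sum>l<d. (\<lambda>ij. B.coord Y l * entries n (b l) ij))"
      by (subst B.coord(1)[OF Y], subst entries_lincomb) (auto simp: B.basis_in carrierD)
    then have "g (entries n Y) = (\<Sum>l<d. B.coord Y l * g (entries n (b l)))"
      by (simp add: g.sum g.scale)
    also have "\<dots> = (\<Sum>l<d. B.coord Y l * \<phi> (b l))"
      by (intro sum.cong refl) (simp add: g(2) mat_entries carrierD B.basis_in)
    also have "\<dots> = \<phi> Y" 
    proof -
      have "\<phi> (lincomb_mat n d (B.coord Y) b) = (\<Sum>l<d. B.coord Y l * \<phi> (b l))"
        by (rule lc) (rule B.basis_in)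
      then show ?thesis by (simp only: B.coord(1)[OF Y, symmetric])
    qed
    finally have 1: "\<phi> Y = g (entries n Y)" by simp
    have "g (entries n Y) = g (\<Sum>p\<in>?I. (\<lambda>i. entries n Y p * unit_fun p i))"
      by (rule arg_cong[OF fun_unit_expansion]) (auto simp: entries_def split: if_splits)
    also have "\<dots> = (\<Sum>p\<in>?I. g (unit_fun p) * entries n Y p)"
      unfolding g.sum g.scale by (intro sum.cong refl mult.commute)
    finally show "\<phi> Y = (\<Sum>p\<in>?I. g (unit_fun p) * entries n Y p)" using 1 by simp
  qed
qed

text \<open>The forms together are injective on \<open>S\<close>, and a linear left inverse of the
  joint map recovers the entries.\<close>

lemma entries_from_forms:
  fixes \<phi> :: "nat \<Rightarrow> 'k mat \<Rightarrow> 'k"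
  assumes \<phi>: "\<And>l. l < m \<Longrightarrow> lin_form (\<phi> l)"
    and nd: "\<And>Y. Y \<in> S \<Longrightarrow> (\<And>l. l < m \<Longrightarrow> \<phi> l Y = 0) \<Longrightarrow> Y = 0\<^sub>m n n"
  shows "\<exists>c. \<forall>Y\<in>S. \<forall>p. entries n Y p = (\<Sum>l<m. c l p * \<phi> l Y)"
proof -
  let ?I = "{..<n} \<times> {..<n}"
  have "\<exists>c. \<forall>Y\<in>S. \<phi> l Y = (\<Sum>p\<in>?I. c p * entries n Y p)" if "l < m" for l
    using lin_form_entries[OF \<phi>[OF that]] .
  then have "\<forall>l. \<exists>c. l < m \<longrightarrow> (\<forall>Y\<in>S. \<phi> l Y = (\<Sum>p\<in>?I. c p * entries n Y p))" by blast
  from choice[OF this] obtain c where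
    c: "\<forall>l. l < m \<longrightarrow> (\<forall>Y\<in>S. \<phi> l Y = (\<Sum>p\<in>?I. c l p * entries n Y p))" ..
  \<comment> \<open>The tuple of forms, written by \<open>lin_form_entries\<close> as a linear map
    on all functions; injectivity is claimed only on the entry functions of
    \<open>S\<close>.\<close>
  define f :: "(nat \<times> nat \<Rightarrow> 'k) \<Rightarrow> nat \<Rightarrow> 'k" where
    "f y = (\<lambda>l. if l < m then \<Sum>p\<in>?I. c l p * y p else 0)" for y
  have lf: "Vector_Spaces.linear (\<lambda>c f i. c * f i) (\<lambda>c f i. c * f i) f"
    unfolding Vector_Spaces.linear_iff
    by (intro conjI allI vector_space_fun)
      (auto simp: f_def fun_eq_iff sum.distrib sum_distrib_left distrib_left mult_ac)
  have f\<phi>: "f (entries n Y) = (\<lambda>l. if l < m then \<phi> l Y else 0)" if "Y \<in> S" for Y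
    using c that by (auto simp: f_def fun_eq_iff)
  have diff: "Y + (- 1) \<cdot>\<^sub>m Z \<in> S" if "Y \<in> S" "Z \<in> S" for Y Z
    by (rule add[OF that(1) smult[OF that(2)]])
  have sub: "fs.subspace (entries n ` S)"
    unfolding fs.subspace_def
  proof (intro conjI ballI allI)
    have "0 = entries n (0\<^sub>m n n :: 'k mat)" by (auto simp: entries_def fun_eq_iff)
    then show "0 \<in> entries n ` S" using zero by blast
  next
    fix y z assume "y \<in> entries n ` S" "z \<in> entries n ` S"
    then obtain Y Z where "Y \<in> S" "Z \<in> S" "y = entries n Y" "z = entries n Z" by auto
    then have "y + z = entries n (Y + Z)" "Y + Z \<in> S"
      by (auto simp: entries_add carrierD fun_eq_iff add)
    then show "y + z \<in> entries n ` S" by blast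
  next
    fix a y assume "y \<in> entries n ` S"
    then obtain Y where "Y \<in> S" "y = entries n Y" by auto
    then have "(\<lambda>i. a * y i) = entries n (a \<cdot>\<^sub>m Y)" "a \<cdot>\<^sub>m Y \<in> S"
      by (auto simp: entries_smult carrierD smult)
    then show "(\<lambda>i. a * y i) \<in> entries n ` S" by blast
  qed
  have "inj_on f (entries n ` S)"
  proof (rule inj_onI)
    fix y z assume "y \<in> entries n ` S" "z \<in> entries n ` S" and eq: "f y = f z"
    then obtain Y Z where YZ: "Y \<in> S" "Z \<in> S" "y = entries n Y" "z = entries n Z" by auto
    have "\<phi> l (Y + (- 1) \<cdot>\<^sub>m Z) = 0" if l: "l < m" for l
    proof -
      have "\<phi> l Y = \<phi> l Z" using fun_cong[OF eq, of l] YZ l by (simp add: f\<phi>)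
      moreover have "\<phi> l (Y + (- 1) \<cdot>\<^sub>m Z) = \<phi> l Y + (- 1) * \<phi> l Z"
        using YZ smult[OF YZ(2), of "- 1"] by (simp only: lin_formD[OF \<phi>[OF l]])
      ultimately show ?thesis by simp
    qed
    then have 0: "Y + (- 1) \<cdot>\<^sub>m Z = 0\<^sub>m n n" using nd diff YZ by blast
    have "Y = Z"
    proof (rule eq_matI)
      fix i j assume "i < dim_row Z" "j < dim_col Z"
      then show "Y $$ (i, j) = Z $$ (i, j)"
        using arg_cong[OF 0, of "\<lambda>A. A $$ (i, j)"] carrierD[OF YZ(1)] carrierD[OF YZ(2)] by auto
    qed (use carrierD[OF YZ(1)] carrierD[OF YZ(2)] in auto)
    then show "y = z" using YZ by simp
  qed
  then obtain g where g: "Vector_Spaces.linear (\<lambda>c f i. c * f i) (\<lambda>c f i. c * f i) g"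
    "\<forall>v\<in>entries n ` S. g (f v) = v"
    using fs_pair.linear_exists_left_inverse_on[OF lf sub] by blast
  interpret g: Vector_Spaces.linear "\<lambda>(c :: 'k) f i. c * f i" "\<lambda>(c :: 'k) f i. c * f i" g by (rule g(1))
  show ?thesis
  proof (intro exI ballI allI)
    fix Y p assume Y: "Y \<in> S"
    let ?w = "f (entries n Y)"
    have "entries n Y = g ?w" using g(2) Y by simp
    also have "?w = (\<Sum>l<m. (\<lambda>i. ?w l * unit_fun l i))"
      by (rule fun_unit_expansion) (auto simp: f_def)
    also have "g \<dots> = (\<Sum>l<m. (\<lambda>i. ?w l * g (unit_fun l) i))"
      unfolding g.sum g.scale ..
    finally show "entries n Y p = (\<Sum>l<m. g (unit_fun l) p * \<phi> l Y)"
      using Y by (simp add: fun_sum_apply f\<phi> mult.commute)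
  qed
qed

end

subsection \<open>Brackets and nilpotent matrices\<close>

context
  fixes n :: nat and A B C :: "'k::field mat"
  assumes A: "A \<in> carrier_mat n n" and B: "B \<in> carrier_mat n n" and C: "C \<in> carrier_mat n n"
begin

lemma lie_bracket_add_left: "lie_bracket (A + B) C = lie_bracket A C + lie_bracket B C"
  unfolding lie_bracket_def add_mult_distrib_mat[OF A B C] mult_add_distrib_mat[OF C A B]
  using A B C by (intro eq_matI) auto

lemma lie_bracket_add_right: "lie_bracket C (A + B) = lie_bracket C A + lie_bracket C B"
  unfolding lie_bracket_def add_mult_distrib_mat[OF A B C] mult_add_distrib_mat[OF C A B]
  using A B C by (intro eq_matI) auto

lemma lie_bracket_smult_left: "lie_bracket (c \<cdot>\<^sub>m A) B = c \<cdot>\<^sub>m lie_bracket A B"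
  unfolding lie_bracket_def mult_smult_assoc_mat[OF A B] mult_smult_distrib[OF B A]
  using A B by (intro eq_matI) (auto simp: right_diff_distrib)

lemma lie_bracket_smult_right: "lie_bracket A (c \<cdot>\<^sub>m B) = c \<cdot>\<^sub>m lie_bracket A B"
  unfolding lie_bracket_def mult_smult_assoc_mat[OF B A] mult_smult_distrib[OF A B]
  using A B by (intro eq_matI) (auto simp: right_diff_distrib)

lemma lie_bracket_antisym: "lie_bracket A B = (- 1) \<cdot>\<^sub>m lie_bracket B A"
  unfolding lie_bracket_def using A B by (intro eq_matI) auto

lemma lie_jacobi: "lie_bracket A (lie_bracket B C) = lie_bracket (lie_bracket A B) C + lie_bracket B (lie_bracket A C)"
proof -
  have c: "A * B \<in> carrier_mat n n" "B * A \<in> carrier_mat n n" "B * C \<in> carrier_mat n n"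
    "C * B \<in> carrier_mat n n" "A * C \<in> carrier_mat n n" "C * A \<in> carrier_mat n n"
    using A B C by auto
  note m = minus_mult_distrib_mat[where nr = n and n = n and nc = n] mult_minus_distrib_mat[where nr = n and n = n and nc = n]
  show ?thesis
    unfolding lie_bracket_def
    by (simp only: m A B C c assoc_mult_mat[where n\<^sub>1 = n and n\<^sub>2 = n and n\<^sub>3 = n and n\<^sub>4 = n])
      (rule eq_matI, use A B C in \<open>auto simp del: index_mult_mat(1)\<close>)
qed

lemma lie_bracket_mult_right: "lie_bracket A (B * C) = lie_bracket A B * C + B * lie_bracket A C"
proof -
  have c: "A * B \<in> carrier_mat n n" "B * A \<in> carrier_mat n n"
    "C * A \<in> carrier_mat n n" "A * C \<in> carrier_mat n n"
    using A B C by auto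
  show ?thesis
    unfolding lie_bracket_def minus_mult_distrib_mat[OF c(1,2) C] mult_minus_distrib_mat[OF B c(4,3)]
    by (simp only: A B C assoc_mult_mat[where n\<^sub>1 = n and n\<^sub>2 = n and n\<^sub>3 = n and n\<^sub>4 = n])
      (rule eq_matI, use A B C in \<open>auto simp del: index_mult_mat(1)\<close>)
qed

end

lemma pow_mat_add:
  fixes Y :: "'k::field mat"
  assumes Y: "Y \<in> carrier_mat n n"
  shows "Y ^\<^sub>m (a + b) = Y ^\<^sub>m a * Y ^\<^sub>m b"
proof (induction b)
  case 0
  show ?case using pow_carrier_mat[OF Y, of a] Y by simp
next
  case (Suc b)
  then show ?case using assoc_mult_mat[OF pow_carrier_mat[OF Y] pow_carrier_mat[OF Y] Y, of a b] by simp
qed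

text \<open>More than \<open>card I\<close> vectors in a space of that dimension are dependent. The
  family is indexed, so a repeated member, invisible to the notion of an independent set, is treated
  apart.\<close>

lemma fun_dependent:
  fixes u :: "nat \<Rightarrow> 'i \<Rightarrow> 'k::field"
  assumes I: "finite I" "card I \<le> N" and u: "\<And>l i. i \<notin> I \<Longrightarrow> u l i = 0"
  shows "\<exists>c. (\<exists>l\<le>N. c l \<noteq> 0) \<and> (\<forall>i. (\<Sum>l\<le>N. c l * u l i) = 0)"
proof (cases "inj_on u {..N}")
  case False
  then obtain a b where ab: "a \<le> N" "b \<le> N" "a \<noteq> b" "u a = u b" by (auto simp: inj_on_def)
  let ?c = "\<lambda>l. (if l = a then 1 else 0) - (if l = b then 1 else 0 :: 'k)"
  have "(\<Sum>l\<le>N. ?c l * u l i) = 0" for i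
  proof -
    have "(\<Sum>l\<le>N. ?c l * u l i) = (\<Sum>l\<le>N. if l = a then u l i else 0) - (\<Sum>l\<le>N. if l = b then u l i else 0)"
      unfolding sum_subtractf[symmetric] by (rule sum.cong) auto
    then show ?thesis using ab by simp
  qed
  moreover have "?c a \<noteq> 0" using ab by simp
  ultimately show ?thesis using ab(1) by (intro exI[of _ ?c]) auto
next
  case True
  let ?B = "u ` {..N}" and ?U = "unit_fun ` I :: ('i \<Rightarrow> 'k) set"
  have "?B \<subseteq> fs.span ?U"
  proof
    fix f assume "f \<in> ?B"
    then have "f = (\<Sum>p\<in>I. (\<lambda>i. f p * unit_fun p i))"
      using u I by (intro fun_unit_expansion) auto
    also have "\<dots> \<in> fs.span ?U"
      by (intro fs.span_sum fs.span_scale fs.span_base) auto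
    finally show "f \<in> fs.span ?U" .
  qed
  moreover have "card ?B = Suc N" using card_image[OF True] by simp
  moreover have "card ?U \<le> N" using card_image_le[OF I(1), of "unit_fun :: 'i \<Rightarrow> 'i \<Rightarrow> 'k"] I(2) by simp
  ultimately have "\<not> fs.independent ?B"
    using fs.independent_span_bound[of ?U ?B] I(1) by auto
  then obtain r where r: "\<exists>v\<in>?B. r v \<noteq> 0" "(\<Sum>v\<in>?B. (\<lambda>i. r v * v i)) = 0"
    by (subst (asm) fs.dependent_finite) auto
  have "(\<Sum>l\<le>N. r (u l) * u l i) = 0" for i
    using fun_cong[OF r(2), of i] by (simp add: fun_sum_apply sum.reindex[OF True])
  then show ?thesis using r(1) by (intro exI[of _ "\<lambda>l. r (u l)"]) auto
qed

text \<open>\<open>mat_exp\<close> stops before the n-th term, so nilpotency of some order has to be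
  sharpened to order n. Fixed columns of the first n + 1 powers are dependent; multiplied by a
  suitable power of \<open>Y\<close>, the relation retains only its lowest term, against the
  minimality of \<open>m\<close>.\<close>

lemma nilpotent_index:
  fixes Y :: "'k::field mat"
  assumes Y: "Y \<in> carrier_mat n n" and nil: "Y ^\<^sub>m m = 0\<^sub>m n n"
  shows "Y ^\<^sub>m n = 0\<^sub>m n n"
proof -
  define m where "m = (LEAST m. Y ^\<^sub>m m = 0\<^sub>m n n)"
  have m: "Y ^\<^sub>m m = 0\<^sub>m n n" unfolding m_def using nil by (rule LeastI)
  have big: "Y ^\<^sub>m k = 0\<^sub>m n n" if "k \<ge> m" for k
    using pow_mat_add[OF Y, of m "k - m"] that m
      left_mult_zero_mat[OF pow_carrier_mat[OF Y, of "k - m"]] by simp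
  show ?thesis
  proof (cases "m \<le> n")
    case False
    have "(Y ^\<^sub>m (m - 1)) $$ (i, j) = 0" if ij: "i < n" "j < n" for i j
    proof -
      let ?u = "\<lambda>l i. if i < n then (Y ^\<^sub>m l) $$ (i, j) else 0"
      obtain c where c: "\<exists>l\<le>n. c l \<noteq> 0" "\<forall>i. (\<Sum>l\<le>n. c l * ?u l i) = 0"
        using fun_dependent[of "{..<n}" n ?u] by auto
      define l0 where "l0 = (LEAST l. l \<le> n \<and> c l \<noteq> 0)"
      have l0: "l0 \<le> n" "c l0 \<noteq> 0" using LeastI_ex[of "\<lambda>l. l \<le> n \<and> c l \<noteq> 0"] c(1) by (auto simp: l0_def)
      have lt: "c l = 0" if "l < l0" for l
        using not_less_Least[of l "\<lambda>l. l \<le> n \<and> c l \<noteq> 0"] that l0(1) by (auto simp: l0_def)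
      \<comment> \<open>This exponent moves the lowest term \<open>l0\<close> to exponent
        \<open>m - 1\<close> and all later terms to \<open>m\<close> or beyond, where they
        vanish.\<close>
      define s where "s = m - 1 - l0"
      have P: "(Y ^\<^sub>m (s + l)) $$ (i, j) = (\<Sum>p<n. (Y ^\<^sub>m s) $$ (i, p) * (Y ^\<^sub>m l) $$ (p, j))" for l
        unfolding pow_mat_add[OF Y]
        using Y pow_carrier_mat[OF Y, of s] pow_carrier_mat[OF Y, of l] ij
        by (auto simp: scalar_prod_def atLeast0LessThan intro!: sum.cong)
      have "(\<Sum>l\<le>n. c l * (Y ^\<^sub>m (s + l)) $$ (i, j)) =
          (\<Sum>l\<le>n. \<Sum>p<n. (Y ^\<^sub>m s) $$ (i, p) * (c l * ?u l p))"
        by (intro sum.cong refl) (simp add: P sum_distrib_left mult_ac)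
      also have "\<dots> = (\<Sum>p<n. (Y ^\<^sub>m s) $$ (i, p) * (\<Sum>l\<le>n. c l * ?u l p))"
        by (subst sum.swap) (simp add: sum_distrib_left)
      also have "\<dots> = 0" by (simp only: c(2)[rule_format]) simp
      finally have 0: "(\<Sum>l\<le>n. c l * (Y ^\<^sub>m (s + l)) $$ (i, j)) = 0" .
      have "c l * (Y ^\<^sub>m (s + l)) $$ (i, j) = (if l = l0 then c l0 * (Y ^\<^sub>m (m - 1)) $$ (i, j) else 0)" for l
      proof -
        consider "l < l0" | "l = l0" | "l > l0" by linarith
        then show ?thesis
        proof cases
          case 3
          then have "s + l \<ge> m" using l0(1) False by (simp add: s_def)
          then show ?thesis using big[of "s + l"] ij 3 by simp
        qed (use lt l0 False in \<open>auto simp: s_def\<close>)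
      qed
      then have "(\<Sum>l\<le>n. if l = l0 then c l0 * (Y ^\<^sub>m (m - 1)) $$ (i, j) else 0) = 0"
        using 0 by simp
      then show ?thesis using l0 by simp
    qed
    then have "Y ^\<^sub>m (m - 1) = 0\<^sub>m n n"
      using pow_carrier_mat[OF Y, of "m - 1"] by (intro eq_matI) auto
    then have "m \<le> m - 1" unfolding m_def by (rule Least_le)
    then show ?thesis using False by simp
  qed (rule big)
qed

subsection \<open>Weight vectors\<close>

abbreviation adp :: "'k::field mat \<Rightarrow> nat \<Rightarrow> 'k mat \<Rightarrow> 'k mat" where
  "adp h j \<equiv> (lie_bracket h ^^ j)"

text \<open>Lagrange interpolation; the nodes are distinct since \<open>c \<noteq> 0\<close> in
  characteristic 0. Inserting \<open>ad h\<close> makes \<open>P\<close> the projection to a single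
  weight.\<close>

lemma nodes_poly:
  fixes c :: "'k::field_char_0" and l0 N :: nat
  assumes c0: "c \<noteq> 0"
  shows "\<exists>P. poly P (of_nat l0 * c) = 1 \<and> (\<forall>l<N. l \<noteq> l0 \<longrightarrow> poly P (of_nat l * c) = 0)"
proof -
  define P0 where "P0 = (\<Prod>l\<in>{..<N} - {l0}. [:- (of_nat l * c), 1:])"
  have "poly P0 (of_nat l0 * c) \<noteq> 0"
    unfolding P0_def poly_prod using c0 by (auto simp: prod_zero_iff)
  moreover have "poly P0 (of_nat l * c) = 0" if "l < N" "l \<noteq> l0" for l
    unfolding P0_def poly_prod using that by (intro prod_zero) auto
  ultimately show ?thesis
    by (intro exI[of _ "Polynomial.smult (inverse (poly P0 (of_nat l0 * c))) P0"]) auto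
qed

locale weight_vector =
  fixes n :: nat and h Y :: "'k::field_char_0 mat" and c :: 'k
  assumes h: "h \<in> carrier_mat n n" and Y: "Y \<in> carrier_mat n n"
    and weight: "lie_bracket h Y = c \<cdot>\<^sub>m Y" and c0: "c \<noteq> 0"
begin

text \<open>\<open>ad h\<close> is a derivation of the matrix product, so weights add up.\<close>

lemma weight_pow: "lie_bracket h (Y ^\<^sub>m l) = (of_nat l * c) \<cdot>\<^sub>m (Y ^\<^sub>m l)"
proof (induction l)
  case 0
  have "Y ^\<^sub>m 0 = 1\<^sub>m n" using Y by simp
  then show ?case using h by (simp add: lie_bracket_def) (intro eq_matI, auto)
next
  case (Suc l)
  have P: "Y ^\<^sub>m l \<in> carrier_mat n n" using Y by (rule pow_carrier_mat)
  have "lie_bracket h (Y ^\<^sub>m l * Y) = lie_bracket h (Y ^\<^sub>m l) * Y + Y ^\<^sub>m l * lie_bracket h Y"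
    by (rule lie_bracket_mult_right[OF h P Y])
  also have "\<dots> = (of_nat l * c) \<cdot>\<^sub>m (Y ^\<^sub>m l) * Y + Y ^\<^sub>m l * (c \<cdot>\<^sub>m Y)"
    using Suc weight by simp
  also have "\<dots> = (of_nat (Suc l) * c) \<cdot>\<^sub>m (Y ^\<^sub>m l * Y)"
    unfolding mult_smult_assoc_mat[OF P Y] mult_smult_distrib[OF P Y]
    using P Y by (intro eq_matI) (auto simp: algebra_simps)
  finally show ?case by simp
qed

lemma adp_combination:
  "adp h j (lincomb_mat n N a (\<lambda>l. Y ^\<^sub>m l)) =
    lincomb_mat n N (\<lambda>l. a l * (of_nat l * c) ^ j) (\<lambda>l. Y ^\<^sub>m l)"
proof (induction j)
  case (Suc j)
  have P: "Y ^\<^sub>m l \<in> carrier_mat n n" for l using Y by (rule pow_carrier_mat)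
  have lb: "lie_bracket h (lincomb_mat n m b (\<lambda>l. Y ^\<^sub>m l)) =
      lincomb_mat n m (\<lambda>l. b l * (of_nat l * c)) (\<lambda>l. Y ^\<^sub>m l)" for m b
  proof (induction m)
    case 0
    show ?case using h by (simp add: lincomb_0 lie_bracket_def)
  next
    case (Suc m)
    have L: "lincomb_mat n m b (\<lambda>l. Y ^\<^sub>m l) \<in> carrier_mat n n" by (simp add: lincomb_mat_def)
    have "lie_bracket h (lincomb_mat n (Suc m) b (\<lambda>l. Y ^\<^sub>m l)) =
        lie_bracket h (lincomb_mat n m b (\<lambda>l. Y ^\<^sub>m l)) + lie_bracket h (b m \<cdot>\<^sub>m Y ^\<^sub>m m)"
      unfolding lincomb_Suc[OF P] by (rule lie_bracket_add_right[OF L _ h]) (use P in simp)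
    also have "lie_bracket h (b m \<cdot>\<^sub>m Y ^\<^sub>m m) = b m \<cdot>\<^sub>m lie_bracket h (Y ^\<^sub>m m)"
      by (rule lie_bracket_smult_right[OF h P P])
    also have "\<dots> = (b m * (of_nat m * c)) \<cdot>\<^sub>m Y ^\<^sub>m m"
      unfolding weight_pow using P by (intro eq_matI) auto
    finally show ?case unfolding Suc lincomb_Suc[OF P] .
  qed
  show ?case using Suc by (simp add: lb mult_ac)
qed simp

text \<open>The powers of \<open>Y\<close> are eigenvectors of \<open>ad h\<close>, so
  \<open>P(ad h)\<close> acts on their combinations through the values of \<open>P\<close> at the
  weights.\<close>

lemma adp_poly:
  assumes "p < n" "q < n"
  shows "(\<Sum>j\<le>Polynomial.degree P. Polynomial.coeff P j *
      (adp h j (lincomb_mat n N a (\<lambda>l. Y ^\<^sub>m l))) $$ (p, q)) =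
    (\<Sum>l<N. a l * poly P (of_nat l * c) * (Y ^\<^sub>m l) $$ (p, q))"
proof -
  have "(\<Sum>j\<le>Polynomial.degree P. Polynomial.coeff P j *
      (adp h j (lincomb_mat n N a (\<lambda>l. Y ^\<^sub>m l))) $$ (p, q)) =
    (\<Sum>j\<le>Polynomial.degree P. \<Sum>l<N. a l * (Polynomial.coeff P j * (of_nat l * c) ^ j) * (Y ^\<^sub>m l) $$ (p, q))"
    unfolding adp_combination using assms
    by (simp add: lincomb_mat_def sum_distrib_left mult_ac)
  also have "\<dots> = (\<Sum>l<N. a l * poly P (of_nat l * c) * (Y ^\<^sub>m l) $$ (p, q))"
    by (subst sum.swap) (simp add: poly_altdef sum_distrib_left sum_distrib_right)
  finally show ?thesis .
qed

text \<open>The n^2 + 1 powers of \<open>Y\<close> up to exponent n^2 are linearly dependent. Their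
  weights are distinct, so a polynomial in \<open>ad h\<close> isolates one that occurs in the
  relation with nonzero coefficient, and this power is 0.\<close>

lemma nilpotent: "Y ^\<^sub>m n = 0\<^sub>m n n"
proof -
  let ?N = "n * n"
  have P: "Y ^\<^sub>m l \<in> carrier_mat n n" for l using Y by (rule pow_carrier_mat)
  obtain a where a: "\<exists>l\<le>?N. a l \<noteq> 0" "\<forall>ij. (\<Sum>l\<le>?N. a l * entries n (Y ^\<^sub>m l) ij) = 0"
  proof -
    have "entries n (Y ^\<^sub>m l) ij = 0" if "ij \<notin> {..<n} \<times> {..<n}" for l ij
      using that by (cases ij) (auto simp: entries_def)
    with fun_dependent[of "{..<n} \<times> {..<n}" ?N "\<lambda>l. entries n (Y ^\<^sub>m l)"] that
    show thesis by (simp add: card_cartesian_product) blast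
  qed
  then obtain l0 where l0: "l0 \<le> ?N" "a l0 \<noteq> 0" by auto
  have z: "lincomb_mat n (Suc ?N) a (\<lambda>l. Y ^\<^sub>m l) = 0\<^sub>m n n"
  proof (rule eq_matI)
    fix i j assume "i < dim_row (0\<^sub>m n n :: 'k mat)" "j < dim_col (0\<^sub>m n n :: 'k mat)"
    then show "lincomb_mat n (Suc ?N) a (\<lambda>l. Y ^\<^sub>m l) $$ (i, j) = 0\<^sub>m n n $$ (i, j)"
      using a(2)[rule_format, of "(i, j)"] by (simp add: lincomb_mat_def entries_def lessThan_Suc_atMost)
  qed (auto simp: lincomb_mat_def)
  have adz: "adp h j (0\<^sub>m n n) = 0\<^sub>m n n" for j
    by (induction j) (use h in \<open>auto simp: lie_bracket_def\<close>)
  obtain P where P1: "poly P (of_nat l0 * c) = 1" "\<And>l. l < Suc ?N \<Longrightarrow> l \<noteq> l0 \<Longrightarrow> poly P (of_nat l * c) = 0"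
    using nodes_poly[OF c0, of l0 "Suc ?N"] by blast
  have "(Y ^\<^sub>m l0) $$ (p, q) = 0" if pq: "p < n" "q < n" for p q
  proof -
    have "(\<Sum>l<Suc ?N. a l * poly P (of_nat l * c) * (Y ^\<^sub>m l) $$ (p, q)) = 0"
      using adp_poly[OF pq, of P "Suc ?N" a] pq by (simp add: z adz del: sum.lessThan_Suc)
    moreover have "(\<Sum>l<Suc ?N. a l * poly P (of_nat l * c) * (Y ^\<^sub>m l) $$ (p, q)) =
        (\<Sum>l<Suc ?N. if l = l0 then a l0 * (Y ^\<^sub>m l0) $$ (p, q) else 0)"
      by (intro sum.cong refl) (use P1 in auto)
    ultimately show ?thesis using l0 by (simp del: sum.lessThan_Suc)
  qed
  then have "Y ^\<^sub>m l0 = 0\<^sub>m n n" using P[of l0] by (intro eq_matI) auto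
  then show ?thesis by (rule nilpotent_index[OF Y])
qed

lemma mat_exp_lincomb: "mat_exp n Y = lincomb_mat n n (\<lambda>l. 1 / fact l) (\<lambda>l. Y ^\<^sub>m l)"
  by (simp add: mat_exp_def lincomb_mat_def)

end

lemma adp_entries:
  fixes h :: "'k::field mat"
  assumes h: "h \<in> carrier_mat n n"
  shows "\<exists>C. \<forall>Z\<in>carrier_mat n n. \<forall>p. entries n (adp h j Z) p = (\<Sum>q\<in>{..<n} \<times> {..<n}. C p q * entries n Z q)"
proof -
  interpret mat_space n "carrier_mat n n :: 'k mat set" by unfold_locales auto
  have car: "adp h j Z \<in> carrier_mat n n" if "Z \<in> carrier_mat n n" for Z j
    using that h by (induction j) (auto simp: lie_bracket_def)
  have lin: "adp h j (Y + Z) = adp h j Y + adp h j Z \<and> adp h j (c \<cdot>\<^sub>m Y) = c \<cdot>\<^sub>m adp h j Y"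
    if "Y \<in> carrier_mat n n" "Z \<in> carrier_mat n n" for Y Z c
  proof (induction j)
    case (Suc j)
    then show ?case
      using lie_bracket_add_right[OF car[OF that(1)] car[OF that(2)] h, of j j]
        lie_bracket_smult_right[OF h car[OF that(1)] h, of c j] by simp
  qed simp
  have "lin_form (\<lambda>Z. entries n (adp h j Z) p)" for p
    unfolding lin_form_def using lin car by (auto simp: entries_add entries_smult)
  from lin_form_entries[OF this]
  have "\<forall>p. \<exists>C. \<forall>Z\<in>carrier_mat n n. entries n (adp h j Z) p = (\<Sum>q\<in>{..<n} \<times> {..<n}. C q * entries n Z q)"
    by blast
  from choice[OF this] show ?thesis by blast
qed

text \<open>On vectors of a fixed non-zero weight, the logarithm is the projection of \<open>exp Y = \<Sum> Y\<^sup>l / l!\<close>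
  to the weight \<open>c\<close>, a polynomial in \<open>ad h\<close>.\<close>

lemma mat_log_entries:
  fixes h :: "'k::field_char_0 mat"
  assumes h: "h \<in> carrier_mat n n" and c: "c \<noteq> 0"
  shows "\<exists>C. \<forall>Y\<in>carrier_mat n n. lie_bracket h Y = c \<cdot>\<^sub>m Y \<longrightarrow>
    (\<forall>p. entries n Y p = (\<Sum>q\<in>{..<n} \<times> {..<n}. C p q * entries n (mat_exp n Y) q))"
proof -
  let ?I = "{..<n} \<times> {..<n}"
  obtain P where P: "poly P (of_nat 1 * c) = 1" "\<And>l. l < n \<Longrightarrow> l \<noteq> 1 \<Longrightarrow> poly P (of_nat l * c) = 0"
    using nodes_poly[OF c, of 1 n] by blast
  have "\<forall>j. \<exists>C. \<forall>Z\<in>carrier_mat n n. \<forall>p. entries n (adp h j Z) p = (\<Sum>q\<in>?I. C p q * entries n Z q)"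
    using adp_entries[OF h] by blast
  from choice[OF this] obtain C where
    C: "\<And>j Z p. Z \<in> carrier_mat n n \<Longrightarrow> entries n (adp h j Z) p = (\<Sum>q\<in>?I. C j p q * entries n Z q)"
    by blast
  let ?D = "\<lambda>p q. \<Sum>j\<le>Polynomial.degree P. Polynomial.coeff P j * C j p q"
  have "entries n Y p = (\<Sum>q\<in>?I. ?D p q * entries n (mat_exp n Y) q)"
    if Y: "Y \<in> carrier_mat n n" and w: "lie_bracket h Y = c \<cdot>\<^sub>m Y" for Y p
  proof -
    interpret weight_vector n h Y c by unfold_locales (use h Y w c in auto)
    have "(\<Sum>q\<in>?I. ?D p q * entries n (mat_exp n Y) q) =
        (\<Sum>j\<le>Polynomial.degree P. Polynomial.coeff P j * entries n (adp h j (mat_exp n Y)) p)"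
      unfolding C[OF mat_exp_carrier] sum_distrib_right sum_distrib_left
      by (subst sum.swap) (simp add: mult.assoc)
    also have "\<dots> = entries n Y p"
    proof (cases "fst p < n \<and> snd p < n")
      case True
      obtain i j where p: "p = (i, j)" by (cases p)
      have ij: "i < n" "j < n" using True p by auto
      have "(\<Sum>j\<le>Polynomial.degree P. Polynomial.coeff P j * entries n (adp h j (mat_exp n Y)) p) =
          (\<Sum>l<n. 1 / fact l * poly P (of_nat l * c) * (Y ^\<^sub>m l) $$ (i, j))"
        using adp_poly[OF ij, of P n "\<lambda>l. 1 / fact l"] ij by (simp add: p entries_def mat_exp_lincomb)
      also have "\<dots> = (\<Sum>l<n. if l = 1 then Y $$ (i, j) else 0)"
      proof (intro sum.cong refl)
        fix l assume "l \<in> {..<n}"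
        then show "1 / fact l * poly P (of_nat l * c) * (Y ^\<^sub>m l) $$ (i, j) = (if l = 1 then Y $$ (i, j) else 0)"
          using P Y by (cases "l = 1") auto
      qed
      also have "\<dots> = Y $$ (i, j)"
      \<comment> \<open>For n = 1 the sum has no term of index 1, but then nilpotency already says
        that \<open>Y\<close> is 0.\<close>
      proof (cases "n = 1")
        case True
        then show ?thesis using nilpotent ij Y by simp
      qed (use ij in auto)
      finally show ?thesis using ij by (simp add: p entries_def)
    qed (cases p; auto simp: entries_def)
    finally show ?thesis by simp
  qed
  then show ?thesis by (intro exI[of _ ?D] ballI impI allI)
qed

section \<open>The Lie algebra graded by the sl2-triple\<close>

locale kkt =
  fixes T :: "'k::field_char_0 kkt_datum"
  assumes graded: "kkt_graded_group T"
begin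

abbreviation "n \<equiv> kkt_size T"
abbreviation "L \<equiv> kkt_lie T"
abbreviation "E \<equiv> kkt_eigenspace T"
abbreviation "h \<equiv> kkt_h T"
abbreviation "e \<equiv> kkt_e T"
abbreviation "f \<equiv> kkt_f T"

end

sublocale kkt \<subseteq> k_group "kkt_size T" "kkt_group T"
  by (rule k_group.intro)
    (use graded in \<open>simp_all add: kkt_graded_group_def almost_simple_group_def algebraic_group_def\<close>)

context kkt begin

lemma L_eq: "L = lie_algebra n (kkt_group T)"
  by (simp add: kkt_lie_def)

lemma L_carrier: "Y \<in> L \<Longrightarrow> Y \<in> carrier_mat n n"
  and L_add: "Y \<in> L \<Longrightarrow> Z \<in> L \<Longrightarrow> Y + Z \<in> L"
  and L_smult: "Y \<in> L \<Longrightarrow> c \<cdot>\<^sub>m Y \<in> L"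
  and L_bracket: "Y \<in> L \<Longrightarrow> Z \<in> L \<Longrightarrow> lie_bracket Y Z \<in> L"
  and L_zero: "0\<^sub>m n n \<in> L"
  unfolding L_eq by (simp_all add: lie_carrier lie_add lie_smult lie_bracket_closed lie_zero)

lemma triple:
  "f \<in> L" "h \<in> L" "e \<in> L" "lie_bracket h e = 2 \<cdot>\<^sub>m e" "lie_bracket h f = (- 2) \<cdot>\<^sub>m f"
  "lie_bracket e f = h"
  and decomp: "Y \<in> L \<Longrightarrow> \<exists>A\<in>E (- 2). \<exists>B\<in>E 0. \<exists>C\<in>E 2. Y = A + B + C"
  using graded by (simp_all add: kkt_graded_group_def)

lemma mat_space_L: "mat_space n L"
  by (rule mat_space.intro) (auto simp: L_carrier L_add L_smult L_zero)

lemma E_L: "Y \<in> E c \<Longrightarrow> Y \<in> L" and E_weight: "Y \<in> E c \<Longrightarrow> lie_bracket h Y = c \<cdot>\<^sub>m Y"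
  and EI: "Y \<in> L \<Longrightarrow> lie_bracket h Y = c \<cdot>\<^sub>m Y \<Longrightarrow> Y \<in> E c"
  by (simp_all add: kkt_eigenspace_def)

lemma E_carrier: "Y \<in> E c \<Longrightarrow> Y \<in> carrier_mat n n"
  by (rule L_carrier[OF E_L])

lemma mat_space_E: "mat_space n (E c)"
proof (rule mat_space.intro)
  note hc = L_carrier[OF triple(2)]
  show "E c \<subseteq> carrier_mat n n" by (auto intro: E_carrier)
  have "lie_bracket h (0\<^sub>m n n) = c \<cdot>\<^sub>m 0\<^sub>m n n"
    using hc by (intro eq_matI) (auto simp: lie_bracket_def)
  then show "0\<^sub>m n n \<in> E c" by (intro EI L_zero)
  fix Y Z assume Y: "Y \<in> E c" and Z: "Z \<in> E c"
  note YZ = E_carrier[OF Y] E_carrier[OF Z]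
  have "lie_bracket h (Y + Z) = c \<cdot>\<^sub>m (Y + Z)"
    unfolding lie_bracket_add_right[OF YZ hc] E_weight[OF Y] E_weight[OF Z]
    using YZ by (intro eq_matI) (auto simp: distrib_left)
  then show "Y + Z \<in> E c" by (intro EI L_add E_L[OF Y] E_L[OF Z])
next
  fix Y a assume Y: "Y \<in> E c"
  note hc = L_carrier[OF triple(2)]
  have "lie_bracket h (a \<cdot>\<^sub>m Y) = c \<cdot>\<^sub>m (a \<cdot>\<^sub>m Y)"
    unfolding lie_bracket_smult_right[OF hc E_carrier[OF Y] E_carrier[OF Y]] E_weight[OF Y]
    using E_carrier[OF Y] by (intro eq_matI) auto
  then show "a \<cdot>\<^sub>m Y \<in> E c" by (intro EI L_smult E_L[OF Y])
qed

lemmas E_add = mat_space.add[OF mat_space_E] and E_smult = mat_space.smult[OF mat_space_E]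

lemma E_bracket:
  assumes Y: "Y \<in> E a" and Z: "Z \<in> E b"
  shows "lie_bracket Y Z \<in> E (a + b)"
proof (rule EI[OF L_bracket[OF E_L[OF Y] E_L[OF Z]]])
  note c = L_carrier[OF triple(2)] E_carrier[OF Y] E_carrier[OF Z]
  show "lie_bracket h (lie_bracket Y Z) = (a + b) \<cdot>\<^sub>m lie_bracket Y Z"
    unfolding lie_jacobi[OF c] E_weight[OF Y] E_weight[OF Z]
      lie_bracket_smult_left[OF c(2,3,3)] lie_bracket_smult_right[OF c(2,3,3)]
    using lie_bracket_carrier[OF c(2,3)] by (intro eq_matI) (auto simp: distrib_right)
qed

text \<open>By the decomposition, \<open>ad h\<close> satisfies \<open>X^3 = 4 X\<close> on the Lie
  algebra, so -2, 0 and 2 are the only possible eigenvalues.\<close>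

lemma E_trivial:
  assumes Y: "Y \<in> E c" and c: "c ^ 3 \<noteq> 4 * c"
  shows "Y = 0\<^sub>m n n"
proof -
  note hc = L_carrier[OF triple(2)]
  obtain A B C where ABC: "A \<in> E (- 2)" "B \<in> E 0" "C \<in> E 2" "Y = A + B + C"
    using decomp[OF E_L[OF Y]] by auto
  note ca = E_carrier[OF ABC(1)] E_carrier[OF ABC(2)] E_carrier[OF ABC(3)]
  have ad: "lie_bracket h (x \<cdot>\<^sub>m A + y \<cdot>\<^sub>m B + z \<cdot>\<^sub>m C) = (- 2 * x) \<cdot>\<^sub>m A + (0 * y) \<cdot>\<^sub>m B + (2 * z) \<cdot>\<^sub>m C" for x y z
  proof -
    have s: "x \<cdot>\<^sub>m A \<in> carrier_mat n n" "y \<cdot>\<^sub>m B \<in> carrier_mat n n" "z \<cdot>\<^sub>m C \<in> carrier_mat n n"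
      "x \<cdot>\<^sub>m A + y \<cdot>\<^sub>m B \<in> carrier_mat n n" using ca by auto
    show ?thesis
      unfolding lie_bracket_add_right[OF s(4,3) hc] lie_bracket_add_right[OF s(1,2) hc]
        lie_bracket_smult_right[OF hc ca(1) hc] lie_bracket_smult_right[OF hc ca(2) hc]
        lie_bracket_smult_right[OF hc ca(3) hc] E_weight[OF ABC(1)] E_weight[OF ABC(2)] E_weight[OF ABC(3)]
      using ca by (intro eq_matI) auto
  qed
  have "Y = 1 \<cdot>\<^sub>m A + 1 \<cdot>\<^sub>m B + 1 \<cdot>\<^sub>m C" unfolding ABC(4) using ca by (intro eq_matI) auto
  then have "lie_bracket h (lie_bracket h (lie_bracket h Y)) = (- 8) \<cdot>\<^sub>m A + 0 \<cdot>\<^sub>m B + 8 \<cdot>\<^sub>m C"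
    "lie_bracket h Y = (- 2) \<cdot>\<^sub>m A + 0 \<cdot>\<^sub>m B + 2 \<cdot>\<^sub>m C"
    by (simp_all add: ad)
  moreover have "lie_bracket h (x \<cdot>\<^sub>m Y) = (x * c) \<cdot>\<^sub>m Y" for x
    unfolding lie_bracket_smult_right[OF hc E_carrier[OF Y] hc] E_weight[OF Y]
    using E_carrier[OF Y] by (intro eq_matI) auto
  then have "lie_bracket h (lie_bracket h (lie_bracket h Y)) = (c ^ 3) \<cdot>\<^sub>m Y"
    by (simp add: E_weight[OF Y] power3_eq_cube)
  ultimately have eq: "(c ^ 3) \<cdot>\<^sub>m Y = (- 8) \<cdot>\<^sub>m A + 0 \<cdot>\<^sub>m B + 8 \<cdot>\<^sub>m C"
    "c \<cdot>\<^sub>m Y = (- 2) \<cdot>\<^sub>m A + 0 \<cdot>\<^sub>m B + 2 \<cdot>\<^sub>m C"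
    by (simp_all add: E_weight[OF Y])
  show ?thesis
  proof (rule eq_matI)
    fix i j assume "i < dim_row (0\<^sub>m n n :: 'k mat)" "j < dim_col (0\<^sub>m n n :: 'k mat)"
    then have ij: "i < n" "j < n" by simp_all
    have "c ^ 3 * Y $$ (i, j) = - 8 * A $$ (i, j) + 8 * C $$ (i, j)"
      "c * Y $$ (i, j) = - 2 * A $$ (i, j) + 2 * C $$ (i, j)"
      using arg_cong[OF eq(1), of "\<lambda>M. M $$ (i, j)"] arg_cong[OF eq(2), of "\<lambda>M. M $$ (i, j)"]
        ij ca E_carrier[OF Y] by auto
    moreover have "(c ^ 3 - 4 * c) * Y $$ (i, j) = c ^ 3 * Y $$ (i, j) - 4 * (c * Y $$ (i, j))"
      by (simp add: left_diff_distrib mult.assoc)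
    ultimately have "(c ^ 3 - 4 * c) * Y $$ (i, j) = 0" by simp
    then show "Y $$ (i, j) = 0\<^sub>m n n $$ (i, j)" using c ij by simp
  qed (use E_carrier[OF Y] in auto)
qed

text \<open>These brackets have degree 4 or -4, which \<open>E_trivial\<close> excludes.\<close>

lemma E2_commute: "A \<in> E 2 \<Longrightarrow> B \<in> E 2 \<Longrightarrow> lie_bracket A B = 0\<^sub>m n n"
  and Em2_commute: "A \<in> E (- 2) \<Longrightarrow> B \<in> E (- 2) \<Longrightarrow> lie_bracket A B = 0\<^sub>m n n"
  using E_bracket[of A 2 B 2] E_bracket[of A "- 2" B "- 2"] by (simp_all add: E_trivial)

lemma weight_vector_E: "Y \<in> E c \<Longrightarrow> c \<noteq> 0 \<Longrightarrow> weight_vector n h Y c"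
  by (rule weight_vector.intro) (simp_all add: L_carrier[OF triple(2)] E_carrier E_weight)

lemma E_nilpotent: "Y \<in> E c \<Longrightarrow> c \<noteq> 0 \<Longrightarrow> Y ^\<^sub>m n = 0\<^sub>m n n"
  by (rule weight_vector.nilpotent[OF weight_vector_E])

lemma G_rational: "kkt_G T = rational_points n (kkt_group T)"
  by (simp add: kkt_G_def)

lemma exp_G: "Y \<in> E c \<Longrightarrow> c \<noteq> 0 \<Longrightarrow> mat_exp n Y \<in> kkt_G T"
  unfolding G_rational by (rule mat_exp_rational) (simp_all add: E_L[unfolded L_eq] E_nilpotent)

lemma log_entries:
  assumes "c \<noteq> 0"
  shows "\<exists>C. \<forall>Y\<in>E c. \<forall>p. entries n Y p = (\<Sum>q\<in>{..<n} \<times> {..<n}. C p q * entries n (mat_exp n Y) q)"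
proof -
  obtain C where "\<forall>Y\<in>carrier_mat n n. lie_bracket h Y = c \<cdot>\<^sub>m Y \<longrightarrow>
    (\<forall>p. entries n Y p = (\<Sum>q\<in>{..<n} \<times> {..<n}. C p q * entries n (mat_exp n Y) q))"
    using mat_log_entries[OF L_carrier[OF triple(2)] assms] ..
  then show ?thesis by (intro exI[of _ C]) (simp add: E_carrier E_weight)
qed

text \<open>By \<open>log_entries\<close> the exponential determines the entries of its
  argument.\<close>

lemma exp_inj: "c \<noteq> 0 \<Longrightarrow> inj_on (mat_exp n) (E c)"
proof (rule inj_onI)
  fix Y Z assume "c \<noteq> 0" and YZ: "Y \<in> E c" "Z \<in> E c" and eq: "mat_exp n Y = mat_exp n Z"
  obtain C where "\<forall>Y\<in>E c. \<forall>p. entries n Y p = (\<Sum>q\<in>{..<n} \<times> {..<n}. C p q * entries n (mat_exp n Y) q)"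
    using log_entries[OF \<open>c \<noteq> 0\<close>] ..
  note * = this[rule_format]
  have "entries n Y = entries n Z" by (rule ext) (simp only: *[OF YZ(1)] *[OF YZ(2)] eq)
  then show "Y = Z" by (rule entries_eqI[OF E_carrier[OF YZ(1)] E_carrier[OF YZ(2)]])
qed

abbreviation "log_of c \<equiv> inv_into (E c) (mat_exp n)"

lemma log_exp: "c \<noteq> 0 \<Longrightarrow> Y \<in> E c \<Longrightarrow> log_of c (mat_exp n Y) = Y"
  by (rule inv_into_f_f[OF exp_inj])

subsection \<open>The action of \<open>M\<close>\<close>

lemma M_G: "m \<in> kkt_M T \<Longrightarrow> m \<in> kkt_G T"
  by (simp add: kkt_M_def)

lemma G_car: "g \<in> kkt_G T \<Longrightarrow> g \<in> carrier_mat n n" and G_GLk: "g \<in> kkt_G T \<Longrightarrow> g \<in> carrier (GL n)"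
  by (simp_all add: G_rational rational_points_carrier)

lemma subgroup_G: "subgroup (kkt_G T) (GL n)"
  unfolding G_rational by (rule subgroup_rational_points)

lemma G_inv:
  assumes "g \<in> kkt_G T"
  shows "inv\<^bsub>GL n\<^esub> g \<in> kkt_G T" "inv\<^bsub>GL n\<^esub> g \<in> carrier_mat n n"
    "g * inv\<^bsub>GL n\<^esub> g = 1\<^sub>m n" "inv\<^bsub>GL n\<^esub> g * g = 1\<^sub>m n"
  using subgroup.m_inv_closed[OF subgroup_G assms] GL_inv[OF G_GLk[OF assms]] by simp_all

lemma G_times: "g \<in> kkt_G T \<Longrightarrow> g' \<in> kkt_G T \<Longrightarrow> g * g' \<in> kkt_G T"
  using subgroup.m_closed[OF subgroup_G] by (simp add: GL_mult)

lemma act_carrier: "g \<in> kkt_G T \<Longrightarrow> Y \<in> carrier_mat n n \<Longrightarrow> kkt_act T g Y \<in> carrier_mat n n"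
  unfolding kkt_act_def by (rule mult_carrier_mat[OF mult_carrier_mat[OF G_car] G_inv(2)])

lemma act_mult:
  assumes g: "g \<in> kkt_G T" and Y: "Y \<in> carrier_mat n n" and Z: "Z \<in> carrier_mat n n"
  shows "kkt_act T g (Y * Z) = kkt_act T g Y * kkt_act T g Z"
proof -
  let ?w = "inv\<^bsub>GL n\<^esub> g"
  note c = G_car[OF g] G_inv(2)[OF g] Y Z
  note a = assoc_mult_mat[where n\<^sub>1 = n and n\<^sub>2 = n and n\<^sub>3 = n and n\<^sub>4 = n]
  have "?w * (g * (Z * ?w)) = Z * ?w"
  proof -
    have "?w * (g * (Z * ?w)) = (?w * g) * (Z * ?w)" using c by (simp add: a)
    then show ?thesis using c G_inv(4)[OF g] by simp
  qed
  then show ?thesis unfolding kkt_act_def using c by (simp add: a)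
qed

lemma act_one: "g \<in> kkt_G T \<Longrightarrow> kkt_act T g (1\<^sub>m n) = 1\<^sub>m n"
  by (simp add: kkt_act_def G_car G_inv right_mult_one_mat[of _ n n])

lemma act_pow:
  assumes g: "g \<in> kkt_G T" and Y: "Y \<in> carrier_mat n n"
  shows "kkt_act T g (Y ^\<^sub>m l) = (kkt_act T g Y) ^\<^sub>m l"
proof (induction l)
  case 0
  have "dim_row (kkt_act T g Y) = n" using act_carrier[OF g Y] by simp
  then show ?case using Y by (simp add: act_one[OF g])
next
  case (Suc l)
  then show ?case by (simp add: act_mult[OF g pow_carrier_mat[OF Y] Y])
qed

lemma entries_act:
  assumes "g \<in> kkt_G T" "Y \<in> carrier_mat n n" "i < n" "j < n"
  shows "kkt_act T g Y $$ (i, j) = (\<Sum>b<n. \<Sum>a<n. g $$ (i, a) * Y $$ (a, b) * (inv\<^bsub>GL n\<^esub> g) $$ (b, j))"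
  unfolding kkt_act_def
  using assms G_car[OF assms(1)] G_inv(2)[OF assms(1)]
  by (simp add: scalar_prod_def atLeast0LessThan sum_distrib_left mult.assoc) (rule sum.swap)

lemma act_exp:
  assumes g: "g \<in> kkt_G T" and Y: "Y \<in> carrier_mat n n"
  shows "kkt_act T g (mat_exp n Y) = mat_exp n (kkt_act T g Y)"
proof (rule eq_matI)
  fix i j assume "i < dim_row (mat_exp n (kkt_act T g Y))" "j < dim_col (mat_exp n (kkt_act T g Y))"
  then have ij: "i < n" "j < n" by (simp_all add: mat_exp_def)
  have "kkt_act T g (mat_exp n Y) $$ (i, j) =
      (\<Sum>b<n. \<Sum>a<n. \<Sum>l<n. g $$ (i, a) * ((Y ^\<^sub>m l) $$ (a, b) / fact l) * (inv\<^bsub>GL n\<^esub> g) $$ (b, j))"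
    unfolding entries_act[OF g mat_exp_carrier ij]
    by (intro sum.cong refl) (simp add: mat_exp_def sum_distrib_left sum_distrib_right)
  also have "\<dots> = (\<Sum>b<n. \<Sum>l<n. \<Sum>a<n. g $$ (i, a) * ((Y ^\<^sub>m l) $$ (a, b) / fact l) * (inv\<^bsub>GL n\<^esub> g) $$ (b, j))"
    by (rule sum.cong[OF refl]) (rule sum.swap)
  also have "\<dots> = (\<Sum>l<n. \<Sum>b<n. \<Sum>a<n. g $$ (i, a) * ((Y ^\<^sub>m l) $$ (a, b) / fact l) * (inv\<^bsub>GL n\<^esub> g) $$ (b, j))"
    by (rule sum.swap)
  also have "\<dots> = (\<Sum>l<n. kkt_act T g (Y ^\<^sub>m l) $$ (i, j) / fact l)"
    by (intro sum.cong refl)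
      (simp add: entries_act[OF g pow_carrier_mat[OF Y] ij] sum_divide_distrib)
  also have "\<dots> = mat_exp n (kkt_act T g Y) $$ (i, j)"
    using ij by (simp add: act_pow[OF g Y] mat_exp_def)
  finally show "kkt_act T g (mat_exp n Y) $$ (i, j) = mat_exp n (kkt_act T g Y) $$ (i, j)" .
qed (use act_carrier[OF g mat_exp_carrier] in \<open>auto simp: mat_exp_def\<close>)

lemma act_E:
  assumes m: "m \<in> kkt_M T" and Y: "Y \<in> E c"
  shows "kkt_act T m Y \<in> E c"
proof (rule EI)
  note g = M_G[OF m] and Yc = E_carrier[OF Y] and hc = L_carrier[OF triple(2)]
  show "kkt_act T m Y \<in> L"
    unfolding kkt_act_def L_eq by (rule lie_conj) (use E_L[OF Y] g in \<open>simp_all add: L_eq G_rational\<close>)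
  have mh: "kkt_act T m h = h" using m by (simp add: kkt_M_def)
  have d: "kkt_act T m (A - B) = kkt_act T m A - kkt_act T m B"
    if "A \<in> carrier_mat n n" "B \<in> carrier_mat n n" for A B
    unfolding kkt_act_def mult_minus_distrib_mat[OF G_car[OF g] that]
    by (rule minus_mult_distrib_mat) (use that G_car[OF g] G_inv(2)[OF g] in auto)
  have "kkt_act T m (lie_bracket h Y) = lie_bracket h (kkt_act T m Y)"
    unfolding lie_bracket_def using hc Yc
    by (simp add: d act_mult[OF g] mh)
  moreover have "kkt_act T m (c \<cdot>\<^sub>m Y) = c \<cdot>\<^sub>m kkt_act T m Y"
    unfolding kkt_act_def mult_smult_distrib[OF G_car[OF g] Yc]
    by (rule mult_smult_assoc_mat) (use Yc G_car[OF g] G_inv(2)[OF g] in auto)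
  ultimately show "lie_bracket h (kkt_act T m Y) = c \<cdot>\<^sub>m kkt_act T m Y"
    using E_weight[OF Y] by simp
qed

lemma act_Nbar: "m \<in> kkt_M T \<Longrightarrow> y \<in> kkt_Nbar T \<Longrightarrow> kkt_act T m y \<in> kkt_Nbar T"
  by (auto simp: kkt_Nbar_def act_exp[OF M_G E_carrier] intro: act_E)

lemma Nbar_carrier: "y \<in> kkt_Nbar T \<Longrightarrow> y \<in> carrier_mat n n"
  by (auto simp: kkt_Nbar_def mat_exp_def)

lemma Nbar_log: "y \<in> kkt_Nbar T \<Longrightarrow> log_of (- 2) y \<in> E (- 2) \<and> mat_exp n (log_of (- 2) y) = y"
  by (auto simp: kkt_Nbar_def log_exp)

subsection \<open>The Killing form\<close>

interpretation LL: mat_space n L by (rule mat_space_L)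

abbreviation "K \<equiv> killing_form n L"

lemma lin_op_ad:
  assumes A: "A \<in> L"
  shows "LL.lin_op (lie_bracket A)"
  unfolding LL.lin_op_def
proof (intro conjI ballI allI)
  fix Y Z c assume Y: "Y \<in> L"
  show "lie_bracket A Y \<in> L" by (rule L_bracket[OF A Y])
  show "lie_bracket A (c \<cdot>\<^sub>m Y) = c \<cdot>\<^sub>m lie_bracket A Y"
    by (rule lie_bracket_smult_right[OF L_carrier[OF A] L_carrier[OF Y] L_carrier[OF Y]])
  assume Z: "Z \<in> L"
  show "lie_bracket A (Y + Z) = lie_bracket A Y + lie_bracket A Z"
    by (rule lie_bracket_add_right[OF L_carrier[OF Y] L_carrier[OF Z] L_carrier[OF A]])
qed

lemma killing_sym: "A \<in> L \<Longrightarrow> B \<in> L \<Longrightarrow> K A B = K B A"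
  unfolding killing_form_def by (rule LL.trace_on_comm[OF lin_op_ad lin_op_ad])

lemmas lin_op_ad2 = LL.lin_op_comp[OF lin_op_ad lin_op_ad]
lemmas lin_op_ad3 = LL.lin_op_comp[OF lin_op_ad lin_op_ad2]

lemma killing_add_right:
  assumes "A \<in> L" "B \<in> L" "C \<in> L"
  shows "K A (B + C) = K A B + K A C"
proof -
  have "K A (B + C) = trace_on n L (\<lambda>Y. lie_bracket A (lie_bracket B Y) + lie_bracket A (lie_bracket C Y))"
    unfolding killing_form_def
  proof (rule LL.trace_on_cong)
    show "LL.lin_op (\<lambda>Y. lie_bracket A (lie_bracket (B + C) Y))"
      by (intro lin_op_ad2 L_add assms)
    show "LL.lin_op (\<lambda>Y. lie_bracket A (lie_bracket B Y) + lie_bracket A (lie_bracket C Y))"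
      by (intro LL.lin_op_add lin_op_ad2 assms)
    fix Y assume Y: "Y \<in> L"
    show "lie_bracket A (lie_bracket (B + C) Y) = lie_bracket A (lie_bracket B Y) + lie_bracket A (lie_bracket C Y)"
      unfolding lie_bracket_add_left[OF L_carrier[OF assms(2)] L_carrier[OF assms(3)] L_carrier[OF Y]]
      by (rule lie_bracket_add_right) (auto intro: L_carrier L_bracket assms Y)
  qed
  also have "\<dots> = K A B + K A C"
    unfolding killing_form_def by (rule LL.trace_on_add[OF lin_op_ad2[OF assms(1,2)] lin_op_ad2[OF assms(1,3)]])
  finally show ?thesis .
qed

lemma killing_smult_right:
  assumes "A \<in> L" "B \<in> L"
  shows "K A (c \<cdot>\<^sub>m B) = c * K A B"
proof -
  have "K A (c \<cdot>\<^sub>m B) = trace_on n L (\<lambda>Y. c \<cdot>\<^sub>m lie_bracket A (lie_bracket B Y))"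
    unfolding killing_form_def
  proof (rule LL.trace_on_cong)
    show "LL.lin_op (\<lambda>Y. lie_bracket A (lie_bracket (c \<cdot>\<^sub>m B) Y))"
      by (intro lin_op_ad2 L_smult assms)
    show "LL.lin_op (\<lambda>Y. c \<cdot>\<^sub>m lie_bracket A (lie_bracket B Y))"
      by (intro LL.lin_op_smult lin_op_ad2 assms)
    fix Y assume Y: "Y \<in> L"
    show "lie_bracket A (lie_bracket (c \<cdot>\<^sub>m B) Y) = c \<cdot>\<^sub>m lie_bracket A (lie_bracket B Y)"
      unfolding lie_bracket_smult_left[OF L_carrier[OF assms(2)] L_carrier[OF Y] L_carrier[OF Y]]
      by (rule lie_bracket_smult_right) (auto intro: L_carrier L_bracket assms Y)
  qed
  also have "\<dots> = c * K A B"
    unfolding killing_form_def by (rule LL.trace_on_smult[OF lin_op_ad2[OF assms]])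
  finally show ?thesis .
qed

text \<open>With letters standing for \<open>ad\<close> operators, the left side is
  \<open>tr(A B C) - tr(B A C)\<close> and the right side \<open>tr(A B C) - tr(A C B)\<close>;
  cyclicity of the trace identifies them.\<close>

lemma killing_invariant:
  assumes A: "A \<in> L" and B: "B \<in> L" and C: "C \<in> L"
  shows "K (lie_bracket A B) C = K A (lie_bracket B C)"
proof -
  let ?br = "\<lambda>P Q R Y. lie_bracket P (lie_bracket Q (lie_bracket R Y))"
  let ?t = "\<lambda>P Q R. trace_on n L (?br P Q R)"
  note lop = lin_op_ad3
  have j: "lie_bracket (lie_bracket P Q) Y = lie_bracket P (lie_bracket Q Y) + (- 1) \<cdot>\<^sub>m lie_bracket Q (lie_bracket P Y)"
    if "P \<in> L" "Q \<in> L" "Y \<in> L" for P Q Y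
    using lie_jacobi[OF L_carrier[OF that(1)] L_carrier[OF that(2)] L_carrier[OF that(3)]]
      L_carrier[OF L_bracket[OF L_bracket[OF that(1,2)] that(3)]]
      L_carrier[OF L_bracket[OF that(2) L_bracket[OF that(1,3)]]]
    by (intro eq_matI) auto
  have 1: "K (lie_bracket A B) C = ?t A B C + (- 1) * ?t B A C"
  proof -
    have "K (lie_bracket A B) C = trace_on n L (\<lambda>Y. ?br A B C Y + (- 1) \<cdot>\<^sub>m ?br B A C Y)"
      unfolding killing_form_def
      by (rule LL.trace_on_cong[OF lin_op_ad2[OF L_bracket[OF A B] C]
            LL.lin_op_add[OF lop[OF A B C] LL.lin_op_smult[OF lop[OF B A C]]] j[OF A B L_bracket[OF C]]])
    then show ?thesis
      unfolding LL.trace_on_add[OF lop[OF A B C] LL.lin_op_smult[OF lop[OF B A C]]]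
        LL.trace_on_smult[OF lop[OF B A C]] .
  qed
  have 2: "K A (lie_bracket B C) = ?t A B C + (- 1) * ?t A C B"
  proof -
    have "K A (lie_bracket B C) = trace_on n L (\<lambda>Y. ?br A B C Y + (- 1) \<cdot>\<^sub>m ?br A C B Y)"
      unfolding killing_form_def
    proof (rule LL.trace_on_cong)
      show "LL.lin_op (\<lambda>Y. lie_bracket A (lie_bracket (lie_bracket B C) Y))"
        by (rule lin_op_ad2[OF A L_bracket[OF B C]])
      show "LL.lin_op (\<lambda>Y. ?br A B C Y + (- 1) \<cdot>\<^sub>m ?br A C B Y)"
        by (rule LL.lin_op_add[OF lop[OF A B C] LL.lin_op_smult[OF lop[OF A C B]]])
      fix Y assume Y: "Y \<in> L"
      have l: "lie_bracket B (lie_bracket C Y) \<in> L" "lie_bracket C (lie_bracket B Y) \<in> L"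
        by (intro L_bracket B C Y)+
      show "lie_bracket A (lie_bracket (lie_bracket B C) Y) = ?br A B C Y + (- 1) \<cdot>\<^sub>m ?br A C B Y"
        unfolding j[OF B C Y]
        using lie_bracket_add_right[OF L_carrier[OF l(1)] L_carrier[OF L_smult[OF l(2)]] L_carrier[OF A], of "- 1"]
          lie_bracket_smult_right[OF L_carrier[OF A] L_carrier[OF l(2)] L_carrier[OF A], of "- 1"]
        by (simp only:)
    qed
    then show ?thesis
      unfolding LL.trace_on_add[OF lop[OF A B C] LL.lin_op_smult[OF lop[OF A C B]]]
        LL.trace_on_smult[OF lop[OF A C B]] .
  qed
  have "?t B A C = ?t A C B"
    by (rule LL.trace_on_comm[OF lin_op_ad[OF B] lin_op_ad2[OF A C]])
  then show ?thesis using 1 2 by simp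
qed

end

subsection \<open>Ideals of the Jordan algebras\<close>

definition jideal :: "('k, 'j) jordan_algebra \<Rightarrow> 'j set \<Rightarrow> bool" where
  "jideal J I \<longleftrightarrow> I \<subseteq> jcarrier J \<and> (\<forall>a\<in>I. \<forall>b\<in>I. jadd J a b \<in> I) \<and>
     (\<forall>c. \<forall>a\<in>I. jscale J c a \<in> I) \<and> (\<forall>b\<in>jcarrier J. \<forall>a\<in>I. jprod J b a \<in> I)"

lemma jidealD:
  assumes "jideal J I"
  shows "a \<in> I \<Longrightarrow> a \<in> jcarrier J" "a \<in> I \<Longrightarrow> b \<in> I \<Longrightarrow> jadd J a b \<in> I"
    "a \<in> I \<Longrightarrow> jscale J c a \<in> I" "b \<in> jcarrier J \<Longrightarrow> a \<in> I \<Longrightarrow> jprod J b a \<in> I"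
  using assms unfolding jideal_def by (auto dest: subsetD)

text \<open>A form of simplicity adapted to the normalisation of \<open>\<kappa>\<close> at the
  frame. The record has no field for zero, so \<open>jscale J 0 a\<close> stands for it.\<close>

definition frame_simple :: "('k::field, 'j) jordan_algebra \<Rightarrow> bool" where
  "frame_simple J \<longleftrightarrow> (\<forall>I. jideal J I \<longrightarrow> I \<inter> jframe J = {} \<longrightarrow> (\<forall>a\<in>I. a = jscale J 0 a))"

definition jordan_closed :: "('k, 'j) jordan_algebra \<Rightarrow> bool" where
  "jordan_closed J \<longleftrightarrow> (\<forall>a\<in>jcarrier J. \<forall>b\<in>jcarrier J. jadd J a b \<in> jcarrier J \<and> jprod J a b \<in> jcarrier J) \<and>
     (\<forall>c. \<forall>a\<in>jcarrier J. jscale J c a \<in> jcarrier J)"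

lemma jordan_closed_quadratic: "jordan_closed (quadratic_jordan sc Q)"
  by (simp add: jordan_closed_def quadratic_jordan_def)

context quadratic_space begin

lemma polar_sym: "polar Q u w = polar Q w u"
  by (simp add: polar_def add.commute)

lemma polar_add_right: "polar Q w (u + u') = polar Q w u + polar Q w u'"
  using polar_add[of u u' w] by (simp add: polar_sym)

lemma polar_scale_right: "polar Q w (sc c u) = c * polar Q w u"
  using polar_scale[of c u w] by (simp add: polar_sym)

lemma polar_zero: "polar Q 0 w = 0" "polar Q w 0 = 0"
  using polar_scale[of 0 0 w] by (simp_all add: polar_sym[of w])

lemma polar_diff: "polar Q (u - u') w = polar Q u w - polar Q u' w"
  using polar_add[of "u - u'" u' w] by simp

lemma polar_diff_right: "polar Q w (u - u') = polar Q w u - polar Q w u'"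
  using polar_diff[of u u' w] by (simp add: polar_sym[of w])

lemma polar_self: "polar Q u u = 2 * Q u"
proof -
  have "u + u = sc 2 u" using scale_left_distrib[of 1 1 u] by simp
  then show ?thesis by (simp add: polar_def quad_scale power2_eq_square)
qed

text \<open>Peirce decomposition: for a frame element \<open>e\<close>, the combination
  \<open>2 e(e a) - e a\<close> keeps only the coordinate of \<open>a\<close> at \<open>e\<close>,
  which must be 0. After that, multiplication by a vector \<open>w'\<close> moves
  \<open>polar Q w' w / 2\<close> to the first two coordinates, so it vanishes as well.\<close>

lemma frame_simple_quadratic: "frame_simple (quadratic_jordan sc Q)"
  unfolding frame_simple_def
proof (intro allI impI ballI)
  fix I a assume I: "jideal (quadratic_jordan sc Q) I"
    and fr: "I \<inter> jframe (quadratic_jordan sc Q) = {}" and a: "a \<in> I"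
  let ?J = "quadratic_jordan sc Q"
  have add: "(x + x', y + y', w + w') \<in> I" if "(x, y, w) \<in> I" "(x', y', w') \<in> I" for x y w x' y' w'
    using jidealD(2)[OF I that] by (simp add: quadratic_jordan_def)
  have scale: "(c * x, c * y, sc c w) \<in> I" if "(x, y, w) \<in> I" for c x y w
    using jidealD(3)[OF I that, of c] by (simp add: quadratic_jordan_def)
  have prod: "jprod ?J b c \<in> I" if "c \<in> I" for b c
    using jidealD(4)[OF I _ that, of b] by (simp add: quadratic_jordan_def)
  have e: "(1, 0, 0) \<notin> I" "(0, 1, 0) \<notin> I" using fr by (auto simp: quadratic_jordan_def)
  have no1: "x = 0" if "(x, 0, 0) \<in> I" for x
    using scale[OF that, of "inverse x"] e by (cases "x = 0") auto
  have no2: "x = 0" if "(0, x, 0) \<in> I" for x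
    using scale[OF that, of "inverse x"] e by (cases "x = 0") auto
  have p1: "(x, 0, sc (1/2) w) \<in> I" and p2: "(0, y, sc (1/2) w) \<in> I" if "(x, y, w) \<in> I" for x y w
    using prod[OF that, of "(1, 0, 0)"] prod[OF that, of "(0, 1, 0)"]
    by (simp_all add: quadratic_jordan_def polar_zero)
  have half: "sc 2 (sc (1/2) (sc (1/2) w)) + sc (- 1) (sc (1/2) w) = 0" for w
    by (simp add: scale_left_distrib[symmetric])
  obtain x y w where axyw: "a = (x, y, w)" by (cases a)
  have xyw: "(x, y, w) \<in> I" using a axyw by simp
  have "(x, 0, 0) \<in> I"
    using add[OF scale[OF p1[OF p1[OF xyw]], of 2] scale[OF p1[OF xyw], of "- 1"]] half by simp
  then have x: "x = 0" by (rule no1)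
  have "(0, y, 0) \<in> I"
    using add[OF scale[OF p2[OF p2[OF xyw]], of 2] scale[OF p2[OF xyw], of "- 1"]] half by simp
  then have y: "y = 0" by (rule no2)
  have "polar Q w w' = 0" for w'
  proof -
    have "(polar Q w' w / 2, polar Q w' w / 2, 0) \<in> I"
      using prod[OF xyw, of "(0, 0, w')"] x y by (simp add: quadratic_jordan_def)
    from p1[OF this] have "(polar Q w' w / 2, 0, 0) \<in> I" by simp
    then show ?thesis using no1 polar_sym by fastforce
  qed
  then have "w = 0" by (rule nondegenerate)
  then show "a = jscale ?J 0 a" using x y axyw by (simp add: quadratic_jordan_def)
qed

end

context composition_algebra begin

abbreviation "bar \<equiv> canonical_involution sc N unit"

lemma prd_zero: "prd 0 u = 0" "prd u 0 = 0"
  using mult_scale_left[of 0 0 u] mult_scale_right[of u 0 0] by simp_all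

lemma polar_mult_right: "polar N (prd u v) (prd w v) = polar N u w * N v"
  unfolding polar_def by (simp add: norm_mult mult_add_left[symmetric] left_diff_distrib)

text \<open>The full linearisation of \<open>N(u w) = N(u) N(w)\<close>, the source of the trace and
  conjugation identities below.\<close>

lemma polar_mult: "polar N (prd a b) (prd c d) + polar N (prd a d) (prd c b) = polar N a c * polar N b d"
proof -
  have "polar N (prd a (b + d)) (prd c (b + d)) = polar N a c * N (b + d)"
    by (rule polar_mult_right)
  moreover have "N (b + d) = polar N b d + N b + N d" by (simp add: polar_def)
  ultimately show ?thesis
    by (simp add: mult_add_right polar_add polar_add_right polar_mult_right algebra_simps)
qed

text \<open>The linearised quadratic equation \<open>u u - t(u) u + N(u) 1 = 0\<close> with
  \<open>t(u) = polar N u unit\<close>. It is verified by pairing with every \<open>z\<close>, where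
  three instances of \<open>polar_mult\<close> suffice.\<close>

lemma mult_sym: "prd u w + prd w u = sc (polar N u unit) w + sc (polar N w unit) u - sc (polar N u w) unit"
proof -
  have "polar N (prd u w + prd w u - (sc (polar N u unit) w + sc (polar N w unit) u - sc (polar N u w) unit)) z = 0" for z
  proof -
    note 1 = polar_mult[of u w unit z, unfolded unit_left unit_right polar_sym[of "prd u z" w]]
    note 2 = polar_mult[of w u unit z, unfolded unit_left unit_right polar_sym[of "prd w z" u]]
    note 3 = polar_mult[of u z w unit, unfolded unit_left unit_right polar_sym[of "prd u z" w] polar_sym[of z unit]]
    show ?thesis
      unfolding polar_diff polar_add polar_scale 1[symmetric] 2[symmetric] 3[symmetric]
      by (simp add: algebra_simps)
  qed
  from nondegenerate[OF this] show ?thesis by simp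
qed

text \<open>The linearised identity \<open>u (bar u) = N(u) 1\<close>, for both orders of the
  factors.\<close>

lemma conj_sum:
  "prd w (bar u) + prd u (bar w) = sc (polar N u w) unit"
  "prd (bar w) u + prd (bar u) w = sc (polar N u w) unit"
proof -
  have d: "prd x (y - z) = prd x y - prd x z" "prd (y - z) x = prd y x - prd z x" for x y z
    using mult_add_right[of x "y - z" z] mult_add_left[of "y - z" z x] by simp_all
  have "prd w (bar u) + prd u (bar w) =
      sc (polar N u unit) w + sc (polar N w unit) u - (prd u w + prd w u)"
    by (simp add: canonical_involution_def d mult_scale_right unit_right)
  then show "prd w (bar u) + prd u (bar w) = sc (polar N u w) unit" by (simp add: mult_sym)
  have "prd (bar w) u + prd (bar u) w =
      sc (polar N u unit) w + sc (polar N w unit) u - (prd u w + prd w u)"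
    by (simp add: canonical_involution_def d mult_scale_left unit_left)
  then show "prd (bar w) u + prd (bar u) w = sc (polar N u w) unit" by (simp add: mult_sym)
qed

text \<open>\<open>N unit\<close> is an idempotent of k. If it is 0, then \<open>N\<close> vanishes
  and nondegeneracy forces the zero algebra, which the axioms of the locale admit.\<close>

lemma trivial_or_norm_unit: "(\<forall>u :: 'd. u = 0) \<or> N unit = 1"
proof (cases "N unit = 0")
  case True
  have "N u = 0" for u using norm_mult[of unit u] True by (simp add: unit_left)
  then have "polar N u w = 0" for u w by (simp add: polar_def)
  then show ?thesis using nondegenerate by blast
next
  case False
  then show ?thesis using norm_mult[of unit unit] by (simp add: unit_left)
qed

lemma conj_conj: "bar (bar w) = w"
  using trivial_or_norm_unit
proof
  assume "N unit = 1"
  then have "polar N unit unit = 2" by (simp add: polar_self)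
  then have "polar N (sc (polar N w unit) unit - w) unit = polar N w unit"
    by (simp add: polar_diff polar_scale)
  then show ?thesis by (simp add: canonical_involution_def)
next
  assume z: "\<forall>u :: 'd. u = 0"
  show ?thesis by (rule trans[OF z[rule_format] z[rule_format, symmetric]])
qed

text \<open>This is \<open>polar_mult\<close> with \<open>c = unit\<close>, rewritten with
  \<open>bar a = t(a) 1 - a\<close>.\<close>

lemma polar_adjoint_left: "polar N (prd a b) d = polar N b (prd (bar a) d)"
proof -
  have eq: "prd (bar a) d = sc (polar N a unit) d - prd a d"
    using mult_add_left[of "bar a" a d] by (simp add: canonical_involution_def mult_scale_left unit_left)
  have "polar N b (prd (bar a) d) = polar N a unit * polar N b d - polar N (prd a d) b"
    unfolding eq polar_diff_right polar_scale_right polar_sym[of b "prd a d"] ..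
  with eq_diff_eq[THEN iffD2, OF polar_mult[of a b unit d, unfolded unit_left]]
  show ?thesis by (simp only:)
qed

lemma polar_adjoint_right: "polar N (prd a b) d = polar N a (prd d (bar b))"
proof -
  have eq: "prd d (bar b) = sc (polar N b unit) d - prd d b"
    using mult_add_right[of d "bar b" b] by (simp add: canonical_involution_def mult_scale_right unit_right)
  have "polar N a (prd d (bar b)) = polar N a d * polar N b unit - polar N a (prd d b)"
    unfolding eq polar_diff_right polar_scale_right by (simp only: mult.commute)
  with eq_diff_eq[THEN iffD2, OF polar_mult[of a b d unit, unfolded unit_right]]
  show ?thesis by (simp only:)
qed

lemma polar_bar: "polar N (bar u) z = polar N u (bar z)"
  unfolding canonical_involution_def polar_diff polar_diff_right polar_scale polar_scale_right
    polar_sym[of unit z]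
  by (simp only: mult.commute)

text \<open>Paired with \<open>z\<close>, both sides reduce by the adjoint rules to the pairing of
  \<open>w\<close> with \<open>(bar u) (bar z)\<close>.\<close>

lemma bar_mult: "bar (prd u w) = prd (bar w) (bar u)"
proof -
  have "polar N (bar (prd u w) - prd (bar w) (bar u)) z = 0" for z
  proof -
    have "polar N (bar (prd u w)) z = polar N w (prd (bar u) (bar z))"
      by (simp only: polar_bar polar_adjoint_left)
    moreover have "polar N (prd (bar w) (bar u)) z = polar N (bar u) (prd w (bar (bar z)))"
      by (simp only: polar_adjoint_left[of "bar w"] conj_conj)
    then have "polar N (prd (bar w) (bar u)) z = polar N (prd (bar u) (bar z)) w"
      by (simp only: polar_adjoint_right[of "bar u" "bar z"])
    ultimately show ?thesis unfolding polar_diff by (simp only: polar_sym[of w] diff_self)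
  qed
  from nondegenerate[OF this] show ?thesis by simp
qed

lemma bar_add: "bar (u + w) = bar u + bar w"
  by (simp add: canonical_involution_def polar_add scale_left_distrib)

lemma bar_scale: "bar (sc c u) = sc c (bar u)"
  by (simp add: canonical_involution_def polar_scale scale_right_diff_distrib)

lemma bar_zero: "bar 0 = 0"
  by (simp add: canonical_involution_def polar_zero)

lemma bar_sum: "bar (sum g A) = (\<Sum>i\<in>A. bar (g i))"
proof (induction A rule: infinite_finite_induct)
  case (insert x F)
  then show ?case by (simp only: sum.insert[OF insert.hyps] bar_add)
qed (simp_all only: sum.infinite sum.empty bar_zero simp_thms)

lemma jordan_closed_hermitian: "jordan_closed (hermitian_jordan r sc N prd unit)"
proof -
  define H where "H A \<longleftrightarrow> A \<in> carrier_mat r r \<and> (\<forall>i<r. \<forall>j<r. A $$ (i, j) = bar (A $$ (j, i)))" for A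
  have HD: "A \<in> carrier_mat r r" "i < r \<Longrightarrow> j < r \<Longrightarrow> bar (A $$ (j, i)) = A $$ (i, j)" if "H A" for A i j
  proof -
    from that have h: "A \<in> carrier_mat r r" "\<forall>i<r. \<forall>j<r. A $$ (i, j) = bar (A $$ (j, i))"
      unfolding H_def by (rule conjunct1, rule conjunct2)
    show "A \<in> carrier_mat r r" by (rule h(1))
    show "i < r \<Longrightarrow> j < r \<Longrightarrow> bar (A $$ (j, i)) = A $$ (i, j)" by (rule h(2)[rule_format, symmetric])
  qed
  have "H (A + B)" if "H A" "H B" for A B
    unfolding H_def using HD[OF that(1)] HD[OF that(2)] by (auto simp: bar_add)
  moreover have "H (map_mat (sc c) A)" if "H A" for A c
    unfolding H_def using HD[OF that] by (auto simp: bar_scale)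
  moreover have "H (map_mat (sc (1/2)) (dmat_mult r prd A B + dmat_mult r prd B A))" if "H A" "H B" for A B
  proof -
    have s: "bar (\<Sum>l<r. prd (C $$ (j, l)) (D $$ (l, i))) = (\<Sum>l<r. prd (D $$ (i, l)) (C $$ (l, j)))"
      if "H C" "H D" "i < r" "j < r" for C D i j
      unfolding bar_sum by (intro sum.cong refl) (use that in \<open>simp add: bar_mult HD\<close>)
    show ?thesis unfolding H_def dmat_mult_def
      by (auto simp: bar_scale bar_add s[OF that] s[OF that(2,1)] add.commute)
  qed
  ultimately show ?thesis
    unfolding jordan_closed_def by (simp add: hermitian_jordan_def flip: H_def)
qed

text \<open>Only products of two entries occur, so a nonassociative \<open>D\<close> is covered.
  Diagonal entries vanish because a nonzero one would yield some \<open>e i\<close>; off-diagonal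
  entries are then moved to the diagonal by a product.\<close>

lemma frame_simple_hermitian: "frame_simple (hermitian_jordan r sc N prd unit)"
  unfolding frame_simple_def
proof (intro allI impI ballI)
  let ?J = "hermitian_jordan r sc N prd unit"
  fix I a assume I: "jideal ?J I" and fr: "I \<inter> jframe ?J = {}" and a: "a \<in> I"
  define H where "H A \<longleftrightarrow> A \<in> carrier_mat r r \<and> (\<forall>i<r. \<forall>j<r. A $$ (i, j) = bar (A $$ (j, i)))" for A
  define P where "P b c = map_mat (sc (1/2)) (dmat_mult r prd b c + dmat_mult r prd c b)" for b c
  define e where "e i = Matrix.mat r r (\<lambda>(a, b). if a = i \<and> b = i then unit else 0)" for i
  have HJ: "jcarrier ?J = {A. H A}" by (simp only: hermitian_jordan_def H_def jordan_algebra.select_convs)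
  have HI: "H b" if "b \<in> I" for b
    using jidealD(1)[OF I that] by (simp add: HJ)
  have add: "b + c \<in> I" if "b \<in> I" "c \<in> I" for b c
    using jidealD(2)[OF I that] by (simp add: hermitian_jordan_def)
  have scale: "map_mat (sc t) b \<in> I" if "b \<in> I" for b t
    using jidealD(3)[OF I that, of t] by (simp add: hermitian_jordan_def)
  have prod: "P b c \<in> I" if "H b" "c \<in> I" for b c
    using jidealD(4)[OF I _ that(2), of b] that(1) by (simp only: HJ mem_Collect_eq) (simp add: hermitian_jordan_def P_def)
  have eI: "e i \<notin> I" if "i < r" for i
    using fr that by (auto simp: hermitian_jordan_def e_def)
  have c0: "bar 0 = 0" by (simp add: canonical_involution_def polar_zero)
  show "a = jscale ?J 0 a"
  proof (cases "\<forall>u :: 'd. u = 0")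
    case True
    have "a = map_mat (sc 0) a"
    proof (rule eq_matI)
      fix i j assume "i < dim_row (map_mat (sc 0) a)" "j < dim_col (map_mat (sc 0) a)"
      show "a $$ (i, j) = map_mat (sc 0) a $$ (i, j)"
        by (rule trans[OF True[rule_format] True[rule_format, symmetric]])
    qed auto
    then show ?thesis by (simp add: hermitian_jordan_def)
  next
    case False
    then have N1: "N unit = 1" using trivial_or_norm_unit by blast
    then have c1: "bar unit = unit"
      using scale_left_distrib[of 1 1 unit] by (simp add: canonical_involution_def polar_self)
    have He: "H (e i)" for i by (auto simp: H_def e_def c0 c1)
    have car: "b \<in> carrier_mat r r" if "b \<in> I" for b
      using HI[OF that] unfolding H_def by (rule conjunct1)
    have Pent: "P b c $$ (p, q) = sc (1/2) ((\<Sum>l<r. prd (b $$ (p, l)) (c $$ (l, q))) + (\<Sum>l<r. prd (c $$ (p, l)) (b $$ (l, q))))"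
      if "p < r" "q < r" for b c p q
      using that by (simp add: P_def dmat_mult_def)
    have Pcar: "P b c \<in> carrier_mat r r" for b c by (simp add: P_def dmat_mult_def)
    have eP: "P (e i) c $$ (p, q) = sc (1/2) ((if p = i then c $$ (i, q) else 0) + (if q = i then c $$ (p, i) else 0))"
      if "i < r" "p < r" "q < r" for i c p q
    proof -
      have "(\<Sum>l<r. prd (e i $$ (p, l)) (c $$ (l, q))) = (\<Sum>l<r. if l = i then (if p = i then c $$ (i, q) else 0) else 0)"
        using that by (intro sum.cong refl) (auto simp: e_def prd_zero unit_left)
      moreover have "(\<Sum>l<r. prd (c $$ (p, l)) (e i $$ (l, q))) = (\<Sum>l<r. if l = i then (if q = i then c $$ (p, i) else 0) else 0)"
        using that by (intro sum.cong refl) (auto simp: e_def prd_zero unit_right)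
      ultimately show ?thesis using that by (simp add: Pent)
    qed
    have diag: "d $$ (i, i) = 0" if d: "d \<in> I" and i: "i < r" for d i
    proof -
      let ?u = "d $$ (i, i)"
      \<comment> \<open>The Peirce projection \<open>2 e(e d) - e d\<close> leaves just the entry at
        (i, i).\<close>
      let ?m = "map_mat (sc 2) (P (e i) (P (e i) d)) + map_mat (sc (- 1)) (P (e i) d)"
      have m: "?m \<in> I" by (intro add scale prod He d)
      have mi: "?m = Matrix.mat r r (\<lambda>(a, b). if a = i \<and> b = i then ?u else 0)"
      proof (rule eq_matI)
        have half: "sc 2 (sc (1/2) (sc (1/2) u)) = sc (1/2) u" "sc (1/2) u + sc (1/2) u = u" for u
          by (simp_all add: scale_left_distrib[symmetric])
        have half3: "u + (- sc (1/2) u - sc (1/2) u) = 0" for u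
        proof -
          have "- sc (1/2) u - sc (1/2) u = - (sc (1/2) u + sc (1/2) u)"
            by (simp only: minus_add_distrib diff_conv_add_uminus)
          then show ?thesis by (simp only: half(2) right_minus)
        qed
        fix p q assume "p < dim_row (Matrix.mat r r (\<lambda>(a, b). if a = i \<and> b = i then ?u else 0))"
          "q < dim_col (Matrix.mat r r (\<lambda>(a, b). if a = i \<and> b = i then ?u else 0))"
        then show "?m $$ (p, q) = Matrix.mat r r (\<lambda>(a, b). if a = i \<and> b = i then ?u else 0) $$ (p, q)"
          using i Pcar[THEN carrier_matD(1)] Pcar[THEN carrier_matD(2)]
          by (auto simp: eP scale_right_distrib half half3)
      qed (use Pcar[THEN carrier_matD(1)] Pcar[THEN carrier_matD(2)] in auto)
      \<comment> \<open>A self-conjugate element is half its trace times \<open>unit\<close>, hence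
        a scalar.\<close>
      have "?u = bar ?u" using HI[OF d] i unfolding H_def by blast
      then have "?u = sc (polar N ?u unit) unit - ?u" unfolding canonical_involution_def .
      then have "?u + ?u = sc (polar N ?u unit) unit" by (simp only: eq_diff_eq)
      then have "sc (1/2) (?u + ?u) = sc (1/2) (sc (polar N ?u unit) unit)" by simp
      moreover have "sc (1/2) (?u + ?u) = ?u"
        by (simp add: scale_right_distrib scale_left_distrib[symmetric])
      ultimately obtain t where t: "?u = sc t unit" by auto
      have "t = 0"
      proof (rule ccontr)
        assume "t \<noteq> 0"
        then have "map_mat (sc (inverse t)) ?m = e i"
          unfolding mi by (intro eq_matI) (auto simp: e_def t)
        then show False using scale[OF m, of "inverse t"] eI[OF i] by simp
      qed
      then show ?thesis using t by simp
    qed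
    have off: "a $$ (i, j) = 0" if ij: "i < r" "j < r" "i \<noteq> j" for i j
    proof (rule nondegenerate)
      fix w
      let ?u = "a $$ (i, j)" and ?v = "a $$ (j, i)"
      have v: "?v = bar ?u" using HI[OF a] ij unfolding H_def by blast
      \<comment> \<open>Applying \<open>e j\<close> and then \<open>e i\<close> keeps exactly the
        entries at (i, j) and (j, i), each divided by 4.\<close>
      define B where "B = map_mat (sc 4) (P (e i) (P (e j) a))"
      have B: "B \<in> I" unfolding B_def by (intro scale prod He a)
      have Bent: "B $$ (p, q) = (if p = i \<and> q = j then ?u else if p = j \<and> q = i then ?v else 0)"
        if "p < r" "q < r" for p q
        using that ij Pcar[THEN carrier_matD(1)] Pcar[THEN carrier_matD(2)]
        by (auto simp: B_def eP scale_right_distrib)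
      \<comment> \<open>The product of this hermitian matrix with \<open>B\<close> has
        \<open>polar N ?u w / 2\<close> times \<open>unit\<close> at (i, i), and diagonal entries in
        the ideal are already known to be 0.\<close>
      define C where "C = Matrix.mat r r (\<lambda>(p, q). if p = i \<and> q = j then w else if p = j \<and> q = i then bar w else 0)"
      have HC: "H C" using ij by (auto simp: H_def C_def c0 conj_conj)
      have PI: "P C B \<in> I" by (rule prod[OF HC B])
      let ?b = "polar N ?u w"
      have 1: "(\<Sum>l<r. prd (C $$ (i, l)) (B $$ (l, i))) = prd w ?v"
      proof -
        have "(\<Sum>l<r. prd (C $$ (i, l)) (B $$ (l, i))) = (\<Sum>l<r. if l = j then prd w ?v else 0)"
          using ij by (intro sum.cong refl) (auto simp: C_def Bent prd_zero)
        then show ?thesis using ij by simp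
      qed
      have 2: "(\<Sum>l<r. prd (B $$ (i, l)) (C $$ (l, i))) = prd ?u (bar w)"
      proof -
        have "(\<Sum>l<r. prd (B $$ (i, l)) (C $$ (l, i))) = (\<Sum>l<r. if l = j then prd ?u (bar w) else 0)"
          using ij by (intro sum.cong refl) (auto simp: C_def Bent prd_zero)
        then show ?thesis using ij by simp
      qed
      have "P C B $$ (i, i) = sc (1/2) (sc ?b unit)"
        using ij by (simp add: Pent 1 2 v conj_sum(1))
      then have "sc (?b / 2) unit = 0" using diag[OF PI ij(1)] by simp
      moreover have "unit \<noteq> 0" using N1 quad_scale[of 0 0] by auto
      ultimately show "?b = 0" by simp
    qed
    have "a = map_mat (sc 0) a"
    proof (rule eq_matI)
      fix i j assume "i < dim_row (map_mat (sc 0) a)" "j < dim_col (map_mat (sc 0) a)"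
      then show "a $$ (i, j) = map_mat (sc 0) a $$ (i, j)"
        using off[of i j] diag[OF a, of i] car[OF a] by (cases "i = j") auto
    qed auto
    then show ?thesis by (simp add: hermitian_jordan_def)
  qed
qed

end

subsection \<open>Nondegeneracy of the pairing\<close>

context kkt begin

text \<open>Simplicity removes the radical \<open>R\<close> in degree 2, but \<open>Y\<close> has
  degree -2. Invariance puts \<open>[e, [e, Y]]\<close> into \<open>R\<close>, and
  \<open>[f, [f, [e, [e, Y]]]] = 4 Y\<close> leads back to \<open>Y\<close>.\<close>

lemma pairing_nondegenerate:
  assumes J: "kkt_attached T J" and closed: "jordan_closed J" and simple: "frame_simple J"
    and ne: "jframe J \<noteq> {}"
    and Y: "Y \<in> E (- 2)" and orth: "\<And>A. A \<in> E 2 \<Longrightarrow> kkt_kappa T A Y = 0"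
  shows "Y = 0\<^sub>m n n"
proof -
  obtain \<phi> where \<phi>: "bij_betw \<phi> (jcarrier J) (E 2)"
    "\<And>a b. a \<in> jcarrier J \<Longrightarrow> b \<in> jcarrier J \<Longrightarrow> \<phi> (jadd J a b) = \<phi> a + \<phi> b"
    "\<And>c a. a \<in> jcarrier J \<Longrightarrow> \<phi> (jscale J c a) = c \<cdot>\<^sub>m \<phi> a"
    "\<And>a b. a \<in> jcarrier J \<Longrightarrow> b \<in> jcarrier J \<Longrightarrow>
       \<phi> (jprod J a b) = (1/2) \<cdot>\<^sub>m lie_bracket (\<phi> a) (lie_bracket f (\<phi> b))"
    "\<And>i. i \<in> jframe J \<Longrightarrow>
       kkt_kappa T ((- 1/2) \<cdot>\<^sub>m lie_bracket f (lie_bracket f (\<phi> i))) (\<phi> i) = 1"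
    using J unfolding kkt_attached_def by auto
  define R where "R = {A \<in> E 2. \<forall>Y\<in>E (- 2). K Y A = 0}"
  define I where "I = {a \<in> jcarrier J. \<phi> a \<in> R}"
  have \<phi>E: "\<phi> a \<in> E 2" if "a \<in> jcarrier J" for a using \<phi>(1) that by (auto simp: bij_betw_def)
  have RD: "A \<in> E 2" "A \<in> L" if "A \<in> R" for A using that by (auto simp: R_def intro: E_L)
  have fE: "f \<in> E (- 2)" by (rule EI[OF triple(1,5)])
  have eE: "e \<in> E 2" by (rule EI[OF triple(3,4)])
  have R_add: "A + B \<in> R" if "A \<in> R" "B \<in> R" for A B
    using that by (auto simp: R_def E_add killing_add_right E_L)
  have R_smult: "c \<cdot>\<^sub>m A \<in> R" if "A \<in> R" for A c
    using that by (auto simp: R_def E_smult killing_smult_right E_L)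
  have R_ad: "lie_bracket M A \<in> R" if M: "M \<in> E 0" and A: "A \<in> R" for M A
  proof -
    have "lie_bracket M A \<in> E 2" using E_bracket[OF M RD(1)[OF A]] by simp
    moreover have "K Y (lie_bracket M A) = 0" if Y: "Y \<in> E (- 2)" for Y
    proof -
      have "lie_bracket Y M \<in> E (- 2)" using E_bracket[OF Y M] by simp
      then have "K (lie_bracket Y M) A = 0" using A by (simp add: R_def)
      then show ?thesis by (simp only: killing_invariant[OF E_L[OF Y] E_L[OF M] RD(2)[OF A]])
    qed
    ultimately show ?thesis by (simp add: R_def)
  qed
  \<comment> \<open>Since \<open>A\<close> and \<open>B\<close> commute, the Jacobi identity turns
    the product into the action of \<open>[B, f]\<close>, which has degree 0 and preserves
    \<open>R\<close> by invariance.\<close>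
  have R_prod: "(1/2) \<cdot>\<^sub>m lie_bracket B (lie_bracket f A) \<in> R" if B: "B \<in> E 2" and A: "A \<in> R" for A B
  proof -
    note c = E_carrier[OF B] E_carrier[OF fE] E_carrier[OF RD(1)[OF A]]
    have "lie_bracket f (lie_bracket B A) = 0\<^sub>m n n"
      unfolding E2_commute[OF B RD(1)[OF A]] using c by (simp add: lie_bracket_def)
    then have "lie_bracket B (lie_bracket f A) = lie_bracket (lie_bracket B f) A"
      unfolding lie_jacobi[OF c] using lie_bracket_carrier[OF lie_bracket_carrier[OF c(1,2)] c(3)] by simp
    moreover have "lie_bracket B f \<in> E 0" using E_bracket[OF B fE] by simp
    ultimately show ?thesis using R_smult[OF R_ad[OF _ A]] by simp
  qed
  \<comment> \<open>The normalisation pairs \<open>\<phi> i\<close> with an element of degree -2 to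
    the value 1, so it is not in the radical.\<close>
  have frI: "i \<notin> I" if i: "i \<in> jframe J" for i
  proof
    assume "i \<in> I"
    then have iR: "\<phi> i \<in> R" by (simp add: I_def)
    have "lie_bracket f (lie_bracket f (\<phi> i)) \<in> E (- 2)"
      using E_bracket[OF fE E_bracket[OF fE RD(1)[OF iR]]] by simp
    then have "K ((- 1/2) \<cdot>\<^sub>m lie_bracket f (lie_bracket f (\<phi> i))) (\<phi> i) = 0"
      using iR E_smult by (simp add: R_def)
    then show False using \<phi>(5)[OF i] by (simp add: kkt_kappa_def)
  qed
  \<comment> \<open>The normalisation at a single frame element excludes a zero scaling
    factor.\<close>
  have c0: "kkt_const T \<noteq> 0"
    using ne \<phi>(5) by (auto simp: kkt_kappa_def)
  have "jideal J I" unfolding jideal_def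
  proof (intro conjI ballI allI)
    show "I \<subseteq> jcarrier J" by (auto simp: I_def)
    fix a assume a: "a \<in> I"
    then have aJ: "a \<in> jcarrier J" and aR: "\<phi> a \<in> R" by (simp_all add: I_def)
    fix b
    show "jadd J a b \<in> I" if "b \<in> I"
      using that aJ aR closed by (simp add: I_def jordan_closed_def \<phi>(2) R_add)
    show "jscale J c a \<in> I" for c
      using aJ aR closed by (simp add: I_def jordan_closed_def \<phi>(3) R_smult)
    show "jprod J b a \<in> I" if "b \<in> jcarrier J"
      using that aJ aR closed R_prod[OF \<phi>E[OF that] aR] by (simp add: I_def jordan_closed_def \<phi>(4))
  qed
  moreover have "I \<inter> jframe J = {}" by (auto dest: frI)
  ultimately have triv: "a = jscale J 0 a" if "a \<in> I" for a
    using simple that unfolding frame_simple_def by (elim allE impE) (assumption | erule bspec)+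
  have R0: "A = 0\<^sub>m n n" if A: "A \<in> R" for A
  proof -
    obtain a where a: "a \<in> jcarrier J" "A = \<phi> a" using \<phi>(1) RD(1)[OF A] by (auto simp: bij_betw_def)
    then have "a = jscale J 0 a" using A by (intro triv) (simp add: I_def)
    then have "A = 0 \<cdot>\<^sub>m A" using \<phi>(3)[OF a(1), of 0] a(2) by simp
    also have "\<dots> = 0\<^sub>m n n" using E_carrier[OF RD(1)[OF A]] by (intro eq_matI) auto
    finally show ?thesis .
  qed
  have KY: "K A Y = 0" if "A \<in> E 2" for A using orth[OF that] c0 by (simp add: kkt_kappa_def)
  have e1: "lie_bracket e Y \<in> E 0" using E_bracket[OF eE Y] by simp
  have e2: "lie_bracket e (lie_bracket e Y) \<in> E 2" using E_bracket[OF eE e1] by simp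
  have "lie_bracket e (lie_bracket e Y) \<in> R"
  proof -
    have "K Z (lie_bracket e (lie_bracket e Y)) = 0" if Z: "Z \<in> E (- 2)" for Z
    proof -
      have z1: "lie_bracket Z e \<in> E 0" using E_bracket[OF Z eE] by simp
      have z2: "lie_bracket (lie_bracket Z e) e \<in> E 2" using E_bracket[OF z1 eE] by simp
      have "K Z (lie_bracket e (lie_bracket e Y)) = K (lie_bracket (lie_bracket Z e) e) Y"
        unfolding killing_invariant[OF E_L[OF Z] E_L[OF eE] E_L[OF e1], symmetric]
          killing_invariant[OF E_L[OF z1] E_L[OF eE] E_L[OF Y], symmetric] ..
      then show ?thesis using KY[OF z2] by simp
    qed
    then show ?thesis using e2 by (simp add: R_def)
  qed
  then have ee0: "lie_bracket e (lie_bracket e Y) = 0\<^sub>m n n" by (rule R0)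
  note ec = E_carrier[OF eE] and fc = E_carrier[OF fE] and Yc = E_carrier[OF Y] and e1c = E_carrier[OF e1]
    and hc = L_carrier[OF triple(2)]
  have fe: "lie_bracket f e = (- 1) \<cdot>\<^sub>m h" using lie_bracket_antisym[OF fc ec fc] triple(6) by simp
  have fY: "lie_bracket f Y = 0\<^sub>m n n" by (rule Em2_commute[OF fE Y])
  have z0: "lie_bracket A (0\<^sub>m n n) = 0\<^sub>m n n" if "A \<in> carrier_mat n n" for A
    using that by (simp add: lie_bracket_def)
  \<comment> \<open>\<open>f\<close> annihilates \<open>Y\<close>, so only
    \<open>[f, e] = - h\<close> acts, and \<open>Y\<close> has weight -2.\<close>
  have 1: "lie_bracket f (lie_bracket e Y) = 2 \<cdot>\<^sub>m Y"
    unfolding lie_jacobi[OF fc ec Yc] fe fY z0[OF ec] lie_bracket_smult_left[OF hc Yc Yc] E_weight[OF Y]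
    using Yc by (intro eq_matI) auto
  have h0: "lie_bracket h (lie_bracket e Y) = 0 \<cdot>\<^sub>m lie_bracket e Y" by (rule E_weight[OF e1])
  have 2: "lie_bracket f (lie_bracket e (lie_bracket e Y)) = 2 \<cdot>\<^sub>m lie_bracket e Y"
    unfolding lie_jacobi[OF fc ec e1c] fe 1 lie_bracket_smult_left[OF hc e1c e1c] h0
      lie_bracket_smult_right[OF ec Yc Yc]
    using e1c by (intro eq_matI) auto
  have "lie_bracket f (lie_bracket f (lie_bracket e (lie_bracket e Y))) = 4 \<cdot>\<^sub>m Y"
    unfolding 2 lie_bracket_smult_right[OF fc e1c e1c] 1
    using Yc by (intro eq_matI) auto
  then have "4 \<cdot>\<^sub>m Y = 0\<^sub>m n n" by (simp only: ee0 z0[OF fc])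
  then show ?thesis
    using Yc by (intro eq_matI) (auto dest!: arg_cong[of _ _ "\<lambda>A. A $$ _"] simp: mat_eq_iff)
qed

end

subsection \<open>\<open>p\<close>-adic fields\<close>

locale padic =
  fixes v :: "'k::field_char_0 \<Rightarrow> real"
  assumes padic: "padic_field v"
begin

lemma v_nonneg: "0 \<le> v a" and v_zero_iff: "v a = 0 \<longleftrightarrow> a = 0" and v_mult: "v (a * b) = v a * v b"
  and v_add: "v (a + b) \<le> max (v a) (v b)"
  and v_compact: "compactin (field_topology v) {a. v a \<le> 1}"
  using padic unfolding padic_field_def by blast+

lemma v_zero: "v 0 = 0"
  by (simp add: v_zero_iff)

lemma v_pos: "a \<noteq> 0 \<Longrightarrow> 0 < v a"
  using v_nonneg[of a] v_zero_iff[of a] by simp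

lemma v_one: "v 1 = 1"
  using v_mult[of 1 1] v_zero_iff[of 1] by simp

lemma v_uminus: "v (- a) = v a"
proof -
  have "v (- 1) * v (- 1) = 1" using v_mult[of "- 1" "- 1"] v_one by simp
  then have "v (- 1) = 1"
    using v_nonneg[of "- 1"] by (metis abs_of_nonneg abs_square_eq_1 power2_eq_square)
  then show ?thesis using v_mult[of "- 1" a] by simp
qed

lemma v_diff: "v (a - b) \<le> max (v a) (v b)"
  using v_add[of a "- b"] by (simp add: v_uminus)

lemma v_add_less: "v a < \<epsilon> \<Longrightarrow> v b < \<epsilon> \<Longrightarrow> v (a + b) < \<epsilon>"
  by (rule le_less_trans[OF v_add]) simp

lemma v_add_le: "v a \<le> \<epsilon> \<Longrightarrow> v b \<le> \<epsilon> \<Longrightarrow> v (a + b) \<le> \<epsilon>"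
  by (rule order_trans[OF v_add]) simp

lemma v_diff_less: "v a < \<epsilon> \<Longrightarrow> v b < \<epsilon> \<Longrightarrow> v (a - b) < \<epsilon>"
  by (rule le_less_trans[OF v_diff]) simp

lemma v_diff_sym: "v (a - b) = v (b - a)"
  using v_uminus[of "a - b"] by simp

lemma v_inverse: "v (inverse a) = inverse (v a)"
proof (cases "a = 0")
  case False
  then have "v a * v (inverse a) = 1" using v_mult[of a "inverse a"] v_one by simp
  then show ?thesis by (metis inverse_unique)
qed (simp add: v_zero)

lemma v_power: "v (a ^ m) = v a ^ m"
  by (induction m) (simp_all add: v_one v_mult)

lemma v_of_nat: "v (of_nat m) \<le> 1"
proof (induction m)
  case (Suc m)
  then show ?case using v_add[of "of_nat m" 1] by (simp add: v_one add.commute)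
qed (simp add: v_zero)

lemma v_sum_less: "0 < \<epsilon> \<Longrightarrow> (\<And>i. i \<in> A \<Longrightarrow> v (f i) < \<epsilon>) \<Longrightarrow> v (sum f A) < \<epsilon>"
proof (induction A rule: infinite_finite_induct)
  case (insert x F)
  then have "v (f x) < \<epsilon>" "v (sum f F) < \<epsilon>" by simp_all
  then have "max (v (f x)) (v (sum f F)) < \<epsilon>" by simp
  then show ?case unfolding sum.insert[OF insert.hyps] by (rule le_less_trans[OF v_add])
qed (simp_all add: v_zero)

lemma large_element: "\<exists>t. t \<noteq> 0 \<and> \<rho> < v t"
proof -
  obtain a where a: "v a \<noteq> 0" "v a \<noteq> 1" using padic unfolding padic_field_def by blast
  obtain b where b: "1 < v b"
  proof (cases "v a < 1")
    case True
    then have "1 < inverse (v a)" using a v_nonneg[of a] by (intro one_less_inverse) auto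
    then show ?thesis using that[of "inverse a"] by (simp add: v_inverse)
  qed (use a that[of a] in auto)
  obtain m where "max \<rho> 0 < v b ^ m" using real_arch_pow[OF b] by blast
  then have "max \<rho> 0 < v (b ^ m)" by (simp add: v_power)
  then show ?thesis using v_zero by (intro exI[of _ "b ^ m"]) (auto simp del: power_eq_0_iff)
qed

sublocale Mk: Metric_space UNIV "\<lambda>a b. v (a - b)"
proof
  fix x y z :: 'k
  show "0 \<le> v (x - y)" by (rule v_nonneg)
  show "v (x - y) = v (y - x)" by (rule v_diff_sym)
  show "v (x - y) = 0 \<longleftrightarrow> x = y" by (simp add: v_zero_iff)
  show "v (x - z) \<le> v (x - y) + v (y - z)"
    using v_add[of "x - y" "y - z"] v_nonneg[of "x - y"] v_nonneg[of "y - z"] by simp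
qed

text \<open>Multiplication by a large \<open>t\<close> carries the compact unit ball onto a ball
  containing the given one, and compact sets are totally bounded.\<close>

lemma finite_net: 
  assumes "0 < \<delta>"
  shows "\<exists>F. finite F \<and> (\<forall>c. v c \<le> \<rho> \<longrightarrow> (\<exists>c'\<in>F. v (c - c') < \<delta>))"
proof -
  obtain t where t: "t \<noteq> 0" "\<rho> < v t" using large_element by blast
  have vt: "0 < v t" using t v_pos by blast
  have "Mk.mtotally_bounded {a. v a \<le> 1}"
    using v_compact unfolding field_topology_def by (rule Mk.compactin_imp_mtotally_bounded)
  then have "\<forall>\<epsilon>>0. \<exists>F. finite F \<and> F \<subseteq> {a. v a \<le> 1} \<and> {a. v a \<le> 1} \<subseteq> (\<Union>x\<in>F. Mk.mball x \<epsilon>)"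
    unfolding Mk.mtotally_bounded_def .
  from this[rule_format, OF divide_pos_pos[OF assms vt]]
  obtain F where F: "finite F" "{a. v a \<le> 1} \<subseteq> (\<Union>x\<in>F. Mk.mball x (\<delta> / v t))"
    by (elim exE conjE)
  have "\<exists>c'\<in>(\<lambda>x. t * x) ` F. v (c - c') < \<delta>" if c: "v c \<le> \<rho>" for c
  proof -
    have "v (c / t) = v c / v t" by (simp add: divide_inverse v_mult v_inverse)
    then have "v (c / t) \<le> 1" using c t(2) vt by (simp add: divide_le_eq)
    then have "c / t \<in> {a. v a \<le> 1}" by simp
    from subsetD[OF F(2) this] have "c / t \<in> (\<Union>x\<in>F. Mk.mball x (\<delta> / v t))" .
    then obtain x where x: "x \<in> F" "v (x - c / t) < \<delta> / v t" by (elim UN_E) (simp add: Mk.in_mball)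
    have "c - t * x = - (t * (x - c / t))" using t by (simp add: right_diff_distrib)
    then have "v (c - t * x) = v t * v (x - c / t)" by (simp only: v_uminus v_mult)
    then have "v (c - t * x) < \<delta>" using x(2) vt by (simp add: less_divide_eq mult.commute)
    then show ?thesis using x(1) by blast
  qed
  then show ?thesis using F(1) by (intro exI[of _ "(\<lambda>x. t * x) ` F"]) auto
qed

text \<open>Pigeonhole: all naturals lie in the unit ball, two of them are close to the same point
  of a finite net, and their difference is small. The residue characteristic need not be
  named.\<close>

lemma small_nat:
  assumes "0 < \<epsilon>"
  shows "\<exists>q>0. v (of_nat q) < \<epsilon>"
proof -
  obtain F where F: "finite F" "\<And>c. v c \<le> 1 \<Longrightarrow> \<exists>c'\<in>F. v (c - c') < \<epsilon>"
    using finite_net[OF assms, of 1] by blast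
  have "\<exists>c'. c' \<in> F \<and> v (of_nat m - c') < \<epsilon>" for m using F(2)[OF v_of_nat[of m]] by blast
  then have "\<forall>m. \<exists>c'. c' \<in> F \<and> v (of_nat m - c') < \<epsilon>" ..
  from choice[OF this] obtain g where g: "\<forall>m :: nat. g m \<in> F \<and> v (of_nat m - g m) < \<epsilon>" ..
  have "finite (range g)" by (rule finite_subset[OF _ F(1)]) (use g in auto)
  then have "\<not> inj g" using finite_imageD[of g UNIV] infinite_UNIV_nat by auto
  then obtain a' b' where "a' \<noteq> b'" "g a' = g b'" unfolding inj_def by auto
  then obtain a b where ab: "a < b" "g a = g b" by (cases "a' < b'") (auto simp: not_less le_less)
  have "of_nat (b - a) = (of_nat b - g b) - (of_nat a - g a :: 'k)" using ab by (simp add: of_nat_diff)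
  moreover have "v ((of_nat b - g b) - (of_nat a - g a)) < \<epsilon>"
    by (rule v_diff_less) (use g in auto)
  ultimately have "v (of_nat (b - a)) < \<epsilon>" by (simp only:)
  then show ?thesis using ab by (intro exI[of _ "b - a"]) simp
qed

text \<open>Finite nets of all radii and precisions are collected; this is the separability behind
  the countable covering in \<open>null_open_empty\<close>.\<close>

lemma countable_dense: "\<exists>D. countable D \<and> (\<forall>c. \<forall>\<epsilon>>0. \<exists>c'\<in>D. v (c - c') < \<epsilon>)"
proof -
  have "\<forall>i j. \<exists>F. finite F \<and> (\<forall>c. v c \<le> real i \<longrightarrow> (\<exists>c'\<in>F. v (c - c') < 1 / real (Suc j)))"
    by (intro allI finite_net) simp
  from choice[OF allI[OF choice[OF spec[OF this]]]] obtain F where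
    FF: "\<forall>i j. finite (F i j) \<and> (\<forall>c. v c \<le> real i \<longrightarrow> (\<exists>c'\<in>F i j. v (c - c') < 1 / real (Suc j)))" ..
  then have F: "\<And>i j. finite (F i j)"
    "\<And>i j c. v c \<le> real i \<Longrightarrow> \<exists>c'\<in>F i j. v (c - c') < 1 / real (Suc j)" by simp_all
  have "\<exists>c'\<in>(\<Union>i j. F i j). v (c - c') < \<epsilon>" if \<epsilon>: "0 < \<epsilon>" for c \<epsilon>
  proof -
    obtain i where i: "v c \<le> real i" using real_arch_simple by blast
    obtain j where j: "1 / real (Suc j) < \<epsilon>" using nat_approx_posE[OF \<epsilon>] by blast
    obtain c' where "c' \<in> F i j" "v (c - c') < 1 / real (Suc j)" using F(2)[OF i] by blast
    then show ?thesis using j by (intro bexI[of _ c']) auto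
  qed
  moreover have "countable (\<Union>i j. F i j)" by (intro countable_UN countable_finite F(1) countableI_type)
  ultimately show ?thesis by blast
qed

text \<open>The circle has no small subgroups. As long as \<open>\<psi> a\<close> is within 1/2 of
  1, the factor in \<open>|\<psi> (2 a) - 1| = |\<psi> a - 1| |\<psi> a + 1|\<close> is at least
  3/2, while doubling never leaves the ball where this closeness holds.\<close>

lemma character_trivial_near_0:
  assumes \<psi>: "unitary_character v \<psi>"
  shows "\<exists>\<delta>>0. \<forall>a. v a < \<delta> \<longrightarrow> \<psi> a = 1"
proof -
  have add: "\<psi> (a + b) = \<psi> a * \<psi> b" and norm: "cmod (\<psi> a) = 1" for a b
    using \<psi> unfolding unitary_character_def by blast+
  have 0: "\<psi> 0 = 1" using add[of 0 0] norm[of 0] by auto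
  have "openin (field_topology v) {a \<in> topspace (field_topology v). \<psi> a \<in> ball 1 (1/2)}"
    using \<psi> unfolding unitary_character_def by (intro openin_continuous_map_preimage) auto
  moreover have "0 \<in> {a \<in> topspace (field_topology v). \<psi> a \<in> ball 1 (1/2)}"
    using 0 by (simp add: field_topology_def)
  ultimately have "\<exists>\<delta>>0. Mk.mball 0 \<delta> \<subseteq> {a \<in> topspace (field_topology v). \<psi> a \<in> ball 1 (1/2)}"
    unfolding field_topology_def Mk.openin_mtopology by (elim conjE allE impE)
  then obtain \<delta> where \<delta>: "0 < \<delta>" "Mk.mball 0 \<delta> \<subseteq> {a \<in> topspace (field_topology v). \<psi> a \<in> ball 1 (1/2)}"
    by (elim exE conjE)
  have close: "cmod (\<psi> a - 1) < 1 / 2" if "v a < \<delta>" for a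
  proof -
    have "a \<in> Mk.mball 0 \<delta>" using that by (simp add: Mk.in_mball v_uminus)
    from subsetD[OF \<delta>(2) this] show ?thesis by (simp add: dist_norm norm_minus_commute)
  qed
  have "\<psi> a = 1" if a: "v a < \<delta>" for a
  proof (rule ccontr)
    assume ne: "\<psi> a \<noteq> 1"
    have small: "v (2 ^ m * a) < \<delta>" for m
    proof -
      have "v (2 ^ m * a) \<le> 1 * v a"
        unfolding v_mult using v_of_nat[of "2 ^ m"] by (intro mult_right_mono v_nonneg) simp
      then show ?thesis using a by simp
    qed
    have grow: "(3/2) ^ m * cmod (\<psi> a - 1) \<le> cmod (\<psi> (2 ^ m * a) - 1)" for m
    proof (induction m)
      case (Suc m)
      let ?z = "\<psi> (2 ^ m * a)"
      have "2 ^ Suc m * a = 2 ^ m * a + 2 ^ m * a" by simp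
      then have "\<psi> (2 ^ Suc m * a) = ?z * ?z" using add by metis
      then have e: "\<psi> (2 ^ Suc m * a) - 1 = (?z - 1) * (?z + 1)" by (simp add: algebra_simps)
      have "2 \<le> cmod (?z + 1) + cmod (?z - 1)"
        using norm_triangle_ineq4[of "?z + 1" "?z - 1"] by simp
      then have "3/2 \<le> cmod (?z + 1)" using close[OF small[of m]] by simp
      then have "3/2 * cmod (?z - 1) \<le> cmod (?z + 1) * cmod (?z - 1)" by (intro mult_right_mono) auto
      then show ?case using Suc unfolding e norm_mult by (simp add: mult.commute)
    qed simp
    obtain m where "1 / cmod (\<psi> a - 1) < (3/2) ^ m" using real_arch_pow[of "3/2"] by auto
    then have "1 < (3/2) ^ m * cmod (\<psi> a - 1)" using ne by (simp add: field_simps)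
    then show False using grow[of m] close[OF small[of m]] by simp
  qed
  then show ?thesis using \<delta>(1) by blast
qed

subsection \<open>Limits along a filter\<close>

text \<open>Limits are expressed through \<open>v\<close>, since the type of k carries no topology
  of its own.\<close>

definition conv :: "('c \<Rightarrow> 'k) \<Rightarrow> 'k \<Rightarrow> 'c filter \<Rightarrow> bool" where
  "conv f c F \<longleftrightarrow> (\<forall>\<epsilon>>0. eventually (\<lambda>x. v (f x - c) < \<epsilon>) F)"

lemma conv_cong:
  assumes "conv g c F" and "eventually (\<lambda>x. f x = g x) F"
  shows "conv f c F"
  unfolding conv_def
proof (intro allI impI)
  fix \<epsilon> :: real assume "0 < \<epsilon>"
  then have "eventually (\<lambda>x. v (g x - c) < \<epsilon>) F" using assms(1) by (simp add: conv_def)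
  with assms(2) show "eventually (\<lambda>x. v (f x - c) < \<epsilon>) F" by eventually_elim simp
qed

lemma conv_const: "conv (\<lambda>_. c) c F"
  by (simp add: conv_def v_zero)

lemma conv_add:
  assumes "conv f c F" "conv g d F" shows "conv (\<lambda>x. f x + g x) (c + d) F"
  unfolding conv_def
proof (intro allI impI)
  fix \<epsilon> :: real assume "0 < \<epsilon>"
  then have "eventually (\<lambda>x. v (f x - c) < \<epsilon>) F" "eventually (\<lambda>x. v (g x - d) < \<epsilon>) F"
    using assms by (auto simp: conv_def)
  then show "eventually (\<lambda>x. v (f x + g x - (c + d)) < \<epsilon>) F"
  proof eventually_elim
    case (elim x)
    have e: "f x + g x - (c + d) = (f x - c) + (g x - d)" by simp
    show ?case unfolding e by (rule v_add_less[OF elim])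
  qed
qed

lemma conv_mult:
  assumes f: "conv f c F" and g: "conv g d F" shows "conv (\<lambda>x. f x * g x) (c * d) F"
  unfolding conv_def
proof (intro allI impI)
  fix \<epsilon> :: real assume \<epsilon>: "0 < \<epsilon>"
  let ?b = "1 + v c + v d"
  have b: "0 < ?b" "1 \<le> ?b" "v c < ?b" "v d < ?b" using v_nonneg[of c] v_nonneg[of d] by auto
  have "eventually (\<lambda>x. v (f x - c) < \<epsilon> / ?b) F" "eventually (\<lambda>x. v (g x - d) < \<epsilon> / ?b) F"
    "eventually (\<lambda>x. v (f x - c) < 1) F"
    using f g \<epsilon> b by (auto simp: conv_def)
  then show "eventually (\<lambda>x. v (f x * g x - c * d) < \<epsilon>) F"
  proof eventually_elim
    case (elim x)
    have e: "f x * g x - c * d = f x * (g x - d) + (f x - c) * d" by (simp add: algebra_simps)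
    have "v ((f x - c) + c) \<le> ?b" using elim(3) b by (intro v_add_le) simp_all
    then have vf: "v (f x) \<le> ?b" by simp
    have "v (f x) * v (g x - d) \<le> ?b * v (g x - d)" by (intro mult_right_mono vf v_nonneg)
    also have "\<dots> < \<epsilon>" using elim b by (simp add: field_simps)
    finally have 1: "v (f x * (g x - d)) < \<epsilon>" by (simp add: v_mult)
    have "v (f x - c) * v d \<le> v (f x - c) * ?b" using b by (intro mult_left_mono v_nonneg) simp
    also have "\<dots> < \<epsilon>" using elim b by (simp add: field_simps)
    finally have 2: "v ((f x - c) * d) < \<epsilon>" by (simp add: v_mult)
    show ?case unfolding e by (rule v_add_less[OF 1 2])
  qed
qed

lemma conv_sum: "(\<And>i. i \<in> A \<Longrightarrow> conv (f i) (c i) F) \<Longrightarrow> conv (\<lambda>x. \<Sum>i\<in>A. f i x) (\<Sum>i\<in>A. c i) F"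
proof (induction A rule: infinite_finite_induct)
  case (insert i A)
  then have "conv (\<lambda>x. f i x + (\<Sum>i\<in>A. f i x)) (c i + (\<Sum>i\<in>A. c i)) F"
    by (intro conv_add) auto
  then show ?case using insert by simp
qed (simp_all add: conv_const)

subsection \<open>The topology on matrices\<close>

definition matdist :: "nat \<Rightarrow> 'k mat \<Rightarrow> 'k mat \<Rightarrow> real" where
  "matdist n A B = Max (insert 0 {v (A $$ (i, j) - B $$ (i, j)) | i j. i < n \<and> j < n})"

lemma matdist_finite: "finite {v (A $$ (i, j) - B $$ (i, j)) | i j. i < n \<and> j < n}"
proof -
  have "{v (A $$ (i, j) - B $$ (i, j)) | i j. i < n \<and> j < n} =
      (\<lambda>(i, j). v (A $$ (i, j) - B $$ (i, j))) ` ({..<n} \<times> {..<n})" by auto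
  then show ?thesis by simp
qed

lemma matdist_le: "0 \<le> r \<Longrightarrow> matdist n A B \<le> r \<longleftrightarrow> (\<forall>i<n. \<forall>j<n. v (A $$ (i, j) - B $$ (i, j)) \<le> r)"
  unfolding matdist_def using matdist_finite[of A B n] by (subst Max_le_iff) auto

lemma matdist_less: "0 < r \<Longrightarrow> matdist n A B < r \<longleftrightarrow> (\<forall>i<n. \<forall>j<n. v (A $$ (i, j) - B $$ (i, j)) < r)"
  unfolding matdist_def using matdist_finite[of A B n] by (subst Max_less_iff) auto

lemma matdist_nonneg: "0 \<le> matdist n A B"
  unfolding matdist_def using matdist_finite[of A B n] by (intro Max_ge) auto

lemma matdist_sym: "matdist n A B = matdist n B A"
  unfolding matdist_def by (simp only: v_diff_sym)

lemma matdist_ultra: "matdist n A C \<le> max (matdist n A B) (matdist n B C)"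
proof -
  have "v (A $$ (i, j) - C $$ (i, j)) \<le> max (matdist n A B) (matdist n B C)" if "i < n" "j < n" for i j
  proof -
    have "v (A $$ (i, j) - B $$ (i, j)) \<le> matdist n A B" "v (B $$ (i, j) - C $$ (i, j)) \<le> matdist n B C"
      using matdist_le[OF matdist_nonneg, of n A B n A B] matdist_le[OF matdist_nonneg, of n B C n B C] that by auto
    then have "v ((A $$ (i, j) - B $$ (i, j)) + (B $$ (i, j) - C $$ (i, j))) \<le> max (matdist n A B) (matdist n B C)"
      by (intro v_add_le) (simp_all add: le_max_iff_disj)
    then show ?thesis by simp
  qed
  then show ?thesis using matdist_nonneg[of n A B] by (subst matdist_le) auto
qed

lemma matdist_zero: "A \<in> carrier_mat n n \<Longrightarrow> B \<in> carrier_mat n n \<Longrightarrow> matdist n A B = 0 \<longleftrightarrow> A = B"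
proof
  assume c: "A \<in> carrier_mat n n" "B \<in> carrier_mat n n" and "matdist n A B = 0"
  then have "v (A $$ (i, j) - B $$ (i, j)) \<le> 0" if "i < n" "j < n" for i j
    using matdist_le[of 0 n A B] that by simp
  then have "A $$ (i, j) = B $$ (i, j)" if "i < n" "j < n" for i j
    using that v_nonneg[of "A $$ (i, j) - B $$ (i, j)"] v_zero_iff[of "A $$ (i, j) - B $$ (i, j)"]
    by (simp add: order_antisym)
  then show "A = B" using c by (intro eq_matI) auto
next
  assume "A = B"
  then have "matdist n A B \<le> 0" by (subst matdist_le) (auto simp: v_zero)
  then show "matdist n A B = 0" using matdist_nonneg[of n A B] by simp
qed

lemma Metric_space_matdist: "Metric_space (carrier_mat n n) (matdist n)"
proof
  fix A B C :: "'k mat"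
  show "0 \<le> matdist n A B" by (rule matdist_nonneg)
  show "matdist n A B = matdist n B A" by (rule matdist_sym)
  assume A: "A \<in> carrier_mat n n" and B: "B \<in> carrier_mat n n"
  show "matdist n A B = 0 \<longleftrightarrow> A = B" by (rule matdist_zero[OF A B])
  show "matdist n A C \<le> matdist n A B + matdist n B C"
    using matdist_ultra[of n A C B] matdist_nonneg[of n A B] matdist_nonneg[of n B C] by simp
qed

lemma mat_topology_eq: "mat_topology v n = Metric_space.mtopology (carrier_mat n n) (matdist n)"
  by (simp add: mat_topology_def matdist_def[abs_def])

text \<open>Neighbourhoods are taken among all n by n matrices, so one filter serves every subspace;
  membership in the subspace appears as a premise under \<open>eventually\<close>.\<close>

definition nhm :: "nat \<Rightarrow> 'k mat \<Rightarrow> 'k mat filter" where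
  "nhm n x = (INF \<delta>\<in>{0<..}. principal {y \<in> carrier_mat n n. matdist n x y < \<delta>})"

lemma eventually_nhm:
  "eventually P (nhm n x) \<longleftrightarrow> (\<exists>\<delta>>0. \<forall>y\<in>carrier_mat n n. matdist n x y < \<delta> \<longrightarrow> P y)"
  unfolding nhm_def
proof (subst eventually_INF_base)
  show "\<exists>c\<in>{0<..}. principal {y \<in> carrier_mat n n. matdist n x y < c} \<le>
      inf (principal {y \<in> carrier_mat n n. matdist n x y < a}) (principal {y \<in> carrier_mat n n. matdist n x y < b})"
    if "a \<in> {0<..}" "b \<in> {0<..}" for a b :: real
    using that by (intro bexI[of _ "min a b"]) auto
qed (auto simp: eventually_principal)

lemma conv_entries: "conv (\<lambda>y. entries n y p) (entries n x p) (nhm n x)"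
  unfolding conv_def eventually_nhm
proof (intro allI impI)
  fix \<epsilon> :: real assume \<epsilon>: "0 < \<epsilon>"
  show "\<exists>\<delta>>0. \<forall>y\<in>carrier_mat n n. matdist n x y < \<delta> \<longrightarrow> v (entries n y p - entries n x p) < \<epsilon>"
    by (rule exI[of _ \<epsilon>], cases p)
      (use \<epsilon> in \<open>auto simp: entries_def matdist_less v_zero v_diff_sym\<close>)
qed

lemma eventually_mdist':
  assumes "\<And>p. conv (\<lambda>y. entries n (F y) p) (entries n z p) FF" and "0 < \<epsilon>"
  shows "eventually (\<lambda>y. matdist n z (F y) < \<epsilon>) FF"
proof -
  have "eventually (\<lambda>y. \<forall>p\<in>{..<n} \<times> {..<n}. v (entries n (F y) p - entries n z p) < \<epsilon>) FF"
    using assms by (intro eventually_ball_finite) (auto simp: conv_def)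
  then show ?thesis
    by (rule eventually_mono)
      (use assms(2) in \<open>auto simp: matdist_less entries_def v_diff_sym[of "z $$ _"]\<close>)
qed

lemma openin_sub_iff:
  assumes "S \<subseteq> carrier_mat n n"
  shows "openin (subtopology (mat_topology v n) S) U \<longleftrightarrow>
    U \<subseteq> S \<and> (\<forall>x\<in>U. eventually (\<lambda>y. y \<in> S \<longrightarrow> y \<in> U) (nhm n x))"
proof -
  interpret Metric_space "carrier_mat n n" "matdist n" by (rule Metric_space_matdist)
  interpret S: Submetric "carrier_mat n n" "matdist n" S by unfold_locales (rule assms)
  have key: "S.sub.mball x r \<subseteq> U \<longleftrightarrow> (\<forall>y\<in>carrier_mat n n. matdist n x y < r \<longrightarrow> y \<in> S \<longrightarrow> y \<in> U)"
    if "x \<in> S" for x r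
    using that assms by (auto simp: S.sub.in_mball subset_iff)
  show ?thesis
    unfolding mat_topology_eq S.mtopology_submetric[symmetric] S.sub.openin_mtopology eventually_nhm
  proof (rule conj_cong[OF refl])
    assume US: "U \<subseteq> S"
    show "(\<forall>x. x \<in> U \<longrightarrow> (\<exists>r>0. S.sub.mball x r \<subseteq> U)) \<longleftrightarrow>
        (\<forall>x\<in>U. \<exists>r>0. \<forall>y\<in>carrier_mat n n. matdist n x y < r \<longrightarrow> y \<in> S \<longrightarrow> y \<in> U)"
      unfolding Ball_def[of U]
      by (intro arg_cong[of _ _ All] ext imp_cong refl) (simp only: key[OF subsetD[OF US]])
  qed
qed

lemma topspace_sub: "S \<subseteq> carrier_mat n n \<Longrightarrow> topspace (subtopology (mat_topology v n) S) = S"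
proof -
  interpret Metric_space "carrier_mat n n" "matdist n" by (rule Metric_space_matdist)
  show "S \<subseteq> carrier_mat n n \<Longrightarrow> topspace (subtopology (mat_topology v n) S) = S"
    by (auto simp: mat_topology_eq topspace_subtopology)
qed

lemma openin_matball:
  assumes S: "S \<subseteq> carrier_mat n n" and \<delta>: "0 < \<delta>"
  shows "openin (subtopology (mat_topology v n) S) {y \<in> S. matdist n x y < \<delta>}"
  unfolding openin_sub_iff[OF S]
proof (intro conjI ballI)
  fix z assume z: "z \<in> {y \<in> S. matdist n x y < \<delta>}"
  have "matdist n x y < \<delta>" if "matdist n z y < \<delta>" for y
    by (rule le_less_trans[OF matdist_ultra[of n x y z]]) (use z that in simp)
  then show "eventually (\<lambda>y. y \<in> S \<longrightarrow> y \<in> {y \<in> S. matdist n x y < \<delta>}) (nhm n z)"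
    unfolding eventually_nhm using \<delta> by (intro exI[of _ \<delta>]) simp
qed auto

lemma locally_constant_sub:
  assumes S: "S \<subseteq> carrier_mat n n"
  shows "locally_constant (subtopology (mat_topology v n) S) f \<longleftrightarrow>
    (\<forall>x\<in>S. eventually (\<lambda>y. y \<in> S \<longrightarrow> f y = f x) (nhm n x))"
  unfolding locally_constant_def topspace_sub[OF S]
proof (intro ball_cong refl iffI)
  fix x assume x: "x \<in> S"
  {
    assume "\<exists>U. openin (subtopology (mat_topology v n) S) U \<and> x \<in> U \<and> (\<forall>b\<in>U. f b = f x)"
    then obtain U where U: "x \<in> U" "\<forall>b\<in>U. f b = f x" "\<forall>x\<in>U. eventually (\<lambda>y. y \<in> S \<longrightarrow> y \<in> U) (nhm n x)"
      unfolding openin_sub_iff[OF S] by (elim exE conjE)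
    from bspec[OF U(3,1)] show "eventually (\<lambda>y. y \<in> S \<longrightarrow> f y = f x) (nhm n x)"
      by (rule eventually_mono) (use U(2) in auto)
  next
    assume "eventually (\<lambda>y. y \<in> S \<longrightarrow> f y = f x) (nhm n x)"
    then obtain \<delta> where \<delta>: "0 < \<delta>" "\<And>y. y \<in> carrier_mat n n \<Longrightarrow> matdist n x y < \<delta> \<Longrightarrow> y \<in> S \<Longrightarrow> f y = f x"
      unfolding eventually_nhm by blast
    let ?U = "{y \<in> S. matdist n x y < \<delta>}"
    have "openin (subtopology (mat_topology v n) S) ?U" by (rule openin_matball[OF S \<delta>(1)])
    moreover have "x \<in> ?U"
      using x \<delta>(1) matdist_zero[OF subsetD[OF S x] subsetD[OF S x]] by simp
    moreover have "\<forall>b\<in>?U. f b = f x" using \<delta>(2) subsetD[OF S] by simp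
    ultimately show "\<exists>U. openin (subtopology (mat_topology v n) S) U \<and> x \<in> U \<and> (\<forall>b\<in>U. f b = f x)"
      by (intro exI[of _ ?U] conjI)
  }
qed

lemma mat_countable_net:
  "\<exists>Q. countable Q \<and> Q \<subseteq> carrier_mat n n \<and> (\<forall>y\<in>carrier_mat n n. \<forall>\<epsilon>>0. \<exists>q\<in>Q. matdist n q y < \<epsilon>)"
proof -
  obtain D where "countable D \<and> (\<forall>c. \<forall>\<epsilon>>0. \<exists>c'\<in>D. v (c - c') < \<epsilon>)"
    using countable_dense ..
  then have D: "countable D" "\<And>c \<epsilon>. 0 < \<epsilon> \<Longrightarrow> \<exists>c'\<in>D. v (c - c') < \<epsilon>" by simp_all
  let ?Q = "(\<lambda>g. Matrix.mat n n g) ` (({..<n} \<times> {..<n}) \<rightarrow>\<^sub>E D)"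
  have "\<exists>q\<in>?Q. matdist n q y < \<epsilon>" if y: "y \<in> carrier_mat n n" and \<epsilon>: "0 < \<epsilon>" for y \<epsilon>
  proof -
    have "\<exists>c'. c' \<in> D \<and> v (y $$ p - c') < \<epsilon>" for p using D(2)[OF \<epsilon>, of "y $$ p"] by blast
    then have "\<forall>p. \<exists>c'. c' \<in> D \<and> v (y $$ p - c') < \<epsilon>" ..
    from choice[OF this] obtain g where gg: "\<forall>p. g p \<in> D \<and> v (y $$ p - g p) < \<epsilon>" ..
    have g: "g p \<in> D" "v (y $$ p - g p) < \<epsilon>" for p using spec[OF gg, of p] by simp_all
    let ?g = "restrict g ({..<n} \<times> {..<n})"
    have "Matrix.mat n n ?g \<in> ?Q" 
      by (rule imageI, rule restrict_PiE_iff[THEN iffD2], rule ballI, rule g(1))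
    moreover have "matdist n (Matrix.mat n n ?g) y < \<epsilon>"
      unfolding matdist_less[OF \<epsilon>]
    proof (intro allI impI)
      fix i j assume "i < n" "j < n"
      then show "v (Matrix.mat n n ?g $$ (i, j) - y $$ (i, j)) < \<epsilon>"
        using g(2)[of "(i, j)"] v_diff_sym[of "g (i, j)" "y $$ (i, j)"] by simp
    qed
    ultimately show ?thesis by (rule bexI[rotated])
  qed
  moreover have "countable ?Q" using D(1) by (intro countable_image countable_PiE) auto
  ultimately show ?thesis by (intro exI[of _ ?Q]) auto
qed

subsection \<open>Continuity of matrix operations\<close>

lemma conv_pow:
  assumes "x \<in> carrier_mat n n" "i < n" "j < n"
  shows "conv (\<lambda>y. entries n (y ^\<^sub>m l) (i, j)) (entries n (x ^\<^sub>m l) (i, j)) (nhm n x)"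
  using assms(2,3)
proof (induction l arbitrary: i j)
  case 0
  have e: "y ^\<^sub>m 0 = 1\<^sub>m n" if "y \<in> carrier_mat n n" for y :: "'k mat" using that by simp
  have "conv (\<lambda>y. entries n (1\<^sub>m n) (i, j)) (entries n (x ^\<^sub>m 0) (i, j)) (nhm n x)"
    unfolding e[OF assms(1)] by (rule conv_const)
  moreover have "eventually (\<lambda>y. entries n (y ^\<^sub>m 0) (i, j) = entries n (1\<^sub>m n) (i, j)) (nhm n x)"
    unfolding eventually_nhm by (intro exI[of _ 1] conjI ballI impI) (simp_all only: e zero_less_one)
  ultimately show ?case by (rule conv_cong)
next
  case (Suc l)
  have e: "entries n (y ^\<^sub>m Suc l) (i, j) = (\<Sum>p<n. entries n (y ^\<^sub>m l) (i, p) * entries n y (p, j))"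
    if y: "y \<in> carrier_mat n n" for y
    using fun_cong[OF entries_mult[OF pow_carrier_mat[OF y] y], of l "(i, j)"] by simp
  have "conv (\<lambda>y. \<Sum>p<n. entries n (y ^\<^sub>m l) (i, p) * entries n y (p, j))
      (\<Sum>p<n. entries n (x ^\<^sub>m l) (i, p) * entries n x (p, j)) (nhm n x)"
    using Suc by (intro conv_sum conv_mult conv_entries) auto
  then have "conv (\<lambda>y. \<Sum>p<n. entries n (y ^\<^sub>m l) (i, p) * entries n y (p, j))
      (entries n (x ^\<^sub>m Suc l) (i, j)) (nhm n x)" by (simp only: e[OF assms(1)])
  moreover have "eventually (\<lambda>y. entries n (y ^\<^sub>m Suc l) (i, j) =
      (\<Sum>p<n. entries n (y ^\<^sub>m l) (i, p) * entries n y (p, j))) (nhm n x)"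
    unfolding eventually_nhm by (intro exI[of _ 1] conjI ballI impI e) simp
  ultimately show ?case by (rule conv_cong)
qed

lemma conv_exp:
  assumes x: "x \<in> carrier_mat n n"
  shows "conv (\<lambda>y. entries n (mat_exp n y) p) (entries n (mat_exp n x) p) (nhm n x)"
proof -
  obtain i j where p: "p = (i, j)" by (cases p)
  show ?thesis
  proof (cases "i < n \<and> j < n")
    case True
    have e: "entries n (mat_exp n y) (i, j) = (\<Sum>l<n. entries n (y ^\<^sub>m l) (i, j) * inverse (fact l))" for y
      using True by (simp add: mat_exp_def entries_def divide_inverse)
    show ?thesis unfolding p e using True by (intro conv_sum conv_mult conv_const conv_pow x) auto
  next
    case False
    then have "entries n A p = 0" for A :: "'k mat" by (auto simp: p entries_def)
    then show ?thesis by (simp add: conv_const)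
  qed
qed

end

subsection \<open>Representations extending \<open>\<pi>\<close>\<close>

text \<open>Nondegeneracy of the pairing is assumed here. It is the one point whose proof depends on
  the kind of Jordan algebra, and it is supplied separately for each kind.\<close>

locale kkt_rep = padic v + kkt T
  for v :: "'k::field_char_0 \<Rightarrow> real" and T :: "'k kkt_datum" +
  fixes \<psi> :: "'k \<Rightarrow> complex" and \<omega> :: "'k mat set" and \<nu> :: "'k mat \<Rightarrow> complex"
    and \<mu> :: "'k mat measure"
    and \<Phi> :: "'k mat \<Rightarrow> ('k mat \<Rightarrow> complex) \<Rightarrow> 'k mat \<Rightarrow> complex"
  assumes psi: "unitary_character v \<psi>" and psi_nontrivial: "\<exists>a. \<psi> a \<noteq> 1"
    and orbit: "kkt_orbit T \<omega>"
    and quasi_inv: "quasi_invariant_measure v T \<omega> \<nu> \<mu>"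
    and extends: "extends_pi v T \<psi> \<nu> \<mu> \<Phi>"
    and nondeg: "\<And>Y. Y \<in> kkt_eigenspace T (- 2) \<Longrightarrow>
      (\<And>A. A \<in> kkt_eigenspace T 2 \<Longrightarrow> kkt_kappa T A Y = 0) \<Longrightarrow> Y = 0\<^sub>m (kkt_size T) (kkt_size T)"
begin

abbreviation "lg \<equiv> log_of (- 2)"
abbreviation "tpl S \<equiv> kkt_topology v T S"
abbreviation "kap \<equiv> kkt_kappa T"

lemma psi_add: "\<psi> (a + b) = \<psi> a * \<psi> b" and psi_norm: "cmod (\<psi> a) = 1"
  using psi by (simp_all add: unitary_character_def)

lemma psi_zero: "\<psi> 0 = 1"
  using psi_add[of 0 0] psi_norm[of 0] by auto

lemma psi_nonzero: "\<psi> a \<noteq> 0"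
  using psi_norm[of a] by auto

lemma psi_diff: "\<psi> (a - b) = \<psi> a / \<psi> b"
  using psi_add[of "a - b" b] psi_nonzero[of b] by (simp add: field_simps)

lemma psi_of_nat: "\<psi> (of_nat m * a) = \<psi> a ^ m"
  by (induction m) (simp_all add: psi_zero distrib_right psi_add)

lemma kap_add_right: "A \<in> L \<Longrightarrow> Y \<in> L \<Longrightarrow> Z \<in> L \<Longrightarrow> kap A (Y + Z) = kap A Y + kap A Z"
  and kap_smult_right: "A \<in> L \<Longrightarrow> Y \<in> L \<Longrightarrow> kap A (c \<cdot>\<^sub>m Y) = c * kap A Y"
  and kap_sym: "A \<in> L \<Longrightarrow> Y \<in> L \<Longrightarrow> kap A Y = kap Y A"
  by (simp_all add: kkt_kappa_def killing_add_right killing_smult_right killing_sym distrib_left)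

lemma kap_smult_left: "A \<in> L \<Longrightarrow> Y \<in> L \<Longrightarrow> kap (c \<cdot>\<^sub>m A) Y = c * kap A Y"
  using kap_sym[of "c \<cdot>\<^sub>m A" Y] kap_sym[of A Y] kap_smult_right[of Y A c] L_smult[of A c] by simp

lemma kap_add_left: "A \<in> L \<Longrightarrow> B \<in> L \<Longrightarrow> Y \<in> L \<Longrightarrow> kap (A + B) Y = kap A Y + kap B Y"
  using kap_sym[of "A + B" Y] kap_sym[of A Y] kap_sym[of B Y] kap_add_right[of Y A B] L_add[of A B] by simp

lemma lg_E: "y \<in> kkt_Nbar T \<Longrightarrow> lg y \<in> E (- 2)" and exp_lg: "y \<in> kkt_Nbar T \<Longrightarrow> mat_exp n (lg y) = y"
  using Nbar_log by simp_all

lemma psi_char_exp: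
  assumes "A \<in> E 2"
  shows "psi_char T \<psi> y (mat_exp n A) = \<psi> (kap A (lg y))"
  using assms by (simp add: psi_char_def kkt_pairing_def log_exp)

lemma omega_Nbar: "y \<in> \<omega> \<Longrightarrow> y \<in> kkt_Nbar T"
  using orbit act_Nbar by (auto simp: kkt_orbit_def)

lemma Nbar_sub: "kkt_Nbar T \<subseteq> carrier_mat n n" and omega_sub: "\<omega> \<subseteq> carrier_mat n n"
  and G_sub: "kkt_G T \<subseteq> carrier_mat n n"
  using omega_Nbar Nbar_carrier G_car by blast+

text \<open>The form is linear in the entries of the logarithm, which are linear in those of
  \<open>y\<close>. So no continuity of \<open>lg\<close> has to be established separately.\<close>

lemma kap_entries:
  assumes A: "A \<in> E 2"
  shows "\<exists>D. \<forall>y\<in>kkt_Nbar T. kap A (lg y) = (\<Sum>q\<in>{..<n} \<times> {..<n}. D q * entries n y q)"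
proof -
  let ?I = "{..<n} \<times> {..<n}"
  interpret E: mat_space n "E (- 2)" by (rule mat_space_E)
  have "E.lin_form (kap A)"
    unfolding E.lin_form_def using E_L[OF A] E_L by (simp add: kap_add_right kap_smult_right)
  from E.lin_form_entries[OF this] obtain c where
    c: "\<forall>Y\<in>E (- 2). kap A Y = (\<Sum>p\<in>?I. c p * entries n Y p)" ..
  have "(- 2 :: 'k) \<noteq> 0" by simp
  from log_entries[OF this] obtain C where
    C: "\<forall>Y\<in>E (- 2). \<forall>p. entries n Y p = (\<Sum>q\<in>?I. C p q * entries n (mat_exp n Y) q)" ..
  have "kap A (lg y) = (\<Sum>q\<in>?I. (\<Sum>p\<in>?I. c p * C p q) * entries n y q)" if y: "y \<in> kkt_Nbar T" for y
  proof -
    have "kap A (lg y) = (\<Sum>p\<in>?I. c p * entries n (lg y) p)" by (rule bspec[OF c lg_E[OF y]])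
    also have "\<dots> = (\<Sum>p\<in>?I. \<Sum>q\<in>?I. c p * (C p q * entries n y q))"
      unfolding spec[OF bspec[OF C lg_E[OF y]]] exp_lg[OF y] sum_distrib_left ..
    also have "\<dots> = (\<Sum>q\<in>?I. (\<Sum>p\<in>?I. c p * C p q) * entries n y q)"
      by (subst sum.swap) (simp only: sum_distrib_right mult.assoc)
    finally show ?thesis .
  qed
  then show ?thesis by (intro exI[of _ "\<lambda>q. \<Sum>p\<in>?I. c p * C p q"] ballI)
qed

lemma psi_char_locally_constant:
  assumes A: "A \<in> E 2" and x: "x \<in> kkt_Nbar T"
  shows "eventually (\<lambda>y. y \<in> kkt_Nbar T \<longrightarrow> \<psi> (kap A (lg y)) = \<psi> (kap A (lg x))) (nhm n x)"
proof -
  obtain D where D: "\<forall>y\<in>kkt_Nbar T. kap A (lg y) = (\<Sum>q\<in>{..<n} \<times> {..<n}. D q * entries n y q)"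
    using kap_entries[OF A] ..
  obtain \<delta> where \<delta>: "\<delta> > 0 \<and> (\<forall>a. v a < \<delta> \<longrightarrow> \<psi> a = 1)"
    using character_trivial_near_0[OF psi] ..
  let ?F = "\<lambda>y. \<Sum>q\<in>{..<n} \<times> {..<n}. D q * entries n y q"
  have "conv ?F (?F x) (nhm n x)"
    by (intro conv_sum conv_mult conv_const conv_entries)
  then have "eventually (\<lambda>y. v (?F y - ?F x) < \<delta>) (nhm n x)" using \<delta> by (simp add: conv_def)
  then show ?thesis
  proof (rule eventually_mono, intro impI)
    fix y assume small: "v (?F y - ?F x) < \<delta>" and y: "y \<in> kkt_Nbar T"
    have "\<psi> (kap A (lg y) - kap A (lg x)) = 1"
      using small \<delta> by (simp add: bspec[OF D y] bspec[OF D x])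
    then show "\<psi> (kap A (lg y)) = \<psi> (kap A (lg x))"
      using psi_nonzero[of "kap A (lg x)"] by (simp add: psi_diff)
  qed
qed

subsection \<open>The action on the orbit\<close>

lemma act_act:
  assumes g: "g \<in> kkt_G T" and k: "k \<in> kkt_G T" and y: "y \<in> carrier_mat n n"
  shows "kkt_act T (g * k) y = kkt_act T g (kkt_act T k y)"
proof -
  interpret GLk: group "GL n :: 'k mat monoid" by (rule GL_group)
  have "inv\<^bsub>GL n\<^esub> (g * k) = inv\<^bsub>GL n\<^esub> k * inv\<^bsub>GL n\<^esub> g"
    using GLk.inv_mult_group[OF G_GLk[OF g] G_GLk[OF k]] by (simp add: GL_mult)
  then show ?thesis
    unfolding kkt_act_def
    by (simp add: assoc_mult_mat[where n\<^sub>1 = n and n\<^sub>2 = n and n\<^sub>3 = n and n\<^sub>4 = n]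
        G_car[OF g] G_car[OF k] G_inv(2)[OF g] G_inv(2)[OF k] y mult_carrier_mat[where n = n])
qed

lemma act_id: "y \<in> carrier_mat n n \<Longrightarrow> kkt_act T (1\<^sub>m n) y = y"
proof -
  interpret GLk: group "GL n :: 'k mat monoid" by (rule GL_group)
  have "inv\<^bsub>GL n\<^esub> (1\<^sub>m n :: 'k mat) = 1\<^sub>m n" using GLk.inv_one by (simp add: GL_one)
  then show "y \<in> carrier_mat n n \<Longrightarrow> kkt_act T (1\<^sub>m n) y = y" by (simp add: kkt_act_def)
qed

lemma act_inv:
  assumes g: "g \<in> kkt_G T" and y: "y \<in> carrier_mat n n"
  shows "kkt_act T g (kkt_act T (inv\<^bsub>GL n\<^esub> g) y) = y" "kkt_act T (inv\<^bsub>GL n\<^esub> g) (kkt_act T g y) = y"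
  by (simp_all add: act_act[OF g G_inv(1)[OF g] y, symmetric] act_act[OF G_inv(1)[OF g] g y, symmetric]
      G_inv[OF g] act_id[OF y])

lemma M_mult: "m \<in> kkt_M T \<Longrightarrow> m' \<in> kkt_M T \<Longrightarrow> m * m' \<in> kkt_M T"
  using act_act[of m m' h] L_carrier[OF triple(2)] by (simp add: kkt_M_def G_times)

lemma M_inv: "m \<in> kkt_M T \<Longrightarrow> inv\<^bsub>GL n\<^esub> m \<in> kkt_M T"
  using act_inv(2)[of m h] L_carrier[OF triple(2)] G_inv(1)[of m] by (simp add: kkt_M_def)

lemma act_continuous:
  assumes g: "g \<in> kkt_G T" and S: "S \<subseteq> carrier_mat n n" and gS: "\<And>y. y \<in> S \<Longrightarrow> kkt_act T g y \<in> S"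
  shows "continuous_map (tpl S) (tpl S) (kkt_act T g)"
  unfolding continuous_map_def topspace_sub[OF S]
proof (intro conjI allI impI)
  show "kkt_act T g \<in> S \<rightarrow> S" using gS by (intro funcsetI)
  fix U assume U: "openin (tpl S) U"
  have cv: "conv (\<lambda>y. entries n (kkt_act T g y) p) (entries n (kkt_act T g x) p) (nhm n x)"
    if x: "x \<in> carrier_mat n n" for x p
  proof -
    obtain i j where p: "p = (i, j)" by (cases p)
    show ?thesis
    proof (cases "i < n \<and> j < n")
      case True
      let ?F = "\<lambda>y. \<Sum>b<n. \<Sum>a<n. g $$ (i, a) * entries n y (a, b) * (inv\<^bsub>GL n\<^esub> g) $$ (b, j)"
      have e: "entries n (kkt_act T g y) (i, j) = ?F y" if y: "y \<in> carrier_mat n n" for y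
        using True entries_act[OF g y, of i j] by (simp add: entries_def)
      have "conv ?F (?F x) (nhm n x)"
        by (intro conv_sum conv_mult conv_const conv_entries)
      then have "conv ?F (entries n (kkt_act T g x) p) (nhm n x)" unfolding p e[OF x] .
      moreover have "eventually (\<lambda>y. entries n (kkt_act T g y) p = ?F y) (nhm n x)"
        unfolding p eventually_nhm by (intro exI[of _ 1] conjI ballI impI e) simp_all
      ultimately show ?thesis by (rule conv_cong)
    next
      case False
      then have "entries n A p = 0" for A :: "'k mat" by (auto simp: p entries_def)
      then show ?thesis by (simp add: conv_const)
    qed
  qed
  show "openin (tpl S) {x \<in> S. kkt_act T g x \<in> U}"
    unfolding openin_sub_iff[OF S]
  proof (intro conjI ballI)
    fix x assume x: "x \<in> {x \<in> S. kkt_act T g x \<in> U}"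
    then have "eventually (\<lambda>z. z \<in> S \<longrightarrow> z \<in> U) (nhm n (kkt_act T g x))"
      using U unfolding openin_sub_iff[OF S] by simp
    then obtain \<delta> where \<delta>: "0 < \<delta>"
      "\<forall>z\<in>carrier_mat n n. matdist n (kkt_act T g x) z < \<delta> \<longrightarrow> z \<in> S \<longrightarrow> z \<in> U"
      unfolding eventually_nhm by (elim exE conjE)
    have "x \<in> carrier_mat n n" using x S by (auto dest: subsetD)
    from eventually_mdist'[OF cv[OF this] \<delta>(1)]
    show "eventually (\<lambda>y. y \<in> S \<longrightarrow> y \<in> {x \<in> S. kkt_act T g x \<in> U}) (nhm n x)"
      by (rule eventually_mono) (use \<delta>(2) gS subsetD[OF S] in simp)
  qed auto
qed

subsection \<open>The measure has full support\<close>

lemma act_omega: "m \<in> kkt_M T \<Longrightarrow> y \<in> \<omega> \<Longrightarrow> kkt_act T m y \<in> \<omega>"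
  and omega_transitive: "y \<in> \<omega> \<Longrightarrow> z \<in> \<omega> \<Longrightarrow> \<exists>m\<in>kkt_M T. z = kkt_act T m y"
proof -
  obtain x0 where x0: "x0 \<in> kkt_Nbar T" "\<omega> = {kkt_act T m x0 | m. m \<in> kkt_M T}"
    using orbit unfolding kkt_orbit_def by (elim bexE)
  note c = Nbar_carrier[OF x0(1)]
  show "kkt_act T m y \<in> \<omega>" if m: "m \<in> kkt_M T" and y: "y \<in> \<omega>"
  proof -
    obtain k where k: "k \<in> kkt_M T" "y = kkt_act T k x0" using y x0(2) by auto
    have "kkt_act T m y = kkt_act T (m * k) x0" unfolding k(2) by (rule act_act[OF M_G[OF m] M_G[OF k(1)] c, symmetric])
    then show ?thesis using M_mult[OF m k(1)] x0(2) by auto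
  qed
  show "\<exists>m\<in>kkt_M T. z = kkt_act T m y" if y: "y \<in> \<omega>" and z: "z \<in> \<omega>"
  proof -
    obtain k where k: "k \<in> kkt_M T" "y = kkt_act T k x0" using y x0(2) by auto
    obtain k' where k': "k' \<in> kkt_M T" "z = kkt_act T k' x0" using z x0(2) by auto
    have "kkt_act T (k' * inv\<^bsub>GL n\<^esub> k) y = kkt_act T k' (kkt_act T (inv\<^bsub>GL n\<^esub> k) y)"
      by (rule act_act[OF M_G[OF k'(1)] M_G[OF M_inv[OF k(1)]]]) (use y omega_sub in auto)
    also have "kkt_act T (inv\<^bsub>GL n\<^esub> k) y = x0" unfolding k(2) by (rule act_inv(2)[OF M_G[OF k(1)] c])
    finally show ?thesis using M_mult[OF k'(1) M_inv[OF k(1)]] k'(2) by (intro bexI) simp_all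
  qed
qed

lemma measure_facts:
  "space \<mu> = \<omega>" "openin (tpl \<omega>) U \<Longrightarrow> U \<in> sets \<mu>" "emeasure \<mu> \<omega> \<noteq> 0"
  "m \<in> kkt_M T \<Longrightarrow> A \<in> sets \<mu> \<Longrightarrow> emeasure \<mu> (kkt_act T m ` A) = ennreal (1 / (cmod (\<nu> m))\<^sup>2) * emeasure \<mu> A"
  using quasi_inv by (auto simp: quasi_invariant_measure_def intro: sigma_sets.Basic)

lemma act_open:
  assumes m: "m \<in> kkt_M T" and U: "openin (tpl \<omega>) U"
  shows "openin (tpl \<omega>) (kkt_act T m ` U)"
proof -
  have sub: "U \<subseteq> \<omega>" using U unfolding openin_sub_iff[OF omega_sub] by (rule conjunct1)
  have "kkt_act T m ` U = {x \<in> \<omega>. kkt_act T (inv\<^bsub>GL n\<^esub> m) x \<in> U}" (is "?A = ?B")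
  proof (rule subset_antisym; rule subsetI)
    fix z assume "z \<in> ?A"
    then obtain y where y: "y \<in> U" "z = kkt_act T m y" by (elim imageE)
    have "y \<in> \<omega>" using y sub by (auto dest: subsetD)
    then show "z \<in> ?B"
      using y act_omega[OF m] act_inv(2)[OF M_G[OF m] subsetD[OF omega_sub]] by simp
  next
    fix z assume "z \<in> ?B"
    then have z: "z \<in> \<omega>" "kkt_act T (inv\<^bsub>GL n\<^esub> m) z \<in> U" by simp_all
    then show "z \<in> ?A"
      using act_inv(1)[OF M_G[OF m] subsetD[OF omega_sub z(1)]] by (intro image_eqI[OF _ z(2)]) simp
  qed
  also have "openin (tpl \<omega>) \<dots>"
    by (rule openin_continuous_map_preimage[OF act_continuous[OF M_G[OF M_inv[OF m]] omega_sub act_omega[OF M_inv[OF m]]] U,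
        unfolded topspace_sub[OF omega_sub]])
  finally show ?thesis .
qed

lemma null_open_empty:
  assumes U: "openin (tpl \<omega>) U" and null: "emeasure \<mu> U = 0"
  shows "U = {}"
proof (rule ccontr)
  assume "U \<noteq> {}"
  then obtain x where x: "x \<in> U" by auto
  have sub: "U \<subseteq> \<omega>" using U unfolding openin_sub_iff[OF omega_sub] by (rule conjunct1)
  have xo: "x \<in> \<omega>" using x sub by (rule rev_subsetD)
  obtain Q where Q: "countable Q" "Q \<subseteq> carrier_mat n n"
    "\<forall>y\<in>carrier_mat n n. \<forall>\<epsilon>>0. \<exists>q\<in>Q. matdist n q y < \<epsilon>"
    using mat_countable_net[of n] by (elim exE conjE)
  \<comment> \<open>The translates of \<open>U\<close> may be uncountably many, so the cover is made
    of balls from a countable stock, each contained in some null translate.\<close>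
  define B where "B = (\<lambda>(q, k :: nat). {y \<in> \<omega>. matdist n q y < 1 / real (Suc k)})"
  define good where "good = {(q, k). q \<in> Q \<and> (\<exists>m\<in>kkt_M T. B (q, k) \<subseteq> kkt_act T m ` U)}"
  have good_countable: "countable good"
    by (rule countable_subset[of _ "Q \<times> UNIV"]) (auto simp: good_def Q(1))
  have cover: "\<omega> \<subseteq> (\<Union>p\<in>good. B p)"
  proof
    fix y assume y: "y \<in> \<omega>"
    obtain m where m: "m \<in> kkt_M T" "y = kkt_act T m x" using omega_transitive[OF xo y] by (elim bexE)
    have "openin (tpl \<omega>) (kkt_act T m ` U)" by (rule act_open[OF m(1) U])
    then have "eventually (\<lambda>z. z \<in> \<omega> \<longrightarrow> z \<in> kkt_act T m ` U) (nhm n y)"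
      unfolding openin_sub_iff[OF omega_sub] using m(2) x by simp
    then obtain \<delta> where \<delta>: "0 < \<delta>" "\<forall>z\<in>carrier_mat n n. matdist n y z < \<delta> \<longrightarrow> z \<in> \<omega> \<longrightarrow> z \<in> kkt_act T m ` U"
      unfolding eventually_nhm by (elim exE conjE)
    obtain k where k: "1 / real (Suc k) < \<delta>" using nat_approx_posE[OF \<delta>(1)] by auto
    have yc: "y \<in> carrier_mat n n" using omega_sub y by (rule subsetD)
    have "(0::real) < 1 / real (Suc k)" by simp
    from mp[OF spec[OF bspec[OF Q(3) yc]] this]
    obtain q where q: "q \<in> Q" "matdist n q y < 1 / real (Suc k)" ..
    have "B (q, k) \<subseteq> kkt_act T m ` U"
    proof
      fix z assume "z \<in> B (q, k)"
      then have z: "z \<in> \<omega>" "matdist n q z < 1 / real (Suc k)" by (simp_all add: B_def)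
      have "matdist n y z < 1 / real (Suc k)"
        by (rule le_less_trans[OF matdist_ultra[of n y z q]]) (use q z in \<open>simp add: matdist_sym[of n y q]\<close>)
      then have "matdist n y z < \<delta>" using k by simp
      then show "z \<in> kkt_act T m ` U" using \<delta>(2) z(1) subsetD[OF omega_sub z(1)] by simp
    qed
    then have "(q, k) \<in> good" using q(1) m(1) by (auto simp: good_def)
    moreover have "y \<in> B (q, k)" using y q(2) by (simp add: B_def)
    ultimately show "y \<in> (\<Union>p\<in>good. B p)" by (rule UN_I)
  qed
  have Bopen: "openin (tpl \<omega>) (B p)" for p
    unfolding B_def by (cases p) (simp add: openin_matball[OF omega_sub])
  have "B p \<in> null_sets \<mu>" if p: "p \<in> good" for p
  proof -
    obtain m where m: "m \<in> kkt_M T" "B p \<subseteq> kkt_act T m ` U" using p by (auto simp: good_def)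
    have "emeasure \<mu> (kkt_act T m ` U) = 0"
      using measure_facts(4)[OF m(1) measure_facts(2)[OF U]] null by simp
    then have "emeasure \<mu> (B p) \<le> 0"
      using emeasure_mono[OF m(2) measure_facts(2)[OF act_open[OF m(1) U]]] by simp
    then show ?thesis using measure_facts(2)[OF Bopen] by (auto simp: null_sets_def)
  qed
  then have N: "(\<Union>p\<in>good. B p) \<in> null_sets \<mu>" by (intro null_sets_UN' good_countable)
  have "emeasure \<mu> \<omega> \<le> emeasure \<mu> (\<Union>p\<in>good. B p)"
    by (rule emeasure_mono[OF cover]) (use N in auto)
  also have "\<dots> = 0" using N by auto
  finally show False using measure_facts(3) by simp
qed

abbreviation "lc \<equiv> locally_constant (tpl \<omega>)"

lemma lc_iff: "lc u \<longleftrightarrow> (\<forall>x\<in>\<omega>. eventually (\<lambda>y. y \<in> \<omega> \<longrightarrow> u y = u x) (nhm n x))"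
  by (rule locally_constant_sub[OF omega_sub])

lemma lc_comb:
  assumes "lc u" "lc w"
  shows "lc (\<lambda>y. F (u y) (w y))"
  unfolding lc_iff
proof
  fix x assume x: "x \<in> \<omega>"
  from assms have "eventually (\<lambda>y. y \<in> \<omega> \<longrightarrow> u y = u x) (nhm n x)"
    "eventually (\<lambda>y. y \<in> \<omega> \<longrightarrow> w y = w x) (nhm n x)" using x unfolding lc_iff by simp_all
  then show "eventually (\<lambda>y. y \<in> \<omega> \<longrightarrow> F (u y) (w y) = F (u x) (w x)) (nhm n x)"
    by eventually_elim simp
qed

lemma lc_open: "lc u \<Longrightarrow> openin (tpl \<omega>) {y \<in> \<omega>. u y \<in> S}"
  unfolding openin_sub_iff[OF omega_sub]
proof (intro conjI ballI)
  fix x assume u: "lc u" and x: "x \<in> {y \<in> \<omega>. u y \<in> S}"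
  then have "eventually (\<lambda>y. y \<in> \<omega> \<longrightarrow> u y = u x) (nhm n x)" unfolding lc_iff by simp
  then show "eventually (\<lambda>y. y \<in> \<omega> \<longrightarrow> y \<in> {y \<in> \<omega>. u y \<in> S}) (nhm n x)"
    by (rule eventually_mono) (use x in auto)
qed auto

lemma lc_measurable:
  fixes u :: "'k mat \<Rightarrow> complex"
  assumes u: "lc u"
  shows "u \<in> borel_measurable \<mu>"
proof (rule measurableI)
  fix S :: "complex set"
  have "{y \<in> \<omega>. u y \<in> S} \<in> sets \<mu>" by (intro measure_facts(2) lc_open u)
  moreover have "u -` S \<inter> space \<mu> = {y \<in> \<omega>. u y \<in> S}" by (auto simp: measure_facts(1))
  ultimately show "u -` S \<inter> space \<mu> \<in> sets \<mu>" by simp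
qed auto

text \<open>The set where the two functions differ is open and null, hence empty.\<close>

lemma lc_ae_eq:
  assumes u: "lc u" and w: "lc w" and ae: "AE y in \<mu>. u y = w y" and y: "y \<in> \<omega>"
  shows "u y = w y"
proof -
  let ?U = "{y \<in> \<omega>. (u y = w y) \<in> {False}}"
  have U: "openin (tpl \<omega>) ?U" by (rule lc_open[OF lc_comb[OF u w]])
  have "{y \<in> space \<mu>. \<not> u y = w y} = ?U" by (simp add: measure_facts(1))
  from AE_iff_measurable[OF measure_facts(2)[OF U] this, THEN iffD1, OF ae]
  have "emeasure \<mu> ?U = 0" .
  from null_open_empty[OF U this] y show ?thesis by auto
qed

end

subsection \<open>Smooth vectors\<close>

lemma (in group) subgroup_conj:
  assumes KK: "subgroup KK G" and a: "a \<in> carrier G"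
  shows "subgroup ((\<lambda>k. a \<otimes> k \<otimes> inv a) ` KK) G"
proof (rule subgroupI)
  note sub = subgroup.mem_carrier[OF KK]
  show "(\<lambda>k. a \<otimes> k \<otimes> inv a) ` KK \<subseteq> carrier G" using sub a by auto
  show "(\<lambda>k. a \<otimes> k \<otimes> inv a) ` KK \<noteq> {}" using subgroup.one_closed[OF KK] by auto
  fix g assume "g \<in> (\<lambda>k. a \<otimes> k \<otimes> inv a) ` KK"
  then obtain k where k: "k \<in> KK" "g = a \<otimes> k \<otimes> inv a" by (elim imageE)
  have "inv g = a \<otimes> inv k \<otimes> inv a"
    unfolding k(2) using sub[OF k(1)] a by (simp add: inv_mult_group m_assoc)
  then show "inv g \<in> (\<lambda>k. a \<otimes> k \<otimes> inv a) ` KK" using subgroup.m_inv_closed[OF KK k(1)] by (rule image_eqI)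
next
  note sub = subgroup.mem_carrier[OF KK]
  fix g g' assume "g \<in> (\<lambda>k. a \<otimes> k \<otimes> inv a) ` KK" "g' \<in> (\<lambda>k. a \<otimes> k \<otimes> inv a) ` KK"
  then obtain k k' where k: "k \<in> KK" "g = a \<otimes> k \<otimes> inv a" "k' \<in> KK" "g' = a \<otimes> k' \<otimes> inv a"
    by (elim imageE)
  have "inv a \<otimes> (a \<otimes> (k' \<otimes> inv a)) = k' \<otimes> inv a"
    using sub[OF k(3)] a by (simp add: m_assoc[symmetric])
  then have "g \<otimes> g' = a \<otimes> (k \<otimes> k') \<otimes> inv a"
    unfolding k(2,4) using sub[OF k(1)] sub[OF k(3)] a by (simp add: m_assoc)
  then show "g \<otimes> g' \<in> (\<lambda>k. a \<otimes> k \<otimes> inv a) ` KK" using subgroup.m_closed[OF KK k(1,3)] by (rule image_eqI)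
qed

context kkt_rep begin

abbreviation "GG \<equiv> mat_subgroup n (kkt_G T)"
abbreviation "V \<equiv> smooth_vectors v T \<omega> \<mu> \<Phi>"

lemma GG_group: "group GG"
proof -
  interpret GLk: group "GL n :: 'k mat monoid" by (rule GL_group)
  show ?thesis by (rule GLk.subgroup_imp_group[OF subgroup_G])
qed

lemma GG_simps: "carrier GG = kkt_G T" "mult GG = (*)" "one GG = 1\<^sub>m n"
  "a \<in> kkt_G T \<Longrightarrow> inv\<^bsub>GG\<^esub> a = inv\<^bsub>GL n\<^esub> a"
proof -
  interpret GLk: group "GL n :: 'k mat monoid" by (rule GL_group)
  show "carrier GG = kkt_G T" "mult GG = (*)" "one GG = 1\<^sub>m n" by (simp_all add: GL_mult GL_one)
  show "a \<in> kkt_G T \<Longrightarrow> inv\<^bsub>GG\<^esub> a = inv\<^bsub>GL n\<^esub> a" by (rule GLk.m_inv_consistent[OF subgroup_G])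
qed

lemma rep:
  "g \<in> kkt_G T \<Longrightarrow> u \<in> L2 \<mu> \<Longrightarrow> \<Phi> g u \<in> L2 \<mu>"
  "g \<in> kkt_G T \<Longrightarrow> u \<in> L2 \<mu> \<Longrightarrow> w \<in> L2 \<mu> \<Longrightarrow> eq_L2 \<mu> u w \<Longrightarrow> eq_L2 \<mu> (\<Phi> g u) (\<Phi> g w)"
  "g \<in> kkt_G T \<Longrightarrow> u \<in> L2 \<mu> \<Longrightarrow> w \<in> L2 \<mu> \<Longrightarrow>
    eq_L2 \<mu> (\<Phi> g (\<lambda>y. a * u y + b * w y)) (\<lambda>y. a * \<Phi> g u y + b * \<Phi> g w y)"
  "u \<in> L2 \<mu> \<Longrightarrow> eq_L2 \<mu> (\<Phi> (1\<^sub>m n) u) u"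
  "g \<in> kkt_G T \<Longrightarrow> k \<in> kkt_G T \<Longrightarrow> u \<in> L2 \<mu> \<Longrightarrow> eq_L2 \<mu> (\<Phi> (g * k) u) (\<Phi> g (\<Phi> k u))"
  "g \<in> kkt_N T \<Longrightarrow> u \<in> L2 \<mu> \<Longrightarrow> eq_L2 \<mu> (\<Phi> g u) (pi_N T \<psi> g u)"
  using extends unfolding extends_pi_def unitary_representation_def GG_simps by simp_all

lemma eq_L2_trans: "eq_L2 \<mu> u w \<Longrightarrow> eq_L2 \<mu> w z \<Longrightarrow> eq_L2 \<mu> u z"
  unfolding eq_L2_def by (elim AE_mp) (auto intro: AE_I2)

lemma eq_L2_sym: "eq_L2 \<mu> u w \<Longrightarrow> eq_L2 \<mu> w u"
  unfolding eq_L2_def by (rule AE_mp) (auto intro: AE_I2)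

lemma L2_comb:
  assumes u: "u \<in> L2 \<mu>" and w: "w \<in> L2 \<mu>"
  shows "(\<lambda>y. a * u y + b * w y) \<in> L2 \<mu>"
proof -
  have m: "u \<in> borel_measurable \<mu>" "w \<in> borel_measurable \<mu>"
    and i: "integrable \<mu> (\<lambda>y. (cmod (u y))\<^sup>2)" "integrable \<mu> (\<lambda>y. (cmod (w y))\<^sup>2)"
    using u w by (simp_all add: L2_def)
  have m': "(\<lambda>y. a * u y + b * w y) \<in> borel_measurable \<mu>" using m by measurable
  have "integrable \<mu> (\<lambda>y. (cmod (a * u y + b * w y))\<^sup>2)"
  proof (rule Bochner_Integration.integrable_bound)
    show "integrable \<mu> (\<lambda>y. 2 * (cmod a)\<^sup>2 * (cmod (u y))\<^sup>2 + 2 * (cmod b)\<^sup>2 * (cmod (w y))\<^sup>2)"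
      by (intro Bochner_Integration.integrable_add integrable_mult_right i)
    show "(\<lambda>y. (cmod (a * u y + b * w y))\<^sup>2) \<in> borel_measurable \<mu>" using m' by measurable
    have "(cmod (a * u y + b * w y))\<^sup>2 \<le> 2 * (cmod a)\<^sup>2 * (cmod (u y))\<^sup>2 + 2 * (cmod b)\<^sup>2 * (cmod (w y))\<^sup>2" for y
    proof -
      have "cmod (a * u y + b * w y) \<le> cmod a * cmod (u y) + cmod b * cmod (w y)"
        using norm_triangle_ineq[of "a * u y" "b * w y"] by (simp add: norm_mult)
      then have "(cmod (a * u y + b * w y))\<^sup>2 \<le> (cmod a * cmod (u y) + cmod b * cmod (w y))\<^sup>2"
        by (intro power_mono) auto
      also have "\<dots> \<le> 2 * (cmod a * cmod (u y))\<^sup>2 + 2 * (cmod b * cmod (w y))\<^sup>2"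
        using sum_squares_bound[of "cmod a * cmod (u y)" "cmod b * cmod (w y)"]
        by (simp add: power2_sum)
      finally show ?thesis by (simp add: power_mult_distrib mult.assoc)
    qed
    then show "AE y in \<mu>. norm ((cmod (a * u y + b * w y))\<^sup>2) \<le>
        norm (2 * (cmod a)\<^sup>2 * (cmod (u y))\<^sup>2 + 2 * (cmod b)\<^sup>2 * (cmod (w y))\<^sup>2)"
      by (intro AE_I2) (smt (verit) real_norm_def zero_le_power2)
  qed
  with m' show ?thesis by (simp add: L2_def)
qed

definition fixes_open :: "'k mat set \<Rightarrow> ('k mat \<Rightarrow> complex) \<Rightarrow> bool" where
  "fixes_open KK u \<longleftrightarrow> subgroup KK GG \<and> openin (tpl (kkt_G T)) KK \<and> compactin (tpl (kkt_G T)) KK \<and>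
     (\<forall>g\<in>KK. eq_L2 \<mu> (\<Phi> g u) u)"

lemma V_iff: "u \<in> V \<longleftrightarrow> u \<in> L2 \<mu> \<and> lc u \<and> (\<forall>y. y \<notin> \<omega> \<longrightarrow> u y = 0) \<and> (\<exists>KK. fixes_open KK u)"
  by (simp add: smooth_vectors_def fixes_open_def)

lemma VD:
  assumes "u \<in> V"
  shows "u \<in> L2 \<mu>" "lc u" "y \<notin> \<omega> \<Longrightarrow> u y = 0"
  using assms by (simp_all add: V_iff)

lemma KK_G: "fixes_open KK u \<Longrightarrow> g \<in> KK \<Longrightarrow> g \<in> kkt_G T"
  unfolding fixes_open_def using subgroup.mem_carrier[of KK GG g] by (simp add: GG_simps)

lemma hausdorff_G: "Hausdorff_space (tpl (kkt_G T))"
  unfolding mat_topology_eq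
  by (rule Hausdorff_space_subtopology[OF Metric_space.Hausdorff_space_mtopology[OF Metric_space_matdist]])

lemma V_comb:
  assumes u: "u \<in> V" and w: "w \<in> V"
  shows "(\<lambda>y. a * u y + b * w y) \<in> V"
proof -
  obtain K1 where K1: "fixes_open K1 u" using u unfolding V_iff by (elim conjE exE)
  obtain K2 where K2: "fixes_open K2 w" using w unfolding V_iff by (elim conjE exE)
  interpret GGg: group GG by (rule GG_group)
  have "fixes_open (K1 \<inter> K2) (\<lambda>y. a * u y + b * w y)"
    unfolding fixes_open_def
  proof (intro conjI ballI)
    show "subgroup (K1 \<inter> K2) GG"
      using K1 K2 unfolding fixes_open_def by (intro GGg.subgroups_Inter_pair) simp_all
    show "openin (tpl (kkt_G T)) (K1 \<inter> K2)"
      using K1 K2 unfolding fixes_open_def by (intro openin_Int) simp_all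
    \<comment> \<open>Compact sets are closed in a Hausdorff space, so the intersection of the two
      subgroups stays compact.\<close>
    show "compactin (tpl (kkt_G T)) (K1 \<inter> K2)"
      using K1 K2 unfolding fixes_open_def
      by (intro closed_Int_compactin compactin_imp_closedin[OF hausdorff_G]) simp_all
    fix g assume g: "g \<in> K1 \<inter> K2"
    then have gG: "g \<in> kkt_G T" using KK_G[OF K1] by simp
    have "eq_L2 \<mu> (\<Phi> g u) u" "eq_L2 \<mu> (\<Phi> g w) w" using g K1 K2 by (simp_all add: fixes_open_def)
    then have "eq_L2 \<mu> (\<lambda>y. a * \<Phi> g u y + b * \<Phi> g w y) (\<lambda>y. a * u y + b * w y)"
      unfolding eq_L2_def by eventually_elim simp
    then show "eq_L2 \<mu> (\<Phi> g (\<lambda>y. a * u y + b * w y)) (\<lambda>y. a * u y + b * w y)"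
      by (rule eq_L2_trans[OF rep(3)[OF gG VD(1)[OF u] VD(1)[OF w]]])
  qed
  then show ?thesis
    unfolding V_iff using L2_comb[OF VD(1)[OF u] VD(1)[OF w]] lc_comb[OF VD(2)[OF u] VD(2)[OF w], of "\<lambda>x y. a * x + b * y"]
      VD(3)[OF u] VD(3)[OF w] by auto
qed

lemma lc_psi:
  assumes A: "A \<in> E 2"
  shows "lc (\<lambda>y. psi_char T \<psi> y (mat_exp n A))"
  unfolding lc_iff psi_char_exp[OF A]
proof
  fix x assume "x \<in> \<omega>"
  from psi_char_locally_constant[OF A omega_Nbar[OF this]]
  show "eventually (\<lambda>y. y \<in> \<omega> \<longrightarrow> \<psi> (kap A (lg y)) = \<psi> (kap A (lg x))) (nhm n x)"
    by (rule eventually_mono) (simp add: omega_Nbar)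
qed

lemma pi_N_facts:
  assumes A: "A \<in> E 2" and u: "u \<in> V"
  shows "lc (pi_N T \<psi> (mat_exp n A) u)" "pi_N T \<psi> (mat_exp n A) u \<in> L2 \<mu>"
proof -
  show lcp: "lc (pi_N T \<psi> (mat_exp n A) u)"
    unfolding pi_N_def by (rule lc_comb[OF lc_psi[OF A] VD(2)[OF u]])
  have "cmod (pi_N T \<psi> (mat_exp n A) u y) = cmod (u y)" for y
    by (simp add: pi_N_def norm_mult psi_char_def psi_norm)
  then show "pi_N T \<psi> (mat_exp n A) u \<in> L2 \<mu>"
    using VD(1)[OF u] lc_measurable[OF lcp] by (simp add: L2_def)
qed

lemma exp_N: "A \<in> E 2 \<Longrightarrow> mat_exp n A \<in> kkt_N T"
  by (simp add: kkt_N_def)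

lemma exp_2_G: "A \<in> E 2 \<Longrightarrow> mat_exp n A \<in> kkt_G T"
  by (rule exp_G[of _ 2]) simp_all

text \<open>If \<open>KK\<close> fixes \<open>u\<close>, its conjugate by exp(A) fixes the translate
  of \<open>u\<close>, and conjugation is a homeomorphism of the group. The identities hold almost
  everywhere only, hence the chain of \<open>eq_L2\<close> steps.\<close>

lemma V_pi:
  assumes A: "A \<in> E 2" and u: "u \<in> V"
  shows "pi_N T \<psi> (mat_exp n A) u \<in> V"
proof -
  let ?a = "mat_exp n A" and ?w = "pi_N T \<psi> (mat_exp n A) u"
  obtain KK where KK: "fixes_open KK u" using u unfolding V_iff by (elim conjE exE)
  interpret GGg: group GG by (rule GG_group)
  have aG: "?a \<in> kkt_G T" by (rule exp_2_G[OF A])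
  let ?b = "inv\<^bsub>GL n\<^esub> ?a"
  note b = G_inv[OF aG]
  note uL = VD(1)[OF u] and wL = pi_N_facts(2)[OF A u]
  let ?C = "kkt_act T ?a ` KK"
  have actG: "kkt_act T g y \<in> kkt_G T" if "g \<in> kkt_G T" "y \<in> kkt_G T" for g y
    unfolding kkt_act_def by (intro G_times that G_inv)
  have wu: "eq_L2 \<mu> (\<Phi> ?b ?w) u"
  proof -
    have "eq_L2 \<mu> (\<Phi> ?b ?w) (\<Phi> ?b (\<Phi> ?a u))"
      by (rule rep(2)[OF b(1) wL rep(1)[OF aG uL] eq_L2_sym[OF rep(6)[OF exp_N[OF A] uL]]])
    moreover have "eq_L2 \<mu> (\<Phi> ?b (\<Phi> ?a u)) (\<Phi> (?b * ?a) u)" by (rule eq_L2_sym[OF rep(5)[OF b(1) aG uL]])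
    moreover have "eq_L2 \<mu> (\<Phi> (?b * ?a) u) u" unfolding b(4) by (rule rep(4)[OF uL])
    ultimately show ?thesis by (blast intro: eq_L2_trans)
  qed
  have "fixes_open ?C ?w"
    unfolding fixes_open_def
  proof (intro conjI ballI)
    have sg: "subgroup KK GG" and op: "openin (tpl (kkt_G T)) KK" and cp: "compactin (tpl (kkt_G T)) KK"
      using KK by (simp_all add: fixes_open_def)
    have ac: "?a \<in> carrier GG" using aG by (simp only: GG_simps)
    have act_fun: "kkt_act T ?a = (\<lambda>k. ?a * k * ?b)" by (rule ext) (simp only: kkt_act_def)
    from GGg.subgroup_conj[OF sg ac] show "subgroup ?C GG"
      by (simp only: GG_simps(2) GG_simps(4)[OF aG] act_fun)
    show "compactin (tpl (kkt_G T)) ?C"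
      by (rule image_compactin[OF cp act_continuous[OF aG G_sub actG[OF aG]]])
    have "?C = {x \<in> kkt_G T. kkt_act T ?b x \<in> KK}"
    proof (rule subset_antisym; rule subsetI)
      fix z assume "z \<in> ?C"
      then obtain k where k: "k \<in> KK" "z = kkt_act T ?a k" by (elim imageE)
      note kG = KK_G[OF KK k(1)]
      show "z \<in> {x \<in> kkt_G T. kkt_act T ?b x \<in> KK}"
        using k actG[OF aG kG] act_inv(2)[OF aG G_car[OF kG]] by simp
    next
      fix z assume "z \<in> {x \<in> kkt_G T. kkt_act T ?b x \<in> KK}"
      then have z: "z \<in> kkt_G T" "kkt_act T ?b z \<in> KK" by simp_all
      show "z \<in> ?C" by (rule image_eqI[OF _ z(2)]) (simp only: act_inv(1)[OF aG G_car[OF z(1)]])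
    qed
    moreover have "openin (tpl (kkt_G T)) {x \<in> kkt_G T. kkt_act T ?b x \<in> KK}"
      by (rule openin_continuous_map_preimage[OF act_continuous[OF b(1) G_sub actG[OF b(1)]] op, unfolded topspace_sub[OF G_sub]])
    ultimately show "openin (tpl (kkt_G T)) ?C" by simp
    fix g assume "g \<in> ?C"
    then obtain k where k: "k \<in> KK" "g = kkt_act T ?a k" by (elim imageE)
    note kG = KK_G[OF KK k(1)]
    have ku: "eq_L2 \<mu> (\<Phi> k u) u" using KK k(1) by (simp add: fixes_open_def)
    have akG: "?a * k \<in> kkt_G T" by (rule G_times[OF aG kG])
    have "eq_L2 \<mu> (\<Phi> (?a * k * ?b) ?w) (\<Phi> (?a * k) (\<Phi> ?b ?w))" by (rule rep(5)[OF akG b(1) wL])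
    moreover have "eq_L2 \<mu> (\<Phi> (?a * k) (\<Phi> ?b ?w)) (\<Phi> (?a * k) u)"
      by (rule rep(2)[OF akG rep(1)[OF b(1) wL] uL wu])
    moreover have "eq_L2 \<mu> (\<Phi> (?a * k) u) (\<Phi> ?a (\<Phi> k u))" by (rule rep(5)[OF aG kG uL])
    moreover have "eq_L2 \<mu> (\<Phi> ?a (\<Phi> k u)) (\<Phi> ?a u)" by (rule rep(2)[OF aG rep(1)[OF kG uL] uL ku])
    moreover have "eq_L2 \<mu> (\<Phi> ?a u) ?w" by (rule rep(6)[OF exp_N[OF A] uL])
    ultimately show "eq_L2 \<mu> (\<Phi> g ?w) ?w"
      unfolding k(2) kkt_act_def by (blast intro: eq_L2_trans)
  qed
  moreover have "?w y = 0" if "y \<notin> \<omega>" for y using VD(3)[OF u that] by (simp add: pi_N_def)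
  ultimately show ?thesis unfolding V_iff using pi_N_facts[OF A u] by auto
qed

text \<open>\<open>chi A y = \<psi>\<^sub>y (exp A)\<close>\<close>

abbreviation "chi A y \<equiv> \<psi> (kap A (lg y))"

lemma chi_smult: "A \<in> E 2 \<Longrightarrow> y \<in> kkt_Nbar T \<Longrightarrow> chi (c \<cdot>\<^sub>m A) y = \<psi> (c * kap A (lg y))"
  by (simp add: kap_smult_left[OF E_L E_L[OF lg_E]])

text \<open>For \<open>c\<close> near 0, exp(c A) lies in the open subgroup fixing \<open>u\<close>,
  so multiplication by its character leaves \<open>u\<close> unchanged, at every point by local
  constancy. The bound on \<open>c\<close> is uniform over the support of \<open>u\<close>.\<close>

lemma small_multiples:
  assumes u: "u \<in> V" and A: "A \<in> E 2" and x: "x \<in> kkt_Nbar T"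
  shows "\<exists>\<delta>>0. \<forall>c. v c < \<delta> \<longrightarrow> \<psi> (c * kap A (lg x)) = 1 \<and>
    (\<forall>y\<in>\<omega>. u y \<noteq> 0 \<longrightarrow> \<psi> (c * kap A (lg y)) = 1)"
proof -
  obtain KK where KK: "fixes_open KK u" using u unfolding V_iff by (elim conjE exE)
  have oneK: "1\<^sub>m n \<in> KK" using KK subgroup.one_closed[of KK GG] by (simp add: fixes_open_def GL_one)
  have "eventually (\<lambda>g. g \<in> kkt_G T \<longrightarrow> g \<in> KK) (nhm n (1\<^sub>m n))"
    using KK oneK unfolding fixes_open_def openin_sub_iff[OF G_sub] by simp
  then obtain \<epsilon> where \<epsilon>: "0 < \<epsilon>" "\<forall>g\<in>carrier_mat n n. matdist n (1\<^sub>m n) g < \<epsilon> \<longrightarrow> g \<in> kkt_G T \<longrightarrow> g \<in> KK"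
    unfolding eventually_nhm by (elim exE conjE)
  have exp0: "mat_exp n (0\<^sub>m n n) = (1\<^sub>m n :: 'k mat)"
  proof (rule eq_matI)
    fix i j assume "i < dim_row (1\<^sub>m n :: 'k mat)" "j < dim_col (1\<^sub>m n :: 'k mat)"
    then have ij: "i < n" "j < n" by simp_all
    have z: "((0\<^sub>m n n :: 'k mat) ^\<^sub>m Suc l) $$ (i, j) = 0" for l
      using ij right_mult_zero_mat[OF pow_carrier_mat[OF zero_carrier_mat[of n n]], of n l] by simp
    have "mat_exp n (0\<^sub>m n n :: 'k mat) $$ (i, j) = (\<Sum>l<n. ((0\<^sub>m n n :: 'k mat) ^\<^sub>m l) $$ (i, j) / fact l)"
      using ij by (simp add: mat_exp_def)
    also have "\<dots> = (\<Sum>l<n. if l = 0 then (1\<^sub>m n :: 'k mat) $$ (i, j) else 0)"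
    proof (rule sum.cong[OF refl])
      fix l show "((0\<^sub>m n n :: 'k mat) ^\<^sub>m l) $$ (i, j) / fact l = (if l = 0 then (1\<^sub>m n :: 'k mat) $$ (i, j) else 0)"
        by (cases l) (simp_all add: z del: pow_mat.simps(2))
    qed
    also have "\<dots> = (1\<^sub>m n :: 'k mat) $$ (i, j)" using ij by (simp only: sum.delta finite_lessThan lessThan_iff) simp
    finally show "mat_exp n (0\<^sub>m n n :: 'k mat) $$ (i, j) = (1\<^sub>m n :: 'k mat) $$ (i, j)" .
  qed (simp_all add: mat_exp_def)
  have "eventually (\<lambda>y. matdist n (mat_exp n (0\<^sub>m n n)) (mat_exp n y) < \<epsilon>) (nhm n (0\<^sub>m n n))"
    by (rule eventually_mdist'[OF conv_exp[OF zero_carrier_mat] \<epsilon>(1)])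
  then obtain \<eta> where \<eta>: "0 < \<eta>"
    "\<forall>y\<in>carrier_mat n n. matdist n (0\<^sub>m n n) y < \<eta> \<longrightarrow> matdist n (1\<^sub>m n) (mat_exp n y) < \<epsilon>"
    unfolding eventually_nhm exp0 by (elim exE conjE)
  obtain \<delta>1 where \<delta>1: "\<delta>1 > 0 \<and> (\<forall>a. v a < \<delta>1 \<longrightarrow> \<psi> a = 1)"
    using character_trivial_near_0[OF psi] ..
  \<comment> \<open>One bound for the entries of \<open>A\<close> and for the pairing at
    \<open>x\<close>; the summand 1 makes it positive and the inequalities strict.\<close>
  define b where "b = matdist n (0\<^sub>m n n) A + v (kap A (lg x)) + 1"
  have b: "0 < b" "matdist n (0\<^sub>m n n) A < b" "v (kap A (lg x)) < b"
    using matdist_nonneg[of n "0\<^sub>m n n" A] v_nonneg[of "kap A (lg x)"] by (simp_all add: b_def)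
  define \<delta> where "\<delta> = min \<eta> \<delta>1 / b"
  have \<delta>: "0 < \<delta>" using \<eta>(1) \<delta>1 b(1) by (simp add: \<delta>_def)
  have sm: "v c * t < min \<eta> \<delta>1" if "v c < \<delta>" "0 \<le> t" "t < b" for c t
  proof -
    have "v c * t \<le> v c * b" using that(3) by (intro mult_left_mono v_nonneg) simp
    also have "\<dots> < min \<eta> \<delta>1" using that(1) b(1) unfolding \<delta>_def by (simp only: less_divide_eq if_True)
    finally show ?thesis .
  qed
  show ?thesis
  proof (intro exI[of _ \<delta>] conjI \<delta> allI impI ballI)
    fix c assume c: "v c < \<delta>"
    have "v (c * kap A (lg x)) < \<delta>1" using sm[OF c v_nonneg b(3)] by (simp add: v_mult)
    then show "\<psi> (c * kap A (lg x)) = 1" using \<delta>1 by simp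
    fix y assume y: "y \<in> \<omega>" and uy: "u y \<noteq> 0"
    have cA: "c \<cdot>\<^sub>m A \<in> E 2" by (rule E_smult[OF A])
    have "matdist n (0\<^sub>m n n) (c \<cdot>\<^sub>m A) < \<eta>"
      unfolding matdist_less[OF \<eta>(1)]
    proof (intro allI impI)
      fix i j assume ij: "i < n" "j < n"
      have e: "v (A $$ (i, j)) \<le> matdist n (0\<^sub>m n n) A"
        using matdist_le[OF matdist_nonneg, of n "0\<^sub>m n n" A n "0\<^sub>m n n" A] ij by (simp add: v_uminus)
      have "v c * v (A $$ (i, j)) < min \<eta> \<delta>1" by (rule sm[OF c v_nonneg]) (use e b(2) in simp)
      then show "v ((0\<^sub>m n n :: 'k mat) $$ (i, j) - (c \<cdot>\<^sub>m A) $$ (i, j)) < \<eta>"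
        using ij E_carrier[OF A] by (simp add: v_uminus v_mult)
    qed
    then have "matdist n (1\<^sub>m n) (mat_exp n (c \<cdot>\<^sub>m A)) < \<epsilon>"
      by (rule mp[OF bspec[OF \<eta>(2) E_carrier[OF cA]]])
    then have "mat_exp n (c \<cdot>\<^sub>m A) \<in> KK"
      by (rule mp[OF mp[OF bspec[OF \<epsilon>(2) mat_exp_carrier]] exp_2_G[OF cA]])
    then have "eq_L2 \<mu> (\<Phi> (mat_exp n (c \<cdot>\<^sub>m A)) u) u" using KK by (simp add: fixes_open_def)
    from eq_L2_trans[OF eq_L2_sym[OF rep(6)[OF exp_N[OF cA] VD(1)[OF u]]] this]
    have "pi_N T \<psi> (mat_exp n (c \<cdot>\<^sub>m A)) u y = u y"
      unfolding eq_L2_def by (rule lc_ae_eq[OF pi_N_facts(1)[OF cA u] VD(2)[OF u] _ y])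
    then have "chi (c \<cdot>\<^sub>m A) y = 1" using uy by (simp add: pi_N_def psi_char_exp[OF cA])
    then show "\<psi> (c * kap A (lg y)) = 1" by (simp only: chi_smult[OF A omega_Nbar[OF y]])
  qed
qed

end

subsection \<open>Averaging over one-parameter subgroups of \<open>N\<close>\<close>

locale kkt_functional = kkt_rep v T \<psi> \<omega> \<nu> \<mu> \<Phi>
  for v :: "'k::field_char_0 \<Rightarrow> real" and T \<psi> \<omega> \<nu> \<mu> \<Phi> +
  fixes x :: "'k mat" and ell :: "('k mat \<Rightarrow> complex) \<Rightarrow> complex"
  assumes x: "x \<in> kkt_Nbar T"
    and linear: "linear_functional_on (smooth_vectors v T \<omega> \<mu> \<Phi>) ell"
    and equivariant: "\<forall>g\<in>kkt_N T. \<forall>u\<in>smooth_vectors v T \<omega> \<mu> \<Phi>.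
      ell (pi_N T \<psi> g u) = psi_char T \<psi> x g * ell u"
begin

lemma ell_comb: "u \<in> V \<Longrightarrow> w \<in> V \<Longrightarrow> ell (\<lambda>y. a * u y + b * w y) = a * ell u + b * ell w"
  using linear unfolding linear_functional_on_def by simp

lemma ell_pi: "A \<in> E 2 \<Longrightarrow> u \<in> V \<Longrightarrow> ell (pi_N T \<psi> (mat_exp n A) u) = chi A x * ell u"
  using bspec[OF bspec[OF equivariant exp_N[of A]]] by (simp only: psi_char_exp)

lemma V_sum:
  fixes A :: "nat \<Rightarrow> 'k mat"
  assumes u: "u \<in> V" and A: "\<And>j. A j \<in> E 2"
  shows "(\<lambda>y. (\<Sum>j<m. b j * chi (A j) y) * u y) \<in> V \<and>
    ell (\<lambda>y. (\<Sum>j<m. b j * chi (A j) y) * u y) = (\<Sum>j<m. b j * chi (A j) x) * ell u"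
proof (induction m)
  case 0
  show ?case using V_comb[OF u u, of 0 0] ell_comb[OF u u, of 0 0] by simp
next
  case (Suc m)
  let ?w = "\<lambda>y. (\<Sum>j<m. b j * chi (A j) y) * u y"
  let ?p = "pi_N T \<psi> (mat_exp n (A m)) u"
  have e: "(\<lambda>y. (\<Sum>j<Suc m. b j * chi (A j) y) * u y) = (\<lambda>y. 1 * ?w y + b m * ?p y)"
    by (rule ext) (simp add: pi_N_def psi_char_exp[OF A] distrib_right)
  have w: "?w \<in> V" "ell ?w = (\<Sum>j<m. b j * chi (A j) x) * ell u" using Suc by simp_all
  show ?case
    unfolding e using V_comb[OF w(1) V_pi[OF A u], of 1 "b m"]
    by (simp only: ell_comb[OF w(1) V_pi[OF A u]] w(2) ell_pi[OF A u]) (simp add: distrib_right)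
qed

lemma average:
  assumes u: "u \<in> V" and A: "A \<in> E 2"
  shows "\<exists>u'. u' \<in> V \<and> ell u' = ell u \<and> (\<forall>y\<in>\<omega>. u' y = (if chi A y = chi A x then u y else 0))"
proof -
  obtain \<delta> where \<delta>: "0 < \<delta>" "\<forall>c. v c < \<delta> \<longrightarrow> \<psi> (c * kap A (lg x)) = 1 \<and>
    (\<forall>y\<in>\<omega>. u y \<noteq> 0 \<longrightarrow> \<psi> (c * kap A (lg y)) = 1)"
    using small_multiples[OF u A x] by (elim exE conjE)
  obtain q :: nat where q: "0 < q" "v (of_nat q) < \<delta>" using small_nat[OF \<delta>(1)] by (elim exE conjE)
  \<comment> \<open>These coefficients make \<open>S y\<close> the mean of the first q powers of
    \<open>chi A y / chi A x\<close>.\<close>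
  define b where "b j = 1 / of_nat q * inverse (chi A x) ^ j" for j
  define S where "S y = (\<Sum>j<q. b j * chi (of_nat j \<cdot>\<^sub>m A) y)" for y
  have chi_j: "b j * chi (of_nat j \<cdot>\<^sub>m A) y = 1 / of_nat q * (chi A y / chi A x) ^ j"
    if y: "y \<in> kkt_Nbar T" for j y
    by (simp only: chi_smult[OF A y] psi_of_nat) (simp add: b_def divide_inverse power_mult_distrib)
  have S: "S y = 1 / of_nat q * (\<Sum>j<q. (chi A y / chi A x) ^ j)" if y: "y \<in> kkt_Nbar T" for y
    unfolding S_def sum_distrib_left by (rule sum.cong[OF refl chi_j[OF y]])
  have one: "S y = 1" if "y \<in> kkt_Nbar T" "chi A y = chi A x" for y
  proof -
    have "chi A y / chi A x = 1" using that(2) psi_nonzero by simp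
    then show ?thesis unfolding S[OF that(1)] using q(1) by (simp del: divide_eq_1_iff)
  qed
  have chi_q: "chi A x ^ q = 1" "y \<in> \<omega> \<Longrightarrow> u y \<noteq> 0 \<Longrightarrow> chi A y ^ q = 1" for y
    using \<delta>(2) q(2) by (simp_all flip: psi_of_nat)
  \<comment> \<open>On the support of \<open>u\<close> the ratio is a q-th root of unity, and the
    first q powers of one different from 1 add up to 0.\<close>
  have zero: "S y = 0" if y: "y \<in> \<omega>" "u y \<noteq> 0" "chi A y \<noteq> chi A x" for y
  proof -
    have "chi A y / chi A x \<noteq> 1" using y(3) psi_nonzero by simp
    note geometric_sum[OF this, of q]
    moreover have "(chi A y / chi A x) ^ q = 1" by (simp only: power_divide chi_q(1) chi_q(2)[OF y(1,2)]) simp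
    ultimately show ?thesis unfolding S[OF omega_Nbar[OF y(1)]] by simp
  qed
  have "(\<lambda>y. S y * u y) \<in> V \<and> ell (\<lambda>y. S y * u y) = S x * ell u"
    unfolding S_def by (rule V_sum[OF u E_smult[OF A]])
  moreover have "S y * u y = (if chi A y = chi A x then u y else 0)" if y: "y \<in> \<omega>" for y
    using one[OF omega_Nbar[OF y]] zero[OF y] by (cases "u y = 0") auto
  ultimately show ?thesis using one[OF x refl] by (intro exI[of _ "\<lambda>y. S y * u y"]) simp
qed

lemma average_finite:
  assumes u: "u \<in> V" and "finite \<A>" "\<A> \<subseteq> E 2"
  shows "\<exists>u'. u' \<in> V \<and> ell u' = ell u \<and>
    (\<forall>y\<in>\<omega>. u' y = (if \<forall>A\<in>\<A>. chi A y = chi A x then u y else 0))"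
  using assms(2,3)
proof (induction \<A> rule: finite_induct)
  case empty
  show ?case using u by (intro exI[of _ u]) simp
next
  case (insert A \<A>)
  then have "\<A> \<subseteq> E 2" and A: "A \<in> E 2" by simp_all
  from insert.IH[OF this(1)] obtain w where w: "w \<in> V" "ell w = ell u"
    "\<forall>y\<in>\<omega>. w y = (if \<forall>A\<in>\<A>. chi A y = chi A x then u y else 0)" by (elim exE conjE)
  from average[OF w(1) A] obtain w' where w': "w' \<in> V" "ell w' = ell w"
    "\<forall>y\<in>\<omega>. w' y = (if chi A y = chi A x then w y else 0)" by (elim exE conjE)
  show ?case
    by (intro exI[of _ w'] conjI ballI w'(1)) (simp_all add: w'(2,3) w(2,3))
qed

subsection \<open>Separating points by characters of \<open>N\<close>\<close>

text \<open>If the difference t of the two pairings were not small, \<open>a / t\<close> would be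
  within \<open>\<delta>\<close> of some \<open>c'\<close> in the net. Then
  \<open>\<psi> (c' t) = 1\<close> by equality of characters and
  \<open>\<psi> ((a / t - c') t) = 1\<close> by \<open>small_multiples\<close>, so
  \<open>\<psi> a = 1\<close>. The net is chosen before \<open>y\<close>, although the support of
  \<open>u\<close> is not known to be bounded.\<close>

lemma separate_one:
  assumes u: "u \<in> V" and B: "B \<in> E 2" and \<kappa>: "0 < \<kappa>"
  shows "\<exists>\<A>. finite \<A> \<and> \<A> \<subseteq> E 2 \<and> (\<forall>y\<in>\<omega>. u y \<noteq> 0 \<longrightarrow> (\<forall>A\<in>\<A>. chi A y = chi A x) \<longrightarrow>
    v (kap B (lg y) - kap B (lg x)) < \<kappa>)"
proof -
  obtain a where a: "\<psi> a \<noteq> 1" using psi_nontrivial by (elim exE)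
  obtain \<delta> where \<delta>: "0 < \<delta>" "\<forall>c. v c < \<delta> \<longrightarrow> \<psi> (c * kap B (lg x)) = 1 \<and>
    (\<forall>y\<in>\<omega>. u y \<noteq> 0 \<longrightarrow> \<psi> (c * kap B (lg y)) = 1)"
    using small_multiples[OF u B x] by (elim exE conjE)
  \<comment> \<open>The radius bounds the size of \<open>a / t\<close> whenever t has absolute value
    at least \<open>\<kappa>\<close>.\<close>
  obtain F where F: "finite F" "\<forall>c. v c \<le> v a / \<kappa> \<longrightarrow> (\<exists>c'\<in>F. v (c - c') < \<delta>)"
    using finite_net[OF \<delta>(1), of "v a / \<kappa>"] by (elim exE conjE)
  have "v (kap B (lg y) - kap B (lg x)) < \<kappa>"
    if y: "y \<in> \<omega>" "u y \<noteq> 0" and eq: "\<forall>A\<in>(\<lambda>c. c \<cdot>\<^sub>m B) ` F. chi A y = chi A x" for y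
  proof (rule ccontr)
    let ?t = "kap B (lg y) - kap B (lg x)"
    assume "\<not> v ?t < \<kappa>"
    then have t: "\<kappa> \<le> v ?t" by simp
    then have vt: "0 < v ?t" "?t \<noteq> 0" using \<kappa> v_zero by auto
    have "v a / v ?t \<le> v a / \<kappa>" using t \<kappa> vt v_nonneg by (intro divide_left_mono mult_pos_pos) simp_all
    then have "v (a / ?t) \<le> v a / \<kappa>" by (simp only: divide_inverse v_mult v_inverse)
    then obtain c' where c': "c' \<in> F" "v (a / ?t - c') < \<delta>"
      using mp[OF spec[OF F(2)], of "a / ?t"] by auto
    have "chi (c' \<cdot>\<^sub>m B) y = chi (c' \<cdot>\<^sub>m B) x" using eq c'(1) by simp
    then have "\<psi> (c' * kap B (lg y)) = \<psi> (c' * kap B (lg x))"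
      by (simp only: chi_smult[OF B omega_Nbar[OF y(1)]] chi_smult[OF B x])
    then have 1: "\<psi> (c' * ?t) = 1" by (simp add: right_diff_distrib psi_diff psi_nonzero)
    have "\<psi> ((a / ?t - c') * kap B (lg y)) = 1" "\<psi> ((a / ?t - c') * kap B (lg x)) = 1"
      using mp[OF spec[OF \<delta>(2)] c'(2)] y by simp_all
    then have 2: "\<psi> ((a / ?t - c') * ?t) = 1" by (simp only: right_diff_distrib psi_diff) simp
    have "a = (a / ?t - c') * ?t + c' * ?t" using vt(2) by (simp add: left_diff_distrib)
    then have "\<psi> a = \<psi> ((a / ?t - c') * ?t) * \<psi> (c' * ?t)" using psi_add by metis
    then show False using a 1 2 by simp
  qed
  then show ?thesis using F(1) E_smult[OF B] by (intro exI[of _ "(\<lambda>c. c \<cdot>\<^sub>m B) ` F"]) auto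
qed

text \<open>By nondegeneracy, pairing with a basis of degree 2 is injective on degree -2, so the
  pairings serve as coordinates from which the entries are recovered linearly.\<close>

lemma pairing_coordinates:
  "\<exists>(d :: nat) b c. (\<forall>l<d. b l \<in> E 2) \<and> (\<forall>Y\<in>E (- 2). \<forall>p. entries n Y p = (\<Sum>l<d. c l p * kap (b l) Y))"
proof -
  interpret E2: mat_space n "E 2" by (rule mat_space_E)
  interpret Em: mat_space n "E (- 2)" by (rule mat_space_E)
  obtain d b where "mat_basis n (E 2) d b" by (rule E2.basis_exists)
  then interpret B: mat_space_basis n "E 2" d b by unfold_locales
  have form: "Em.lin_form (kap (b l))" if "l < d" for l
    unfolding Em.lin_form_def using E_L[OF B.basis_in[OF that]] E_L by (simp add: kap_add_right kap_smult_right)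
  have "Y = 0\<^sub>m n n" if Y: "Y \<in> E (- 2)" and z: "\<And>l. l < d \<Longrightarrow> kap (b l) Y = 0" for Y
  proof (rule nondeg[OF Y])
    fix A assume A: "A \<in> E 2"
    have "E2.lin_form (\<lambda>A. kap A Y)"
      unfolding E2.lin_form_def using E_L[OF Y] E_L by (simp add: kap_add_left kap_smult_left)
    from E2.lin_form_lincomb[OF this B.basis_in, of d "\<lambda>l. l" "B.coord A"]
    have "kap (lincomb_mat n d (B.coord A) b) Y = (\<Sum>l<d. B.coord A l * kap (b l) Y)" by simp
    then show "kap A Y = 0" using z by (simp flip: B.coord(1)[OF A])
  qed
  from Em.entries_from_forms[of d "\<lambda>l. kap (b l)", OF form this] obtain c where
    "\<forall>Y\<in>E (- 2). \<forall>p. entries n Y p = (\<Sum>l<d. c l p * kap (b l) Y)" ..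
  then show ?thesis using B.basis_in by (intro exI[of _ d] exI[of _ b] exI[of _ c]) simp
qed

lemma separate:
  assumes u: "u \<in> V" and \<epsilon>: "0 < \<epsilon>"
  shows "\<exists>\<A>. finite \<A> \<and> \<A> \<subseteq> E 2 \<and> (\<forall>y\<in>\<omega>. u y \<noteq> 0 \<longrightarrow> (\<forall>A\<in>\<A>. chi A y = chi A x) \<longrightarrow>
    matdist n x y < \<epsilon>)"
proof -
  let ?I = "{..<n} \<times> {..<n}"
  \<comment> \<open>Continuity of the exponential at \<open>lg x\<close> reduces closeness of points
    to closeness of their logarithms.\<close>
  have "eventually (\<lambda>Y. matdist n (mat_exp n (lg x)) (mat_exp n Y) < \<epsilon>) (nhm n (lg x))"
    by (rule eventually_mdist'[OF conv_exp[OF E_carrier[OF lg_E[OF x]]] \<epsilon>])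
  then obtain \<eta> where \<eta>: "0 < \<eta>"
    "\<forall>Y\<in>carrier_mat n n. matdist n (lg x) Y < \<eta> \<longrightarrow> matdist n x (mat_exp n Y) < \<epsilon>"
    unfolding eventually_nhm exp_lg[OF x] by (elim exE conjE)
  obtain d :: nat and b c where b: "\<forall>l<d. b l \<in> E 2"
    and c: "\<forall>Y\<in>E (- 2). \<forall>p. entries n Y p = (\<Sum>l<d. c l p * kap (b l) Y)"
    using pairing_coordinates by (elim exE conjE)
  \<comment> \<open>A strict bound for all coefficients: pairings within \<open>\<eta> / C\<close>
    give logarithms within \<open>\<eta>\<close>. By the ultrametric inequality the number of
    summands does not enter.\<close>
  define C where "C = 1 + (\<Sum>l<d. \<Sum>p\<in>?I. v (c l p))"
  have vC: "v (c l p) < C" if "l < d" "p \<in> ?I" for l p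
  proof -
    have "v (c l p) \<le> (\<Sum>p\<in>?I. v (c l p))"
      by (rule member_le_sum[OF that(2)]) (simp_all add: v_nonneg)
    also have "\<dots> \<le> (\<Sum>l<d. \<Sum>p\<in>?I. v (c l p))"
      by (rule member_le_sum[of l "{..<d}" "\<lambda>l. \<Sum>p\<in>?I. v (c l p)"]) (use that in \<open>simp_all add: sum_nonneg v_nonneg\<close>)
    finally show ?thesis by (simp add: C_def)
  qed
  have C: "0 < C" unfolding C_def by (intro add_pos_nonneg sum_nonneg v_nonneg) simp
  have \<kappa>: "0 < \<eta> / C" using \<eta>(1) C by simp
  have "\<exists>\<A>. l < d \<longrightarrow> finite \<A> \<and> \<A> \<subseteq> E 2 \<and> (\<forall>y\<in>\<omega>. u y \<noteq> 0 \<longrightarrow> (\<forall>A\<in>\<A>. chi A y = chi A x) \<longrightarrow>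
    v (kap (b l) (lg y) - kap (b l) (lg x)) < \<eta> / C)" for l
  proof (cases "l < d")
    case True
    show ?thesis using separate_one[OF u mp[OF spec[OF b] True] \<kappa>] by simp
  qed simp
  then have "\<forall>l. \<exists>\<A>. l < d \<longrightarrow> finite \<A> \<and> \<A> \<subseteq> E 2 \<and> (\<forall>y\<in>\<omega>. u y \<noteq> 0 \<longrightarrow> (\<forall>A\<in>\<A>. chi A y = chi A x) \<longrightarrow>
    v (kap (b l) (lg y) - kap (b l) (lg x)) < \<eta> / C)" ..
  from choice[OF this] obtain \<A> where
    \<A>: "\<forall>l<d. finite (\<A> l) \<and> \<A> l \<subseteq> E 2 \<and> (\<forall>y\<in>\<omega>. u y \<noteq> 0 \<longrightarrow> (\<forall>A\<in>\<A> l. chi A y = chi A x) \<longrightarrow>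
    v (kap (b l) (lg y) - kap (b l) (lg x)) < \<eta> / C)" ..
  have "matdist n x y < \<epsilon>"
    if y: "y \<in> \<omega>" "u y \<noteq> 0" and eq: "\<forall>A\<in>(\<Union>l<d. \<A> l). chi A y = chi A x" for y
  proof -
    have yN: "y \<in> kkt_Nbar T" by (rule omega_Nbar[OF y(1)])
    have small: "v (kap (b l) (lg y) - kap (b l) (lg x)) < \<eta> / C" if l: "l < d" for l
    proof -
      have "\<forall>A\<in>\<A> l. chi A y = chi A x" using eq l by simp
      then show ?thesis using \<A> l y by simp
    qed
    have "matdist n (lg y) (lg x) < \<eta>"
      unfolding matdist_less[OF \<eta>(1)]
    proof (intro allI impI)
      fix i j assume ij: "i < n" "j < n"
      have "lg y $$ (i, j) - lg x $$ (i, j) = entries n (lg y) (i, j) - entries n (lg x) (i, j)"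
        using ij by (simp add: entries_def)
      also have "\<dots> = (\<Sum>l<d. c l (i, j) * (kap (b l) (lg y) - kap (b l) (lg x)))"
        unfolding spec[OF bspec[OF c lg_E[OF yN]]] spec[OF bspec[OF c lg_E[OF x]]]
        by (simp only: right_diff_distrib sum_subtractf)
      finally have e: "lg y $$ (i, j) - lg x $$ (i, j) = \<dots>" .
      show "v (lg y $$ (i, j) - lg x $$ (i, j)) < \<eta>"
        unfolding e
      proof (rule v_sum_less[OF \<eta>(1)])
        fix l assume "l \<in> {..<d}"
        then have l: "l < d" by simp
        have "v (c l (i, j)) * v (kap (b l) (lg y) - kap (b l) (lg x)) \<le> C * v (kap (b l) (lg y) - kap (b l) (lg x))"
          using vC[OF l, of "(i, j)"] ij by (intro mult_right_mono v_nonneg) simp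
        also have "\<dots> < \<eta>" using small[OF l] C by (simp only: less_divide_eq if_True mult.commute)
        finally show "v (c l (i, j) * (kap (b l) (lg y) - kap (b l) (lg x))) < \<eta>" by (simp only: v_mult)
      qed
    qed
    then have "matdist n (lg x) (lg y) < \<eta>" by (simp only: matdist_sym)
    from mp[OF bspec[OF \<eta>(2) E_carrier[OF lg_E[OF yN]]] this]
    show ?thesis by (simp only: exp_lg[OF yN])
  qed
  moreover have "finite (\<Union>l<d. \<A> l)" "(\<Union>l<d. \<A> l) \<subseteq> E 2" using \<A> by auto
  ultimately show ?thesis by (intro exI[of _ "\<Union>l<d. \<A> l"]) simp
qed

section \<open>Localisation of the functional at x\<close>

lemma ell_zero: "u \<in> V \<Longrightarrow> (\<And>y. y \<in> \<omega> \<Longrightarrow> u y = 0) \<Longrightarrow> ell u = 0"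
proof -
  assume u: "u \<in> V" and "\<And>y. y \<in> \<omega> \<Longrightarrow> u y = 0"
  then have z: "u y = 0" for y using VD(3)[OF u, of y] by (cases "y \<in> \<omega>") simp_all
  have "u = (\<lambda>y. 0 * u y + 0 * u y)" by (rule ext) (simp add: z)
  then have "ell u = ell (\<lambda>y. 0 * u y + 0 * u y)" by (rule arg_cong)
  then show "ell u = 0" by (simp only: ell_comb[OF u u]) simp
qed

text \<open>Averaging leaves \<open>ell u\<close> unchanged and cuts \<open>u\<close> down to points
  within \<open>\<epsilon>\<close> of \<open>x\<close>, where \<open>u\<close> is 0.\<close>

lemma ell_local:
  assumes u: "u \<in> V" and \<epsilon>: "0 < \<epsilon>" and z: "\<And>y. y \<in> \<omega> \<Longrightarrow> matdist n x y < \<epsilon> \<Longrightarrow> u y = 0"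
  shows "ell u = 0"
proof -
  obtain \<A> where \<A>: "finite \<A>" "\<A> \<subseteq> E 2"
    "\<forall>y\<in>\<omega>. u y \<noteq> 0 \<longrightarrow> (\<forall>A\<in>\<A>. chi A y = chi A x) \<longrightarrow> matdist n x y < \<epsilon>"
    using separate[OF u \<epsilon>] by (elim exE conjE)
  obtain u' where u': "u' \<in> V" "ell u' = ell u"
    "\<forall>y\<in>\<omega>. u' y = (if \<forall>A\<in>\<A>. chi A y = chi A x then u y else 0)"
    using average_finite[OF u \<A>(1,2)] by (elim exE conjE)
  have "u' y = 0" if y: "y \<in> \<omega>" for y
  proof (cases "\<forall>A\<in>\<A>. chi A y = chi A x")
    case True
    then have "u y = 0" using mp[OF mp[OF bspec[OF \<A>(3) y]] True] z[OF y] by (cases "u y = 0") simp_all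
    then show ?thesis using bspec[OF u'(3) y] by simp
  next
    case False
    then show ?thesis using bspec[OF u'(3) y] by (simp only: if_False)
  qed
  then have "ell u' = 0" by (rule ell_zero[OF u'(1)])
  then show ?thesis using u'(2) by simp
qed

lemma ell_outside_closure:
  assumes xc: "x \<notin> tpl (kkt_Nbar T) closure_of \<omega>" and u: "u \<in> V"
  shows "ell u = 0"
proof -
  obtain U where U: "x \<in> U" "openin (tpl (kkt_Nbar T)) U" "\<not> (\<exists>y. y \<in> \<omega> \<and> y \<in> U)"
    using xc x unfolding in_closure_of topspace_sub[OF Nbar_sub] by blast
  then have "eventually (\<lambda>y. y \<in> kkt_Nbar T \<longrightarrow> y \<in> U) (nhm n x)"
    unfolding openin_sub_iff[OF Nbar_sub] by simp
  then obtain \<epsilon> where \<epsilon>: "0 < \<epsilon>" "\<forall>y\<in>carrier_mat n n. matdist n x y < \<epsilon> \<longrightarrow> y \<in> kkt_Nbar T \<longrightarrow> y \<in> U"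
    unfolding eventually_nhm by (elim exE conjE)
  show ?thesis
  proof (rule ell_local[OF u \<epsilon>(1)])
    fix y assume y: "y \<in> \<omega>" and "matdist n x y < \<epsilon>"
    then have "y \<in> U" by (intro mp[OF mp[OF bspec[OF \<epsilon>(2) subsetD[OF omega_sub y]]] omega_Nbar[OF y]])
    then show "u y = 0" using y U(3) by simp
  qed
qed

lemma ell_vanishing:
  assumes xo: "x \<in> \<omega>" and u: "u \<in> V" and ux: "u x = 0"
  shows "ell u = 0"
proof -
  have "eventually (\<lambda>y. y \<in> \<omega> \<longrightarrow> u y = u x) (nhm n x)"
    using VD(2)[OF u] xo unfolding lc_iff by simp
  then obtain \<epsilon> where \<epsilon>: "0 < \<epsilon>" "\<forall>y\<in>carrier_mat n n. matdist n x y < \<epsilon> \<longrightarrow> y \<in> \<omega> \<longrightarrow> u y = u x"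
    unfolding eventually_nhm by (elim exE conjE)
  show ?thesis
  proof (rule ell_local[OF u \<epsilon>(1)])
    fix y assume y: "y \<in> \<omega>" and "matdist n x y < \<epsilon>"
    then show "u y = 0" using bspec[OF \<epsilon>(2) subsetD[OF omega_sub y]] ux by simp
  qed
qed

text \<open>By \<open>ell_vanishing\<close>, the kernel of evaluation at \<open>x\<close> lies in
  the kernel of \<open>ell\<close>, and evaluation has codimension at most 1. If it is 0 on
  \<open>V\<close>, then so is \<open>ell\<close>.\<close>

lemma ell_evaluation:
  assumes xo: "x \<in> \<omega>"
  shows "\<exists>c. \<forall>u\<in>V. ell u = c * u x"
proof (cases "\<forall>u\<in>V. u x = 0")
  case True
  then show ?thesis using ell_vanishing[OF xo] by (intro exI[of _ 0]) simp
next
  case False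
  then obtain w where w: "w \<in> V" "w x \<noteq> 0" unfolding ball_simps by (elim bexE)
  have "ell u = ell w / w x * u x" if u: "u \<in> V" for u
  proof -
    have "ell (\<lambda>y. 1 * u y + (- (u x / w x)) * w y) = 0"
      by (rule ell_vanishing[OF xo V_comb[OF u w(1)]]) (use w(2) in simp)
    then show ?thesis by (simp only: ell_comb[OF u w(1)]) (simp add: field_simps)
  qed
  then show ?thesis by (intro exI[of _ "ell w / w x"] ballI)
qed

end

theorem proposition7p2:
  fixes v :: "'k::field_char_0 \<Rightarrow> real"
    and T :: "'k kkt_datum"
    and r :: nat
    and scaleD :: "'k \<Rightarrow> 'd::ab_group_add \<Rightarrow> 'd" and N\<^sub>D :: "'d \<Rightarrow> 'k"
    and multD :: "'d \<Rightarrow> 'd \<Rightarrow> 'd" and unitD :: 'd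
    and scaleW :: "'k \<Rightarrow> 'w::ab_group_add \<Rightarrow> 'w" and Q :: "'w \<Rightarrow> 'k"
    and \<psi> :: "'k \<Rightarrow> complex"
    and \<omega> :: "'k mat set"
    and \<nu> :: "'k mat \<Rightarrow> complex"
    and \<mu> :: "'k mat measure"
    and \<Phi> :: "'k mat \<Rightarrow> ('k mat \<Rightarrow> complex) \<Rightarrow> 'k mat \<Rightarrow> complex"
    and V :: "('k mat \<Rightarrow> complex) set"
    and x :: "'k mat"
    and ell :: "('k mat \<Rightarrow> complex) \<Rightarrow> complex"
  assumes "padic_field v"
    and "(0 < r \<and> composition_algebra scaleD N\<^sub>D multD unitD \<and>
            (vector_space.dim scaleD (UNIV :: 'd set) \<in> {1, 2, 4} \<or>
             vector_space.dim scaleD (UNIV :: 'd set) = 8 \<and> r = 3) \<and>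
            kkt_attached T (hermitian_jordan r scaleD N\<^sub>D multD unitD))
       \<or> (quadratic_space scaleW Q \<and>
            (\<exists>B. finite B \<and> module.span scaleW B = (UNIV :: 'w set)) \<and> (\<exists>w :: 'w. w \<noteq> 0) \<and>
            kkt_attached T (quadratic_jordan scaleW Q))"
    and "unitary_character v \<psi>" and "\<exists>a. \<psi> a \<noteq> 1"
    and "kkt_orbit T \<omega>"
    and "smooth_character v T \<nu>"
    and "quasi_invariant_measure v T \<omega> \<nu> \<mu>"
    and "extends_pi v T \<psi> \<nu> \<mu> \<Phi>"
    and "V = smooth_vectors v T \<omega> \<mu> \<Phi>"
    and "x \<in> kkt_Nbar T"
    and "linear_functional_on V ell"
    and "\<forall>n\<in>kkt_N T. \<forall>f\<in>V. ell (pi_N T \<psi> n f) = psi_char T \<psi> x n * ell f"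
  shows "(x \<notin> (kkt_topology v T (kkt_Nbar T)) closure_of \<omega> \<longrightarrow> (\<forall>f\<in>V. ell f = 0)) \<and>
         (x \<in> \<omega> \<longrightarrow> (\<exists>c. \<forall>f\<in>V. ell f = c * f x))"
proof -
  obtain graded: "kkt_graded_group T" and nondeg: "\<And>Y. Y \<in> kkt_eigenspace T (- 2) \<Longrightarrow>
      (\<And>A. A \<in> kkt_eigenspace T 2 \<Longrightarrow> kkt_kappa T A Y = 0) \<Longrightarrow> Y = 0\<^sub>m (kkt_size T) (kkt_size T)"
    using assms(2)
  proof (rule disjE)
    assume "0 < r \<and> composition_algebra scaleD N\<^sub>D multD unitD \<and>
            (vector_space.dim scaleD (UNIV :: 'd set) \<in> {1, 2, 4} \<or>
             vector_space.dim scaleD (UNIV :: 'd set) = 8 \<and> r = 3) \<and>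
            kkt_attached T (hermitian_jordan r scaleD N\<^sub>D multD unitD)"
    then have r: "0 < r" and D: "composition_algebra scaleD N\<^sub>D multD unitD"
      and J: "kkt_attached T (hermitian_jordan r scaleD N\<^sub>D multD unitD)" by simp_all
    from J have graded: "kkt_graded_group T" by (simp add: kkt_attached_def)
    then interpret kkt T by (rule kkt.intro)
    \<comment> \<open>\<open>0 < r\<close> provides a frame element, whose normalisation shows
      \<open>kkt_const T \<noteq> 0\<close>.\<close>
    have ne: "jframe (hermitian_jordan r scaleD N\<^sub>D multD unitD) \<noteq> {}"
      using r by (auto simp: hermitian_jordan_def)
    show thesis
      by (rule that[OF graded pairing_nondegenerate[OF J composition_algebra.jordan_closed_hermitian[OF D]
            composition_algebra.frame_simple_hermitian[OF D] ne]])
  next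
    assume "quadratic_space scaleW Q \<and>
            (\<exists>B. finite B \<and> module.span scaleW B = (UNIV :: 'w set)) \<and> (\<exists>w :: 'w. w \<noteq> 0) \<and>
            kkt_attached T (quadratic_jordan scaleW Q)"
    then have W: "quadratic_space scaleW Q" and J: "kkt_attached T (quadratic_jordan scaleW Q)" by simp_all
    from J have graded: "kkt_graded_group T" by (simp add: kkt_attached_def)
    then interpret kkt T by (rule kkt.intro)
    have ne: "jframe (quadratic_jordan scaleW Q) \<noteq> {}" by (simp add: quadratic_jordan_def)
    show thesis
      by (rule that[OF graded pairing_nondegenerate[OF J jordan_closed_quadratic
            quadratic_space.frame_simple_quadratic[OF W] ne]])
  qed
  interpret kkt_functional v T \<psi> \<omega> \<nu> \<mu> \<Phi> x ell
  proof (intro kkt_functional.intro kkt_functional_axioms.intro kkt_rep.intro kkt_rep_axioms.intro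
      padic.intro kkt.intro)
    show "linear_functional_on (smooth_vectors v T \<omega> \<mu> \<Phi>) ell"
      "\<forall>g\<in>kkt_N T. \<forall>u\<in>smooth_vectors v T \<omega> \<mu> \<Phi>. ell (pi_N T \<psi> g u) = psi_char T \<psi> x g * ell u"
      using assms(11,12) unfolding assms(9) .
    show "Y = 0\<^sub>m (kkt_size T) (kkt_size T)" if "Y \<in> kkt_eigenspace T (- 2)"
      "\<And>A. A \<in> kkt_eigenspace T 2 \<Longrightarrow> kkt_kappa T A Y = 0" for Y by (rule nondeg[OF that])
  qed (fact assms graded)+
  show ?thesis
    unfolding assms(9) using ell_outside_closure ell_evaluation by simp
qed

end
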